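(* Let $I$ be an ideal of a commutative Noetherian local ring $R$, and let $0\to M_1\to M_2\to M_3\to 0$ be a short exact sequence of $R$-modules. Then for a finitely generated $R$-module $N$: (i) There is a long exact sequence $$\cdots \to L_{i}\Lambda^I(N, D(M_3))\to L_{i}\Lambda^I(N, D(M_2))\to L_{i}\Lambda^I(N, D(M_1))\to L_{i-1}\Lambda^I(N, D(M_3))\to \cdots \to L_{0}\Lambda^I(N, D(M_2))\to L_{0}\Lambda^I(N, D(M_1))\to 0.$$ (ii) Suppose that $M_i$ is Artinian for each $i=1,2,3$. Then there is a long exact sequence $$\cdots \to L_{i}\Lambda^I(N, M_1)\to L_{i}\Lambda^I(N, M_2)\to L_{i}\Lambda^I(N, M_3)\to L_{i-1}\Lambda^I(N, M_1)\to \cdots \to L_{0}\Lambda^I(N, M_2)\to L_{0}\Lambda^I(N, M_3)\to 0.$$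
   Context: For $R$-modules $N,X$, $L_i\Lambda^I(N,X)=H_i(\varprojlim_s(N/I^sN\otimes_R F_\cdot))$, where $F_\cdot$ is a flat resolution of $X$ (independent of the choice of $F_\cdot$). $D(\cdot)=\operatorname{Hom}_R(\cdot,E_R(k))$ is the Matlis dual functor, $k$ the residue field of the local ring $R$. *)

theory Defs
  imports "HOL-Algebra.Module" "HOL-Algebra.Ideal_Product" "HOL-Algebra.Ring_Divisibility"
begin

section \<open>Linear maps, submodules, quotients\<close>

definition mod_hom ::
    "('r, 'z) ring_scheme \<Rightarrow> ('r, 'a) module \<Rightarrow> ('r, 'b) module \<Rightarrow> ('a \<Rightarrow> 'b) set" where
  "mod_hom R M N = {f. f \<in> carrier M \<rightarrow> carrier N \<and>
     (\<forall>x\<in>carrier M. \<forall>y\<in>carrier M. f (x \<oplus>\<^bsub>M\<^esub> y) = f x \<oplus>\<^bsub>N\<^esub> f y) \<and>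
     (\<forall>r\<in>carrier R. \<forall>x\<in>carrier M. f (r \<odot>\<^bsub>M\<^esub> x) = r \<odot>\<^bsub>N\<^esub> f x)}"

definition mod_ker :: "('r, 'a) module \<Rightarrow> ('r, 'b) module \<Rightarrow> ('a \<Rightarrow> 'b) \<Rightarrow> 'a set" where
  "mod_ker M N f = {x \<in> carrier M. f x = \<zero>\<^bsub>N\<^esub>}"

definition short_exact ::
    "('r, 'z) ring_scheme \<Rightarrow> ('r, 'a) module \<Rightarrow> ('r, 'b) module \<Rightarrow> ('r, 'c) module \<Rightarrow>
     ('a \<Rightarrow> 'b) \<Rightarrow> ('b \<Rightarrow> 'c) \<Rightarrow> bool" where
  "short_exact R M1 M2 M3 f g \<longleftrightarrow>
     module R M1 \<and> module R M2 \<and> module R M3 \<and>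
     f \<in> mod_hom R M1 M2 \<and> g \<in> mod_hom R M2 M3 \<and>
     inj_on f (carrier M1) \<and> f ` carrier M1 = mod_ker M2 M3 g \<and> g ` carrier M2 = carrier M3"

definition span_submodule ::
    "('r, 'z) ring_scheme \<Rightarrow> ('r, 'a) module \<Rightarrow> 'a set \<Rightarrow> 'a set" where
  "span_submodule R M S = \<Inter> {H. submodule H R M \<and> S \<subseteq> H}"

definition fin_gen_module :: "('r, 'z) ring_scheme \<Rightarrow> ('r, 'a) module \<Rightarrow> bool" where
  "fin_gen_module R M \<longleftrightarrow> module R M \<and>
     (\<exists>S. finite S \<and> S \<subseteq> carrier M \<and> span_submodule R M S = carrier M)"

definition artinian_module :: "('r, 'z) ring_scheme \<Rightarrow> ('r, 'a) module \<Rightarrow> bool" where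
  "artinian_module R M \<longleftrightarrow> module R M \<and>
     (\<forall>C :: nat \<Rightarrow> 'a set. (\<forall>n. submodule (C n) R M) \<and> (\<forall>n. C (Suc n) \<subseteq> C n) \<longrightarrow>
        (\<exists>n. \<forall>m\<ge>n. C m = C n))"

text \<open>
  \<open>module\<close> records carry the multiplicative fields of a ring, which play no role for modules;
  the constructions below leave them unspecified.
\<close>

definition quot_module ::
    "('r, 'a) module \<Rightarrow> 'a set \<Rightarrow> ('r, 'a set) module" where
  "quot_module M K =
     \<lparr>carrier = a_rcosets\<^bsub>M\<^esub> K, monoid.mult = undefined, one = undefined,
      zero = K, add = (\<lambda>C C'. C <+>\<^bsub>M\<^esub> C'),
      smult = (\<lambda>r C. \<Union>x\<in>C. K +>\<^bsub>M\<^esub> (r \<odot>\<^bsub>M\<^esub> x))\<rparr>"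

text \<open>
  The map \<open>M / K \<rightarrow> M' / K'\<close> induced by a linear map \<open>f\<close> from \<open>M\<close> to \<open>M'\<close> that sends \<open>K\<close> into \<open>K'\<close>:
  all cosets in the union coincide.
\<close>

definition quot_map ::
    "('r, 'b) module \<Rightarrow> 'b set \<Rightarrow> ('a \<Rightarrow> 'b) \<Rightarrow> 'a set \<Rightarrow> 'b set" where
  "quot_map M' K' f C = (\<Union>x\<in>C. K' +>\<^bsub>M'\<^esub> f x)"

definition regular_module :: "('r, 'z) ring_scheme \<Rightarrow> ('r, 'r) module" where
  "regular_module R =
     \<lparr>carrier = carrier R, monoid.mult = monoid.mult R, one = one R, zero = zero R, add = add R,
      smult = monoid.mult R\<rparr>"


section \<open>Tensor products\<close>

text \<open>
  The free module on \<open>S\<close> consists of the finitely supported functions; the tensor product is the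
  free module on pairs modulo the bilinearity relations.
\<close>

definition free_module :: "('r, 'z) ring_scheme \<Rightarrow> 's set \<Rightarrow> ('r, 's \<Rightarrow> 'r) module" where
  "free_module R S =
     \<lparr>carrier = {c. (\<forall>x. c x \<in> carrier R) \<and> (\<forall>x. x \<notin> S \<longrightarrow> c x = \<zero>\<^bsub>R\<^esub>) \<and>
                    finite {x. c x \<noteq> \<zero>\<^bsub>R\<^esub>}},
      monoid.mult = undefined, one = undefined,
      zero = (\<lambda>x. \<zero>\<^bsub>R\<^esub>), add = (\<lambda>c d x. c x \<oplus>\<^bsub>R\<^esub> d x),
      smult = (\<lambda>r c x. r \<otimes>\<^bsub>R\<^esub> c x)\<rparr>"

definition free_gen :: "('r, 'z) ring_scheme \<Rightarrow> 's \<Rightarrow> 's \<Rightarrow> 'r" where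
  "free_gen R s = (\<lambda>x. if x = s then \<one>\<^bsub>R\<^esub> else \<zero>\<^bsub>R\<^esub>)"

definition free_map ::
    "('r, 'z) ring_scheme \<Rightarrow> ('s \<Rightarrow> 't) \<Rightarrow> ('s \<Rightarrow> 'r) \<Rightarrow> 't \<Rightarrow> 'r" where
  "free_map R f c = (\<lambda>y. finsum R c {x. c x \<noteq> \<zero>\<^bsub>R\<^esub> \<and> f x = y})"

definition tensor_relations ::
    "('r, 'z) ring_scheme \<Rightarrow> ('r, 'a) module \<Rightarrow> ('r, 'b) module \<Rightarrow> ('a \<times> 'b \<Rightarrow> 'r) set" where
  "tensor_relations R A B =
     (let W = free_module R (carrier A \<times> carrier B); e = (\<lambda>a b. free_gen R (a, b)) in
        {e (a \<oplus>\<^bsub>A\<^esub> a') b \<ominus>\<^bsub>W\<^esub> (e a b \<oplus>\<^bsub>W\<^esub> e a' b) | a a' b.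
            a \<in> carrier A \<and> a' \<in> carrier A \<and> b \<in> carrier B} \<union>
        {e a (b \<oplus>\<^bsub>B\<^esub> b') \<ominus>\<^bsub>W\<^esub> (e a b \<oplus>\<^bsub>W\<^esub> e a b') | a b b'.
            a \<in> carrier A \<and> b \<in> carrier B \<and> b' \<in> carrier B} \<union>
        {e (r \<odot>\<^bsub>A\<^esub> a) b \<ominus>\<^bsub>W\<^esub> (r \<odot>\<^bsub>W\<^esub> e a b) | r a b.
            r \<in> carrier R \<and> a \<in> carrier A \<and> b \<in> carrier B} \<union>
        {e a (r \<odot>\<^bsub>B\<^esub> b) \<ominus>\<^bsub>W\<^esub> (r \<odot>\<^bsub>W\<^esub> e a b) | r a b.
            r \<in> carrier R \<and> a \<in> carrier A \<and> b \<in> carrier B})"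

definition tensor_kernel ::
    "('r, 'z) ring_scheme \<Rightarrow> ('r, 'a) module \<Rightarrow> ('r, 'b) module \<Rightarrow> ('a \<times> 'b \<Rightarrow> 'r) set" where
  "tensor_kernel R A B =
     span_submodule R (free_module R (carrier A \<times> carrier B)) (tensor_relations R A B)"

definition tensor ::
    "('r, 'z) ring_scheme \<Rightarrow> ('r, 'a) module \<Rightarrow> ('r, 'b) module \<Rightarrow>
     ('r, ('a \<times> 'b \<Rightarrow> 'r) set) module" where
  "tensor R A B =
     quot_module (free_module R (carrier A \<times> carrier B)) (tensor_kernel R A B)"

text \<open>\<open>tensor_map R A' B' f g\<close> is \<open>f \<otimes> g\<close>; only the codomains \<open>A'\<close> and \<open>B'\<close> enter the formula.\<close>

definition tensor_map ::
    "('r, 'z) ring_scheme \<Rightarrow> ('r, 'c) module \<Rightarrow> ('r, 'd) module \<Rightarrow> ('a \<Rightarrow> 'c) \<Rightarrow> ('b \<Rightarrow> 'd) \<Rightarrow>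
     ('a \<times> 'b \<Rightarrow> 'r) set \<Rightarrow> ('c \<times> 'd \<Rightarrow> 'r) set" where
  "tensor_map R A' B' f g =
     quot_map (free_module R (carrier A' \<times> carrier B')) (tensor_kernel R A' B')
       (free_map R (map_prod f g))"


section \<open>Flat and injective modules, injective hulls, Matlis duality\<close>

text \<open>
  A definition cannot quantify over types, so the test modules in the next two definitions are
  all the \<open>R\<close>-modules whose carrier lies in the type of the ring elements. These include \<open>R\<close> and its
  ideals; hence, by the ideal criterion for flatness and by Baer's criterion for injectivity,
  the test is equivalent to that against all \<open>R\<close>-modules in any type.
\<close>

definition flat_module :: "('r, 'z) ring_scheme \<Rightarrow> ('r, 'a) module \<Rightarrow> bool" where
  "flat_module R F \<longleftrightarrow> module R F \<and>
     (\<forall>(A :: ('r, 'r) module) (B :: ('r, 'r) module) j.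
        module R A \<and> module R B \<and> j \<in> mod_hom R A B \<and> inj_on j (carrier A) \<longrightarrow>
        inj_on (tensor_map R B F j (\<lambda>x. x)) (carrier (tensor R A F)))"

definition injective_module :: "('r, 'z) ring_scheme \<Rightarrow> ('r, 'a) module \<Rightarrow> bool" where
  "injective_module R E \<longleftrightarrow> module R E \<and>
     (\<forall>(A :: ('r, 'r) module) (B :: ('r, 'r) module) j h.
        module R A \<and> module R B \<and> j \<in> mod_hom R A B \<and> inj_on j (carrier A) \<and>
        h \<in> mod_hom R A E \<longrightarrow>
        (\<exists>h' \<in> mod_hom R B E. \<forall>x\<in>carrier A. h' (j x) = h x))"

definition injective_hull ::
    "('r, 'z) ring_scheme \<Rightarrow> ('r, 'a) module \<Rightarrow> ('r, 'e) module \<Rightarrow> ('a \<Rightarrow> 'e) \<Rightarrow> bool" where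
  "injective_hull R K E \<iota> \<longleftrightarrow>
     injective_module R E \<and> \<iota> \<in> mod_hom R K E \<and> inj_on \<iota> (carrier K) \<and>
     (\<forall>H. submodule H R E \<and> H \<inter> \<iota> ` carrier K = {\<zero>\<^bsub>E\<^esub>} \<longrightarrow> H = {\<zero>\<^bsub>E\<^esub>})"

text \<open>Homomorphisms are taken extensional, so that equality in \<open>Hom\<^sub>R(M, N)\<close> is equality on \<open>M\<close>.\<close>

definition Hom_module ::
    "('r, 'z) ring_scheme \<Rightarrow> ('r, 'a) module \<Rightarrow> ('r, 'b) module \<Rightarrow> ('r, 'a \<Rightarrow> 'b) module" where
  "Hom_module R M N =
     \<lparr>carrier = mod_hom R M N \<inter> extensional (carrier M),
      monoid.mult = undefined, one = undefined,
      zero = (\<lambda>x\<in>carrier M. \<zero>\<^bsub>N\<^esub>),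
      add = (\<lambda>f g. \<lambda>x\<in>carrier M. f x \<oplus>\<^bsub>N\<^esub> g x),
      smult = (\<lambda>r f. \<lambda>x\<in>carrier M. r \<odot>\<^bsub>N\<^esub> f x)\<rparr>"

text \<open>\<open>E\<close> stands for the injective hull of the residue field of \<open>R\<close>.\<close>

definition matlis_dual ::
    "('r, 'z) ring_scheme \<Rightarrow> ('r, 'e) module \<Rightarrow> ('r, 'a) module \<Rightarrow> ('r, 'a \<Rightarrow> 'e) module" where
  "matlis_dual R E M = Hom_module R M E"

definition matlis_dual_map :: "('r, 'a) module \<Rightarrow> ('a \<Rightarrow> 'b) \<Rightarrow> ('b \<Rightarrow> 'e) \<Rightarrow> ('a \<Rightarrow> 'e)" where
  "matlis_dual_map M f h = (\<lambda>x\<in>carrier M. h (f x))"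

definition local_ring :: "('r, 'z) ring_scheme \<Rightarrow> bool" where
  "local_ring R \<longleftrightarrow> cring R \<and> (\<exists>!m. maximalideal m R)"

definition residue_field_module :: "('r, 'z) ring_scheme \<Rightarrow> ('r, 'r set) module" where
  "residue_field_module R = quot_module (regular_module R) (THE m. maximalideal m R)"


section \<open>Complexes, homology, flat resolutions\<close>

text \<open>\<open>diff C n\<close> is the differential \<open>C\<^sub>n\<^sub>+\<^sub>1 \<rightarrow> C\<^sub>n\<close>; complexes vanish in negative degrees.\<close>

record ('r, 'a) chain_complex =
  obj :: "nat \<Rightarrow> ('r, 'a) module"
  diff :: "nat \<Rightarrow> 'a \<Rightarrow> 'a"

definition cycles :: "('r, 'a) chain_complex \<Rightarrow> nat \<Rightarrow> 'a set" where
  "cycles C i = (case i of 0 \<Rightarrow> carrier (obj C 0)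
     | Suc n \<Rightarrow> mod_ker (obj C (Suc n)) (obj C n) (diff C n))"

definition boundaries :: "('r, 'a) chain_complex \<Rightarrow> nat \<Rightarrow> 'a set" where
  "boundaries C i = diff C i ` carrier (obj C (Suc i))"

definition homology :: "('r, 'a) chain_complex \<Rightarrow> nat \<Rightarrow> ('r, 'a set) module" where
  "homology C i = quot_module ((obj C i)\<lparr>carrier := cycles C i\<rparr>) (boundaries C i)"

definition homology_map ::
    "('r, 'b) chain_complex \<Rightarrow> (nat \<Rightarrow> 'a \<Rightarrow> 'b) \<Rightarrow> nat \<Rightarrow> 'a set \<Rightarrow> 'b set" where
  "homology_map C' \<phi> i = quot_map ((obj C' i)\<lparr>carrier := cycles C' i\<rparr>) (boundaries C' i) (\<phi> i)"

definition flat_resolution ::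
    "('r, 'z) ring_scheme \<Rightarrow> ('r, 'x) module \<Rightarrow> ('r, 'f) chain_complex \<Rightarrow> ('f \<Rightarrow> 'x) \<Rightarrow> bool" where
  "flat_resolution R X F \<epsilon> \<longleftrightarrow>
     module R X \<and> (\<forall>n. flat_module R (obj F n)) \<and>
     (\<forall>n. diff F n \<in> mod_hom R (obj F (Suc n)) (obj F n)) \<and>
     \<epsilon> \<in> mod_hom R (obj F 0) X \<and> \<epsilon> ` carrier (obj F 0) = carrier X \<and>
     boundaries F 0 = mod_ker (obj F 0) X \<epsilon> \<and>
     (\<forall>n. boundaries F (Suc n) = cycles F (Suc n))"

definition lifts_to ::
    "('r, 'z) ring_scheme \<Rightarrow> ('r, 'f) chain_complex \<Rightarrow> ('f \<Rightarrow> 'x) \<Rightarrow>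
     ('r, 'g) chain_complex \<Rightarrow> ('g \<Rightarrow> 'y) \<Rightarrow> ('x \<Rightarrow> 'y) \<Rightarrow> (nat \<Rightarrow> 'f \<Rightarrow> 'g) \<Rightarrow> bool" where
  "lifts_to R F \<epsilon> G \<eta> f \<phi> \<longleftrightarrow>
     (\<forall>n. \<phi> n \<in> mod_hom R (obj F n) (obj G n)) \<and>
     (\<forall>n. \<forall>x\<in>carrier (obj F (Suc n)). \<phi> n (diff F n x) = diff G n (\<phi> (Suc n) x)) \<and>
     (\<forall>x\<in>carrier (obj F 0). \<eta> (\<phi> 0 x) = f (\<epsilon> x))"


section \<open>Generalized local homology\<close>

definition inverse_limit ::
    "(nat \<Rightarrow> ('r, 'a) module) \<Rightarrow> (nat \<Rightarrow> 'a \<Rightarrow> 'a) \<Rightarrow> ('r, nat \<Rightarrow> 'a) module" where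
  "inverse_limit A p =
     \<lparr>carrier = {x. (\<forall>s. x s \<in> carrier (A s)) \<and> (\<forall>s. p s (x (Suc s)) = x s)},
      monoid.mult = undefined, one = undefined,
      zero = (\<lambda>s. \<zero>\<^bsub>A s\<^esub>), add = (\<lambda>x y s. x s \<oplus>\<^bsub>A s\<^esub> y s),
      smult = (\<lambda>r x s. r \<odot>\<^bsub>A s\<^esub> x s)\<rparr>"

definition ideal_power_mult ::
    "('r, 'z) ring_scheme \<Rightarrow> 'r set \<Rightarrow> ('r, 'n) module \<Rightarrow> nat \<Rightarrow> 'n set" where
  "ideal_power_mult R I N s =
     span_submodule R N {a \<odot>\<^bsub>N\<^esub> x | a x. a \<in> I [^]\<^bsub>ideals_set R\<^esub> s \<and> x \<in> carrier N}"

definition adic_quot ::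
    "('r, 'z) ring_scheme \<Rightarrow> 'r set \<Rightarrow> ('r, 'n) module \<Rightarrow> nat \<Rightarrow> ('r, 'n set) module" where
  "adic_quot R I N s = quot_module N (ideal_power_mult R I N s)"

definition adic_proj ::
    "('r, 'z) ring_scheme \<Rightarrow> 'r set \<Rightarrow> ('r, 'n) module \<Rightarrow> nat \<Rightarrow> 'n set \<Rightarrow> 'n set" where
  "adic_proj R I N s = quot_map N (ideal_power_mult R I N s) (\<lambda>x. x)"

text \<open>The functor \<open>lim\<^sub>s (N / I\<^sup>s N \<otimes> _)\<close>, first on linear maps into \<open>Y\<close> and then on complexes.\<close>

definition adic_tensor_map ::
    "('r, 'z) ring_scheme \<Rightarrow> 'r set \<Rightarrow> ('r, 'n) module \<Rightarrow> ('r, 'b) module \<Rightarrow> ('a \<Rightarrow> 'b) \<Rightarrow>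
     (nat \<Rightarrow> ('n set \<times> 'a \<Rightarrow> 'r) set) \<Rightarrow> nat \<Rightarrow> ('n set \<times> 'b \<Rightarrow> 'r) set" where
  "adic_tensor_map R I N Y f x = (\<lambda>s. tensor_map R (adic_quot R I N s) Y (\<lambda>c. c) f (x s))"

definition adic_tensor_complex ::
    "('r, 'z) ring_scheme \<Rightarrow> 'r set \<Rightarrow> ('r, 'n) module \<Rightarrow> ('r, 'f) chain_complex \<Rightarrow>
     ('r, nat \<Rightarrow> ('n set \<times> 'f \<Rightarrow> 'r) set) chain_complex" where
  "adic_tensor_complex R I N F =
     \<lparr>obj = (\<lambda>i. inverse_limit (\<lambda>s. tensor R (adic_quot R I N s) (obj F i))
        (\<lambda>s. tensor_map R (adic_quot R I N s) (obj F i) (adic_proj R I N s) (\<lambda>x. x))),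
      diff = (\<lambda>i. adic_tensor_map R I N (obj F i) (diff F i))\<rparr>"

text \<open>\<open>L\<^sub>i\<Lambda>\<^sup>I(N, X)\<close>, computed from a flat resolution \<open>F\<close> of \<open>X\<close>.\<close>

definition local_homology ::
    "('r, 'z) ring_scheme \<Rightarrow> 'r set \<Rightarrow> ('r, 'n) module \<Rightarrow> ('r, 'f) chain_complex \<Rightarrow> nat \<Rightarrow>
     ('r, (nat \<Rightarrow> ('n set \<times> 'f \<Rightarrow> 'r) set) set) module" where
  "local_homology R I N F i = homology (adic_tensor_complex R I N F) i"

definition local_homology_map ::
    "('r, 'z) ring_scheme \<Rightarrow> 'r set \<Rightarrow> ('r, 'n) module \<Rightarrow> ('r, 'g) chain_complex \<Rightarrow>
     (nat \<Rightarrow> 'f \<Rightarrow> 'g) \<Rightarrow> nat \<Rightarrow>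
     (nat \<Rightarrow> ('n set \<times> 'f \<Rightarrow> 'r) set) set \<Rightarrow> (nat \<Rightarrow> ('n set \<times> 'g \<Rightarrow> 'r) set) set" where
  "local_homology_map R I N G \<phi> =
     homology_map (adic_tensor_complex R I N G)
       (\<lambda>i. adic_tensor_map R I N (obj G i) (\<phi> i))"

text \<open>
  \<open>\<alpha> i\<close> is the map \<open>L\<^sub>i\<Lambda>\<^sup>I(N, X) \<rightarrow> L\<^sub>i\<Lambda>\<^sup>I(N, Y)\<close> induced by \<open>f : X \<rightarrow> Y\<close>, where the source and target are
  computed from the flat resolutions \<open>F\<close> and \<open>G\<close>. If \<open>f\<close> lifts to a chain map \<open>\<psi> : F \<rightarrow> G\<close>, then this
  is the map induced by \<open>\<psi>\<close> (take \<open>P = F\<close>). Between flat resolutions a lift need not exist, so the map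
  is described through resolutions \<open>P\<close> of \<open>X\<close>, e.g. free ones, mapping to both \<open>F\<close> and \<open>G\<close>.
\<close>

definition induced_local_homology_map ::
    "('r, 'z) ring_scheme \<Rightarrow> 'r set \<Rightarrow> ('r, 'n) module \<Rightarrow>
     ('r, 'x) module \<Rightarrow> ('r, 'f) chain_complex \<Rightarrow> ('f \<Rightarrow> 'x) \<Rightarrow>
     ('r, 'f) chain_complex \<Rightarrow> ('f \<Rightarrow> 'y) \<Rightarrow> ('x \<Rightarrow> 'y) \<Rightarrow>
     (nat \<Rightarrow> (nat \<Rightarrow> ('n set \<times> 'f \<Rightarrow> 'r) set) set \<Rightarrow> (nat \<Rightarrow> ('n set \<times> 'f \<Rightarrow> 'r) set) set) \<Rightarrow> bool" where
  "induced_local_homology_map R I N X F \<epsilon> G \<eta> f \<alpha> \<longleftrightarrow>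
     (\<forall>(P :: ('r, 'f) chain_complex) \<pi> \<phi> \<psi>.
        flat_resolution R X P \<pi> \<and> lifts_to R P \<pi> F \<epsilon> (\<lambda>x. x) \<phi> \<and> lifts_to R P \<pi> G \<eta> f \<psi> \<longrightarrow>
        (\<forall>i. \<forall>z\<in>carrier (local_homology R I N P i).
           \<alpha> i (local_homology_map R I N F \<phi> i z) = local_homology_map R I N G \<psi> i z))"

text \<open>
  Exactness of \<open>\<dots> \<rightarrow> A\<^sub>i \<rightarrow> B\<^sub>i \<rightarrow> C\<^sub>i \<rightarrow> A\<^sub>i\<^sub>-\<^sub>1 \<rightarrow> \<dots> \<rightarrow> A\<^sub>0 \<rightarrow> B\<^sub>0 \<rightarrow> C\<^sub>0 \<rightarrow> 0\<close>; the connecting map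
  \<open>\<delta> i\<close> goes from \<open>C\<^sub>i\<^sub>+\<^sub>1\<close> to \<open>A\<^sub>i\<close>.
\<close>

definition long_exact ::
    "('r, 'z) ring_scheme \<Rightarrow>
     (nat \<Rightarrow> ('r, 'a) module) \<Rightarrow> (nat \<Rightarrow> ('r, 'b) module) \<Rightarrow> (nat \<Rightarrow> ('r, 'c) module) \<Rightarrow>
     (nat \<Rightarrow> 'a \<Rightarrow> 'b) \<Rightarrow> (nat \<Rightarrow> 'b \<Rightarrow> 'c) \<Rightarrow> (nat \<Rightarrow> 'c \<Rightarrow> 'a) \<Rightarrow> bool" where
  "long_exact R A B C \<alpha> \<beta> \<delta> \<longleftrightarrow>
     (\<forall>i. module R (A i) \<and> module R (B i) \<and> module R (C i)) \<and>
     (\<forall>i. \<alpha> i \<in> mod_hom R (A i) (B i)) \<and>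
     (\<forall>i. \<beta> i \<in> mod_hom R (B i) (C i)) \<and>
     (\<forall>i. \<delta> i \<in> mod_hom R (C (Suc i)) (A i)) \<and>
     (\<forall>i. \<alpha> i ` carrier (A i) = mod_ker (B i) (C i) (\<beta> i)) \<and>
     (\<forall>i. \<beta> (Suc i) ` carrier (B (Suc i)) = mod_ker (C (Suc i)) (A i) (\<delta> i)) \<and>
     (\<forall>i. \<delta> i ` carrier (C (Suc i)) = mod_ker (A i) (B i) (\<alpha> i)) \<and>
     \<beta> 0 ` carrier (B 0) = carrier (C 0)"

end

theory Submission imports Defs begin

text \<open>
  Both parts are instances of one statement: a short exact sequence \<open>0 \<rightarrow> X \<rightarrow> Y \<rightarrow> Z \<rightarrow> 0\<close> of modules gives
  a long exact sequence of the modules \<open>L\<^sub>i\<Lambda>\<^sup>I(N, _)\<close> (\<open>local_homology_long_exact\<close>). The second part is this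
  for the given sequence. For the first part, Matlis duality is exact because \<open>E\<close> is injective; as
  injectivity is tested on ideals, this needs Baer's criterion (\<open>injective_module_extend\<close>).

  The functor \<open>F \<mapsto> lim\<^sub>s (N / I\<^sup>s N \<otimes> F)\<close> is exact on short exact sequences of flat modules: these remain
  exact after tensoring, and the transition maps of all inverse systems are surjective, so that the
  limit is exact as well (\<open>Tm_inj\<close>, \<open>Tm_exact\<close>, \<open>Tm_surj\<close>). Hence the functor preserves exactness of
  bounded below complexes of flat modules (\<open>TC_acyclic\<close>), and the usual argument with cones shows that
  the homology does not depend on the flat resolution (\<open>Hm_bij\<close>) and carries a long exact sequence
  (\<open>long_exact_derived\<close>).

  Flatness is known for test modules in a fixed type, but is needed for tensor products with the
  quotients of \<open>N\<close>, for kernels and for direct sums, in many types. So it is first turned into the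
  equational criterion, that relations in \<open>F\<close> come from relations in \<open>R\<close> (\<open>flat_module_eq_flat\<close>).
  The criterion is inherited by kernels and direct sums, holds for free modules, and shows that the
  kernel of a surjection onto a flat module is pure (\<open>flat_quotient_pure\<close>). By a description of
  the elements of \<open>A \<otimes> C\<close> that vanish (\<open>tensor_kernel_iff\<close>), purity is what makes tensor products exact.

  Mapping cones occur twice. The cone of a map between resolutions of the same module is exact,
  which gives the independence of the resolution. The cone of a lift of an injective map \<open>X \<rightarrow> Y\<close> is
  a resolution of the cokernel \<open>Z\<close> (\<open>cone_cx_resolution\<close>); its long exact sequence, in which
  the connecting map is a projection, is the desired one. Since maps between modules need not lift to
  flat resolutions, everything is compared with free resolutions.
\<close>

section \<open>Modules, submodules and quotients\<close>

lemma mod_hom_closed: "f \<in> mod_hom R M N \<Longrightarrow> x \<in> carrier M \<Longrightarrow> f x \<in> carrier N"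
  by (auto simp: mod_hom_def)

lemma mod_hom_add:
  "f \<in> mod_hom R M N \<Longrightarrow> x \<in> carrier M \<Longrightarrow> y \<in> carrier M \<Longrightarrow> f (x \<oplus>\<^bsub>M\<^esub> y) = f x \<oplus>\<^bsub>N\<^esub> f y"
  by (auto simp: mod_hom_def)

lemma mod_hom_smult:
  "f \<in> mod_hom R M N \<Longrightarrow> r \<in> carrier R \<Longrightarrow> x \<in> carrier M \<Longrightarrow> f (r \<odot>\<^bsub>M\<^esub> x) = r \<odot>\<^bsub>N\<^esub> f x"
  by (auto simp: mod_hom_def)

lemma mod_homI:
  assumes "\<And>x. x \<in> carrier M \<Longrightarrow> f x \<in> carrier N"
    and "\<And>x y. x \<in> carrier M \<Longrightarrow> y \<in> carrier M \<Longrightarrow> f (x \<oplus>\<^bsub>M\<^esub> y) = f x \<oplus>\<^bsub>N\<^esub> f y"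
    and "\<And>r x. r \<in> carrier R \<Longrightarrow> x \<in> carrier M \<Longrightarrow> f (r \<odot>\<^bsub>M\<^esub> x) = r \<odot>\<^bsub>N\<^esub> f x"
  shows "f \<in> mod_hom R M N"
  using assms by (auto simp: mod_hom_def)

lemma mod_hom_cong:
  assumes "\<And>x. x \<in> carrier M \<Longrightarrow> f x = g x" "module R M" "g \<in> mod_hom R M N"
  shows "f \<in> mod_hom R M N"
proof -
  interpret M: module R M by fact
  show ?thesis using assms(1,3) by (auto simp: mod_hom_def)
qed

lemma mod_hom_id: "(\<lambda>x. x) \<in> mod_hom R M M"
  by (auto simp: mod_hom_def)

lemma mod_hom_comp:
  "f \<in> mod_hom R M N \<Longrightarrow> g \<in> mod_hom R N L \<Longrightarrow> (\<lambda>x. g (f x)) \<in> mod_hom R M L"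
  by (auto simp: mod_hom_def Pi_iff)

lemma mod_hom_zero:
  assumes "module R M" "module R N" "f \<in> mod_hom R M N"
  shows "f \<zero>\<^bsub>M\<^esub> = \<zero>\<^bsub>N\<^esub>"
proof -
  interpret M: module R M by fact
  interpret N: module R N by fact
  have "f (\<zero>\<^bsub>R\<^esub> \<odot>\<^bsub>M\<^esub> \<zero>\<^bsub>M\<^esub>) = \<zero>\<^bsub>R\<^esub> \<odot>\<^bsub>N\<^esub> f \<zero>\<^bsub>M\<^esub>"
    by (rule mod_hom_smult[OF assms(3)]) auto
  then show ?thesis using mod_hom_closed[OF assms(3)] by simp
qed

lemma mod_hom_neg:
  assumes "module R M" "module R N" "f \<in> mod_hom R M N" "x \<in> carrier M"
  shows "f (\<ominus>\<^bsub>M\<^esub> x) = \<ominus>\<^bsub>N\<^esub> f x"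
proof -
  interpret M: module R M by fact
  interpret N: module R N by fact
  have "f (\<ominus>\<^bsub>M\<^esub> x) \<oplus>\<^bsub>N\<^esub> f x = \<zero>\<^bsub>N\<^esub>"
    using mod_hom_add[OF assms(3), of "\<ominus>\<^bsub>M\<^esub> x" x] mod_hom_zero[OF assms(1-3)] assms(4)
    by (simp add: M.l_neg)
  then show ?thesis
    using mod_hom_closed[OF assms(3)] assms(4) by (intro N.minus_equality[symmetric]) auto
qed

lemma mod_hom_diff:
  assumes "module R M" "module R N" "f \<in> mod_hom R M N" "x \<in> carrier M" "y \<in> carrier M"
  shows "f (x \<ominus>\<^bsub>M\<^esub> y) = f x \<ominus>\<^bsub>N\<^esub> f y"
proof -
  interpret M: module R M by fact
  show ?thesis using assms
    by (simp add: a_minus_def mod_hom_add[OF assms(3)] mod_hom_neg[OF assms(1-3)])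
qed

lemma mod_hom_sum:
  assumes "module R N" "f \<in> mod_hom R M N" "g \<in> mod_hom R M N"
  shows "(\<lambda>x. f x \<oplus>\<^bsub>N\<^esub> g x) \<in> mod_hom R M N"
proof -
  interpret N: module R N by fact
  show ?thesis using assms(2,3)
    by (auto simp: mod_hom_def Pi_iff N.a_ac N.smult_r_distr)
qed

lemma mod_hom_uminus:
  assumes "module R N" "f \<in> mod_hom R M N"
  shows "(\<lambda>x. \<ominus>\<^bsub>N\<^esub> f x) \<in> mod_hom R M N"
proof -
  interpret N: module R N by fact
  show ?thesis using assms(2)
    by (auto simp: mod_hom_def Pi_iff N.minus_add N.smult_r_minus)
qed

lemma mod_hom_minus:
  assumes "module R N" "f \<in> mod_hom R M N" "g \<in> mod_hom R M N"
  shows "(\<lambda>x. f x \<ominus>\<^bsub>N\<^esub> g x) \<in> mod_hom R M N"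
  unfolding a_minus_def by (intro mod_hom_sum mod_hom_uminus assms)

lemma mod_hom_const_zero:
  assumes "module R N"
  shows "(\<lambda>x. \<zero>\<^bsub>N\<^esub>) \<in> mod_hom R M N"
proof -
  interpret N: module R N by fact
  show ?thesis by (auto simp: mod_hom_def)
qed

lemma mod_hom_smult_const:
  assumes "module R N" "r \<in> carrier R" "f \<in> mod_hom R M N"
  shows "(\<lambda>x. r \<odot>\<^bsub>N\<^esub> f x) \<in> mod_hom R M N"
proof -
  interpret N: module R N by fact
  show ?thesis using assms(2,3)
    by (auto simp: mod_hom_def Pi_iff N.smult_r_distr N.smult_assoc1[symmetric] N.R.m_comm)
qed

lemma module_cring: "module R M \<Longrightarrow> cring R"
  by (simp add: module_def)

lemma submodule_in_carrier: "module R M \<Longrightarrow> submodule H R M \<Longrightarrow> x \<in> H \<Longrightarrow> x \<in> carrier M"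
  using module.submoduleE(1) by blast

lemma submodule_diff:
  "module R M \<Longrightarrow> submodule H R M \<Longrightarrow> x \<in> H \<Longrightarrow> y \<in> H \<Longrightarrow> x \<ominus>\<^bsub>M\<^esub> y \<in> H"
  by (simp add: a_minus_def module.submoduleE(3,5))

lemma submodule_zero:
  assumes "module R M" "submodule H R M"
  shows "\<zero>\<^bsub>M\<^esub> \<in> H"
  using assms subgroup.one_closed[OF submodule.axioms(1)[OF assms(2)]] by simp

lemma submodule_vimage:
  assumes "module R M" "module R N" "f \<in> mod_hom R M N" "submodule K R N"
  shows "submodule {x \<in> carrier M. f x \<in> K} R M"
proof -
  interpret M: module R M by fact
  interpret N: module R N by fact
  show ?thesis
    by (rule M.submoduleI)
      (auto simp: mod_hom_add[OF assms(3)] mod_hom_smult[OF assms(3)]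
        mod_hom_zero[OF assms(1-3)] mod_hom_neg[OF assms(1-3)]
        N.submoduleE[OF assms(4)] submodule_zero[OF assms(2,4)])
qed

lemma submodule_image:
  assumes "module R M" "module R N" "f \<in> mod_hom R M N"
  shows "submodule (f ` carrier M) R N"
proof -
  interpret M: module R M by fact
  interpret N: module R N by fact
  show ?thesis
  proof (rule N.submoduleI)
    show "f ` carrier M \<subseteq> carrier N" using mod_hom_closed[OF assms(3)] by auto
    show "\<zero>\<^bsub>N\<^esub> \<in> f ` carrier M" using mod_hom_zero[OF assms] by force
    show "\<ominus>\<^bsub>N\<^esub> a \<in> f ` carrier M" if "a \<in> f ` carrier M" for a
      using that by (auto simp: mod_hom_neg[OF assms, symmetric])
    show "a \<oplus>\<^bsub>N\<^esub> b \<in> f ` carrier M" if "a \<in> f ` carrier M" "b \<in> f ` carrier M" for a b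
      using that by (auto simp: mod_hom_add[OF assms(3), symmetric])
    show "a \<odot>\<^bsub>N\<^esub> x \<in> f ` carrier M" if "a \<in> carrier R" "x \<in> f ` carrier M" for a x
      using that by (auto simp: mod_hom_smult[OF assms(3), symmetric])
  qed
qed

lemma submodule_singleton_zero:
  assumes "module R M"
  shows "submodule {\<zero>\<^bsub>M\<^esub>} R M"
proof -
  interpret M: module R M by fact
  show ?thesis by (rule M.submoduleI) auto
qed

lemma submodule_ker:
  assumes "module R M" "module R N" "f \<in> mod_hom R M N"
  shows "submodule (mod_ker M N f) R M"
  using submodule_vimage[OF assms submodule_singleton_zero[OF assms(2)]]
  by (simp add: mod_ker_def)

lemma submodule_module:
  "module R M \<Longrightarrow> submodule H R M \<Longrightarrow> module R (M\<lparr>carrier := H\<rparr>)"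
  by (rule submodule.submodule_is_module)

lemma submodule_of_submodule:
  assumes "module R M" "submodule H R M" "submodule K R M" "K \<subseteq> H"
  shows "submodule K R (M\<lparr>carrier := H\<rparr>)"
proof -
  interpret M: module R M by fact
  interpret H: module R "M\<lparr>carrier := H\<rparr>" using submodule_module[OF assms(1,2)] .
  show ?thesis
    by (rule H.module_incl_imp_submodule) (use submodule_module[OF assms(1,3)] assms(4) in auto)
qed

lemma submodule_span:
  assumes "module R M" "S \<subseteq> carrier M"
  shows "submodule (span_submodule R M S) R M"
proof -
  interpret M: module R M by fact
  have ne: "carrier M \<in> {H. submodule H R M \<and> S \<subseteq> H}"
    using M.carrier_is_submodule assms(2) by auto
  show ?thesis unfolding span_submodule_def
    by (rule M.submoduleI)
      (use ne in \<open>auto simp: M.submoduleE submodule_zero[OF assms(1)]\<close>)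
qed

lemma span_superset: "S \<subseteq> span_submodule R M S"
  by (auto simp: span_submodule_def)

lemma span_least: "submodule H R M \<Longrightarrow> S \<subseteq> H \<Longrightarrow> span_submodule R M S \<subseteq> H"
  by (auto simp: span_submodule_def)

lemma submodule_abelian_subgroup:
  assumes "module R M" "submodule K R M"
  shows "abelian_subgroup K M"
proof -
  interpret M: module R M by fact
  show ?thesis
    by (rule abelian_subgroupI3)
      (use assms(2) in \<open>auto simp: additive_subgroup_def submodule_def
        intro: M.abelian_group_axioms\<close>)
qed

lemma coset_eq_iff:
  assumes "module R M" "submodule K R M" "x \<in> carrier M" "y \<in> carrier M"
  shows "K +>\<^bsub>M\<^esub> x = K +>\<^bsub>M\<^esub> y \<longleftrightarrow> x \<ominus>\<^bsub>M\<^esub> y \<in> K"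
proof -
  interpret M: module R M by fact
  interpret K: abelian_subgroup K M by (rule submodule_abelian_subgroup[OF assms(1,2)])
  show ?thesis
    by (metis K.a_rcos_module_minus K.a_rcos_self K.a_repr_independence' M.is_abelian_group assms(3,4)
        abelian_subgroup.a_repr_independenceD K.abelian_subgroup_axioms ring_def M.R.ring_axioms
        K.a_rcos_module a_minus_def)
qed

lemma mem_coset_iff:
  assumes "module R M" "submodule K R M" "x \<in> carrier M"
  shows "y \<in> K +>\<^bsub>M\<^esub> x \<longleftrightarrow> y \<in> carrier M \<and> K +>\<^bsub>M\<^esub> y = K +>\<^bsub>M\<^esub> x"
proof -
  interpret M: module R M by fact
  interpret K: abelian_subgroup K M by (rule submodule_abelian_subgroup[OF assms(1,2)])
  show ?thesis
    by (metis K.a_elemrcos_carrier K.a_rcos_self K.a_repr_independence' assms(3))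
qed

lemma carrier_quot_module: "carrier (quot_module M K) = (\<lambda>x. K +>\<^bsub>M\<^esub> x) ` carrier M"
  by (auto simp: quot_module_def A_RCOSETS_def')

lemma zero_quot_module: "\<zero>\<^bsub>quot_module M K\<^esub> = K"
  by (simp add: quot_module_def)

lemma coset_eq_self_iff:
  assumes "module R M" "submodule K R M" "x \<in> carrier M"
  shows "K +>\<^bsub>M\<^esub> x = K \<longleftrightarrow> x \<in> K"
proof -
  interpret M: module R M by fact
  interpret K: abelian_subgroup K M by (rule submodule_abelian_subgroup[OF assms(1,2)])
  show ?thesis
    by (metis K.a_rcos_const K.a_rcos_self assms(3))
qed

lemma add_quot_module:
  assumes "module R M" "submodule K R M" "x \<in> carrier M" "y \<in> carrier M"
  shows "(K +>\<^bsub>M\<^esub> x) \<oplus>\<^bsub>quot_module M K\<^esub> (K +>\<^bsub>M\<^esub> y) = K +>\<^bsub>M\<^esub> (x \<oplus>\<^bsub>M\<^esub> y)"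
proof -
  interpret M: module R M by fact
  interpret K: abelian_subgroup K M by (rule submodule_abelian_subgroup[OF assms(1,2)])
  show ?thesis using K.a_rcos_sum[OF assms(3,4)] by (simp add: quot_module_def)
qed

lemma quot_map_coset:
  assumes "module R M" "submodule K R M" "module R M'" "submodule K' R M'"
    and "\<And>y. y \<in> carrier M \<Longrightarrow> f y \<in> carrier M'"
    and "\<And>y. y \<in> carrier M \<Longrightarrow> y \<ominus>\<^bsub>M\<^esub> x \<in> K \<Longrightarrow> f y \<ominus>\<^bsub>M'\<^esub> f x \<in> K'"
    and "x \<in> carrier M"
  shows "quot_map M' K' f (K +>\<^bsub>M\<^esub> x) = K' +>\<^bsub>M'\<^esub> f x"
proof -
  have "K' +>\<^bsub>M'\<^esub> f y = K' +>\<^bsub>M'\<^esub> f x" if "y \<in> K +>\<^bsub>M\<^esub> x" for y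
    using that assms by (auto simp: mem_coset_iff coset_eq_iff)
  moreover have "x \<in> K +>\<^bsub>M\<^esub> x" using assms by (simp add: mem_coset_iff)
  ultimately show ?thesis unfolding quot_map_def by blast
qed

lemma smult_quot_module:
  assumes "module R M" "submodule K R M" "r \<in> carrier R" "x \<in> carrier M"
  shows "r \<odot>\<^bsub>quot_module M K\<^esub> (K +>\<^bsub>M\<^esub> x) = K +>\<^bsub>M\<^esub> (r \<odot>\<^bsub>M\<^esub> x)"
proof -
  interpret M: module R M by fact
  have "r \<odot>\<^bsub>quot_module M K\<^esub> (K +>\<^bsub>M\<^esub> x) = quot_map M K (\<lambda>x. r \<odot>\<^bsub>M\<^esub> x) (K +>\<^bsub>M\<^esub> x)"
    by (simp add: quot_module_def quot_map_def)
  also have "\<dots> = K +>\<^bsub>M\<^esub> (r \<odot>\<^bsub>M\<^esub> x)"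
  proof (rule quot_map_coset[OF assms(1,2,1,2)])
    fix y assume y: "y \<in> carrier M" "y \<ominus>\<^bsub>M\<^esub> x \<in> K"
    have "r \<odot>\<^bsub>M\<^esub> y \<ominus>\<^bsub>M\<^esub> r \<odot>\<^bsub>M\<^esub> x = r \<odot>\<^bsub>M\<^esub> (y \<ominus>\<^bsub>M\<^esub> x)"
      using y assms by (simp add: a_minus_def M.smult_r_distr M.smult_r_minus)
    then show "r \<odot>\<^bsub>M\<^esub> y \<ominus>\<^bsub>M\<^esub> r \<odot>\<^bsub>M\<^esub> x \<in> K"
      using M.submoduleE(4)[OF assms(2,3) y(2)] by simp
  qed (use assms in auto)
  finally show ?thesis .
qed

lemma module_quot:
  assumes "module R M" "submodule K R M"
  shows "module R (quot_module M K)"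
proof -
  interpret M: module R M by fact
  let ?Q = "quot_module M K"
  let ?c = "\<lambda>x. K +>\<^bsub>M\<^esub> x"
  note simps = add_quot_module[OF assms] smult_quot_module[OF assms] carrier_quot_module
  have z: "\<zero>\<^bsub>?Q\<^esub> = ?c \<zero>\<^bsub>M\<^esub>"
    using coset_eq_self_iff[OF assms, of "\<zero>\<^bsub>M\<^esub>"] submodule_zero[OF assms]
    by (simp add: zero_quot_module)
  show ?thesis
  proof (rule moduleI)
    show "cring R" by (rule M.R.cring_axioms)
    show "abelian_group ?Q"
    proof (rule abelian_groupI)
      fix X assume "X \<in> carrier ?Q"
      then obtain x where x: "x \<in> carrier M" "X = ?c x" by (auto simp: simps)
      have "?c (\<ominus>\<^bsub>M\<^esub> x) \<oplus>\<^bsub>?Q\<^esub> X = \<zero>\<^bsub>?Q\<^esub>"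
        using x by (simp add: simps z M.l_neg)
      then show "\<exists>y\<in>carrier ?Q. y \<oplus>\<^bsub>?Q\<^esub> X = \<zero>\<^bsub>?Q\<^esub>"
        using x by (auto simp: carrier_quot_module)
    qed (auto simp: simps z M.a_ac)
  qed (auto simp: simps M.smult_l_distr M.smult_r_distr M.smult_assoc1)
qed

lemma quot_map_coset_hom:
  assumes "module R M" "submodule K R M" "module R M'" "submodule K' R M'"
    and "f \<in> mod_hom R M M'" "\<And>y. y \<in> K \<Longrightarrow> f y \<in> K'" "x \<in> carrier M"
  shows "quot_map M' K' f (K +>\<^bsub>M\<^esub> x) = K' +>\<^bsub>M'\<^esub> f x"
  by (rule quot_map_coset[OF assms(1-4)])
    (use assms(6,7) in \<open>auto simp: mod_hom_closed[OF assms(5)]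
       mod_hom_diff[OF assms(1,3,5), symmetric]\<close>)

lemma quot_map_hom:
  assumes "module R M" "submodule K R M" "module R M'" "submodule K' R M'"
    and "f \<in> mod_hom R M M'" "\<And>y. y \<in> K \<Longrightarrow> f y \<in> K'"
  shows "quot_map M' K' f \<in> mod_hom R (quot_module M K) (quot_module M' K')"
proof -
  interpret M: module R M by fact
  show ?thesis
    by (rule mod_homI)
      (auto simp: carrier_quot_module quot_map_coset_hom[OF assms] add_quot_module[OF assms(1,2)]
        add_quot_module[OF assms(3,4)] smult_quot_module[OF assms(1,2)]
        smult_quot_module[OF assms(3,4)] mod_hom_closed[OF assms(5)] mod_hom_add[OF assms(5)]
        mod_hom_smult[OF assms(5)])
qed

lemma coset_hom:
  assumes "module R M" "submodule K R M"
  shows "(\<lambda>x. K +>\<^bsub>M\<^esub> x) \<in> mod_hom R M (quot_module M K)"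
  by (rule mod_homI)
    (auto simp: carrier_quot_module add_quot_module[OF assms] smult_quot_module[OF assms])

lemma regular_module_module:
  assumes "cring R"
  shows "module R (regular_module R)"
proof -
  interpret R: cring R by fact
  show ?thesis
    by (rule moduleI, fact, rule abelian_groupI)
      (auto simp: regular_module_def R.a_ac R.l_distr R.r_distr R.m_assoc intro: R.l_neg)
qed

lemma regular_module_simps [simp]:
  "carrier (regular_module R) = carrier R" "add (regular_module R) = add R"
  "zero (regular_module R) = zero R" "smult (regular_module R) = monoid.mult R"
  by (simp_all add: regular_module_def)

section \<open>Free modules\<close>

lemma free_module_simps [simp]:
  "zero (free_module R S) = (\<lambda>x. \<zero>\<^bsub>R\<^esub>)"
  "add (free_module R S) = (\<lambda>c d x. c x \<oplus>\<^bsub>R\<^esub> d x)"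
  "smult (free_module R S) = (\<lambda>r c x. r \<otimes>\<^bsub>R\<^esub> c x)"
  by (simp_all add: free_module_def)

lemma mem_free_module:
  "c \<in> carrier (free_module R S) \<longleftrightarrow> (\<forall>x. c x \<in> carrier R) \<and> (\<forall>x. x \<notin> S \<longrightarrow> c x = \<zero>\<^bsub>R\<^esub>) \<and>
     finite {x. c x \<noteq> \<zero>\<^bsub>R\<^esub>}"
  by (simp add: free_module_def)

lemma free_module_coeff: "c \<in> carrier (free_module R S) \<Longrightarrow> c x \<in> carrier R"
  by (simp add: mem_free_module)

lemma module_free_module:
  assumes "cring R"
  shows "module R (free_module R S)"
proof -
  interpret R: cring R by fact
  have fin2: "finite {x. c x \<oplus>\<^bsub>R\<^esub> d x \<noteq> \<zero>\<^bsub>R\<^esub>}"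
    if "finite {x. c x \<noteq> \<zero>\<^bsub>R\<^esub>}" "finite {x. d x \<noteq> \<zero>\<^bsub>R\<^esub>}" for c d
    by (rule finite_subset[OF _ finite_UnI[OF that]]) auto
  have fin1: "finite {x. r \<otimes>\<^bsub>R\<^esub> c x \<noteq> \<zero>\<^bsub>R\<^esub>}"
    if "finite {x. c x \<noteq> \<zero>\<^bsub>R\<^esub>}" "r \<in> carrier R" for r c
    by (rule finite_subset[OF _ that(1)]) (use that(2) in auto)
  show ?thesis
  proof (rule moduleI)
    show "cring R" by fact
    show "abelian_group (free_module R S)"
    proof (rule abelian_groupI)
      fix c assume c: "c \<in> carrier (free_module R S)"
      show "\<exists>d\<in>carrier (free_module R S).
          d \<oplus>\<^bsub>free_module R S\<^esub> c = \<zero>\<^bsub>free_module R S\<^esub>"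
      proof (rule bexI)
        show "(\<lambda>x. \<ominus>\<^bsub>R\<^esub> c x) \<oplus>\<^bsub>free_module R S\<^esub> c = \<zero>\<^bsub>free_module R S\<^esub>"
          using c by (simp add: mem_free_module R.l_neg)
        have "{x. \<ominus>\<^bsub>R\<^esub> c x \<noteq> \<zero>\<^bsub>R\<^esub>} \<subseteq> {x. c x \<noteq> \<zero>\<^bsub>R\<^esub>}" by auto
        then have "finite {x. \<ominus>\<^bsub>R\<^esub> c x \<noteq> \<zero>\<^bsub>R\<^esub>}"
          by (rule finite_subset) (use c in \<open>simp add: mem_free_module\<close>)
        then show "(\<lambda>x. \<ominus>\<^bsub>R\<^esub> c x) \<in> carrier (free_module R S)"
          using c by (auto simp: mem_free_module)
      qed
    qed (auto simp: mem_free_module fin2 R.a_assoc R.a_comm R.a_lcomm)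
  qed (auto simp: mem_free_module fin1 R.l_distr R.r_distr R.m_assoc)
qed

lemma free_gen_closed:
  assumes "cring R" "s \<in> S"
  shows "free_gen R s \<in> carrier (free_module R S)"
proof -
  interpret R: cring R by fact
  have "{x. free_gen R s x \<noteq> \<zero>\<^bsub>R\<^esub>} \<subseteq> {s}" by (auto simp: free_gen_def)
  then have "finite {x. free_gen R s x \<noteq> \<zero>\<^bsub>R\<^esub>}" by (rule finite_subset) simp
  then show ?thesis using assms(2) by (auto simp: mem_free_module free_gen_def)
qed

lemma free_module_uminus:
  assumes "cring R" "c \<in> carrier (free_module R S)"
  shows "\<ominus>\<^bsub>free_module R S\<^esub> c = (\<lambda>x. \<ominus>\<^bsub>R\<^esub> c x)"
proof -
  interpret R: cring R by fact
  interpret F: module R "free_module R S" using module_free_module[OF assms(1)] .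
  have "\<ominus>\<^bsub>free_module R S\<^esub> c = (\<ominus>\<^bsub>R\<^esub> \<one>\<^bsub>R\<^esub>) \<odot>\<^bsub>free_module R S\<^esub> c"
    using F.smult_l_minus[OF R.one_closed assms(2)] F.smult_one[OF assms(2)] by simp
  also have "\<dots> = (\<lambda>x. \<ominus>\<^bsub>R\<^esub> c x)"
    using assms(2) by (simp add: mem_free_module R.l_minus)
  finally show ?thesis .
qed

lemma free_module_minus:
  assumes "cring R" "c \<in> carrier (free_module R S)" "d \<in> carrier (free_module R S)"
  shows "c \<ominus>\<^bsub>free_module R S\<^esub> d = (\<lambda>x. c x \<ominus>\<^bsub>R\<^esub> d x)"
  by (simp add: a_minus_def free_module_uminus[OF assms(1,3)])

lemma free_module_coeff_hom: "(\<lambda>c. c x) \<in> mod_hom R (free_module R S) (regular_module R)"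
  by (rule mod_homI) (auto simp: mem_free_module)

lemma free_module_induct [consumes 2, case_names zero add]:
  assumes "cring R" "w \<in> carrier (free_module R S)"
    and zero: "P (\<lambda>x. \<zero>\<^bsub>R\<^esub>)"
    and add: "\<And>w r s. w \<in> carrier (free_module R S) \<Longrightarrow> P w \<Longrightarrow> r \<in> carrier R \<Longrightarrow> s \<in> S \<Longrightarrow>
       P (w \<oplus>\<^bsub>free_module R S\<^esub> (r \<odot>\<^bsub>free_module R S\<^esub> free_gen R s))"
  shows "P w"
proof -
  interpret R: cring R by fact
  have "\<forall>w \<in> carrier (free_module R S). {x. w x \<noteq> \<zero>\<^bsub>R\<^esub>} = T \<longrightarrow> P w" if "finite T" for T
    using that
  proof (induction T)
    case empty
    have "w = (\<lambda>x. \<zero>\<^bsub>R\<^esub>)" if "{x. w x \<noteq> \<zero>\<^bsub>R\<^esub>} = {}" for w :: "'b \<Rightarrow> 'a" using that by auto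
    then show ?case using zero by auto
  next
    case (insert s T)
    show ?case
    proof (intro ballI impI)
      fix w assume w: "w \<in> carrier (free_module R S)" "{x. w x \<noteq> \<zero>\<^bsub>R\<^esub>} = insert s T"
      let ?v = "w(s := \<zero>\<^bsub>R\<^esub>)"
      have supp: "{x. ?v x \<noteq> \<zero>\<^bsub>R\<^esub>} = T" using w(2) insert.hyps by auto
      then have v: "?v \<in> carrier (free_module R S)"
        using w(1) insert.hyps by (simp add: mem_free_module)
      have "w = ?v \<oplus>\<^bsub>free_module R S\<^esub> (w s \<odot>\<^bsub>free_module R S\<^esub> free_gen R s)"
        using w(1) by (auto simp: free_gen_def mem_free_module fun_eq_iff)
      moreover have "s \<in> S" using w by (auto simp: mem_free_module)
      ultimately show "P w"
        using add[OF v _ free_module_coeff[OF w(1)], of s s] insert.IH v supp by simp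
    qed
  qed
  then show ?thesis using assms(2) by (auto simp: mem_free_module)
qed

lemma free_module_hom_eqI:
  assumes "module R M" "f \<in> mod_hom R (free_module R S) M" "g \<in> mod_hom R (free_module R S) M"
    and "\<And>s. s \<in> S \<Longrightarrow> f (free_gen R s) = g (free_gen R s)"
    and "w \<in> carrier (free_module R S)"
  shows "f w = g w"
  using module_cring[OF assms(1)] assms(5)
proof (induction w rule: free_module_induct)
  case zero
  show ?case
    using mod_hom_zero[OF module_free_module[OF module_cring[OF assms(1)]] assms(1,2)]
      mod_hom_zero[OF module_free_module[OF module_cring[OF assms(1)]] assms(1,3)] by simp
next
  case (add w r s)
  interpret F: module R "free_module R S"
    using module_free_module[OF module_cring[OF assms(1)]] .
  have e: "free_gen R s \<in> carrier (free_module R S)"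
    using free_gen_closed[OF module_cring[OF assms(1)] add.hyps(3)] .
  have "h (w \<oplus>\<^bsub>free_module R S\<^esub> (r \<odot>\<^bsub>free_module R S\<^esub> free_gen R s)) =
      h w \<oplus>\<^bsub>M\<^esub> r \<odot>\<^bsub>M\<^esub> h (free_gen R s)" if "h \<in> mod_hom R (free_module R S) M" for h
    using mod_hom_add[OF that add.hyps(1)  F.smult_closed[OF add.hyps(2) e]] mod_hom_smult[OF that add.hyps(2) e]
    by (simp del: free_module_simps)
  from this[OF assms(2)] this[OF assms(3)] show ?case
    using assms(4) add by (simp del: free_module_simps)
qed

definition lin_ext ::
    "('r, 'z) ring_scheme \<Rightarrow> ('r, 'a) module \<Rightarrow> ('s \<Rightarrow> 'a) \<Rightarrow> ('s \<Rightarrow> 'r) \<Rightarrow> 'a" where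
  "lin_ext R M h w = (\<Oplus>\<^bsub>M\<^esub>s\<in>{s. w s \<noteq> \<zero>\<^bsub>R\<^esub>}. w s \<odot>\<^bsub>M\<^esub> h s)"

lemma lin_ext_superset:
  assumes "module R M" "\<And>s. s \<in> S \<Longrightarrow> h s \<in> carrier M" "w \<in> carrier (free_module R S)"
    and "finite T" "T \<subseteq> S" "{s. w s \<noteq> \<zero>\<^bsub>R\<^esub>} \<subseteq> T"
  shows "lin_ext R M h w = (\<Oplus>\<^bsub>M\<^esub>s\<in>T. w s \<odot>\<^bsub>M\<^esub> h s)"
proof -
  interpret M: module R M by fact
  show ?thesis unfolding lin_ext_def
    by (rule M.add.finprod_mono_neutral_cong_left)
      (use assms in \<open>auto simp: mem_free_module\<close>)
qed

lemma lin_ext_hom: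
  assumes "module R M" "\<And>s. s \<in> S \<Longrightarrow> h s \<in> carrier M"
  shows "lin_ext R M h \<in> mod_hom R (free_module R S) M"
proof -
  interpret M: module R M by fact
  interpret F: module R "free_module R S" using module_free_module[OF M.R.cring_axioms] .
  let ?supp = "\<lambda>w. {s. w s \<noteq> \<zero>\<^bsub>R\<^esub>}"
  show ?thesis
  proof (rule mod_homI)
    fix w assume w: "w \<in> carrier (free_module R S)"
    then show "lin_ext R M h w \<in> carrier M"
      unfolding lin_ext_def using assms(2) by (intro M.finsum_closed) (auto simp: mem_free_module)
    fix r assume r: "r \<in> carrier R"
    let ?rw = "r \<odot>\<^bsub>free_module R S\<^esub> w"
    have rw: "?rw \<in> carrier (free_module R S)" using r w by blast
    have S: "s \<in> S" if "w s \<noteq> \<zero>\<^bsub>R\<^esub>" for s using w that by (auto simp: mem_free_module)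
    have "lin_ext R M h ?rw = (\<Oplus>\<^bsub>M\<^esub>s\<in>?supp w. ?rw s \<odot>\<^bsub>M\<^esub> h s)"
      by (rule lin_ext_superset[OF assms rw]) (use r w in \<open>auto simp: mem_free_module\<close>)
    also have "\<dots> = (\<Oplus>\<^bsub>M\<^esub>s\<in>?supp w. r \<odot>\<^bsub>M\<^esub> (w s \<odot>\<^bsub>M\<^esub> h s))"
      by (rule M.add.finprod_cong)
        (use r w assms(2) in \<open>auto simp: mem_free_module M.smult_assoc1 simp_implies_def S\<close>)
    also have "\<dots> = r \<odot>\<^bsub>M\<^esub> lin_ext R M h w" unfolding lin_ext_def
      by (rule M.finsum_smult_ldistr[symmetric]) (use r w assms(2) in \<open>auto simp: mem_free_module\<close>)
    finally show "lin_ext R M h ?rw = r \<odot>\<^bsub>M\<^esub> lin_ext R M h w" .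
  next
    fix w v assume w: "w \<in> carrier (free_module R S)" and v: "v \<in> carrier (free_module R S)"
    let ?T = "?supp w \<union> ?supp v"
    let ?wv = "w \<oplus>\<^bsub>free_module R S\<^esub> v"
    have T: "finite ?T" "?T \<subseteq> S" using w v by (auto simp: mem_free_module)
    have wv: "?wv \<in> carrier (free_module R S)" using w v by blast
    have h: "h s \<in> carrier M" if "s \<in> ?T" for s using that T(2) assms(2) by blast
    have "lin_ext R M h ?wv = (\<Oplus>\<^bsub>M\<^esub>s\<in>?T. ?wv s \<odot>\<^bsub>M\<^esub> h s)"
      by (rule lin_ext_superset[OF assms wv T]) auto
    also have "\<dots> = (\<Oplus>\<^bsub>M\<^esub>s\<in>?T. w s \<odot>\<^bsub>M\<^esub> h s \<oplus>\<^bsub>M\<^esub> v s \<odot>\<^bsub>M\<^esub> h s)"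
      by (rule M.add.finprod_cong)
        (use w v h in \<open>auto simp: mem_free_module M.smult_l_distr simp_implies_def\<close>)
    also have "\<dots> = (\<Oplus>\<^bsub>M\<^esub>s\<in>?T. w s \<odot>\<^bsub>M\<^esub> h s) \<oplus>\<^bsub>M\<^esub> (\<Oplus>\<^bsub>M\<^esub>s\<in>?T. v s \<odot>\<^bsub>M\<^esub> h s)"
      by (rule M.finsum_addf) (use w v h in \<open>auto simp: mem_free_module\<close>)
    also have "\<dots> = lin_ext R M h w \<oplus>\<^bsub>M\<^esub> lin_ext R M h v"
      using lin_ext_superset[OF assms w T] lin_ext_superset[OF assms v T] by simp
    finally show "lin_ext R M h ?wv = lin_ext R M h w \<oplus>\<^bsub>M\<^esub> lin_ext R M h v" .
  qed
qed

lemma lin_ext_gen: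
  assumes "module R M" "h s \<in> carrier M"
  shows "lin_ext R M h (free_gen R s) = h s"
proof -
  interpret M: module R M by fact
  have "lin_ext R M h (free_gen R s) = (\<Oplus>\<^bsub>M\<^esub>t\<in>{s}. free_gen R s t \<odot>\<^bsub>M\<^esub> h t)"
    by (rule lin_ext_superset[OF assms(1), of "{s}"])
      (use assms(2) in \<open>auto simp: free_gen_closed[OF M.R.cring_axioms]\<close>,
        simp add: free_gen_def split: if_splits)
  also have "\<dots> = h s" using assms(2) by (simp add: free_gen_def)
  finally show ?thesis .
qed

lemma free_map_lin_ext:
  assumes "cring R" "c \<in> carrier (free_module R S)"
  shows "free_map R f c y =
    lin_ext R (regular_module R) (\<lambda>x. if f x = y then \<one>\<^bsub>R\<^esub> else \<zero>\<^bsub>R\<^esub>) c"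
proof -
  interpret R: cring R by fact
  have "free_map R f c y =
      (\<Oplus>\<^bsub>R\<^esub>x\<in>{s. c s \<noteq> \<zero>\<^bsub>R\<^esub>}. c x \<otimes>\<^bsub>R\<^esub> (if f x = y then \<one>\<^bsub>R\<^esub> else \<zero>\<^bsub>R\<^esub>))"
    unfolding free_map_def
    by (rule R.add.finprod_mono_neutral_cong_left) (use assms(2) in \<open>auto simp: mem_free_module\<close>)
  then show ?thesis by (simp add: lin_ext_def finsum_def finprod_def regular_module_def)
qed

lemma free_map_hom:
  assumes "cring R" "\<And>s. s \<in> S \<Longrightarrow> f s \<in> T"
  shows "free_map R f \<in> mod_hom R (free_module R S) (free_module R T)"
proof -
  interpret R: cring R by fact
  let ?h = "\<lambda>y. lin_ext R (regular_module R) (\<lambda>x. if f x = y then \<one>\<^bsub>R\<^esub> else \<zero>\<^bsub>R\<^esub>)"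
  have eq: "free_map R f c y = ?h y c" if "c \<in> carrier (free_module R S)" for c y
    by (rule free_map_lin_ext[OF assms(1) that])
  have hom: "?h y \<in> mod_hom R (free_module R S) (regular_module R)" for y
    by (rule lin_ext_hom[OF regular_module_module[OF assms(1)]]) auto
  interpret F: module R "free_module R S" using module_free_module[OF assms(1)] .
  show ?thesis
  proof (rule mod_homI)
    fix c assume c: "c \<in> carrier (free_module R S)"
    let ?supp = "{s. c s \<noteq> \<zero>\<^bsub>R\<^esub>}"
    have z: "free_map R f c y = \<zero>\<^bsub>R\<^esub>" if "y \<notin> f ` ?supp" for y
    proof -
      have "{x. c x \<noteq> \<zero>\<^bsub>R\<^esub> \<and> f x = y} = {}" using that by auto
      then show ?thesis by (simp add: free_map_def del: Collect_empty_eq)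
    qed
    have "{y. free_map R f c y \<noteq> \<zero>\<^bsub>R\<^esub>} \<subseteq> f ` ?supp" using z by auto
    then have "finite {y. free_map R f c y \<noteq> \<zero>\<^bsub>R\<^esub>}"
      by (rule finite_subset) (use c in \<open>simp add: mem_free_module\<close>)
    moreover have "free_map R f c y = \<zero>\<^bsub>R\<^esub>" if "y \<notin> T" for y
      using z[of y] that assms(2) c by (auto simp: mem_free_module)
    moreover have "free_map R f c y \<in> carrier R" for y
      using mod_hom_closed[OF hom c] eq[OF c] by simp
    ultimately show "free_map R f c \<in> carrier (free_module R T)" by (simp add: mem_free_module)
    fix r assume r: "r \<in> carrier R"
    show "free_map R f (r \<odot>\<^bsub>free_module R S\<^esub> c) = r \<odot>\<^bsub>free_module R T\<^esub> free_map R f c"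
      using mod_hom_smult[OF hom r c] eq[OF c] eq[OF F.smult_closed[OF r c]]
      by (simp add: fun_eq_iff)
  next
    fix c d assume c: "c \<in> carrier (free_module R S)" and d: "d \<in> carrier (free_module R S)"
    show "free_map R f (c \<oplus>\<^bsub>free_module R S\<^esub> d) =
        free_map R f c \<oplus>\<^bsub>free_module R T\<^esub> free_map R f d"
      using mod_hom_add[OF hom c d] eq[OF c] eq[OF d] eq[OF F.a_closed[OF c d]]
      by (simp add: fun_eq_iff)
  qed
qed

lemma free_map_gen:
  assumes "cring R"
  shows "free_map R f (free_gen R s) = free_gen R (f s)"
proof -
  interpret R: cring R by fact
  have "free_map R f (free_gen R s) y = free_gen R (f s) y" for y
    using free_map_lin_ext[OF assms free_gen_closed[OF assms UNIV_I], of f s y]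
      lin_ext_gen[OF regular_module_module[OF assms], of "\<lambda>x. if f x = y then \<one>\<^bsub>R\<^esub> else \<zero>\<^bsub>R\<^esub>" s]
    by (simp add: free_gen_def[of R "f s"])
  then show ?thesis by blast
qed

section \<open>The equational criterion for flatness\<close>

primrec lin_comb ::
    "('r, 'a) module \<Rightarrow> nat \<Rightarrow> (nat \<Rightarrow> 'r) \<Rightarrow> (nat \<Rightarrow> 'a) \<Rightarrow> 'a" where
  "lin_comb M 0 v x = \<zero>\<^bsub>M\<^esub>"
| "lin_comb M (Suc n) v x = lin_comb M n v x \<oplus>\<^bsub>M\<^esub> v n \<odot>\<^bsub>M\<^esub> x n"

lemma lin_comb_closed:
  assumes "module R M" "\<And>i. i < n \<Longrightarrow> v i \<in> carrier R" "\<And>i. i < n \<Longrightarrow> x i \<in> carrier M"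
  shows "lin_comb M n v x \<in> carrier M"
proof -
  interpret M: module R M by fact
  show ?thesis using assms(2,3) by (induction n) auto
qed

lemma lin_comb_cong:
  assumes "\<And>i. i < n \<Longrightarrow> v i = w i" "\<And>i. i < n \<Longrightarrow> x i = y i"
  shows "lin_comb M n v x = lin_comb M n w y"
  using assms by (induction n) auto

lemma lin_comb_add:
  assumes "module R M" "\<And>i. v i \<in> carrier R" "\<And>i. x i \<in> carrier M" "\<And>i. y i \<in> carrier M"
  shows "lin_comb M n v (\<lambda>i. x i \<oplus>\<^bsub>M\<^esub> y i) = lin_comb M n v x \<oplus>\<^bsub>M\<^esub> lin_comb M n v y"
proof -
  interpret M: module R M by fact
  show ?thesis
    by (induction n)
      (simp_all add: assms lin_comb_closed[OF assms(1)] M.smult_r_distr M.add.m_assoc M.add.m_lcomm)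
qed

lemma lin_comb_smult:
  assumes "module R M" "\<And>i. v i \<in> carrier R" "\<And>i. w i \<in> carrier R" "c \<in> carrier M"
  shows "lin_comb M n v (\<lambda>i. w i \<odot>\<^bsub>M\<^esub> c) = lin_comb (regular_module R) n v w \<odot>\<^bsub>M\<^esub> c"
proof -
  interpret M: module R M by fact
  show ?thesis
    using assms(2-4) lin_comb_closed[OF regular_module_module[OF M.R.cring_axioms], of _ v w]
    by (induction n) (simp_all add: M.smult_l_distr M.smult_assoc1)
qed

lemma lin_comb_zero:
  assumes "module R M" "\<And>i. i < n \<Longrightarrow> v i = \<zero>\<^bsub>R\<^esub>" "\<And>i. i < n \<Longrightarrow> x i \<in> carrier M"
  shows "lin_comb M n v x = \<zero>\<^bsub>M\<^esub>"
proof -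
  interpret M: module R M by fact
  show ?thesis using assms(2,3) by (induction n) auto
qed

lemma lin_comb_hom:
  assumes "module R M" "module R N" "f \<in> mod_hom R M N"
    and "\<And>i. i < n \<Longrightarrow> v i \<in> carrier R" "\<And>i. i < n \<Longrightarrow> x i \<in> carrier M"
  shows "f (lin_comb M n v x) = lin_comb N n v (\<lambda>i. f (x i))"
proof -
  interpret M: module R M by fact
  show ?thesis using assms(4,5)
    by (induction n)
      (simp_all add: mod_hom_zero[OF assms(1-3)] mod_hom_add[OF assms(3)]
        mod_hom_smult[OF assms(3)] lin_comb_closed[OF assms(1)])
qed

lemma lin_comb_swap:
  assumes "module R M" "\<And>i. v i \<in> carrier R" "\<And>l i. \<rho> l i \<in> carrier R" "\<And>l. y l \<in> carrier M"
  shows "lin_comb M n v (\<lambda>i. lin_comb M m (\<lambda>l. \<rho> l i) y) =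
    lin_comb M m (\<lambda>l. lin_comb (regular_module R) n v (\<rho> l)) y"
proof -
  interpret M: module R M by fact
  show ?thesis
  proof (induction m)
    case 0
    have "lin_comb M n v (\<lambda>i. \<zero>\<^bsub>M\<^esub>) = \<zero>\<^bsub>M\<^esub>" using assms(2) by (induction n) auto
    then show ?case by simp
  next
    case (Suc m)
    then show ?case
      using assms lin_comb_add[OF assms(1,2), of "\<lambda>i. lin_comb M m (\<lambda>l. \<rho> l i) y" "\<lambda>i. \<rho> m i \<odot>\<^bsub>M\<^esub> y m" n]
        lin_comb_smult[OF assms(1,2), of "\<rho> m" "y m" n]
      by (simp add: lin_comb_closed[OF assms(1)])
  qed
qed

lemma lin_comb_delta:
  assumes "module R M" "\<And>i. x i \<in> carrier M"
  shows "lin_comb M n (\<lambda>l. if l = i then \<one>\<^bsub>R\<^esub> else \<zero>\<^bsub>R\<^esub>) x = (if i < n then x i else \<zero>\<^bsub>M\<^esub>)"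
proof -
  interpret M: module R M by fact
  show ?thesis using assms(2) by (induction n) (auto simp: less_Suc_eq)
qed

lemma lin_comb_comm:
  assumes "cring R" "\<And>i. v i \<in> carrier R" "\<And>i. w i \<in> carrier R"
  shows "lin_comb (regular_module R) n v w = lin_comb (regular_module R) n w v"
proof -
  interpret R: cring R by fact
  show ?thesis using assms(2,3) by (induction n) (auto simp: R.m_comm)
qed

text \<open>
  The families of elements of \<open>M\<close> that are explained by the coefficient vectors in \<open>P\<close>: if \<open>P\<close> is a
  submodule of \<open>R\<^sup>s\<close>, this is the image of \<open>P \<otimes> M\<close> in \<open>M\<^sup>s\<close>. Flatness and vanishing in a tensor
  product are both expressed by it, with \<open>P\<close> a set of relations.
\<close>

inductive_set rel_span ::
    "('r, 'a) module \<Rightarrow> ('s \<Rightarrow> 'r) set \<Rightarrow> ('s \<Rightarrow> 'a) set" for M P where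
  zero: "(\<lambda>_. \<zero>\<^bsub>M\<^esub>) \<in> rel_span M P"
| add: "x \<in> rel_span M P \<Longrightarrow> \<rho> \<in> P \<Longrightarrow> c \<in> carrier M \<Longrightarrow>
     (\<lambda>s. x s \<oplus>\<^bsub>M\<^esub> \<rho> s \<odot>\<^bsub>M\<^esub> c) \<in> rel_span M P"

lemma coeffD: "P \<subseteq> UNIV \<rightarrow> carrier R \<Longrightarrow> \<rho> \<in> P \<Longrightarrow> \<rho> s \<in> carrier R"
  by blast

lemma rel_span_closed:
  assumes "module R M" "P \<subseteq> UNIV \<rightarrow> carrier R" "x \<in> rel_span M P"
  shows "x s \<in> carrier M"
proof -
  interpret M: module R M by fact
  show ?thesis using assms(3) by induction (auto simp: coeffD[OF assms(2)])
qed

lemma rel_span_mono: "x \<in> rel_span M P \<Longrightarrow> P \<subseteq> Q \<Longrightarrow> x \<in> rel_span M Q"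
  by (induction rule: rel_span.induct) (auto intro: rel_span.intros)

lemma rel_span_sum:
  assumes "module R M" "P \<subseteq> UNIV \<rightarrow> carrier R" "x \<in> rel_span M P" "y \<in> rel_span M P"
  shows "(\<lambda>s. x s \<oplus>\<^bsub>M\<^esub> y s) \<in> rel_span M P"
proof -
  interpret M: module R M by fact
  show ?thesis using assms(4)
  proof induction
    case zero
    then show ?case using assms(3) rel_span_closed[OF assms(1-3)] by simp
  next
    case (add y \<rho> c)
    have "(\<lambda>s. x s \<oplus>\<^bsub>M\<^esub> (y s \<oplus>\<^bsub>M\<^esub> \<rho> s \<odot>\<^bsub>M\<^esub> c)) = (\<lambda>s. x s \<oplus>\<^bsub>M\<^esub> y s \<oplus>\<^bsub>M\<^esub> \<rho> s \<odot>\<^bsub>M\<^esub> c)"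
      using add coeffD[OF assms(2)] rel_span_closed[OF assms(1-3)] rel_span_closed[OF assms(1,2)]
      by (auto simp: M.add.m_assoc fun_eq_iff)
    then show ?case using rel_span.add[OF add.IH add.hyps(2,3)] by simp
  qed
qed

lemma rel_span_smult:
  assumes "module R M" "P \<subseteq> UNIV \<rightarrow> carrier R" "x \<in> rel_span M P" "r \<in> carrier R"
  shows "(\<lambda>s. r \<odot>\<^bsub>M\<^esub> x s) \<in> rel_span M P"
proof -
  interpret M: module R M by fact
  show ?thesis using assms(3)
  proof induction
    case zero
    then show ?case using assms(4) rel_span.zero by simp
  next
    case (add y \<rho> c)
    have "(\<lambda>s. r \<odot>\<^bsub>M\<^esub> (y s \<oplus>\<^bsub>M\<^esub> \<rho> s \<odot>\<^bsub>M\<^esub> c)) =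
        (\<lambda>s. r \<odot>\<^bsub>M\<^esub> y s \<oplus>\<^bsub>M\<^esub> \<rho> s \<odot>\<^bsub>M\<^esub> (r \<odot>\<^bsub>M\<^esub> c))"
      using add coeffD[OF assms(2)] assms(4) rel_span_closed[OF assms(1,2)]
      by (auto simp: M.smult_r_distr M.smult_assoc1[symmetric] M.R.m_comm fun_eq_iff)
    then show ?case
      using rel_span.add[OF add.IH add.hyps(2) M.smult_closed[OF assms(4) add.hyps(3)]] by simp
  qed
qed

lemma rel_span_neg:
  assumes "module R M" "P \<subseteq> UNIV \<rightarrow> carrier R" "x \<in> rel_span M P"
  shows "(\<lambda>s. \<ominus>\<^bsub>M\<^esub> x s) \<in> rel_span M P"
proof -
  interpret M: module R M by fact
  have "(\<lambda>s. \<ominus>\<^bsub>M\<^esub> x s) = (\<lambda>s. (\<ominus>\<^bsub>R\<^esub> \<one>\<^bsub>R\<^esub>) \<odot>\<^bsub>M\<^esub> x s)"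
    using rel_span_closed[OF assms] by (simp add: M.smult_l_minus)
  then show ?thesis using rel_span_smult[OF assms, of "\<ominus>\<^bsub>R\<^esub> \<one>\<^bsub>R\<^esub>"] by simp
qed

lemma rel_span_single:
  assumes "module R M" "\<And>s. \<rho> s \<in> carrier R" "\<rho> \<in> P" "c \<in> carrier M"
  shows "(\<lambda>s. \<rho> s \<odot>\<^bsub>M\<^esub> c) \<in> rel_span M P"
proof -
  interpret M: module R M by fact
  show ?thesis using rel_span.add[OF rel_span.zero assms(3,4)] assms by simp
qed

lemma rel_span_lin_comb:
  assumes "\<And>l. l < n \<Longrightarrow> \<rho> l \<in> P" "\<And>l. l < n \<Longrightarrow> c l \<in> carrier M"
  shows "(\<lambda>s. lin_comb M n (\<lambda>l. \<rho> l s) c) \<in> rel_span M P"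
  using assms by (induction n) (auto intro: rel_span.intros)

lemma rel_span_as_lin_comb:
  assumes "module R M" "P \<subseteq> UNIV \<rightarrow> carrier R" "x \<in> rel_span M P"
  shows "\<exists>n \<rho> c. (\<forall>l s. \<rho> l s \<in> carrier R) \<and> (\<forall>l. c l \<in> carrier M) \<and> (\<forall>l<n. \<rho> l \<in> P) \<and>
    (\<forall>s. x s = lin_comb M n (\<lambda>l. \<rho> l s) c)"
proof -
  interpret M: module R M by fact
  show ?thesis using assms(3)
  proof induction
    case zero
    show ?case
      by (rule exI[of _ 0], rule exI[of _ "\<lambda>_ _. \<zero>\<^bsub>R\<^esub>"], rule exI[of _ "\<lambda>_. \<zero>\<^bsub>M\<^esub>"]) simp
  next
    case (add x \<sigma> d)
    then obtain n \<rho> c where *: "\<forall>l s. \<rho> l s \<in> carrier R" "\<forall>l. c l \<in> carrier M" "\<forall>l<n. \<rho> l \<in> P"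
      "\<forall>s. x s = lin_comb M n (\<lambda>l. \<rho> l s) c" by auto
    have "lin_comb M n (\<lambda>l. (\<rho>(n := \<sigma>)) l s) (c(n := d)) = lin_comb M n (\<lambda>l. \<rho> l s) c" for s
      by (rule lin_comb_cong) auto
    then show ?case
      using * add.hyps coeffD[OF assms(2)]
      by (intro exI[of _ "Suc n"] exI[of _ "\<rho>(n := \<sigma>)"] exI[of _ "c(n := d)"])
        (simp add: less_Suc_eq del: fun_upd_apply, simp)
  qed
qed

lemma rel_span_hom:
  assumes "module R M" "module R N" "f \<in> mod_hom R M N"
    and "P \<subseteq> UNIV \<rightarrow> carrier R" "x \<in> rel_span M P"
  shows "(\<lambda>s. f (x s)) \<in> rel_span N P"
proof -
  interpret M: module R M by fact
  show ?thesis using assms(5)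
  proof induction
    case zero
    then show ?case using mod_hom_zero[OF assms(1-3)] rel_span.zero by simp
  next
    case (add x \<rho> c)
    then show ?case
      using rel_span.add[OF add.IH add.hyps(2) mod_hom_closed[OF assms(3) add.hyps(3)]]
      by (simp add: mod_hom_add[OF assms(3)] mod_hom_smult[OF assms(3)] coeffD[OF assms(4)]
        rel_span_closed[OF assms(1,4)])
  qed
qed

lemma rel_span_lift:
  assumes "module R M" "module R N" "f \<in> mod_hom R M N" "f ` carrier M = carrier N"
    and "P \<subseteq> UNIV \<rightarrow> carrier R" "y \<in> rel_span N P"
  shows "\<exists>x\<in>rel_span M P. \<forall>s. f (x s) = y s"
proof -
  interpret M: module R M by fact
  show ?thesis using assms(6)
  proof induction
    case zero
    show ?case by (rule bexI[OF _ rel_span.zero]) (simp add: mod_hom_zero[OF assms(1-3)])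
  next
    case (add y \<rho> d)
    from add.IH obtain x where x: "x \<in> rel_span M P" "\<forall>s. f (x s) = y s" ..
    have "d \<in> f ` carrier M" using add.hyps(3) assms(4) by simp
    then obtain c where c: "c \<in> carrier M" "f c = d" by auto
    have "x s \<in> carrier M" for s by (rule rel_span_closed[OF assms(1,5) x(1)])
    then show ?case
      by (intro bexI[OF _ rel_span.add[OF x(1) add.hyps(2) c(1)]])
        (use x c coeffD[OF assms(5)] add.hyps in
          \<open>simp add: mod_hom_add[OF assms(3)] mod_hom_smult[OF assms(3)]\<close>)
  qed
qed

text \<open>A relation that all coefficient vectors satisfy is satisfied by the families that they explain.\<close>

lemma rel_span_orthogonal:
  assumes "module R M" "P \<subseteq> UNIV \<rightarrow> carrier R" "x \<in> rel_span M P"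
    and "\<And>i. v i \<in> carrier R" "\<And>\<rho>. \<rho> \<in> P \<Longrightarrow> lin_comb (regular_module R) n v \<rho> = \<zero>\<^bsub>R\<^esub>"
  shows "lin_comb M n v x = \<zero>\<^bsub>M\<^esub>"
proof -
  interpret M: module R M by fact
  show ?thesis using assms(3)
  proof induction
    case zero
    show ?case using assms(4) by (induction n) auto
  next
    case (add x \<rho> c)
    show ?case
      using lin_comb_add[OF assms(1,4), of x "\<lambda>i. \<rho> i \<odot>\<^bsub>M\<^esub> c" n] add.hyps add.IH
        lin_comb_smult[OF assms(1,4), of \<rho> c n] coeffD[OF assms(2)] assms(5) rel_span_closed[OF assms(1,2)]
      by simp
  qed
qed

text \<open>
  If the elements \<open>y\<^sub>l\<close>, by which the vectors \<open>\<rho> l\<close> explain a family, are themselves explained by \<open>Q\<close>, then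
  multiplying the two matrices of coefficients explains the family in one step.
\<close>

lemma rel_span_substitute:
  assumes "module R M" "Q \<subseteq> UNIV \<rightarrow> carrier R" "y \<in> rel_span M Q"
    and "\<And>l s. \<rho> l s \<in> carrier R"
  shows "(\<lambda>s. lin_comb M m (\<lambda>l. \<rho> l s) y) \<in>
    rel_span M ((\<lambda>\<sigma> s. lin_comb (regular_module R) m (\<lambda>l. \<rho> l s) \<sigma>) ` Q)"
proof -
  interpret M: module R M by fact
  let ?Q = "(\<lambda>\<sigma> s. lin_comb (regular_module R) m (\<lambda>l. \<rho> l s) \<sigma>) ` Q"
  show ?thesis using assms(3)
  proof induction
    case zero
    have "lin_comb M m (\<lambda>l. \<rho> l s) (\<lambda>_. \<zero>\<^bsub>M\<^esub>) = \<zero>\<^bsub>M\<^esub>" for s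
      using assms(4) by (induction m) auto
    then show ?case using rel_span.zero[of M ?Q] by simp
  next
    case (add y \<sigma> c)
    have "lin_comb M m (\<lambda>l. \<rho> l s) (\<lambda>l. y l \<oplus>\<^bsub>M\<^esub> \<sigma> l \<odot>\<^bsub>M\<^esub> c) =
        lin_comb M m (\<lambda>l. \<rho> l s) y \<oplus>\<^bsub>M\<^esub> lin_comb (regular_module R) m (\<lambda>l. \<rho> l s) \<sigma> \<odot>\<^bsub>M\<^esub> c" for s
      using lin_comb_add[OF assms(1), of "\<lambda>l. \<rho> l s" y "\<lambda>l. \<sigma> l \<odot>\<^bsub>M\<^esub> c" m]
        lin_comb_smult[OF assms(1), of "\<lambda>l. \<rho> l s" \<sigma> c m]
        coeffD[OF assms(2)] assms(4) add.hyps rel_span_closed[OF assms(1,2)]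
      by simp
    then show ?case
      using rel_span.add[OF add.IH imageI[OF add.hyps(2)] add.hyps(3)] by simp
  qed
qed

definition orthogonal ::
    "('r, 'z) ring_scheme \<Rightarrow> nat \<Rightarrow> (nat \<Rightarrow> 'r) set \<Rightarrow> (nat \<Rightarrow> 'r) set" where
  "orthogonal R n V = {\<rho>. (\<forall>i. \<rho> i \<in> carrier R) \<and>
     (\<forall>v\<in>V. lin_comb (regular_module R) n v \<rho> = \<zero>\<^bsub>R\<^esub>)}"

lemma orthogonal_coeffs: "orthogonal R n V \<subseteq> UNIV \<rightarrow> carrier R"
  by (auto simp: orthogonal_def)

text \<open>
  Every relation \<open>\<Sum> v\<^sub>i x\<^sub>i = 0\<close> in \<open>F\<close> comes from relations in \<open>R\<close>. In contrast to
  the definition of flatness by tensor products, no test modules are mentioned, so the criterion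
  applies to modules in any type.
\<close>

definition eq_flat :: "('r, 'z) ring_scheme \<Rightarrow> ('r, 'a) module \<Rightarrow> bool" where
  "eq_flat R F \<longleftrightarrow> module R F \<and>
     (\<forall>n v x. (\<forall>i. v i \<in> carrier R) \<and> (\<forall>i. x i \<in> carrier F) \<and> lin_comb F n v x = \<zero>\<^bsub>F\<^esub> \<longrightarrow>
        (\<exists>y\<in>rel_span F (orthogonal R n {v}). \<forall>i<n. y i = x i))"

lemma eq_flatD:
  assumes "eq_flat R F" "\<And>i. v i \<in> carrier R" "\<And>i. x i \<in> carrier F" "lin_comb F n v x = \<zero>\<^bsub>F\<^esub>"
  shows "\<exists>y\<in>rel_span F (orthogonal R n {v}). \<forall>i<n. y i = x i"
  using assms by (simp add: eq_flat_def)

lemma eq_flat_module: "eq_flat R F \<Longrightarrow> module R F"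
  by (simp add: eq_flat_def)

text \<open>
  Several relations can be removed one after the other: substitute a solution of the first ones
  into the next one, and apply the criterion to the result.
\<close>

lemma eq_flat_system:
  assumes "eq_flat R F" "finite V" "\<And>v i. v \<in> V \<Longrightarrow> v i \<in> carrier R" "\<And>i. x i \<in> carrier F"
    and "\<And>v. v \<in> V \<Longrightarrow> lin_comb F n v x = \<zero>\<^bsub>F\<^esub>"
  shows "\<exists>y\<in>rel_span F (orthogonal R n V). \<forall>i<n. y i = x i"
proof -
  have modF: "module R F" using assms(1) by (rule eq_flat_module)
  interpret F: module R F by fact
  note modR = regular_module_module[OF F.R.cring_axioms]
  show ?thesis using assms(2,3,5)
  proof (induction V)
    case empty
    let ?e = "\<lambda>l i. if l = i then \<one>\<^bsub>R\<^esub> else \<zero>\<^bsub>R\<^esub>"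
    have "(\<lambda>i. lin_comb F n (\<lambda>l. ?e l i) x) \<in> rel_span F (orthogonal R n {})"
      by (rule rel_span_lin_comb) (auto simp: orthogonal_def assms(4))
    then show ?case
      by (rule bexI[rotated]) (use lin_comb_delta[OF modF assms(4), of n] in simp)
  next
    case (insert v V)
    then obtain y where y: "y \<in> rel_span F (orthogonal R n V)" "\<forall>i<n. y i = x i" by blast
    note orth = orthogonal_coeffs
    obtain m \<rho> c where *: "\<forall>l s. \<rho> l s \<in> carrier R" "\<forall>l. c l \<in> carrier F"
      "\<forall>l<m. \<rho> l \<in> orthogonal R n V" "\<forall>s. y s = lin_comb F m (\<lambda>l. \<rho> l s) c"
      using rel_span_as_lin_comb[OF modF orth y(1)] by blast
    have \<rho>: "\<And>l s. \<rho> l s \<in> carrier R" and c: "\<And>l. c l \<in> carrier F"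
      and \<rho>V: "\<And>l. l < m \<Longrightarrow> \<rho> l \<in> orthogonal R n V" and yc: "\<And>s. y s = lin_comb F m (\<lambda>l. \<rho> l s) c"
      using * by auto
    have v: "\<And>i. v i \<in> carrier R" using insert.prems by simp
    \<comment> \<open>In terms of the elements \<open>c\<close> that explain the family, the next relation \<open>v\<close> reads \<open>\<Sum> ?u l c\<^sub>l = 0\<close>.\<close>
    let ?u = "\<lambda>l. lin_comb (regular_module R) n v (\<rho> l)"
    have u: "?u l \<in> carrier R" for l using lin_comb_closed[OF modR, of n v "\<rho> l"] v \<rho> by simp
    have "lin_comb F m ?u c = lin_comb F n v (\<lambda>i. y i)"
      unfolding yc by (rule lin_comb_swap[OF modF, symmetric]) (use v \<rho> c in auto)
    also have "\<dots> = lin_comb F n v x" by (rule lin_comb_cong) (use y(2) in auto)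
    also have "\<dots> = \<zero>\<^bsub>F\<^esub>" using insert.prems by simp
    finally have "\<exists>d\<in>rel_span F (orthogonal R m {?u}). \<forall>l<m. d l = c l"
      using u c by (intro eq_flatD[OF assms(1)])
    then obtain d where d: "d \<in> rel_span F (orthogonal R m {?u})" "\<forall>l<m. d l = c l"
      by blast
    let ?z = "\<lambda>s. lin_comb F m (\<lambda>l. \<rho> l s) d"
    have zy: "?z s = y s" for s unfolding yc by (rule lin_comb_cong) (use d(2) in auto)
    have "?z \<in> rel_span F (orthogonal R n (insert v V))"
    proof (rule rel_span_mono[OF rel_span_substitute[OF modF orth d(1) \<rho>]])
      show "(\<lambda>\<sigma> s. lin_comb (regular_module R) m (\<lambda>l. \<rho> l s) \<sigma>) ` orthogonal R m {?u}
          \<subseteq> orthogonal R n (insert v V)"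
      proof
        fix \<tau> assume "\<tau> \<in> (\<lambda>\<sigma> s. lin_comb (regular_module R) m (\<lambda>l. \<rho> l s) \<sigma>) ` orthogonal R m {?u}"
        then obtain \<sigma> where \<sigma>: "\<sigma> \<in> orthogonal R m {?u}"
          and \<tau>: "\<tau> = (\<lambda>s. lin_comb (regular_module R) m (\<lambda>l. \<rho> l s) \<sigma>)" by blast
        have \<sigma>R: "\<sigma> l \<in> carrier R" for l using coeffD[OF orth \<sigma>] .
        have "lin_comb (regular_module R) n w \<tau> = \<zero>\<^bsub>R\<^esub>" if w: "w \<in> insert v V" for w
        proof -
          have wR: "\<And>i. w i \<in> carrier R" using w insert.prems by blast
          have "lin_comb (regular_module R) n w \<tau> =
              lin_comb (regular_module R) m (\<lambda>l. lin_comb (regular_module R) n w (\<rho> l)) \<sigma>"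
            unfolding \<tau> by (rule lin_comb_swap[OF modR]) (use wR \<rho> \<sigma>R in auto)
          also have "\<dots> = \<zero>\<^bsub>R\<^esub>"
          proof (cases "w \<in> V")
            case True
            then show ?thesis
              using lin_comb_zero[OF modR, of m "\<lambda>l. lin_comb (regular_module R) n w (\<rho> l)" \<sigma>]
                \<rho>V \<sigma>R by (simp add: orthogonal_def)
          next
            case False
            then show ?thesis using w \<sigma> by (simp add: orthogonal_def)
          qed
          finally show ?thesis .
        qed
        moreover have "\<tau> i \<in> carrier R" for i
          unfolding \<tau> using lin_comb_closed[OF modR, of m "\<lambda>l. \<rho> l i" \<sigma>] \<rho> \<sigma>R by simp
        ultimately show "\<tau> \<in> orthogonal R n (insert v V)" by (simp add: orthogonal_def)
      qed
    qed
    then show ?case using zy y(2) by (intro bexI[of _ ?z]) auto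
  qed
qed

text \<open>
  The kernel of a surjection onto a flat module is a pure submodule: coefficients that explain
  a family of elements of the kernel by elements of \<open>C\<close> also explain it by elements of the kernel. The
  images of the former elements in \<open>D\<close> satisfy finitely many relations; a reason for these in \<open>R\<close>
  lifts to \<open>C\<close>, and subtracting it moves the elements into the kernel.
\<close>

lemma flat_quotient_pure:
  assumes "module R K" "module R C" "eq_flat R D"
    and "j \<in> mod_hom R K C" "q \<in> mod_hom R C D"
    and "j ` carrier K = mod_ker C D q" "q ` carrier C = carrier D"
    and "P \<subseteq> UNIV \<rightarrow> carrier R" "x \<in> rel_span C P"
    and "finite T" "\<And>s. s \<in> T \<Longrightarrow> q (x s) = \<zero>\<^bsub>D\<^esub>"
  shows "\<exists>x'\<in>rel_span K P. \<forall>s\<in>T. j (x' s) = x s"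
proof -
  have modD: "module R D" using assms(3) by (rule eq_flat_module)
  interpret K: module R K by fact
  interpret C: module R C by fact
  interpret D: module R D by fact
  obtain n \<rho> c where *: "\<forall>l s. \<rho> l s \<in> carrier R" "\<forall>l. c l \<in> carrier C"
    "\<forall>l<n. \<rho> l \<in> P" "\<forall>s. x s = lin_comb C n (\<lambda>l. \<rho> l s) c"
    using rel_span_as_lin_comb[OF assms(2,8,9)] by blast
  have \<rho>: "\<And>l s. \<rho> l s \<in> carrier R" and c: "\<And>l. c l \<in> carrier C"
    and \<rho>P: "\<And>l. l < n \<Longrightarrow> \<rho> l \<in> P" and xc: "\<And>s. x s = lin_comb C n (\<lambda>l. \<rho> l s) c"
    using * by auto
  \<comment> \<open>One relation between the images of the \<open>c\<^sub>l\<close> in \<open>D\<close> for every \<open>s \<in> T\<close>.\<close>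
  let ?V = "(\<lambda>s l. \<rho> l s) ` T"
  note orth = orthogonal_coeffs
  have "\<exists>z\<in>rel_span D (orthogonal R n ?V). \<forall>i<n. z i = q (c i)"
  proof (rule eq_flat_system[OF assms(3)])
    fix v assume "v \<in> ?V"
    then obtain s where "s \<in> T" "v = (\<lambda>l. \<rho> l s)" by blast
    then show "lin_comb D n v (\<lambda>i. q (c i)) = \<zero>\<^bsub>D\<^esub>"
      using assms(11)[of s] lin_comb_hom[OF assms(2) modD assms(5), of n v c] \<rho> c xc[of s] by simp
  qed (use assms(10) \<rho> c mod_hom_closed[OF assms(5)] in auto)
  then obtain z where z: "z \<in> rel_span D (orthogonal R n ?V)" "\<forall>i<n. z i = q (c i)" by blast
  obtain y where y: "y \<in> rel_span C (orthogonal R n ?V)" "\<forall>s. q (y s) = z s"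
    using rel_span_lift[OF assms(2) modD assms(5,7) orth z(1)] by blast
  have yC: "y l \<in> carrier C" for l using rel_span_closed[OF assms(2) orth y(1)] .
  have "\<exists>k\<in>carrier K. l < n \<longrightarrow> j k = c l \<ominus>\<^bsub>C\<^esub> y l" for l
  proof (cases "l < n")
    case True
    then have "c l \<ominus>\<^bsub>C\<^esub> y l \<in> mod_ker C D q"
      using c yC y(2) z(2) mod_hom_closed[OF assms(5)] mod_hom_diff[OF assms(2) modD assms(5)]
      by (simp add: mod_ker_def D.r_neg a_minus_def)
    then show ?thesis unfolding assms(6)[symmetric] by force
  qed auto
  then obtain k where k: "\<And>l. k l \<in> carrier K" "\<And>l. l < n \<Longrightarrow> j (k l) = c l \<ominus>\<^bsub>C\<^esub> y l" by metis
  have "j (lin_comb K n (\<lambda>l. \<rho> l s) k) = x s" if "s \<in> T" for s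
  proof -
    have "lin_comb C n (\<lambda>l. \<rho> l s) (\<lambda>l. c l \<ominus>\<^bsub>C\<^esub> y l) \<oplus>\<^bsub>C\<^esub> lin_comb C n (\<lambda>l. \<rho> l s) y = x s"
      using lin_comb_add[OF assms(2), of "\<lambda>l. \<rho> l s" "\<lambda>l. c l \<ominus>\<^bsub>C\<^esub> y l" y n] \<rho> c yC
      by (simp add: xc a_minus_def C.add.m_assoc C.l_neg)
    moreover have "lin_comb C n (\<lambda>l. \<rho> l s) y = \<zero>\<^bsub>C\<^esub>"
      by (rule rel_span_orthogonal[OF assms(2) orth y(1)])
        (use that \<rho> in \<open>auto simp: orthogonal_def\<close>)
    ultimately have "lin_comb C n (\<lambda>l. \<rho> l s) (\<lambda>l. c l \<ominus>\<^bsub>C\<^esub> y l) = x s"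
      using c yC \<rho> by (simp add: lin_comb_closed[OF assms(2)])
    moreover have "j (lin_comb K n (\<lambda>l. \<rho> l s) k) = lin_comb C n (\<lambda>l. \<rho> l s) (\<lambda>l. j (k l))"
      by (rule lin_comb_hom[OF assms(1,2,4)]) (use \<rho> k in auto)
    moreover have "\<dots> = lin_comb C n (\<lambda>l. \<rho> l s) (\<lambda>l. c l \<ominus>\<^bsub>C\<^esub> y l)"
      by (rule lin_comb_cong) (use k in auto)
    ultimately show ?thesis by simp
  qed
  moreover have "(\<lambda>s. lin_comb K n (\<lambda>l. \<rho> l s) k) \<in> rel_span K P"
    by (rule rel_span_lin_comb) (use \<rho>P k in auto)
  ultimately show ?thesis by (intro bexI[of _ "\<lambda>s. lin_comb K n (\<lambda>l. \<rho> l s) k"]) auto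
qed

text \<open>
  A relation in \<open>K\<close> is explained in \<open>C\<close>, because \<open>C\<close> is flat; by purity of \<open>K\<close> the same relations of
  scalars explain it by elements of \<open>K\<close>.
\<close>

lemma eq_flat_kernel:
  assumes "module R K" "eq_flat R C" "eq_flat R D"
    and "j \<in> mod_hom R K C" "q \<in> mod_hom R C D" "inj_on j (carrier K)"
    and "j ` carrier K = mod_ker C D q" "q ` carrier C = carrier D"
  shows "eq_flat R K"
  unfolding eq_flat_def
proof (intro conjI assms(1) allI impI)
  fix n v and x :: "nat \<Rightarrow> _"
  assume *: "(\<forall>i. v i \<in> carrier R) \<and> (\<forall>i. x i \<in> carrier K) \<and> lin_comb K n v x = \<zero>\<^bsub>K\<^esub>"
  note modC = eq_flat_module[OF assms(2)]
  note orth = orthogonal_coeffs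
  have jx: "j (x i) \<in> mod_ker C D q" for i using * assms(7) by blast
  have "lin_comb C n v (\<lambda>i. j (x i)) = \<zero>\<^bsub>C\<^esub>"
    using lin_comb_hom[OF assms(1) modC assms(4), of n v x] * mod_hom_zero[OF assms(1) modC assms(4)]
    by simp
  moreover have "j (x i) \<in> carrier C" for i using jx by (simp add: mod_ker_def)
  ultimately obtain y where y: "y \<in> rel_span C (orthogonal R n {v})" "\<forall>i<n. y i = j (x i)"
    using eq_flatD[OF assms(2), of v "\<lambda>i. j (x i)" n] * by auto
  have "\<exists>x'\<in>rel_span K (orthogonal R n {v}). \<forall>s\<in>{..<n}. j (x' s) = y s"
    by (rule flat_quotient_pure[OF assms(1) modC assms(3,4,5,7,8) orth y(1)])
      (use y(2) jx in \<open>auto simp: mod_ker_def\<close>)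
  then obtain x' where x': "x' \<in> rel_span K (orthogonal R n {v})" "\<forall>i<n. j (x' i) = j (x i)"
    using y(2) by auto
  have "x' i = x i" if "i < n" for i
    using x'(2) that * rel_span_closed[OF assms(1) orth x'(1)] inj_onD[OF assms(6)] by blast
  then show "\<exists>y\<in>rel_span K (orthogonal R n {v}). \<forall>i<n. y i = x i" using x'(1) by blast
qed

definition dsum :: "('r, 'a) module \<Rightarrow> ('r, 'b) module \<Rightarrow> ('r, 'a \<times> 'b) module" where
  "dsum M N = \<lparr>carrier = carrier M \<times> carrier N, monoid.mult = undefined, one = undefined,
     zero = (\<zero>\<^bsub>M\<^esub>, \<zero>\<^bsub>N\<^esub>), add = (\<lambda>x y. (fst x \<oplus>\<^bsub>M\<^esub> fst y, snd x \<oplus>\<^bsub>N\<^esub> snd y)),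
     smult = (\<lambda>r x. (r \<odot>\<^bsub>M\<^esub> fst x, r \<odot>\<^bsub>N\<^esub> snd x))\<rparr>"

lemma dsum_simps [simp]:
  "carrier (dsum M N) = carrier M \<times> carrier N"
  "\<zero>\<^bsub>dsum M N\<^esub> = (\<zero>\<^bsub>M\<^esub>, \<zero>\<^bsub>N\<^esub>)"
  "x \<oplus>\<^bsub>dsum M N\<^esub> y = (fst x \<oplus>\<^bsub>M\<^esub> fst y, snd x \<oplus>\<^bsub>N\<^esub> snd y)"
  "r \<odot>\<^bsub>dsum M N\<^esub> x = (r \<odot>\<^bsub>M\<^esub> fst x, r \<odot>\<^bsub>N\<^esub> snd x)"
  by (simp_all add: dsum_def)

lemma module_dsum:
  assumes "module R M" "module R N"
  shows "module R (dsum M N)"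
proof -
  interpret M: module R M by fact
  interpret N: module R N by fact
  show ?thesis
  proof (rule moduleI)
    show "cring R" by (rule M.R.cring_axioms)
    show "abelian_group (dsum M N)"
    proof (rule abelian_groupI)
      fix x assume "x \<in> carrier (dsum M N)"
      then show "\<exists>y\<in>carrier (dsum M N). y \<oplus>\<^bsub>dsum M N\<^esub> x = \<zero>\<^bsub>dsum M N\<^esub>"
        by (intro bexI[of _ "(\<ominus>\<^bsub>M\<^esub> fst x, \<ominus>\<^bsub>N\<^esub> snd x)"]) (auto simp: M.l_neg N.l_neg)
    qed (auto simp: M.add.m_assoc N.add.m_assoc M.add.m_comm N.add.m_comm
        M.add.m_lcomm N.add.m_lcomm)
  qed (auto simp: M.smult_l_distr M.smult_r_distr M.smult_assoc1
      N.smult_l_distr N.smult_r_distr N.smult_assoc1)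
qed

lemma dsum_homs:
  assumes "module R M" "module R N"
  shows "fst \<in> mod_hom R (dsum M N) M" "snd \<in> mod_hom R (dsum M N) N"
    "(\<lambda>x. (x, \<zero>\<^bsub>N\<^esub>)) \<in> mod_hom R M (dsum M N)" "(\<lambda>y. (\<zero>\<^bsub>M\<^esub>, y)) \<in> mod_hom R N (dsum M N)"
proof -
  interpret M: module R M by fact
  interpret N: module R N by fact
  show "fst \<in> mod_hom R (dsum M N) M" "snd \<in> mod_hom R (dsum M N) N"
    "(\<lambda>x. (x, \<zero>\<^bsub>N\<^esub>)) \<in> mod_hom R M (dsum M N)" "(\<lambda>y. (\<zero>\<^bsub>M\<^esub>, y)) \<in> mod_hom R N (dsum M N)"
    by (auto simp: mod_hom_def)
qed

lemma dsum_uminus: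
  assumes "module R M" "module R N" "x \<in> carrier M" "y \<in> carrier N"
  shows "\<ominus>\<^bsub>dsum M N\<^esub> (x, y) = (\<ominus>\<^bsub>M\<^esub> x, \<ominus>\<^bsub>N\<^esub> y)"
proof -
  note D = module_dsum[OF assms(1,2)]
  show ?thesis
    using mod_hom_neg[OF D assms(1) dsum_homs(1)[OF assms(1,2)], of "(x, y)"]
      mod_hom_neg[OF D assms(2) dsum_homs(2)[OF assms(1,2)], of "(x, y)"] assms(3,4)
    by (simp add: prod_eq_iff)
qed

lemma eq_flat_dsum:
  assumes "eq_flat R M" "eq_flat R N"
  shows "eq_flat R (dsum M N)"
proof -
  note modM = eq_flat_module[OF assms(1)] and modN = eq_flat_module[OF assms(2)]
  note modD = module_dsum[OF modM modN] and homs = dsum_homs[OF modM modN]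
  interpret M: module R M by fact
  interpret N: module R N by fact
  show ?thesis unfolding eq_flat_def
  proof (intro conjI modD allI impI)
    fix n v x
    assume *: "(\<forall>i. v i \<in> carrier R) \<and> (\<forall>i. x i \<in> carrier (dsum M N)) \<and>
      lin_comb (dsum M N) n v x = \<zero>\<^bsub>dsum M N\<^esub>"
  note orth = orthogonal_coeffs
    have "lin_comb M n v (\<lambda>i. fst (x i)) = \<zero>\<^bsub>M\<^esub>" "lin_comb N n v (\<lambda>i. snd (x i)) = \<zero>\<^bsub>N\<^esub>"
      using * lin_comb_hom[OF modD modM homs(1), of n v x] lin_comb_hom[OF modD modN homs(2), of n v x]
      by auto
    moreover have "\<forall>i. fst (x i) \<in> carrier M" "\<forall>i. snd (x i) \<in> carrier N"
      using * by (auto simp: mem_Times_iff)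
    ultimately obtain y z
      where y: "y\<in>rel_span M (orthogonal R n {v})" "\<forall>i<n. y i = fst (x i)"
        and z: "z\<in>rel_span N (orthogonal R n {v})" "\<forall>i<n. z i = snd (x i)"
      using * eq_flatD[OF assms(1), of v "\<lambda>i. fst (x i)" n]
        eq_flatD[OF assms(2), of v "\<lambda>i. snd (x i)" n] by force
    have "(\<lambda>i. (y i, \<zero>\<^bsub>N\<^esub>) \<oplus>\<^bsub>dsum M N\<^esub> (\<zero>\<^bsub>M\<^esub>, z i)) \<in> rel_span (dsum M N) (orthogonal R n {v})"
      by (rule rel_span_sum[OF modD orth])
        (use rel_span_hom[OF modM modD homs(3) orth y(1)] rel_span_hom[OF modN modD homs(4) orth z(1)]
         in auto)
    moreover have "(y i, \<zero>\<^bsub>N\<^esub>) \<oplus>\<^bsub>dsum M N\<^esub> (\<zero>\<^bsub>M\<^esub>, z i) = x i" if "i < n" for i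
      using y(2)[rule_format, OF that] z(2)[rule_format, OF that]
        rel_span_closed[OF modM orth y(1), of i] rel_span_closed[OF modN orth z(1), of i]
      by (simp add: prod_eq_iff)
    ultimately show "\<exists>y\<in>rel_span (dsum M N) (orthogonal R n {v}). \<forall>i<n. y i = x i"
      by (intro bexI[of _ "\<lambda>i. (y i, \<zero>\<^bsub>N\<^esub>) \<oplus>\<^bsub>dsum M N\<^esub> (\<zero>\<^bsub>M\<^esub>, z i)"]) auto
  qed
qed

lemma eq_flat_zero:
  assumes "module R M"
  shows "eq_flat R (M\<lparr>carrier := {\<zero>\<^bsub>M\<^esub>}\<rparr>)"
  unfolding eq_flat_def
  by (auto intro!: submodule_module[OF assms submodule_singleton_zero[OF assms]] bexI[OF _ rel_span.zero])

text \<open>In a free module the relation splits into one relation in \<open>R\<close> for every basis element.\<close>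

lemma eq_flat_free_module:
  fixes R :: "('r, 'z) ring_scheme" and S :: "'s set"
  assumes "cring R"
  shows "eq_flat R (free_module R S)"
proof -
  let ?F = "free_module R S"
  interpret R: cring R by fact
  note modF = module_free_module[OF assms, of S]
  note modR = regular_module_module[OF assms]
  interpret F: module R ?F by fact
  show ?thesis unfolding eq_flat_def
  proof (intro conjI modF allI impI)
    fix n :: nat and v :: "nat \<Rightarrow> 'r" and x :: "nat \<Rightarrow> 's \<Rightarrow> 'r"
    assume *: "(\<forall>i. v i \<in> carrier R) \<and> (\<forall>i. x i \<in> carrier ?F) \<and> lin_comb ?F n v x = \<zero>\<^bsub>?F\<^esub>"
  note orth = orthogonal_coeffs
    have col: "(\<lambda>i. x i s) \<in> orthogonal R n {v}" for s
      using lin_comb_hom[OF modF modR free_module_coeff_hom, of n v x s] *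
      by (auto simp: orthogonal_def mem_free_module)
    have "\<exists>y\<in>rel_span ?F (orthogonal R n {v}). \<forall>i t. y i t = (if t \<in> T then x i t else \<zero>\<^bsub>R\<^esub>)"
      if "finite T" for T
      using that
    proof (induction T)
      case empty
      then show ?case by (intro bexI[OF _ rel_span.zero]) simp
    next
      case (insert s T)
      then obtain y where y: "y \<in> rel_span ?F (orthogonal R n {v})"
        "\<forall>i t. y i t = (if t \<in> T then x i t else \<zero>\<^bsub>R\<^esub>)" by blast
      show ?case
      proof (cases "s \<in> S")
        case True
        have "x i t \<in> carrier R" for i t using * by (auto simp: mem_free_module)
        then show ?thesis
          using y(2) * insert.hyps
          by (intro bexI[OF _ rel_span.add[OF y(1) col[of s] free_gen_closed[OF assms True]]])
            (auto simp: free_gen_def)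
      next
        case False
        then show ?thesis using y * by (intro bexI[OF _ y(1)]) (auto simp: mem_free_module)
      qed
    qed
    moreover have "finite (\<Union>i<n. {t. x i t \<noteq> \<zero>\<^bsub>R\<^esub>})" using * by (auto simp: mem_free_module)
    ultimately obtain y where y: "y \<in> rel_span ?F (orthogonal R n {v})"
      "\<forall>i t. y i t = (if t \<in> (\<Union>i<n. {t. x i t \<noteq> \<zero>\<^bsub>R\<^esub>}) then x i t else \<zero>\<^bsub>R\<^esub>)" by blast
    have "y i = x i" if "i < n" for i using that y(2) by (auto simp: fun_eq_iff)
    then show "\<exists>y\<in>rel_span ?F (orthogonal R n {v}). \<forall>i<n. y i = x i" using y(1) by blast
  qed
qed

lemma rel_span_zero_at:
  assumes "module R M" "\<And>\<rho>. \<rho> \<in> P \<Longrightarrow> \<rho> s = \<zero>\<^bsub>R\<^esub>" "x \<in> rel_span M P"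
  shows "x s = \<zero>\<^bsub>M\<^esub>"
proof -
  interpret M: module R M by fact
  show ?thesis using assms(3) by induction (auto simp: assms(2))
qed

lemma rel_span_finite_part:
  assumes "module R M" "P \<subseteq> UNIV \<rightarrow> carrier R" "x \<in> rel_span M P"
  shows "\<exists>Q. finite Q \<and> Q \<subseteq> P \<and> x \<in> rel_span M Q"
  using assms(3)
proof induction
  case zero
  show ?case by (intro exI[of _ "{}"]) (simp add: rel_span.zero)
next
  case (add x \<rho> c)
  then obtain Q where Q: "finite Q" "Q \<subseteq> P" "x \<in> rel_span M Q" by auto
  have "x \<in> rel_span M (insert \<rho> Q)" by (rule rel_span_mono[OF Q(3)]) auto
  then have "(\<lambda>s. x s \<oplus>\<^bsub>M\<^esub> \<rho> s \<odot>\<^bsub>M\<^esub> c) \<in> rel_span M (insert \<rho> Q)"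
    by (rule rel_span.add) (use add.hyps in auto)
  then show ?case using Q add.hyps by (intro exI[of _ "insert \<rho> Q"]) auto
qed

lemma rel_span_finite_support:
  assumes "module R M" "P \<subseteq> UNIV \<rightarrow> carrier R" "\<And>\<rho>. \<rho> \<in> P \<Longrightarrow> finite {s. \<rho> s \<noteq> \<zero>\<^bsub>R\<^esub>}"
    and "x \<in> rel_span M P"
  shows "finite {s. x s \<noteq> \<zero>\<^bsub>M\<^esub>}"
proof -
  obtain Q where Q: "finite Q" "Q \<subseteq> P" "x \<in> rel_span M Q"
    using rel_span_finite_part[OF assms(1,2,4)] by auto
  have "{s. x s \<noteq> \<zero>\<^bsub>M\<^esub>} \<subseteq> (\<Union>\<rho>\<in>Q. {s. \<rho> s \<noteq> \<zero>\<^bsub>R\<^esub>})"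
    using rel_span_zero_at[OF assms(1) _ Q(3)] by auto
  then show ?thesis by (rule finite_subset) (use Q assms(3) in auto)
qed

text \<open>
  If the coefficient vectors have finite support, no finite index set has to be given: outside the
  supports of the finitely many vectors that occur, both families vanish.
\<close>

lemma flat_quotient_pure_all:
  assumes "module R K" "module R C" "eq_flat R D"
    and "j \<in> mod_hom R K C" "q \<in> mod_hom R C D"
    and "j ` carrier K = mod_ker C D q" "q ` carrier C = carrier D"
    and "P \<subseteq> UNIV \<rightarrow> carrier R" "\<And>\<rho>. \<rho> \<in> P \<Longrightarrow> finite {s. \<rho> s \<noteq> \<zero>\<^bsub>R\<^esub>}"
    and "x \<in> rel_span C P" "\<And>s. q (x s) = \<zero>\<^bsub>D\<^esub>"
  shows "\<exists>x'\<in>rel_span K P. \<forall>s. j (x' s) = x s"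
proof -
  obtain Q where Q: "finite Q" "Q \<subseteq> P" "x \<in> rel_span C Q"
    using rel_span_finite_part[OF assms(2,8,10)] by auto
  let ?T = "\<Union>\<rho>\<in>Q. {s. \<rho> s \<noteq> \<zero>\<^bsub>R\<^esub>}"
  have QR: "Q \<subseteq> UNIV \<rightarrow> carrier R" using Q(2) assms(8) by simp
  have T: "finite ?T" using Q assms(9) by auto
  obtain x' where x': "x' \<in> rel_span K Q" "\<forall>s\<in>?T. j (x' s) = x s"
    using flat_quotient_pure[OF assms(1-7) QR Q(3) T] assms(11) by auto
  have "j (x' s) = x s" for s
  proof (cases "s \<in> ?T")
    case False
    then have "x' s = \<zero>\<^bsub>K\<^esub>" "x s = \<zero>\<^bsub>C\<^esub>"
      using rel_span_zero_at[OF assms(1) _ x'(1), of s] rel_span_zero_at[OF assms(2) _ Q(3), of s]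
      by auto
    then show ?thesis using mod_hom_zero[OF assms(1,2,4)] by simp
  qed (use x'(2) in auto)
  then show ?thesis using rel_span_mono[OF x'(1) Q(2)] by auto
qed


section \<open>Tensor products\<close>

definition pure_tensor ::
    "('r, 'z) ring_scheme \<Rightarrow> ('r, 'a) module \<Rightarrow> ('r, 'b) module \<Rightarrow> 'a \<Rightarrow> 'b \<Rightarrow> ('a \<times> 'b \<Rightarrow> 'r) set" where
  "pure_tensor R A B a b =
     tensor_kernel R A B +>\<^bsub>free_module R (carrier A \<times> carrier B)\<^esub> free_gen R (a, b)"

lemma tensor_relations_cases:
  assumes "w \<in> tensor_relations R A B"
  obtains
    (add_left) a a' b where "a \<in> carrier A" "a' \<in> carrier A" "b \<in> carrier B"
      "w = free_gen R (a \<oplus>\<^bsub>A\<^esub> a', b) \<ominus>\<^bsub>free_module R (carrier A \<times> carrier B)\<^esub>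
         (free_gen R (a, b) \<oplus>\<^bsub>free_module R (carrier A \<times> carrier B)\<^esub> free_gen R (a', b))"
  | (add_right) a b b' where "a \<in> carrier A" "b \<in> carrier B" "b' \<in> carrier B"
      "w = free_gen R (a, b \<oplus>\<^bsub>B\<^esub> b') \<ominus>\<^bsub>free_module R (carrier A \<times> carrier B)\<^esub>
         (free_gen R (a, b) \<oplus>\<^bsub>free_module R (carrier A \<times> carrier B)\<^esub> free_gen R (a, b'))"
  | (smult_left) r a b where "r \<in> carrier R" "a \<in> carrier A" "b \<in> carrier B"
      "w = free_gen R (r \<odot>\<^bsub>A\<^esub> a, b) \<ominus>\<^bsub>free_module R (carrier A \<times> carrier B)\<^esub>
         (r \<odot>\<^bsub>free_module R (carrier A \<times> carrier B)\<^esub> free_gen R (a, b))"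
  | (smult_right) r a b where "r \<in> carrier R" "a \<in> carrier A" "b \<in> carrier B"
      "w = free_gen R (a, r \<odot>\<^bsub>B\<^esub> b) \<ominus>\<^bsub>free_module R (carrier A \<times> carrier B)\<^esub>
         (r \<odot>\<^bsub>free_module R (carrier A \<times> carrier B)\<^esub> free_gen R (a, b))"
  using assms unfolding tensor_relations_def Let_def
  by (elim UnE CollectE exE conjE) (rule that; assumption)+

lemma tensor_relationsI:
  shows "a \<in> carrier A \<Longrightarrow> a' \<in> carrier A \<Longrightarrow> b \<in> carrier B \<Longrightarrow>
      free_gen R (a \<oplus>\<^bsub>A\<^esub> a', b) \<ominus>\<^bsub>free_module R (carrier A \<times> carrier B)\<^esub>
         (free_gen R (a, b) \<oplus>\<^bsub>free_module R (carrier A \<times> carrier B)\<^esub> free_gen R (a', b))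
      \<in> tensor_relations R A B"
    and "a \<in> carrier A \<Longrightarrow> b \<in> carrier B \<Longrightarrow> b' \<in> carrier B \<Longrightarrow>
      free_gen R (a, b \<oplus>\<^bsub>B\<^esub> b') \<ominus>\<^bsub>free_module R (carrier A \<times> carrier B)\<^esub>
         (free_gen R (a, b) \<oplus>\<^bsub>free_module R (carrier A \<times> carrier B)\<^esub> free_gen R (a, b'))
      \<in> tensor_relations R A B"
    and "r \<in> carrier R \<Longrightarrow> a \<in> carrier A \<Longrightarrow> b \<in> carrier B \<Longrightarrow>
      free_gen R (r \<odot>\<^bsub>A\<^esub> a, b) \<ominus>\<^bsub>free_module R (carrier A \<times> carrier B)\<^esub>
         (r \<odot>\<^bsub>free_module R (carrier A \<times> carrier B)\<^esub> free_gen R (a, b)) \<in> tensor_relations R A B"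
    and "r \<in> carrier R \<Longrightarrow> a \<in> carrier A \<Longrightarrow> b \<in> carrier B \<Longrightarrow>
      free_gen R (a, r \<odot>\<^bsub>B\<^esub> b) \<ominus>\<^bsub>free_module R (carrier A \<times> carrier B)\<^esub>
         (r \<odot>\<^bsub>free_module R (carrier A \<times> carrier B)\<^esub> free_gen R (a, b)) \<in> tensor_relations R A B"
  unfolding tensor_relations_def Let_def by fast+

lemma tensor_gen_closed:
  "cring R \<Longrightarrow> a \<in> carrier A \<Longrightarrow> b \<in> carrier B \<Longrightarrow>
    free_gen R (a, b) \<in> carrier (free_module R (carrier A \<times> carrier B))"
  by (rule free_gen_closed) auto

lemma tensor_relations_closed:
  assumes "module R A" "module R B"
  shows "tensor_relations R A B \<subseteq> carrier (free_module R (carrier A \<times> carrier B))"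
proof
  interpret A: module R A by fact
  interpret B: module R B by fact
  interpret W: module R "free_module R (carrier A \<times> carrier B)"
    using module_free_module[OF A.R.cring_axioms] .
  note e = tensor_gen_closed[OF A.R.cring_axioms, of _ A _ B]
  fix w assume "w \<in> tensor_relations R A B"
  then show "w \<in> carrier (free_module R (carrier A \<times> carrier B))"
    by (cases rule: tensor_relations_cases) (simp_all add: e del: free_module_simps)
qed

lemma submodule_tensor_kernel:
  assumes "module R A" "module R B"
  shows "submodule (tensor_kernel R A B) R (free_module R (carrier A \<times> carrier B))"
  unfolding tensor_kernel_def
  by (rule submodule_span[OF module_free_module[OF module_cring[OF assms(1)]]
        tensor_relations_closed[OF assms]])

lemma module_tensor:
  assumes "module R A" "module R B"
  shows "module R (tensor R A B)"
  unfolding tensor_def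
  by (rule module_quot[OF module_free_module[OF module_cring[OF assms(1)]]
        submodule_tensor_kernel[OF assms]])

lemma tensor_class_hom:
  assumes "module R A" "module R B"
  shows "(\<lambda>w. tensor_kernel R A B +>\<^bsub>free_module R (carrier A \<times> carrier B)\<^esub> w) \<in>
    mod_hom R (free_module R (carrier A \<times> carrier B)) (tensor R A B)"
  unfolding tensor_def
  by (rule coset_hom[OF module_free_module[OF module_cring[OF assms(1)]]
        submodule_tensor_kernel[OF assms]])

lemma pure_tensor_closed:
  assumes "module R A" "module R B" "a \<in> carrier A" "b \<in> carrier B"
  shows "pure_tensor R A B a b \<in> carrier (tensor R A B)"
  using mod_hom_closed[OF tensor_class_hom[OF assms(1,2)]
      tensor_gen_closed[OF module_cring[OF assms(1)] assms(3,4)]]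
  by (simp add: pure_tensor_def)

lemma pure_tensor_bilinear:
  assumes "module R A" "module R B"
  shows "a \<in> carrier A \<Longrightarrow> a' \<in> carrier A \<Longrightarrow> b \<in> carrier B \<Longrightarrow>
      pure_tensor R A B (a \<oplus>\<^bsub>A\<^esub> a') b =
      pure_tensor R A B a b \<oplus>\<^bsub>tensor R A B\<^esub> pure_tensor R A B a' b" (is "_ \<Longrightarrow> _ \<Longrightarrow> _ \<Longrightarrow> ?g1")
    and "a \<in> carrier A \<Longrightarrow> b \<in> carrier B \<Longrightarrow> b' \<in> carrier B \<Longrightarrow>
      pure_tensor R A B a (b \<oplus>\<^bsub>B\<^esub> b') =
      pure_tensor R A B a b \<oplus>\<^bsub>tensor R A B\<^esub> pure_tensor R A B a b'" (is "_ \<Longrightarrow> _ \<Longrightarrow> _ \<Longrightarrow> ?g2")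
    and "r \<in> carrier R \<Longrightarrow> a \<in> carrier A \<Longrightarrow> b \<in> carrier B \<Longrightarrow>
      pure_tensor R A B (r \<odot>\<^bsub>A\<^esub> a) b = r \<odot>\<^bsub>tensor R A B\<^esub> pure_tensor R A B a b"
      (is "_ \<Longrightarrow> _ \<Longrightarrow> _ \<Longrightarrow> ?g3")
    and "r \<in> carrier R \<Longrightarrow> a \<in> carrier A \<Longrightarrow> b \<in> carrier B \<Longrightarrow>
      pure_tensor R A B a (r \<odot>\<^bsub>B\<^esub> b) = r \<odot>\<^bsub>tensor R A B\<^esub> pure_tensor R A B a b"
      (is "_ \<Longrightarrow> _ \<Longrightarrow> _ \<Longrightarrow> ?g4")
proof -
  interpret A: module R A by fact
  interpret B: module R B by fact
  let ?W = "free_module R (carrier A \<times> carrier B)"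
  let ?cl = "\<lambda>w. tensor_kernel R A B +>\<^bsub>?W\<^esub> w"
  note modW = module_free_module[OF A.R.cring_axioms, of "carrier A \<times> carrier B"]
  interpret W: module R ?W by fact
  note e = tensor_gen_closed[OF A.R.cring_axioms, of _ A _ B]
  note clh = tensor_class_hom[OF assms]
  have eq: "?cl x = ?cl y"
    if "x \<ominus>\<^bsub>?W\<^esub> y \<in> tensor_relations R A B" "x \<in> carrier ?W" "y \<in> carrier ?W" for x y
    using coset_eq_iff[OF modW submodule_tensor_kernel[OF assms] that(2,3)] that(1)
      span_superset[of "tensor_relations R A B" R ?W] by (auto simp: tensor_kernel_def)
  show ?g1 if "a \<in> carrier A" "a' \<in> carrier A" "b \<in> carrier B"
    using eq[OF tensor_relationsI(1)[OF that]] that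
      mod_hom_add[OF clh e[OF that(1,3)] e[OF that(2,3)]]
    by (simp add: pure_tensor_def e del: free_module_simps)
  show ?g2 if "a \<in> carrier A" "b \<in> carrier B" "b' \<in> carrier B"
    using eq[OF tensor_relationsI(2)[OF that]] that
      mod_hom_add[OF clh e[OF that(1,2)] e[OF that(1,3)]]
    by (simp add: pure_tensor_def e del: free_module_simps)
  show ?g3 if "r \<in> carrier R" "a \<in> carrier A" "b \<in> carrier B"
    using eq[OF tensor_relationsI(3)[where A = A and B = B, OF that]] that
      mod_hom_smult[OF clh that(1) e[OF that(2,3)]]
    by (simp add: pure_tensor_def e del: free_module_simps)
  show ?g4 if "r \<in> carrier R" "a \<in> carrier A" "b \<in> carrier B"
    using eq[OF tensor_relationsI(4)[where A = A and B = B, OF that]] that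
      mod_hom_smult[OF clh that(1) e[OF that(2,3)]]
    by (simp add: pure_tensor_def e del: free_module_simps)
qed

lemma pure_tensor_homs:
  assumes "module R A" "module R B"
  shows "b \<in> carrier B \<Longrightarrow> (\<lambda>a. pure_tensor R A B a b) \<in> mod_hom R A (tensor R A B)"
    and "a \<in> carrier A \<Longrightarrow> (\<lambda>b. pure_tensor R A B a b) \<in> mod_hom R B (tensor R A B)"
  by (auto intro!: mod_homI simp: pure_tensor_bilinear[OF assms] pure_tensor_closed[OF assms])

lemma carrier_tensor_cases:
  assumes "z \<in> carrier (tensor R A B)"
  obtains w where "w \<in> carrier (free_module R (carrier A \<times> carrier B))"
    "z = tensor_kernel R A B +>\<^bsub>free_module R (carrier A \<times> carrier B)\<^esub> w"
  using assms by (auto simp: tensor_def carrier_quot_module)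

lemma tensor_hom_eqI:
  assumes "module R A" "module R B" "module R M"
    and "f \<in> mod_hom R (tensor R A B) M" "g \<in> mod_hom R (tensor R A B) M"
    and "\<And>a b. a \<in> carrier A \<Longrightarrow> b \<in> carrier B \<Longrightarrow>
       f (pure_tensor R A B a b) = g (pure_tensor R A B a b)"
    and "z \<in> carrier (tensor R A B)"
  shows "f z = g z"
proof -
  obtain w where w: "w \<in> carrier (free_module R (carrier A \<times> carrier B))"
    "z = tensor_kernel R A B +>\<^bsub>free_module R (carrier A \<times> carrier B)\<^esub> w"
    using carrier_tensor_cases[OF assms(7)] .
  show ?thesis unfolding w(2)
    by (rule free_module_hom_eqI[OF assms(3) mod_hom_comp[OF tensor_class_hom[OF assms(1,2)] assms(4)]
          mod_hom_comp[OF tensor_class_hom[OF assms(1,2)] assms(5)] _ w(1)])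
      (use assms(6) in \<open>auto simp: pure_tensor_def\<close>)
qed

lemma tensor_generated:
  assumes "module R A" "module R B" "submodule H R (tensor R A B)"
    and "\<And>a b. a \<in> carrier A \<Longrightarrow> b \<in> carrier B \<Longrightarrow> pure_tensor R A B a b \<in> H"
  shows "carrier (tensor R A B) \<subseteq> H"
proof
  fix z assume "z \<in> carrier (tensor R A B)"
  then obtain w where w: "w \<in> carrier (free_module R (carrier A \<times> carrier B))"
    "z = tensor_kernel R A B +>\<^bsub>free_module R (carrier A \<times> carrier B)\<^esub> w"
    by (rule carrier_tensor_cases)
  let ?cl = "\<lambda>w. tensor_kernel R A B +>\<^bsub>free_module R (carrier A \<times> carrier B)\<^esub> w"
  note R = module_cring[OF assms(1)]
  note modW = module_free_module[OF R, of "carrier A \<times> carrier B"]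
  note modT = module_tensor[OF assms(1,2)] and hom = tensor_class_hom[OF assms(1,2)]
  interpret W: module R "free_module R (carrier A \<times> carrier B)" by fact
  interpret T: module R "tensor R A B" by fact
  have "?cl w \<in> H" using R w(1)
  proof (induction w rule: free_module_induct)
    case zero
    then show ?case
      using mod_hom_zero[OF modW modT hom] submodule_zero[OF modT assms(3)] by simp
  next
    case (add w r s)
    have e: "free_gen R s \<in> carrier (free_module R (carrier A \<times> carrier B))"
      using free_gen_closed[OF R add.hyps(3)] .
    have "?cl (free_gen R s) \<in> H"
      using assms(4)[of "fst s" "snd s"] add.hyps(3) by (auto simp: pure_tensor_def)
    then show ?case
      using add.IH mod_hom_add[OF hom add.hyps(1) W.smult_closed[OF add.hyps(2) e]]
        mod_hom_smult[OF hom add.hyps(2) e] T.submoduleE(4,5)[OF assms(3)] add.hyps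
      by (simp del: free_module_simps)
  qed
  then show "z \<in> H" using w(2) by simp
qed

subsection \<open>Functoriality\<close>

lemma free_map_prod_hom:
  assumes "cring R" "f \<in> mod_hom R A A'" "g \<in> mod_hom R B B'"
  shows "free_map R (map_prod f g) \<in> mod_hom R (free_module R (carrier A \<times> carrier B))
    (free_module R (carrier A' \<times> carrier B'))"
  by (rule free_map_hom[OF assms(1)]) (auto simp: mod_hom_closed[OF assms(2)] mod_hom_closed[OF assms(3)])

lemma free_map_tensor_kernel:
  assumes "module R A" "module R A'" "module R B" "module R B'"
    and "f \<in> mod_hom R A A'" "g \<in> mod_hom R B B'" "w \<in> tensor_kernel R A B"
  shows "free_map R (map_prod f g) w \<in> tensor_kernel R A' B'"
proof -
  interpret A: module R A by fact
  interpret B: module R B by fact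
  let ?W = "free_module R (carrier A \<times> carrier B)"
  let ?W' = "free_module R (carrier A' \<times> carrier B')"
  note R = module_cring[OF assms(1)]
  note modW = module_free_module[OF R, of "carrier A \<times> carrier B"]
  note modW' = module_free_module[OF R, of "carrier A' \<times> carrier B'"]
  interpret W: module R ?W by fact
  note hom = free_map_prod_hom[OF R assms(5,6)]
  note e = tensor_gen_closed[OF R, of _ A _ B]
  have "tensor_kernel R A B \<subseteq> {w \<in> carrier ?W. free_map R (map_prod f g) w \<in> tensor_kernel R A' B'}"
    unfolding tensor_kernel_def[of R A B]
  proof (rule span_least[OF submodule_vimage[OF modW modW' hom submodule_tensor_kernel[OF assms(2,4)]]])
    have "free_map R (map_prod f g) v \<in> tensor_relations R A' B'"
      if "v \<in> tensor_relations R A B" for v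
      using that
    proof (cases rule: tensor_relations_cases)
      case (add_left a a' b)
      then show ?thesis
        using tensor_relationsI(1)[of "f a" A' "f a'" "g b" B' R]
        by (simp add: e mod_hom_diff[OF modW modW' hom] mod_hom_add[OF hom] free_map_gen[OF R]
            mod_hom_add[OF assms(5)] mod_hom_closed[OF assms(5)] mod_hom_closed[OF assms(6)]
            del: free_module_simps)
    next
      case (add_right a b b')
      then show ?thesis
        using tensor_relationsI(2)[of "f a" A' "g b" B' "g b'" R]
        by (simp add: e mod_hom_diff[OF modW modW' hom] mod_hom_add[OF hom] free_map_gen[OF R]
            mod_hom_add[OF assms(6)] mod_hom_closed[OF assms(5)] mod_hom_closed[OF assms(6)]
            del: free_module_simps)
    next
      case (smult_left r a b)
      then show ?thesis
        using tensor_relationsI(3)[of r R "f a" A' "g b" B']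
        by (simp add: e mod_hom_diff[OF modW modW' hom] mod_hom_smult[OF hom] free_map_gen[OF R]
            mod_hom_smult[OF assms(5)] mod_hom_closed[OF assms(5)] mod_hom_closed[OF assms(6)]
            del: free_module_simps)
    next
      case (smult_right r a b)
      then show ?thesis
        using tensor_relationsI(4)[of r R "f a" A' "g b" B']
        by (simp add: e mod_hom_diff[OF modW modW' hom] mod_hom_smult[OF hom] free_map_gen[OF R]
            mod_hom_smult[OF assms(6)] mod_hom_closed[OF assms(5)] mod_hom_closed[OF assms(6)]
            del: free_module_simps)
    qed
    then show "tensor_relations R A B \<subseteq>
        {w \<in> carrier ?W. free_map R (map_prod f g) w \<in> tensor_kernel R A' B'}"
      using tensor_relations_closed[OF assms(1,3)] span_superset[of "tensor_relations R A' B'" R ?W']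
      by (auto simp: tensor_kernel_def)
  qed
  then show ?thesis using assms(7) by auto
qed

lemma tensor_map_class:
  assumes "module R A" "module R A'" "module R B" "module R B'"
    and "f \<in> mod_hom R A A'" "g \<in> mod_hom R B B'"
    and "w \<in> carrier (free_module R (carrier A \<times> carrier B))"
  shows "tensor_map R A' B' f g (tensor_kernel R A B +>\<^bsub>free_module R (carrier A \<times> carrier B)\<^esub> w) =
    tensor_kernel R A' B' +>\<^bsub>free_module R (carrier A' \<times> carrier B')\<^esub> free_map R (map_prod f g) w"
proof -
  note R = module_cring[OF assms(1)]
  show ?thesis unfolding tensor_map_def
    by (rule quot_map_coset_hom[OF module_free_module[OF R] submodule_tensor_kernel[OF assms(1,3)]
          module_free_module[OF R] submodule_tensor_kernel[OF assms(2,4)]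
          free_map_prod_hom[OF R assms(5,6)] free_map_tensor_kernel[OF assms(1-6)] assms(7)])
qed

lemma tensor_map_hom:
  assumes "module R A" "module R A'" "module R B" "module R B'"
    and "f \<in> mod_hom R A A'" "g \<in> mod_hom R B B'"
  shows "tensor_map R A' B' f g \<in> mod_hom R (tensor R A B) (tensor R A' B')"
proof -
  note R = module_cring[OF assms(1)]
  show ?thesis unfolding tensor_map_def tensor_def
    by (rule quot_map_hom[OF module_free_module[OF R] submodule_tensor_kernel[OF assms(1,3)]
          module_free_module[OF R] submodule_tensor_kernel[OF assms(2,4)]
          free_map_prod_hom[OF R assms(5,6)] free_map_tensor_kernel[OF assms(1-6)]])
qed

lemma tensor_map_pure:
  assumes "module R A" "module R A'" "module R B" "module R B'"
    and "f \<in> mod_hom R A A'" "g \<in> mod_hom R B B'" "a \<in> carrier A" "b \<in> carrier B"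
  shows "tensor_map R A' B' f g (pure_tensor R A B a b) = pure_tensor R A' B' (f a) (g b)"
  using tensor_map_class[OF assms(1-6) tensor_gen_closed[OF module_cring[OF assms(1)] assms(7,8)]]
    free_map_gen[OF module_cring[OF assms(1)], of "map_prod f g" "(a, b)"]
  by (simp add: pure_tensor_def)

lemma tensor_map_comp:
  assumes "module R A" "module R A'" "module R A''" "module R B" "module R B'" "module R B''"
    and "f \<in> mod_hom R A A'" "g \<in> mod_hom R B B'" "f' \<in> mod_hom R A' A''" "g' \<in> mod_hom R B' B''"
    and "z \<in> carrier (tensor R A B)"
  shows "tensor_map R A'' B'' f' g' (tensor_map R A' B' f g z) =
    tensor_map R A'' B'' (\<lambda>a. f' (f a)) (\<lambda>b. g' (g b)) z"
proof -
  note h = tensor_map_hom[OF assms(1,2,4,5,7,8)] and h' = tensor_map_hom[OF assms(2,3,5,6,9,10)]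
  note ff = mod_hom_comp[OF assms(7,9)] and gg = mod_hom_comp[OF assms(8,10)]
  show ?thesis
    by (rule tensor_hom_eqI[OF assms(1,4) module_tensor[OF assms(3,6)] mod_hom_comp[OF h h']
          tensor_map_hom[OF assms(1,3,4,6) ff gg] _ assms(11)])
      (simp add: tensor_map_pure[OF assms(1,2,4,5,7,8)] tensor_map_pure[OF assms(2,3,5,6,9,10)]
        tensor_map_pure[OF assms(1,3,4,6) ff gg] mod_hom_closed[OF assms(7)] mod_hom_closed[OF assms(8)])
qed

lemma tensor_map_id:
  assumes "module R A" "module R B" "z \<in> carrier (tensor R A B)"
  shows "tensor_map R A B (\<lambda>a. a) (\<lambda>b. b) z = z"
  by (rule tensor_hom_eqI[OF assms(1,2) module_tensor[OF assms(1,2)]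
        tensor_map_hom[OF assms(1,1,2,2) mod_hom_id mod_hom_id] mod_hom_id _ assms(3)])
    (simp add: tensor_map_pure[OF assms(1,1,2,2) mod_hom_id mod_hom_id])

lemma tensor_map_cong:
  assumes "module R A" "module R A'" "module R B" "module R B'"
    and "f \<in> mod_hom R A A'" "g \<in> mod_hom R B B'" "h \<in> mod_hom R B B'"
    and "\<And>b. b \<in> carrier B \<Longrightarrow> g b = h b" "z \<in> carrier (tensor R A B)"
  shows "tensor_map R A' B' f g z = tensor_map R A' B' f h z"
  by (rule tensor_hom_eqI[OF assms(1,3) module_tensor[OF assms(2,4)] tensor_map_hom[OF assms(1-6)]
        tensor_map_hom[OF assms(1-5,7)] _ assms(9)])
    (simp add: tensor_map_pure[OF assms(1-6)] tensor_map_pure[OF assms(1-5,7)] assms(8))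

lemma tensor_map_sum:
  assumes "module R A" "module R A'" "module R B" "module R B'"
    and "f \<in> mod_hom R A A'" "g \<in> mod_hom R B B'" "h \<in> mod_hom R B B'"
    and "z \<in> carrier (tensor R A B)"
  shows "tensor_map R A' B' f (\<lambda>b. g b \<oplus>\<^bsub>B'\<^esub> h b) z =
    tensor_map R A' B' f g z \<oplus>\<^bsub>tensor R A' B'\<^esub> tensor_map R A' B' f h z"
proof -
  note gh = mod_hom_sum[OF assms(4,6,7)] and modT = module_tensor[OF assms(2,4)]
  show ?thesis
    by (rule tensor_hom_eqI[OF assms(1,3) modT tensor_map_hom[OF assms(1-5) gh]
          mod_hom_sum[OF modT tensor_map_hom[OF assms(1-6)] tensor_map_hom[OF assms(1-5,7)]] _ assms(8)])
      (simp add: tensor_map_pure[OF assms(1-6)] tensor_map_pure[OF assms(1-5,7)]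
        tensor_map_pure[OF assms(1-5) gh] pure_tensor_bilinear[OF assms(2,4)]
        mod_hom_closed[OF assms(5)] mod_hom_closed[OF assms(6)] mod_hom_closed[OF assms(7)])
qed

lemma tensor_map_surj:
  assumes "module R A" "module R A'" "module R B" "module R B'"
    and "f \<in> mod_hom R A A'" "g \<in> mod_hom R B B'"
    and "f ` carrier A = carrier A'" "g ` carrier B = carrier B'"
  shows "tensor_map R A' B' f g ` carrier (tensor R A B) = carrier (tensor R A' B')"
proof
  note h = tensor_map_hom[OF assms(1-6)]
  show "tensor_map R A' B' f g ` carrier (tensor R A B) \<subseteq> carrier (tensor R A' B')"
    using mod_hom_closed[OF h] by auto
  show "carrier (tensor R A' B') \<subseteq> tensor_map R A' B' f g ` carrier (tensor R A B)"
  proof (rule tensor_generated[OF assms(2,4)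
        submodule_image[OF module_tensor[OF assms(1,3)] module_tensor[OF assms(2,4)] h]])
    fix a' b' assume "a' \<in> carrier A'" "b' \<in> carrier B'"
    then have "a' \<in> f ` carrier A" "b' \<in> g ` carrier B" using assms(7,8) by auto
    then obtain a b where "a \<in> carrier A" "b \<in> carrier B" "a' = f a" "b' = g b" by auto
    then show "pure_tensor R A' B' a' b' \<in> tensor_map R A' B' f g ` carrier (tensor R A B)"
      using tensor_map_pure[OF assms(1-6)] pure_tensor_closed[OF assms(1,3)]
      by (auto intro!: image_eqI[of _ _ "pure_tensor R A B a b"])
  qed
qed

subsection \<open>Vanishing in a tensor product\<close>

definition coeff_eval ::
    "('r, 'z) ring_scheme \<Rightarrow> ('r, 'c) module \<Rightarrow> ('a \<Rightarrow> 's \<Rightarrow> 'r) \<Rightarrow> ('a \<times> 'c \<Rightarrow> 'r) \<Rightarrow> 's \<Rightarrow> 'c" where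
  "coeff_eval R C t w s = lin_ext R C (\<lambda>(a, c). t a s \<odot>\<^bsub>C\<^esub> c) w"

lemma coeff_eval_hom:
  assumes "module R C" "\<And>a. a \<in> A \<Longrightarrow> t a s \<in> carrier R"
  shows "(\<lambda>w. coeff_eval R C t w s) \<in> mod_hom R (free_module R (A \<times> carrier C)) C"
proof -
  interpret C: module R C by fact
  show ?thesis unfolding coeff_eval_def
    by (rule lin_ext_hom[OF assms(1)]) (use assms(2) in auto)
qed

lemma coeff_eval_gen:
  assumes "module R C" "t a s \<in> carrier R" "c \<in> carrier C"
  shows "coeff_eval R C t (free_gen R (a, c)) s = t a s \<odot>\<^bsub>C\<^esub> c"
proof -
  interpret C: module R C by fact
  show ?thesis unfolding coeff_eval_def
    using assms by (subst lin_ext_gen[OF assms(1)]) auto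
qed

text \<open>
  A function \<open>t\<close> from \<open>A\<close> to coefficient vectors that is linear up to vectors in \<open>P\<close> sends \<open>a \<otimes> c\<close>
  to the family \<open>t a s \<cdot> c\<close>; an element of the kernel is sent to a family explained by \<open>P\<close>, since each
  bilinearity relation is.
\<close>

lemma coeff_eval_tensor_kernel:
  assumes "module R A" "module R C" "P \<subseteq> UNIV \<rightarrow> carrier R"
    and t: "\<And>a s. a \<in> carrier A \<Longrightarrow> t a s \<in> carrier R"
    and t_add: "\<And>a a'. a \<in> carrier A \<Longrightarrow> a' \<in> carrier A \<Longrightarrow>
       (\<lambda>s. t (a \<oplus>\<^bsub>A\<^esub> a') s \<ominus>\<^bsub>R\<^esub> (t a s \<oplus>\<^bsub>R\<^esub> t a' s)) \<in> P"
    and t_smult: "\<And>r a. r \<in> carrier R \<Longrightarrow> a \<in> carrier A \<Longrightarrow>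
       (\<lambda>s. t (r \<odot>\<^bsub>A\<^esub> a) s \<ominus>\<^bsub>R\<^esub> (r \<otimes>\<^bsub>R\<^esub> t a s)) \<in> P"
    and "w \<in> tensor_kernel R A C"
  shows "coeff_eval R C t w \<in> rel_span C P"
proof -
  interpret A: module R A by fact
  interpret C: module R C by fact
  note R = A.R.cring_axioms
  let ?W = "free_module R (carrier A \<times> carrier C)"
  note modW = module_free_module[OF R, of "carrier A \<times> carrier C"]
  interpret W: module R ?W by fact
  note e = tensor_gen_closed[OF R, of _ A _ C]
  have hom: "(\<lambda>w. coeff_eval R C t w s) \<in> mod_hom R ?W C" for s
    by (rule coeff_eval_hom[OF assms(2)]) (rule t)
  note add = mod_hom_add[OF hom] and smult = mod_hom_smult[OF hom]
    and diff = mod_hom_diff[OF modW assms(2) hom]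
  have gen: "coeff_eval R C t (free_gen R (a, c)) s = t a s \<odot>\<^bsub>C\<^esub> c"
    if "a \<in> carrier A" "c \<in> carrier C" for a c s
    by (rule coeff_eval_gen[OF assms(2)]) (use that t in auto)
  let ?H = "{w \<in> carrier ?W. coeff_eval R C t w \<in> rel_span C P}"
  have ext: "x \<in> rel_span C P" if "y \<in> rel_span C P" "\<And>s. x s = y s" for x y
    using that(1) ext[of x y, OF that(2)] by simp
  have "submodule ?H R ?W"
  proof (rule W.submoduleI)
    show "\<zero>\<^bsub>?W\<^esub> \<in> ?H"
      using ext[OF rel_span.zero] mod_hom_zero[OF modW assms(2) hom] by blast
    show "\<ominus>\<^bsub>?W\<^esub> a \<in> ?H" if "a \<in> ?H" for a
      using that ext[OF rel_span_neg[OF assms(2,3), of "coeff_eval R C t a"]]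
        mod_hom_neg[OF modW assms(2) hom] by blast
    show "a \<oplus>\<^bsub>?W\<^esub> b \<in> ?H" if "a \<in> ?H" "b \<in> ?H" for a b
      using that ext[OF rel_span_sum[OF assms(2,3), of "coeff_eval R C t a" "coeff_eval R C t b"]]
        add by blast
    show "r \<odot>\<^bsub>?W\<^esub> a \<in> ?H" if "r \<in> carrier R" "a \<in> ?H" for r a
      using that ext[OF rel_span_smult[OF assms(2,3), of "coeff_eval R C t a" r]]
        smult by blast
  qed auto
  moreover have "coeff_eval R C t v \<in> rel_span C P" if v: "v \<in> tensor_relations R A C" for v
    using v
  proof (cases rule: tensor_relations_cases)
    case (add_left a a' b)
    have "(\<lambda>s. (t (a \<oplus>\<^bsub>A\<^esub> a') s \<ominus>\<^bsub>R\<^esub> (t a s \<oplus>\<^bsub>R\<^esub> t a' s)) \<odot>\<^bsub>C\<^esub> b) \<in> rel_span C P"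
      by (rule rel_span_single[OF assms(2) _ t_add]) (use add_left t in auto)
    then show ?thesis
      by (rule ext) (use add_left t in \<open>simp add: diff add gen e C.smult_l_distr C.smult_l_minus
        a_minus_def[of R] a_minus_def[of C] del: free_module_simps\<close>)
  next
    case (add_right a b b')
    show ?thesis
      by (rule ext[OF rel_span.zero]) (use add_right t in \<open>simp add: diff add gen e C.smult_r_distr
        a_minus_def[of C] C.r_neg del: free_module_simps\<close>)
  next
    case (smult_left r a b)
    have "(\<lambda>s. (t (r \<odot>\<^bsub>A\<^esub> a) s \<ominus>\<^bsub>R\<^esub> (r \<otimes>\<^bsub>R\<^esub> t a s)) \<odot>\<^bsub>C\<^esub> b) \<in> rel_span C P"
      by (rule rel_span_single[OF assms(2) _ t_smult]) (use smult_left t in auto)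
    then show ?thesis
      by (rule ext) (use smult_left t in \<open>simp add: diff smult gen e C.smult_l_distr C.smult_l_minus
        C.smult_assoc1 a_minus_def[of R] a_minus_def[of C] del: free_module_simps\<close>)
  next
    case (smult_right r a b)
    show ?thesis
      by (rule ext[OF rel_span.zero]) (use smult_right t in \<open>simp add: diff smult gen e
        C.smult_assoc1[symmetric] A.R.m_comm[of r] a_minus_def[of C] C.r_neg del: free_module_simps\<close>)
  qed
  then have "tensor_relations R A C \<subseteq> ?H" using tensor_relations_closed[OF assms(1,2)] by auto
  ultimately have "tensor_kernel R A C \<subseteq> ?H" unfolding tensor_kernel_def by (rule span_least)
  then show ?thesis using assms(7) by auto
qed

text \<open>
  Collecting the terms with the same left factor identifies \<open>A \<otimes> C\<close> with the finitely supported
  functions \<open>A \<rightarrow> C\<close> modulo those that are explained by linear relations between elements of \<open>A\<close>.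
\<close>

definition relations :: "('r, 'z) ring_scheme \<Rightarrow> ('r, 'a) module \<Rightarrow> ('a \<Rightarrow> 'r) set" where
  "relations R A = {\<rho> \<in> carrier (free_module R (carrier A)). lin_ext R A (\<lambda>a. a) \<rho> = \<zero>\<^bsub>A\<^esub>}"

abbreviation collect ::
    "('r, 'z) ring_scheme \<Rightarrow> ('r, 'c) module \<Rightarrow> ('a \<times> 'c \<Rightarrow> 'r) \<Rightarrow> 'a \<Rightarrow> 'c" where
  "collect R C \<equiv> coeff_eval R C (free_gen R)"

lemma relations_coeffs: "relations R A \<subseteq> UNIV \<rightarrow> carrier R"
  by (auto simp: relations_def mem_free_module)

lemma relations_support:
  "\<rho> \<in> relations R A \<Longrightarrow> finite {s. \<rho> s \<noteq> \<zero>\<^bsub>R\<^esub>}"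
  "\<rho> \<in> relations R A \<Longrightarrow> s \<notin> carrier A \<Longrightarrow> \<rho> s = \<zero>\<^bsub>R\<^esub>"
  by (auto simp: relations_def mem_free_module)

lemma free_gen_apply: "free_gen R s x = (if x = s then \<one>\<^bsub>R\<^esub> else \<zero>\<^bsub>R\<^esub>)"
  by (simp add: free_gen_def)

lemma free_gen_coeff: "cring R \<Longrightarrow> free_gen R a s \<in> carrier R"
proof -
  assume "cring R"
  then interpret R: cring R .
  show ?thesis by (simp add: free_gen_def)
qed

lemma collect_hom:
  assumes "module R C"
  shows "(\<lambda>w. collect R C w a) \<in> mod_hom R (free_module R (A \<times> carrier C)) C"
  by (rule coeff_eval_hom[OF assms]) (rule free_gen_coeff[OF module_cring[OF assms]])

lemma collect_gen:
  assumes "module R C" "c \<in> carrier C"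
  shows "collect R C (free_gen R (a, c)) s = (if s = a then c else \<zero>\<^bsub>C\<^esub>)"
proof -
  interpret C: module R C by fact
  show ?thesis
    using coeff_eval_gen[where t = "free_gen R" and s = s and a = a,
        OF assms(1) free_gen_coeff[OF C.R.cring_axioms] assms(2)] assms(2)
    by (simp add: free_gen_def)
qed

lemma free_module_outside: "c \<in> carrier (free_module R S) \<Longrightarrow> x \<notin> S \<Longrightarrow> c x = \<zero>\<^bsub>R\<^esub>"
  by (simp add: mem_free_module)

lemma free_module_mono: "c \<in> carrier (free_module R S) \<Longrightarrow> S \<subseteq> T \<Longrightarrow> c \<in> carrier (free_module R T)"
  by (auto simp: mem_free_module)

lemma mem_free_module_finite_left:
  assumes "w \<in> carrier (free_module R (A \<times> B))"
  obtains S where "finite S" "S \<subseteq> A" "w \<in> carrier (free_module R (S \<times> B))"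
proof
  let ?S = "fst ` {x. w x \<noteq> \<zero>\<^bsub>R\<^esub>}"
  show "finite ?S" using assms by (simp add: mem_free_module)
  show "?S \<subseteq> A"
  proof
    fix a assume "a \<in> ?S"
    then obtain x where x: "a = fst x" "w x \<noteq> \<zero>\<^bsub>R\<^esub>" by auto
    then have "x \<in> A \<times> B" using free_module_outside[OF assms, of x] by blast
    then show "a \<in> A" using x(1) by auto
  qed
  have "w x = \<zero>\<^bsub>R\<^esub>" if "x \<notin> ?S \<times> B" for x
  proof (rule ccontr)
    assume "w x \<noteq> \<zero>\<^bsub>R\<^esub>"
    then have "fst x \<in> ?S" by simp
    moreover have "x \<in> A \<times> B"
      using \<open>w x \<noteq> \<zero>\<^bsub>R\<^esub>\<close> free_module_outside[OF assms, of x] by blast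
    ultimately show False using that by (auto simp: mem_Times_iff)
  qed
  then show "w \<in> carrier (free_module R (?S \<times> B))"
    unfolding mem_free_module
  proof (intro conjI allI impI)
    show "w x \<in> carrier R" for x by (rule free_module_coeff[OF assms])
    show "finite {x. w x \<noteq> \<zero>\<^bsub>R\<^esub>}" using assms by (simp only: mem_free_module)
  qed
qed

lemma collect_outside:
  assumes "module R C" "w \<in> carrier (free_module R (S \<times> carrier C))" "a \<notin> S"
  shows "collect R C w a = \<zero>\<^bsub>C\<^esub>"
  by (rule free_module_hom_eqI[OF assms(1) collect_hom[OF assms(1)] mod_hom_const_zero[OF assms(1)]
        _ assms(2)])
    (use assms(1,3) in \<open>auto simp: collect_gen\<close>)

lemma collect_surj:
  assumes "module R C" "finite S" "S \<subseteq> A" "\<And>a. a \<in> S \<Longrightarrow> x a \<in> carrier C"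
    and "\<And>a. a \<notin> S \<Longrightarrow> x a = \<zero>\<^bsub>C\<^esub>"
  shows "\<exists>w\<in>carrier (free_module R (A \<times> carrier C)). \<forall>a. collect R C w a = x a"
proof -
  interpret C: module R C by fact
  note modW = module_free_module[OF C.R.cring_axioms, of "A \<times> carrier C"]
  interpret W: module R "free_module R (A \<times> carrier C)" by fact
  note hom = collect_hom[OF assms(1), of _ A]
  have "\<exists>w\<in>carrier (free_module R (A \<times> carrier C)).
      \<forall>a. collect R C w a = (if a \<in> S then x a else \<zero>\<^bsub>C\<^esub>)"
    using assms(2-4)
  proof (induction S)
    case empty
    then show ?case
      using mod_hom_zero[OF modW assms(1) hom] by (intro bexI[OF _ W.zero_closed]) simp
  next
    case (insert b S)
    then obtain w where w: "w \<in> carrier (free_module R (A \<times> carrier C))"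
      "\<forall>a. collect R C w a = (if a \<in> S then x a else \<zero>\<^bsub>C\<^esub>)" by auto
    have e: "free_gen R (b, x b) \<in> carrier (free_module R (A \<times> carrier C))"
      by (rule free_gen_closed[OF C.R.cring_axioms]) (use insert.prems in auto)
    show ?case
      using w insert.hyps insert.prems
      by (intro bexI[OF _ W.a_closed[OF w(1) e]])
        (auto simp: mod_hom_add[OF hom w(1) e] collect_gen[OF assms(1)] simp del: free_module_simps)
  qed
  moreover have "(if a \<in> S then x a else \<zero>\<^bsub>C\<^esub>) = x a" for a using assms(5) by simp
  ultimately show ?thesis by simp
qed

text \<open>
  Bilinearity allows to add up the terms with the same left factor. Both sides are linear in \<open>w\<close>, so it
  is enough to compare them on the basis of the free module.
\<close>

lemma tensor_class_collect:
  assumes "module R A" "module R C" "finite S" "S \<subseteq> carrier A"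
    and "w \<in> carrier (free_module R (S \<times> carrier C))"
  shows "tensor_kernel R A C +>\<^bsub>free_module R (carrier A \<times> carrier C)\<^esub> w =
    (\<Oplus>\<^bsub>tensor R A C\<^esub>a\<in>S. pure_tensor R A C a (collect R C w a))"
proof -
  interpret A: module R A by fact
  interpret C: module R C by fact
  note R = A.R.cring_axioms
  note modT = module_tensor[OF assms(1,2)]
  interpret T: module R "tensor R A C" by fact
  let ?F = "free_module R (S \<times> carrier C)"
  have sub: "w \<in> carrier (free_module R (carrier A \<times> carrier C))" if "w \<in> carrier ?F" for w
    by (rule free_module_mono[OF that]) (use assms(4) in auto)
  have cl: "(\<lambda>w. tensor_kernel R A C +>\<^bsub>free_module R (carrier A \<times> carrier C)\<^esub> w) \<in>
      mod_hom R ?F (tensor R A C)"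
    using tensor_class_hom[OF assms(1,2)] sub by (auto simp: mod_hom_def Pi_iff)
  have pt: "(\<lambda>w. pure_tensor R A C a (collect R C w a)) \<in> mod_hom R ?F (tensor R A C)"
    if "a \<in> S" for a
    using that assms(4)
    by (intro mod_hom_comp[OF collect_hom[OF assms(2)] pure_tensor_homs(2)[OF assms(1,2)]]) auto
  have "(\<lambda>w. \<Oplus>\<^bsub>tensor R A C\<^esub>a\<in>T. pure_tensor R A C a (collect R C w a)) \<in>
      mod_hom R ?F (tensor R A C)" if "T \<subseteq> S" for T
    using finite_subset[OF that assms(3)] that
  proof (induction T)
    case empty
    then show ?case using mod_hom_const_zero[OF modT] by simp
  next
    case (insert b T)
    have "(\<lambda>w. pure_tensor R A C b (collect R C w b) \<oplus>\<^bsub>tensor R A C\<^esub>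
        (\<Oplus>\<^bsub>tensor R A C\<^esub>a\<in>T. pure_tensor R A C a (collect R C w a))) \<in> mod_hom R ?F (tensor R A C)"
      by (rule mod_hom_sum[OF modT pt]) (use insert in auto)
    then show ?case
    proof (rule mod_hom_cong[rotated -1])
      show "(\<Oplus>\<^bsub>tensor R A C\<^esub>a\<in>insert b T. pure_tensor R A C a (collect R C w a)) =
          pure_tensor R A C b (collect R C w b) \<oplus>\<^bsub>tensor R A C\<^esub>
          (\<Oplus>\<^bsub>tensor R A C\<^esub>a\<in>T. pure_tensor R A C a (collect R C w a))" if w: "w \<in> carrier ?F" for w
      proof (rule T.finsum_insert)
        show "(\<lambda>a. pure_tensor R A C a (collect R C w a)) \<in> T \<rightarrow> carrier (tensor R A C)"
          using mod_hom_closed[OF pt w] insert.prems by auto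
        show "pure_tensor R A C b (collect R C w b) \<in> carrier (tensor R A C)"
          using mod_hom_closed[OF pt w] insert.prems by auto
      qed (use insert.hyps in auto)
    qed (rule module_free_module[OF R])
  qed
  then have sum: "(\<lambda>w. \<Oplus>\<^bsub>tensor R A C\<^esub>a\<in>S. pure_tensor R A C a (collect R C w a)) \<in>
      mod_hom R ?F (tensor R A C)" by simp
  show ?thesis
  proof (rule free_module_hom_eqI[OF modT cl sum _ assms(5)])
    fix s assume "s \<in> S \<times> carrier C"
    then obtain b c where s: "s = (b, c)" "b \<in> S" "c \<in> carrier C" by auto
    have pt0: "pure_tensor R A C a \<zero>\<^bsub>C\<^esub> = \<zero>\<^bsub>tensor R A C\<^esub>" if "a \<in> S" for a
      using that assms(4) mod_hom_zero[OF assms(2) modT pure_tensor_homs(2)[OF assms(1,2)]] by auto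
    have ptc: "pure_tensor R A C a c \<in> carrier (tensor R A C)" if "a \<in> S" for a
      using that assms(4) s by (intro pure_tensor_closed[OF assms(1,2)]) auto
    have "(\<Oplus>\<^bsub>tensor R A C\<^esub>a\<in>S. pure_tensor R A C a (collect R C (free_gen R s) a)) =
        (\<Oplus>\<^bsub>tensor R A C\<^esub>a\<in>S. if b = a then pure_tensor R A C a c else \<zero>\<^bsub>tensor R A C\<^esub>)"
      by (rule T.finsum_cong') (use s pt0 ptc in \<open>auto simp: collect_gen[OF assms(2)]\<close>)
    also have "\<dots> = pure_tensor R A C b c"
      by (rule T.add.finprod_singleton) (use s assms(3) ptc in auto)
    finally show "tensor_kernel R A C +>\<^bsub>free_module R (carrier A \<times> carrier C)\<^esub> free_gen R s =
        (\<Oplus>\<^bsub>tensor R A C\<^esub>a\<in>S. pure_tensor R A C a (collect R C (free_gen R s) a))"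
      by (simp add: s pure_tensor_def)
  qed
qed

lemma collect_zero_tensor_kernel:
  assumes "module R A" "module R C" "w \<in> carrier (free_module R (carrier A \<times> carrier C))"
    and "\<And>a. collect R C w a = \<zero>\<^bsub>C\<^esub>"
  shows "w \<in> tensor_kernel R A C"
proof -
  note R = module_cring[OF assms(1)]
  note modT = module_tensor[OF assms(1,2)]
  interpret T: module R "tensor R A C" by fact
  obtain S where S: "finite S" "S \<subseteq> carrier A" "w \<in> carrier (free_module R (S \<times> carrier C))"
    using mem_free_module_finite_left[OF assms(3)] .
  have "pure_tensor R A C a \<zero>\<^bsub>C\<^esub> = \<zero>\<^bsub>tensor R A C\<^esub>" if "a \<in> S" for a
    using that S(2) mod_hom_zero[OF assms(2) modT pure_tensor_homs(2)[OF assms(1,2)]] by auto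
  then have "(\<Oplus>\<^bsub>tensor R A C\<^esub>a\<in>S. pure_tensor R A C a (collect R C w a)) = \<zero>\<^bsub>tensor R A C\<^esub>"
    using assms(4) by (intro T.add.finprod_one_eqI) simp
  then show ?thesis
    using tensor_class_collect[OF assms(1,2) S]
      coset_eq_self_iff[OF module_free_module[OF R] submodule_tensor_kernel[OF assms(1,2)] assms(3)]
    by (simp add: tensor_def zero_quot_module)
qed

text \<open>A linear relation \<open>\<Sum> \<rho>(a) a = 0\<close> in \<open>A\<close> kills \<open>\<Sum> \<rho>(a) (a, c)\<close>, which is \<open>(\<Sum> \<rho>(a) a) \<otimes> c\<close>.\<close>

lemma relation_in_tensor_kernel:
  assumes "module R A" "module R C" "\<rho> \<in> relations R A" "c \<in> carrier C"
  shows "\<exists>w\<in>tensor_kernel R A C. w \<in> carrier (free_module R (carrier A \<times> carrier C)) \<and>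
    (\<forall>a. collect R C w a = \<rho> a \<odot>\<^bsub>C\<^esub> c)"
proof -
  interpret A: module R A by fact
  interpret C: module R C by fact
  note R = A.R.cring_axioms
  let ?W = "free_module R (carrier A \<times> carrier C)" and ?F = "free_module R (carrier A)"
  note modW = module_free_module[OF R, of "carrier A \<times> carrier C"]
  note modT = module_tensor[OF assms(1,2)]
  interpret T: module R "tensor R A C" by fact
  have \<rho>: "\<rho> \<in> carrier ?F" "lin_ext R A (\<lambda>a. a) \<rho> = \<zero>\<^bsub>A\<^esub>" using assms(3) by (auto simp: relations_def)
  have L: "lin_ext R ?W (\<lambda>a. free_gen R (a, c)) \<in> mod_hom R ?F ?W"
    by (rule lin_ext_hom[OF modW]) (use assms(4) in \<open>auto intro: tensor_gen_closed[OF R]\<close>)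
  have Lgen: "lin_ext R ?W (\<lambda>a. free_gen R (a, c)) (free_gen R a) = free_gen R (a, c)"
    if "a \<in> carrier A" for a
    by (rule lin_ext_gen[OF modW]) (rule tensor_gen_closed[OF R that assms(4)])
  let ?w = "lin_ext R ?W (\<lambda>a. free_gen R (a, c)) \<rho>"
  have w: "?w \<in> carrier ?W" using mod_hom_closed[OF L \<rho>(1)] .
  have sc: "(\<lambda>r. r \<odot>\<^bsub>C\<^esub> c) \<in> mod_hom R (regular_module R) C"
    by (rule mod_homI) (use assms(4) in \<open>auto simp: C.smult_l_distr C.smult_assoc1\<close>)
  have "collect R C ?w a = \<rho> a \<odot>\<^bsub>C\<^esub> c" for a
    by (rule free_module_hom_eqI[OF assms(2) mod_hom_comp[OF L collect_hom[OF assms(2)]]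
          mod_hom_comp[OF free_module_coeff_hom sc] _ \<rho>(1)])
      (use assms(4) in \<open>simp add: Lgen collect_gen[OF assms(2)] free_gen_apply\<close>)
  moreover have "tensor_kernel R A C +>\<^bsub>?W\<^esub> ?w = pure_tensor R A C (lin_ext R A (\<lambda>a. a) \<rho>) c"
    by (rule free_module_hom_eqI[OF modT mod_hom_comp[OF L tensor_class_hom[OF assms(1,2)]]
          mod_hom_comp[OF lin_ext_hom[OF assms(1)] pure_tensor_homs(1)[OF assms(1,2,4)]] _ \<rho>(1)])
      (auto simp: Lgen pure_tensor_def lin_ext_gen[OF assms(1)])
  then have "tensor_kernel R A C +>\<^bsub>?W\<^esub> ?w = \<zero>\<^bsub>tensor R A C\<^esub>"
    using mod_hom_zero[OF assms(1) modT pure_tensor_homs(1)[OF assms(1,2,4)]] \<rho>(2) by simp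
  then have "?w \<in> tensor_kernel R A C"
    using coset_eq_self_iff[OF modW submodule_tensor_kernel[OF assms(1,2)] w]
    by (simp add: tensor_def zero_quot_module)
  ultimately show ?thesis using w by (intro bexI[of _ ?w]) auto
qed

text \<open>
  The bilinearity relations in the left factor collect to relations in \<open>A\<close>, those in the right
  factor to zero. Conversely, each explaining relation is collected from an element of the kernel, and
  once these are subtracted, all collected terms vanish.
\<close>

theorem tensor_kernel_iff:
  assumes "module R A" "module R C" "w \<in> carrier (free_module R (carrier A \<times> carrier C))"
  shows "w \<in> tensor_kernel R A C \<longleftrightarrow> collect R C w \<in> rel_span C (relations R A)"
proof
  interpret A: module R A by fact
  interpret C: module R C by fact
  note R = A.R.cring_axioms
  let ?W = "free_module R (carrier A \<times> carrier C)" and ?F = "free_module R (carrier A)"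
  note modF = module_free_module[OF R, of "carrier A"]
  interpret F: module R ?F by fact
  note modW = module_free_module[OF R, of "carrier A \<times> carrier C"]
  interpret W: module R ?W by fact
  have lin: "lin_ext R A (\<lambda>a. a) \<in> mod_hom R ?F A" by (rule lin_ext_hom[OF assms(1)])
  note lin_simps = mod_hom_diff[OF modF assms(1) lin] mod_hom_add[OF lin] mod_hom_smult[OF lin]
    lin_ext_gen[OF assms(1)] free_gen_closed[OF R]
  show "collect R C w \<in> rel_span C (relations R A)" if "w \<in> tensor_kernel R A C"
  proof (rule coeff_eval_tensor_kernel[OF assms(1,2) relations_coeffs _ _ _ that])
    show "free_gen R a s \<in> carrier R" for a s by (rule free_gen_coeff[OF R])
    show "(\<lambda>s. free_gen R (a \<oplus>\<^bsub>A\<^esub> a') s \<ominus>\<^bsub>R\<^esub> (free_gen R a s \<oplus>\<^bsub>R\<^esub> free_gen R a' s)) \<in> relations R A"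
      if "a \<in> carrier A" "a' \<in> carrier A" for a a'
    proof -
      let ?\<rho> = "free_gen R (a \<oplus>\<^bsub>A\<^esub> a') \<ominus>\<^bsub>?F\<^esub> (free_gen R a \<oplus>\<^bsub>?F\<^esub> free_gen R a')"
      have "?\<rho> \<in> relations R A"
        using that by (simp add: relations_def lin_simps a_minus_def[of A] A.M.r_neg
          del: free_module_simps)
      moreover have "?\<rho> = (\<lambda>s. free_gen R (a \<oplus>\<^bsub>A\<^esub> a') s \<ominus>\<^bsub>R\<^esub> (free_gen R a s \<oplus>\<^bsub>R\<^esub> free_gen R a' s))"
        using that free_module_minus[OF R free_gen_closed[OF R]
            F.a_closed[OF free_gen_closed[OF R] free_gen_closed[OF R]]] by simp
      ultimately show ?thesis by simp
    qed
    show "(\<lambda>s. free_gen R (r \<odot>\<^bsub>A\<^esub> a) s \<ominus>\<^bsub>R\<^esub> (r \<otimes>\<^bsub>R\<^esub> free_gen R a s)) \<in> relations R A"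
      if "r \<in> carrier R" "a \<in> carrier A" for r a
    proof -
      let ?\<rho> = "free_gen R (r \<odot>\<^bsub>A\<^esub> a) \<ominus>\<^bsub>?F\<^esub> (r \<odot>\<^bsub>?F\<^esub> free_gen R a)"
      have "?\<rho> \<in> relations R A"
        using that by (simp add: relations_def lin_simps a_minus_def[of A] A.M.r_neg
          del: free_module_simps)
      moreover have "?\<rho> = (\<lambda>s. free_gen R (r \<odot>\<^bsub>A\<^esub> a) s \<ominus>\<^bsub>R\<^esub> (r \<otimes>\<^bsub>R\<^esub> free_gen R a s))"
        using that free_module_minus[OF R free_gen_closed[OF R]
            F.smult_closed[OF that(1) free_gen_closed[OF R]]] by simp
      ultimately show ?thesis by simp
    qed
  qed
  have "w \<in> tensor_kernel R A C"
    if "x \<in> rel_span C (relations R A)" "w \<in> carrier ?W" "collect R C w = x" for x w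
    using that
  proof (induction arbitrary: w)
    case zero
    then show ?case by (intro collect_zero_tensor_kernel[OF assms(1,2)]) auto
  next
    case (add x \<rho> c)
    obtain v where v: "v \<in> tensor_kernel R A C" "v \<in> carrier ?W"
      "\<forall>a. collect R C v a = \<rho> a \<odot>\<^bsub>C\<^esub> c"
      using relation_in_tensor_kernel[OF assms(1,2) add.hyps(2,3)] by auto
    have \<rho>: "\<rho> s \<in> carrier R" for s using coeffD[OF relations_coeffs add.hyps(2)] .
    have x: "x s \<in> carrier C" for s by (rule rel_span_closed[OF assms(2) relations_coeffs add.hyps(1)])
    have "collect R C (w \<ominus>\<^bsub>?W\<^esub> v) a = x a" for a
    proof -
      have "collect R C (w \<ominus>\<^bsub>?W\<^esub> v) a = collect R C w a \<ominus>\<^bsub>C\<^esub> collect R C v a"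
        by (rule mod_hom_diff[OF modW assms(2) collect_hom[OF assms(2)] add.prems(1) v(2)])
      then show ?thesis
        using v(3) add.prems(2) \<rho> x add.hyps(3) by (simp add: a_minus_def C.add.m_assoc C.r_neg)
    qed
    then have "collect R C (w \<ominus>\<^bsub>?W\<^esub> v) = x" by (rule ext)
    then have "w \<ominus>\<^bsub>?W\<^esub> v \<in> tensor_kernel R A C"
      using add.IH[OF W.minus_closed[OF add.prems(1) v(2)]] by simp
    then have "(w \<ominus>\<^bsub>?W\<^esub> v) \<oplus>\<^bsub>?W\<^esub> v \<in> tensor_kernel R A C"
      using W.submoduleE(5)[OF submodule_tensor_kernel[OF assms(1,2)]] v(1) by blast
    then show ?case
      using add.prems(1) v(2)
      by (simp add: a_minus_def[of ?W] W.add.m_assoc W.l_neg del: free_module_simps)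
  qed
  then show "w \<in> tensor_kernel R A C" if "collect R C w \<in> rel_span C (relations R A)"
    using that assms(3) by simp
qed

subsection \<open>Exactness of the tensor product on flat modules\<close>

lemma mod_hom_inj_onI:
  assumes "module R M" "module R N" "f \<in> mod_hom R M N"
    and "\<And>x. x \<in> carrier M \<Longrightarrow> f x = \<zero>\<^bsub>N\<^esub> \<Longrightarrow> x = \<zero>\<^bsub>M\<^esub>"
  shows "inj_on f (carrier M)"
proof (rule inj_onI)
  interpret M: module R M by fact
  interpret N: module R N by fact
  fix x y assume xy: "x \<in> carrier M" "y \<in> carrier M" "f x = f y"
  then have "f (x \<ominus>\<^bsub>M\<^esub> y) = \<zero>\<^bsub>N\<^esub>"
    using mod_hom_diff[OF assms(1-3)] mod_hom_closed[OF assms(3)]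
    by (simp add: a_minus_def N.r_neg)
  then have "x \<ominus>\<^bsub>M\<^esub> y = \<zero>\<^bsub>M\<^esub>" using assms(4) xy by simp
  moreover have "(x \<ominus>\<^bsub>M\<^esub> y) \<oplus>\<^bsub>M\<^esub> y = x"
    using xy by (simp add: a_minus_def M.add.m_assoc M.l_neg)
  ultimately show "x = y" using xy by simp
qed

lemma collect_free_map:
  fixes A :: "('r, 'a) module"
  assumes "module R A" "module R C" "module R D" "g \<in> mod_hom R C D"
    and "w \<in> carrier (free_module R (carrier A \<times> carrier C))"
  shows "collect R D (free_map R (map_prod (\<lambda>x. x) g) w) a = g (collect R C w a)"
proof -
  note R = module_cring[OF assms(1)]
  show ?thesis
    by (rule free_module_hom_eqI[OF assms(3) mod_hom_comp[OF free_map_prod_hom[OF R mod_hom_id[of R A] assms(4)]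
          collect_hom[OF assms(3)]] mod_hom_comp[OF collect_hom[OF assms(2), where A = "carrier A"] assms(4)]
          _ assms(5)])
      (auto simp: free_map_gen[OF R] collect_gen[OF assms(3)] collect_gen[OF assms(2)]
        mod_hom_closed[OF assms(4)] mod_hom_zero[OF assms(2-4)])
qed

lemma tensor_class_eq_zero_iff:
  assumes "module R A" "module R C" "w \<in> carrier (free_module R (carrier A \<times> carrier C))"
  shows "tensor_kernel R A C +>\<^bsub>free_module R (carrier A \<times> carrier C)\<^esub> w = \<zero>\<^bsub>tensor R A C\<^esub>
    \<longleftrightarrow> w \<in> tensor_kernel R A C"
  using coset_eq_self_iff[OF module_free_module[OF module_cring[OF assms(1)]]
      submodule_tensor_kernel[OF assms(1,2)] assms(3)]
  by (simp add: tensor_def zero_quot_module)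

text \<open>
  An element of \<open>A \<otimes> K\<close> that vanishes in \<open>A \<otimes> C\<close> is explained by relations in \<open>A\<close> and elements
  of \<open>C\<close>. By purity these can be replaced by elements of \<open>K\<close>.
\<close>

lemma tensor_map_inj:
  assumes "module R A" "module R K" "module R C" "eq_flat R D"
    and "j \<in> mod_hom R K C" "q \<in> mod_hom R C D" "inj_on j (carrier K)"
    and "j ` carrier K = mod_ker C D q" "q ` carrier C = carrier D"
  shows "inj_on (tensor_map R A C (\<lambda>x. x) j) (carrier (tensor R A K))"
proof (rule mod_hom_inj_onI[OF module_tensor[OF assms(1,2)] module_tensor[OF assms(1,3)]
      tensor_map_hom[OF assms(1,1,2,3) mod_hom_id assms(5)]])
  fix z assume z: "z \<in> carrier (tensor R A K)"
    and z0: "tensor_map R A C (\<lambda>x. x) j z = \<zero>\<^bsub>tensor R A C\<^esub>"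
  note R = module_cring[OF assms(1)]
  note modD = eq_flat_module[OF assms(4)]
  obtain w where w: "w \<in> carrier (free_module R (carrier A \<times> carrier K))"
    "z = tensor_kernel R A K +>\<^bsub>free_module R (carrier A \<times> carrier K)\<^esub> w"
    using carrier_tensor_cases[OF z] .
  let ?v = "free_map R (map_prod (\<lambda>x. x) j) w"
  have v: "?v \<in> carrier (free_module R (carrier A \<times> carrier C))"
    by (rule mod_hom_closed[OF free_map_prod_hom[OF R mod_hom_id assms(5)] w(1)])
  have "?v \<in> tensor_kernel R A C"
    using z0 tensor_map_class[OF assms(1,1,2,3) mod_hom_id assms(5) w(1)]
      tensor_class_eq_zero_iff[OF assms(1,3) v] w(2) by simp
  then have "collect R C ?v \<in> rel_span C (relations R A)"
    using tensor_kernel_iff[OF assms(1,3) v] by simp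
  moreover have cv: "collect R C ?v a = j (collect R K w a)" for a
    by (rule collect_free_map[OF assms(1-3,5) w(1)])
  have cw: "collect R K w a \<in> carrier K" for a using mod_hom_closed[OF collect_hom[OF assms(2)] w(1)] .
  have "j (collect R K w a) \<in> mod_ker C D q" for a using cw[of a] assms(8) by auto
  then have "q (collect R C ?v a) = \<zero>\<^bsub>D\<^esub>" for a by (simp add: cv mod_ker_def)
  ultimately obtain x where x: "x \<in> rel_span K (relations R A)" "\<forall>s. j (x s) = collect R C ?v s"
    using flat_quotient_pure_all[OF assms(2-6,8,9) relations_coeffs, of A "collect R C ?v"]
      relations_support(1)[of _ R A] by auto
  have "x s = collect R K w s" for s
    using x(2) cv cw rel_span_closed[OF assms(2) relations_coeffs x(1)] inj_onD[OF assms(7)] by auto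
  then have "collect R K w = x" by auto
  then have "w \<in> tensor_kernel R A K" using tensor_kernel_iff[OF assms(1,2) w(1)] x(1) by simp
  then show "z = \<zero>\<^bsub>tensor R A K\<^esub>" using tensor_class_eq_zero_iff[OF assms(1,2) w(1)] w(2) by simp
qed

text \<open>
  The elements of \<open>D\<close> that explain why the image in \<open>A \<otimes> D\<close> vanishes are lifted to \<open>C\<close>. Subtracting
  the family that the lifts explain does not change \<open>z\<close> and leaves a family in the kernel of \<open>q\<close>.
\<close>

lemma tensor_map_exact:
  assumes "module R A" "module R K" "module R C" "module R D"
    and "j \<in> mod_hom R K C" "q \<in> mod_hom R C D"
    and "j ` carrier K = mod_ker C D q" "q ` carrier C = carrier D"
    and "z \<in> carrier (tensor R A C)" "tensor_map R A D (\<lambda>x. x) q z = \<zero>\<^bsub>tensor R A D\<^esub>"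
  shows "\<exists>y\<in>carrier (tensor R A K). tensor_map R A C (\<lambda>x. x) j y = z"
proof -
  note R = module_cring[OF assms(1)]
  interpret K: module R K by fact
  interpret C: module R C by fact
  interpret D: module R D by fact
  let ?W = "free_module R (carrier A \<times> carrier C)"
  note modW = module_free_module[OF R, of "carrier A \<times> carrier C"]
  interpret W: module R ?W by fact
  obtain w where w: "w \<in> carrier ?W" "z = tensor_kernel R A C +>\<^bsub>?W\<^esub> w"
    using carrier_tensor_cases[OF assms(9)] .
  let ?v = "free_map R (map_prod (\<lambda>x. x) q) w"
  have v: "?v \<in> carrier (free_module R (carrier A \<times> carrier D))"
    by (rule mod_hom_closed[OF free_map_prod_hom[OF R mod_hom_id assms(6)] w(1)])
  have "?v \<in> tensor_kernel R A D"
    using assms(10) tensor_map_class[OF assms(1,1,3,4) mod_hom_id assms(6) w(1)]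
      tensor_class_eq_zero_iff[OF assms(1,4) v] w(2) by simp
  then have "collect R D ?v \<in> rel_span D (relations R A)"
    using tensor_kernel_iff[OF assms(1,4) v] by simp
  then obtain y where y: "y \<in> rel_span C (relations R A)" "\<forall>a. q (y a) = collect R D ?v a"
    using rel_span_lift[OF assms(3,4,6,8) relations_coeffs[of R A]] by auto
  have cv: "collect R D ?v a = q (collect R C w a)" for a
    by (rule collect_free_map[OF assms(1,3,4,6) w(1)])
  have cw: "collect R C w a \<in> carrier C" for a using mod_hom_closed[OF collect_hom[OF assms(3)] w(1)] .
  have yC: "y a \<in> carrier C" for a by (rule rel_span_closed[OF assms(3) relations_coeffs y(1)])
  obtain S where S: "finite S" "S \<subseteq> carrier A" "w \<in> carrier (free_module R (S \<times> carrier C))"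
    using mem_free_module_finite_left[OF w(1)] .
  let ?T = "S \<union> {a. y a \<noteq> \<zero>\<^bsub>C\<^esub>}"
  have finT: "finite ?T"
    using S(1) rel_span_finite_support[OF assms(3) relations_coeffs relations_support(1) y(1)] by simp
  have "y a = \<zero>\<^bsub>C\<^esub>" if "a \<notin> carrier A" for a
    by (rule rel_span_zero_at[OF assms(3) relations_support(2)[OF _ that] y(1)])
  then have TA: "?T \<subseteq> carrier A" using S(2) by auto
  have "\<exists>k\<in>carrier K. j k = collect R C w a \<ominus>\<^bsub>C\<^esub> y a \<and> (a \<notin> ?T \<longrightarrow> k = \<zero>\<^bsub>K\<^esub>)" for a
  proof (cases "a \<in> ?T")
    case True
    have "q (collect R C w a \<ominus>\<^bsub>C\<^esub> y a) = \<zero>\<^bsub>D\<^esub>"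
      using y(2) cv mod_hom_diff[OF assms(3,4,6) cw yC] mod_hom_closed[OF assms(6) cw]
      by (simp add: a_minus_def D.r_neg)
    then have "collect R C w a \<ominus>\<^bsub>C\<^esub> y a \<in> j ` carrier K"
      using assms(7) cw yC by (simp add: mod_ker_def)
    then show ?thesis using True by auto
  next
    case False
    then have "collect R C w a = \<zero>\<^bsub>C\<^esub>" "y a = \<zero>\<^bsub>C\<^esub>"
      using collect_outside[OF assms(3) S(3)] by auto
    moreover have "\<zero>\<^bsub>C\<^esub> \<ominus>\<^bsub>C\<^esub> \<zero>\<^bsub>C\<^esub> = \<zero>\<^bsub>C\<^esub>" by (simp add: a_minus_def)
    ultimately show ?thesis
      using mod_hom_zero[OF assms(2,3,5)] by (intro bexI[OF _ K.zero_closed]) simp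
  qed
  then obtain k where k: "\<And>a. k a \<in> carrier K" "\<And>a. j (k a) = collect R C w a \<ominus>\<^bsub>C\<^esub> y a"
    "\<And>a. a \<notin> ?T \<Longrightarrow> k a = \<zero>\<^bsub>K\<^esub>" by metis
  have "\<exists>u\<in>carrier (free_module R (carrier A \<times> carrier K)). \<forall>a. collect R K u a = k a"
    by (rule collect_surj[OF assms(2) finT TA]) (use k(1,3) in simp_all)
  then obtain u where u: "u \<in> carrier (free_module R (carrier A \<times> carrier K))"
    "\<forall>a. collect R K u a = k a" by auto
  let ?ju = "free_map R (map_prod (\<lambda>x. x) j) u"
  have ju: "?ju \<in> carrier ?W"
    by (rule mod_hom_closed[OF free_map_prod_hom[OF R mod_hom_id assms(5)] u(1)])
  have cju: "collect R C ?ju a = collect R C w a \<ominus>\<^bsub>C\<^esub> y a" for a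
    using collect_free_map[OF assms(1-3,5) u(1)] u(2) k(2) by simp
  have "collect R C (w \<ominus>\<^bsub>?W\<^esub> ?ju) a = y a" for a
  proof -
    have "collect R C (w \<ominus>\<^bsub>?W\<^esub> ?ju) a = collect R C w a \<ominus>\<^bsub>C\<^esub> (collect R C w a \<ominus>\<^bsub>C\<^esub> y a)"
      using mod_hom_diff[OF modW assms(3) collect_hom[OF assms(3)] w(1) ju] cju by simp
    also have "\<dots> = y a"
      using cw yC by (simp add: a_minus_def C.minus_add C.add.m_assoc[symmetric] C.r_neg)
    finally show ?thesis .
  qed
  then have "collect R C (w \<ominus>\<^bsub>?W\<^esub> ?ju) = y" by (rule ext)
  then have "w \<ominus>\<^bsub>?W\<^esub> ?ju \<in> tensor_kernel R A C"
    using tensor_kernel_iff[OF assms(1,3) W.minus_closed[OF w(1) ju]] y(1) by simp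
  then have "tensor_kernel R A C +>\<^bsub>?W\<^esub> ?ju = z"
    using coset_eq_iff[OF modW submodule_tensor_kernel[OF assms(1,3)] w(1) ju] w(2) by simp
  moreover have "tensor_kernel R A K +>\<^bsub>free_module R (carrier A \<times> carrier K)\<^esub> u \<in> carrier (tensor R A K)"
    by (rule mod_hom_closed[OF tensor_class_hom[OF assms(1,2)] u(1)])
  ultimately show ?thesis
    using tensor_map_class[OF assms(1,1,2,3) mod_hom_id assms(5) u(1)] by auto
qed

subsection \<open>Flat modules satisfy the equational criterion\<close>

lemma pure_tensor_lin_comb:
  assumes "module R A" "module R B" "a \<in> carrier A" "\<And>i. v i \<in> carrier R" "\<And>i. x i \<in> carrier B"
  shows "pure_tensor R A B a (lin_comb B n v x) =
    lin_comb (tensor R A B) n v (\<lambda>i. pure_tensor R A B a (x i))"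
  by (rule lin_comb_hom[OF assms(2) module_tensor[OF assms(1,2)] pure_tensor_homs(2)[OF assms(1-3)]])
    (use assms in auto)

text \<open>
  A relation \<open>\<Sum> v\<^sub>i x\<^sub>i = 0\<close> says that \<open>\<Sum> v\<^sub>i \<otimes> x\<^sub>i\<close> vanishes in \<open>R \<otimes> F\<close>. By flatness it vanishes in
  \<open>J \<otimes> F\<close> for the ideal \<open>J\<close> generated by the \<open>v\<^sub>i\<close>. A choice of coefficients \<open>t a\<close> with
  \<open>a = \<Sum> t a i v\<^sub>i\<close> for \<open>a \<in> J\<close> is linear up to relations between the \<open>v\<^sub>i\<close>, so the vanishing
  explains the family \<open>\<Sum>\<^sub>k t v\<^sub>k i x\<^sub>k\<close> by such relations; and \<open>\<delta>\<^sub>k\<^sub>i - t v\<^sub>k i\<close> is one of them as well.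
\<close>

theorem flat_module_eq_flat:
  fixes R :: "('r, 'z) ring_scheme" and F :: "('r, 'f) module"
  assumes "flat_module R F"
  shows "eq_flat R F"
proof -
  have modF: "module R F" using assms by (simp add: flat_module_def)
  interpret F: module R F by fact
  note R = F.R.cring_axioms
  note modR = regular_module_module[OF R]
  interpret RR: module R "regular_module R" by fact
  show ?thesis unfolding eq_flat_def
  proof (intro conjI modF allI impI)
    fix n :: nat and v :: "nat \<Rightarrow> 'r" and x :: "nat \<Rightarrow> 'f"
    assume *: "(\<forall>i. v i \<in> carrier R) \<and> (\<forall>i. x i \<in> carrier F) \<and> lin_comb F n v x = \<zero>\<^bsub>F\<^esub>"
    then have v: "v i \<in> carrier R" and x: "x i \<in> carrier F" for i by auto
    let ?L = "\<lambda>t. lin_comb (regular_module R) n v t"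
    let ?RR = "regular_module R"
    let ?J = "{a. \<exists>t. (\<forall>i. t i \<in> carrier R) \<and> a = ?L t}"
    let ?A = "?RR\<lparr>carrier := ?J\<rparr>"
    have L: "?L t \<in> carrier R" if "\<forall>i. t i \<in> carrier R" for t
      using lin_comb_closed[OF modR, of n v t] v that by simp
    have Ladd: "?L (\<lambda>i. t i \<oplus>\<^bsub>R\<^esub> u i) = ?L t \<oplus>\<^bsub>R\<^esub> ?L u"
      if "\<forall>i. t i \<in> carrier R" "\<forall>i. u i \<in> carrier R" for t u
      using lin_comb_add[OF modR, of v t u n] v that by simp
    have Lsmult: "?L (\<lambda>i. r \<otimes>\<^bsub>R\<^esub> t i) = r \<otimes>\<^bsub>R\<^esub> ?L t"
      if "\<forall>i. t i \<in> carrier R" "r \<in> carrier R" for t r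
    proof -
      have "?L (\<lambda>i. t i \<otimes>\<^bsub>R\<^esub> r) = ?L t \<otimes>\<^bsub>R\<^esub> r"
        using lin_comb_smult[OF modR, of v t r n] v that by simp
      moreover have "(\<lambda>i. t i \<otimes>\<^bsub>R\<^esub> r) = (\<lambda>i. r \<otimes>\<^bsub>R\<^esub> t i)" using that by (simp add: F.R.m_comm)
      ultimately show ?thesis using that L by (simp add: F.R.m_comm)
    qed
    have Lneg: "?L (\<lambda>i. \<ominus>\<^bsub>R\<^esub> t i) = \<ominus>\<^bsub>R\<^esub> ?L t" if "\<forall>i. t i \<in> carrier R" for t
      using Lsmult[OF that, of "\<ominus>\<^bsub>R\<^esub> \<one>\<^bsub>R\<^esub>"] that L by (simp add: F.R.l_minus)
    have Lzero: "?L (\<lambda>i. \<zero>\<^bsub>R\<^esub>) = \<zero>\<^bsub>R\<^esub>" using v by (induction n) auto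
    have neg: "\<ominus>\<^bsub>regular_module R\<^esub> a = \<ominus>\<^bsub>R\<^esub> a" for a
      by (simp add: a_inv_def m_inv_def regular_module_def)
    have subJ: "submodule ?J R ?RR"
    proof (rule RR.submoduleI)
      show "?J \<subseteq> carrier ?RR" using L by auto
      show "\<zero>\<^bsub>?RR\<^esub> \<in> ?J" using Lzero by (auto intro!: exI[of _ "\<lambda>_. \<zero>\<^bsub>R\<^esub>"])
      show "\<ominus>\<^bsub>?RR\<^esub> a \<in> ?J" if "a \<in> ?J" for a
      proof -
        obtain t where t: "\<forall>i. t i \<in> carrier R" "a = ?L t" using \<open>a \<in> ?J\<close> by auto
        then show ?thesis using Lneg[OF t(1)] by (auto simp: neg intro!: exI[of _ "\<lambda>i. \<ominus>\<^bsub>R\<^esub> t i"])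
      qed
      show "a \<oplus>\<^bsub>?RR\<^esub> b \<in> ?J" if ab: "a \<in> ?J" "b \<in> ?J" for a b
      proof -
        obtain t u where "\<forall>i. t i \<in> carrier R" "a = ?L t" "\<forall>i. u i \<in> carrier R" "b = ?L u"
          using ab by auto
        then show ?thesis using Ladd[of t u] by (auto intro!: exI[of _ "\<lambda>i. t i \<oplus>\<^bsub>R\<^esub> u i"])
      qed
      show "r \<odot>\<^bsub>?RR\<^esub> a \<in> ?J" if ra: "r \<in> carrier R" "a \<in> ?J" for r a
      proof -
        obtain t where "\<forall>i. t i \<in> carrier R" "a = ?L t" using ra by auto
        then show ?thesis using Lsmult[of t r] ra(1) by (auto intro!: exI[of _ "\<lambda>i. r \<otimes>\<^bsub>R\<^esub> t i"])
      qed
    qed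
    have modA: "module R ?A" using submodule_module[OF modR subJ] .
    have incl: "(\<lambda>a. a) \<in> mod_hom R ?A ?RR" using L by (auto simp: mod_hom_def)
    have inj: "inj_on (tensor_map R ?RR F (\<lambda>a. a) (\<lambda>x. x)) (carrier (tensor R ?A F))"
    proof -
      have test: "\<And>(A :: ('r, 'r) module) (B :: ('r, 'r) module) j. module R A \<Longrightarrow> module R B \<Longrightarrow>
          j \<in> mod_hom R A B \<Longrightarrow> inj_on j (carrier A) \<Longrightarrow>
          inj_on (tensor_map R B F j (\<lambda>x. x)) (carrier (tensor R A F))"
        using assms by (simp add: flat_module_def)
      show ?thesis by (rule test[OF modA modR incl]) (simp add: inj_on_def)
    qed
    have delta: "?L (\<lambda>i. if k = i then \<one>\<^bsub>R\<^esub> else \<zero>\<^bsub>R\<^esub>) = v k" if "k < n" for k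
    proof -
      have "?L (\<lambda>i. if k = i then \<one>\<^bsub>R\<^esub> else \<zero>\<^bsub>R\<^esub>) = lin_comb ?RR n (\<lambda>i. if i = k then \<one>\<^bsub>R\<^esub> else \<zero>\<^bsub>R\<^esub>) v"
        by (subst lin_comb_comm[OF R]) (auto simp: v eq_commute)
      then show ?thesis using lin_comb_delta[OF modR, of v n k] v that by simp
    qed
    have vJ: "v k \<in> ?J" if "k < n" for k
      using delta[OF that] by (auto intro!: exI[of _ "\<lambda>i. if k = i then \<one>\<^bsub>R\<^esub> else \<zero>\<^bsub>R\<^esub>"])
    have "\<exists>t. \<forall>a\<in>?J. (\<forall>i. t a i \<in> carrier R) \<and> a = ?L (t a)" by (intro bchoice) auto
    then obtain t where tJ: "\<And>a i. a \<in> ?J \<Longrightarrow> t a i \<in> carrier R" and tL: "\<And>a. a \<in> ?J \<Longrightarrow> a = ?L (t a)"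
      by auto
    let ?W = "free_module R (carrier ?A \<times> carrier F)"
    let ?W' = "free_module R (carrier ?RR \<times> carrier F)"
    note modW = module_free_module[OF R, of "carrier ?A \<times> carrier F"]
    note modW' = module_free_module[OF R, of "carrier ?RR \<times> carrier F"]
    interpret W: module R ?W by fact
    \<comment> \<open>This represents \<open>\<Sum> v\<^sub>k \<otimes> x\<^sub>k\<close> in \<open>J \<otimes> F\<close>.\<close>
    define w where "w = lin_comb ?W n (\<lambda>_. \<one>\<^bsub>R\<^esub>) (\<lambda>k. free_gen R (v k, x k))"
    have e: "free_gen R (v k, x k) \<in> carrier ?W" if "k < n" for k
      using vJ[OF that] x by (intro tensor_gen_closed[OF R]) auto
    have w: "w \<in> carrier ?W" unfolding w_def by (rule lin_comb_closed[OF modW]) (use e in auto)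
    let ?cl = "\<lambda>w. tensor_kernel R ?A F +>\<^bsub>?W\<^esub> w"
    have one_v: "pure_tensor R ?RR F (v k) (x k) = v k \<odot>\<^bsub>tensor R ?RR F\<^esub> pure_tensor R ?RR F \<one>\<^bsub>R\<^esub> (x k)"
      for k
      using pure_tensor_bilinear(3)[OF modR modF, of "v k" "\<one>\<^bsub>R\<^esub>" "x k"] v x by simp
    have TF: "module R (tensor R ?RR F)" by (rule module_tensor[OF modR modF])
    interpret TF: module R "tensor R ?RR F" by (rule TF)
    have thom: "tensor_map R ?RR F (\<lambda>a. a) (\<lambda>x. x) \<in> mod_hom R (tensor R ?A F) (tensor R ?RR F)"
      by (rule tensor_map_hom[OF modA modR modF modF incl mod_hom_id])
    have "tensor_map R ?RR F (\<lambda>a. a) (\<lambda>x. x) (?cl w) =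
        lin_comb (tensor R ?RR F) n (\<lambda>_. \<one>\<^bsub>R\<^esub>) (\<lambda>k. tensor_map R ?RR F (\<lambda>a. a) (\<lambda>x. x) (?cl (free_gen R (v k, x k))))"
      unfolding w_def
      by (rule lin_comb_hom[OF modW TF mod_hom_comp[OF tensor_class_hom[OF modA modF] thom]]) (use e in auto)
    also have "\<dots> = lin_comb (tensor R ?RR F) n v (\<lambda>k. pure_tensor R ?RR F \<one>\<^bsub>R\<^esub> (x k))"
    proof -
      have "tensor_map R ?RR F (\<lambda>a. a) (\<lambda>x. x) (?cl (free_gen R (v k, x k))) =
          v k \<odot>\<^bsub>tensor R ?RR F\<^esub> pure_tensor R ?RR F \<one>\<^bsub>R\<^esub> (x k)" if "k < n" for k
        using tensor_map_pure[OF modA modR modF modF incl mod_hom_id, of "v k" "x k"] vJ[OF that] x one_v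
        by (simp add: pure_tensor_def)
      moreover have "pure_tensor R ?RR F \<one>\<^bsub>R\<^esub> (x k) \<in> carrier (tensor R ?RR F)" for k
        using x by (intro pure_tensor_closed[OF modR modF]) auto
      then have "lin_comb (tensor R ?RR F) m (\<lambda>_. \<one>\<^bsub>R\<^esub>) (\<lambda>k. v k \<odot>\<^bsub>tensor R ?RR F\<^esub> pure_tensor R ?RR F \<one>\<^bsub>R\<^esub> (x k)) =
          lin_comb (tensor R ?RR F) m v (\<lambda>k. pure_tensor R ?RR F \<one>\<^bsub>R\<^esub> (x k))" for m
        using v by (induction m) auto
      ultimately show ?thesis
        using lin_comb_cong[of n "\<lambda>_. \<one>\<^bsub>R\<^esub>" "\<lambda>_. \<one>\<^bsub>R\<^esub>"
          "\<lambda>k. tensor_map R ?RR F (\<lambda>a. a) (\<lambda>x. x) (?cl (free_gen R (v k, x k)))"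
          "\<lambda>k. v k \<odot>\<^bsub>tensor R ?RR F\<^esub> pure_tensor R ?RR F \<one>\<^bsub>R\<^esub> (x k)"] by simp
    qed
    also have "\<dots> = pure_tensor R ?RR F \<one>\<^bsub>R\<^esub> (lin_comb F n v x)"
      by (rule pure_tensor_lin_comb[OF modR modF, symmetric]) (use v x in auto)
    also have "\<dots> = \<zero>\<^bsub>tensor R ?RR F\<^esub>"
      using * mod_hom_zero[OF modF TF pure_tensor_homs(2)[OF modR modF, of "\<one>\<^bsub>R\<^esub>"]] by simp
    finally have "?cl w = \<zero>\<^bsub>tensor R ?A F\<^esub>"
      using inj_onD[OF inj, of "?cl w" "\<zero>\<^bsub>tensor R ?A F\<^esub>"]
        mod_hom_zero[OF module_tensor[OF modA modF] TF thom]
        mod_hom_closed[OF tensor_class_hom[OF modA modF] w]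
        submodule_zero[OF module_tensor[OF modA modF]
          module.carrier_is_submodule[OF module_tensor[OF modA modF]]]
      by simp
    then have wK: "w \<in> tensor_kernel R ?A F" using tensor_class_eq_zero_iff[OF modA modF w] by simp
    let ?P = "orthogonal R n {v}"
    have orthI: "(\<lambda>i. u i) \<in> ?P" if "\<forall>i. u i \<in> carrier R" "?L u = \<zero>\<^bsub>R\<^esub>" for u
      using that by (simp add: orthogonal_def)
    have y: "coeff_eval R F t w \<in> rel_span F ?P"
    proof (rule coeff_eval_tensor_kernel[OF modA modF orthogonal_coeffs _ _ _ wK])
      show "t a s \<in> carrier R" if "a \<in> carrier ?A" for a s using tJ that by simp
      have J: "a \<oplus>\<^bsub>R\<^esub> b \<in> ?J" "r \<otimes>\<^bsub>R\<^esub> a \<in> ?J" if "a \<in> ?J" "b \<in> ?J" "r \<in> carrier R" for a b r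
        using RR.submoduleE(4,5)[OF subJ] that by auto
      show "(\<lambda>s. t (a \<oplus>\<^bsub>?A\<^esub> a') s \<ominus>\<^bsub>R\<^esub> (t a s \<oplus>\<^bsub>R\<^esub> t a' s)) \<in> ?P"
        if "a \<in> carrier ?A" "a' \<in> carrier ?A" for a a'
      proof (rule orthI)
        have a: "a \<in> ?J" "a' \<in> ?J" "a \<oplus>\<^bsub>R\<^esub> a' \<in> ?J" using that J(1)[of a a' "\<one>\<^bsub>R\<^esub>"] by auto
        have "?L (\<lambda>s. t (a \<oplus>\<^bsub>R\<^esub> a') s \<oplus>\<^bsub>R\<^esub> \<ominus>\<^bsub>R\<^esub> (t a s \<oplus>\<^bsub>R\<^esub> t a' s)) =
            (a \<oplus>\<^bsub>R\<^esub> a') \<oplus>\<^bsub>R\<^esub> \<ominus>\<^bsub>R\<^esub> (a \<oplus>\<^bsub>R\<^esub> a')"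
          using a tJ by (simp add: Ladd Lneg tL[symmetric])
        also have "\<dots> = \<zero>\<^bsub>R\<^esub>" using a(3) L by (auto intro: F.R.r_neg)
        finally show "?L (\<lambda>s. t (a \<oplus>\<^bsub>?A\<^esub> a') s \<ominus>\<^bsub>R\<^esub> (t a s \<oplus>\<^bsub>R\<^esub> t a' s)) = \<zero>\<^bsub>R\<^esub>"
          by (simp add: a_minus_def)
      qed (use that tJ J(1)[of _ _ "\<one>\<^bsub>R\<^esub>"] in auto)
      show "(\<lambda>s. t (r \<odot>\<^bsub>?A\<^esub> a) s \<ominus>\<^bsub>R\<^esub> (r \<otimes>\<^bsub>R\<^esub> t a s)) \<in> ?P"
        if "r \<in> carrier R" "a \<in> carrier ?A" for r a
      proof (rule orthI)
        have a: "a \<in> ?J" "r \<otimes>\<^bsub>R\<^esub> a \<in> ?J" using that J(2)[of a a r] by auto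
        have "?L (\<lambda>s. t (r \<otimes>\<^bsub>R\<^esub> a) s \<oplus>\<^bsub>R\<^esub> \<ominus>\<^bsub>R\<^esub> (r \<otimes>\<^bsub>R\<^esub> t a s)) =
            (r \<otimes>\<^bsub>R\<^esub> a) \<oplus>\<^bsub>R\<^esub> \<ominus>\<^bsub>R\<^esub> (r \<otimes>\<^bsub>R\<^esub> a)"
          using a tJ that(1) by (simp add: Ladd Lneg Lsmult tL[symmetric])
        also have "\<dots> = \<zero>\<^bsub>R\<^esub>" using a(2) L by (auto intro: F.R.r_neg)
        finally show "?L (\<lambda>s. t (r \<odot>\<^bsub>?A\<^esub> a) s \<ominus>\<^bsub>R\<^esub> (r \<otimes>\<^bsub>R\<^esub> t a s)) = \<zero>\<^bsub>R\<^esub>"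
          by (simp add: a_minus_def)
      qed (use that tJ J(2) in auto)
    qed
    have yk: "coeff_eval R F t w i = lin_comb F n (\<lambda>k. t (v k) i) x" for i
    proof -
      have "coeff_eval R F t w i =
          lin_comb F n (\<lambda>_. \<one>\<^bsub>R\<^esub>) (\<lambda>k. coeff_eval R F t (free_gen R (v k, x k)) i)"
        unfolding w_def
        by (rule lin_comb_hom[OF modW modF coeff_eval_hom[OF modF]]) (use e tJ in auto)
      also have "\<dots> = lin_comb F n (\<lambda>_. \<one>\<^bsub>R\<^esub>) (\<lambda>k. t (v k) i \<odot>\<^bsub>F\<^esub> x k)"
      proof (rule lin_comb_cong)
        fix k assume "k < n"
        then show "coeff_eval R F t (free_gen R (v k, x k)) i = t (v k) i \<odot>\<^bsub>F\<^esub> x k"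
          by (intro coeff_eval_gen[OF modF] tJ vJ x)
      qed simp
      also have "\<dots> = lin_comb F n (\<lambda>k. t (v k) i) x"
      proof -
        have "m \<le> n \<Longrightarrow> lin_comb F m (\<lambda>_. \<one>\<^bsub>R\<^esub>) (\<lambda>k. t (v k) i \<odot>\<^bsub>F\<^esub> x k) =
          lin_comb F m (\<lambda>k. t (v k) i) x" for m
          using tJ vJ x by (induction m) auto
        then show ?thesis by simp
      qed
      finally show ?thesis .
    qed
    let ?d = "\<lambda>k i. (if k = i then \<one>\<^bsub>R\<^esub> else \<zero>\<^bsub>R\<^esub>) \<ominus>\<^bsub>R\<^esub> t (v k) i"
    have dR: "?d k i \<in> carrier R" if "k < n" for k i using tJ[OF vJ[OF that]] by simp
    have d: "(\<lambda>i. lin_comb F n (\<lambda>k. ?d k i) x) \<in> rel_span F ?P"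
    proof (rule rel_span_lin_comb)
      fix k assume k: "k < n"
      show "?d k \<in> ?P"
      proof (rule orthI)
        have "?L (\<lambda>i. (if k = i then \<one>\<^bsub>R\<^esub> else \<zero>\<^bsub>R\<^esub>) \<oplus>\<^bsub>R\<^esub> \<ominus>\<^bsub>R\<^esub> t (v k) i) = v k \<oplus>\<^bsub>R\<^esub> \<ominus>\<^bsub>R\<^esub> v k"
          using tJ[OF vJ[OF k]] delta[OF k] tL[OF vJ[OF k]] by (subst Ladd) (auto simp: Lneg)
        then show "?L (?d k) = \<zero>\<^bsub>R\<^esub>" using v by (simp add: a_minus_def F.R.r_neg)
      qed (use dR[OF k] in auto)
    qed (use x in auto)
    let ?y = "\<lambda>i. lin_comb F n (\<lambda>k. ?d k i) x \<oplus>\<^bsub>F\<^esub> coeff_eval R F t w i"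
    have "?y \<in> rel_span F ?P" by (rule rel_span_sum[OF modF orthogonal_coeffs d y])
    moreover have "?y i = x i" if "i < n" for i
    proof -
      have "m \<le> n \<Longrightarrow> lin_comb F m (\<lambda>k. ?d k i) x \<oplus>\<^bsub>F\<^esub> lin_comb F m (\<lambda>k. t (v k) i) x =
          lin_comb F m (\<lambda>k. if k = i then \<one>\<^bsub>R\<^esub> else \<zero>\<^bsub>R\<^esub>) x" for m
      proof (induction m)
        case (Suc m)
        let ?a = "lin_comb F m (\<lambda>k. ?d k i) x" and ?b = "lin_comb F m (\<lambda>k. t (v k) i) x"
        have c: "?a \<in> carrier F" "?b \<in> carrier F"
          using Suc.prems dR tJ vJ x by (auto intro!: lin_comb_closed[OF modF])
        have tm: "t (v m) i \<in> carrier R" using Suc.prems by (intro tJ vJ) simp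
        have "?a \<oplus>\<^bsub>F\<^esub> ?d m i \<odot>\<^bsub>F\<^esub> x m \<oplus>\<^bsub>F\<^esub> (?b \<oplus>\<^bsub>F\<^esub> t (v m) i \<odot>\<^bsub>F\<^esub> x m) =
            ?a \<oplus>\<^bsub>F\<^esub> ?b \<oplus>\<^bsub>F\<^esub> (?d m i \<odot>\<^bsub>F\<^esub> x m \<oplus>\<^bsub>F\<^esub> t (v m) i \<odot>\<^bsub>F\<^esub> x m)"
          using c tm x dR[of m] Suc.prems by (simp add: F.add.m_ac)
        also have "?d m i \<odot>\<^bsub>F\<^esub> x m \<oplus>\<^bsub>F\<^esub> t (v m) i \<odot>\<^bsub>F\<^esub> x m = (if m = i then \<one>\<^bsub>R\<^esub> else \<zero>\<^bsub>R\<^esub>) \<odot>\<^bsub>F\<^esub> x m"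
          using tm x by (simp add: F.smult_l_distr[symmetric] a_minus_def F.R.add.m_assoc F.R.l_neg)
        finally show ?case using Suc by simp
      qed simp
      then show ?thesis using yk lin_comb_delta[OF modF, of x n i] x that by simp
    qed
    ultimately show "\<exists>y\<in>rel_span F ?P. \<forall>i<n. y i = x i" by (intro bexI[of _ ?y]) auto
  qed
qed

section \<open>Completed tensor products\<close>

lemma inverse_limit_simps [simp]:
  "zero (inverse_limit A p) = (\<lambda>s. \<zero>\<^bsub>A s\<^esub>)"
  "add (inverse_limit A p) = (\<lambda>x y s. x s \<oplus>\<^bsub>A s\<^esub> y s)"
  "smult (inverse_limit A p) = (\<lambda>r x s. r \<odot>\<^bsub>A s\<^esub> x s)"
  by (simp_all add: inverse_limit_def)

lemma mem_inverse_limit: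
  "x \<in> carrier (inverse_limit A p) \<longleftrightarrow> (\<forall>s. x s \<in> carrier (A s)) \<and> (\<forall>s. p s (x (Suc s)) = x s)"
  by (simp add: inverse_limit_def)

lemma module_inverse_limit:
  assumes "\<And>s. module R (A s)" "\<And>s. p s \<in> mod_hom R (A (Suc s)) (A s)"
  shows "module R (inverse_limit A p)"
proof -
  interpret A: module R "A s" for s by (rule assms(1))
  note hom = mod_hom_add[OF assms(2)] mod_hom_smult[OF assms(2)]
    mod_hom_zero[OF assms(1,1,2)] mod_hom_neg[OF assms(1,1,2)]
  show ?thesis
  proof (rule moduleI)
    show "cring R" by (rule A.R.cring_axioms)
    show "abelian_group (inverse_limit A p)"
    proof (rule abelian_groupI)
      fix x assume x: "x \<in> carrier (inverse_limit A p)"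
      show "\<exists>y\<in>carrier (inverse_limit A p). y \<oplus>\<^bsub>inverse_limit A p\<^esub> x = \<zero>\<^bsub>inverse_limit A p\<^esub>"
        by (rule bexI[of _ "\<lambda>s. \<ominus>\<^bsub>A s\<^esub> x s"])
          (use x in \<open>auto simp: mem_inverse_limit hom A.l_neg\<close>)
    qed (auto simp: mem_inverse_limit hom A.add.m_assoc A.add.m_comm A.add.m_lcomm)
  qed (auto simp: mem_inverse_limit hom A.smult_l_distr A.smult_r_distr A.smult_assoc1)
qed

text \<open>
  Surjectivity of the transition maps is the Mittag-Leffler condition in its simplest form; it is
  inherited by every tensor product and makes the limit exact.
\<close>

locale surj_system =
  fixes R :: "('r, 'z) ring_scheme" and A :: "nat \<Rightarrow> ('r, 'n) module" and p :: "nat \<Rightarrow> 'n \<Rightarrow> 'n"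
  assumes modA: "module R (A s)"
    and p_hom: "p s \<in> mod_hom R (A (Suc s)) (A s)"
    and p_surj: "p s ` carrier (A (Suc s)) = carrier (A s)"
begin

abbreviation trans :: "('r, 'x) module \<Rightarrow> nat \<Rightarrow> ('n \<times> 'x \<Rightarrow> 'r) set \<Rightarrow> ('n \<times> 'x \<Rightarrow> 'r) set" where
  "trans X s \<equiv> tensor_map R (A s) X (p s) (\<lambda>x. x)"

text \<open>The functor \<open>lim\<^sub>s (A\<^sub>s \<otimes> _)\<close> on modules and, with values in \<open>lim\<^sub>s (A\<^sub>s \<otimes> Y)\<close>, on maps.\<close>

definition T :: "('r, 'x) module \<Rightarrow> ('r, nat \<Rightarrow> ('n \<times> 'x \<Rightarrow> 'r) set) module" where
  "T X = inverse_limit (\<lambda>s. tensor R (A s) X) (trans X)"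

definition Tm :: "('r, 'y) module \<Rightarrow> ('x \<Rightarrow> 'y) \<Rightarrow>
    (nat \<Rightarrow> ('n \<times> 'x \<Rightarrow> 'r) set) \<Rightarrow> nat \<Rightarrow> ('n \<times> 'y \<Rightarrow> 'r) set" where
  "Tm Y f x = (\<lambda>s. tensor_map R (A s) Y (\<lambda>c. c) f (x s))"

lemma trans_hom: "module R X \<Longrightarrow> trans X s \<in> mod_hom R (tensor R (A (Suc s)) X) (tensor R (A s) X)"
  by (rule tensor_map_hom[OF modA modA _ _ p_hom mod_hom_id])

lemma trans_surj:
  assumes "module R X"
  shows "trans X s ` carrier (tensor R (A (Suc s)) X) = carrier (tensor R (A s) X)"
  by (rule tensor_map_surj[OF modA modA assms assms p_hom mod_hom_id p_surj]) simp

lemma mem_T: "x \<in> carrier (T X) \<longleftrightarrow>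
    (\<forall>s. x s \<in> carrier (tensor R (A s) X)) \<and> (\<forall>s. trans X s (x (Suc s)) = x s)"
  by (simp add: T_def mem_inverse_limit)

lemma T_simps [simp]:
  "zero (T X) = (\<lambda>s. \<zero>\<^bsub>tensor R (A s) X\<^esub>)"
  "add (T X) = (\<lambda>x y s. x s \<oplus>\<^bsub>tensor R (A s) X\<^esub> y s)"
  "smult (T X) = (\<lambda>r x s. r \<odot>\<^bsub>tensor R (A s) X\<^esub> x s)"
  by (simp_all add: T_def)

lemma T_module: "module R X \<Longrightarrow> module R (T X)"
  unfolding T_def
  by (rule module_inverse_limit) (auto intro: module_tensor[OF modA] trans_hom)

lemma level_hom:
  assumes "module R X" "module R Y" "f \<in> mod_hom R X Y"
  shows "tensor_map R (A s) Y (\<lambda>c. c) f \<in> mod_hom R (tensor R (A s) X) (tensor R (A s) Y)"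
  by (rule tensor_map_hom[OF modA modA assms(1,2) mod_hom_id assms(3)])

lemma trans_level:
  assumes "module R X" "module R Y" "f \<in> mod_hom R X Y" "z \<in> carrier (tensor R (A (Suc s)) X)"
  shows "trans Y s (tensor_map R (A (Suc s)) Y (\<lambda>c. c) f z) =
    tensor_map R (A s) Y (\<lambda>c. c) f (trans X s z)"
  using tensor_map_comp[OF modA modA modA assms(1,2,2) mod_hom_id assms(3) p_hom mod_hom_id assms(4)]
    tensor_map_comp[OF modA modA modA assms(1,1,2) p_hom mod_hom_id mod_hom_id assms(3,4)]
  by simp

lemma Tm_hom:
  assumes "module R X" "module R Y" "f \<in> mod_hom R X Y"
  shows "Tm Y f \<in> mod_hom R (T X) (T Y)"
proof (rule mod_homI)
  note h = level_hom[OF assms]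
  fix x assume x: "x \<in> carrier (T X)"
  then show "Tm Y f x \<in> carrier (T Y)"
    using mod_hom_closed[OF h] trans_level[OF assms] by (simp add: mem_T Tm_def)
  show "Tm Y f (r \<odot>\<^bsub>T X\<^esub> x) = r \<odot>\<^bsub>T Y\<^esub> Tm Y f x" if "r \<in> carrier R" for r
    using x mod_hom_smult[OF h that] by (simp add: mem_T Tm_def)
  show "Tm Y f (x \<oplus>\<^bsub>T X\<^esub> y) = Tm Y f x \<oplus>\<^bsub>T Y\<^esub> Tm Y f y" if "y \<in> carrier (T X)" for y
    using x that mod_hom_add[OF h] by (simp add: mem_T Tm_def)
qed

lemma Tm_id: "module R X \<Longrightarrow> x \<in> carrier (T X) \<Longrightarrow> Tm X (\<lambda>x. x) x = x"
  by (simp add: Tm_def mem_T tensor_map_id[OF modA])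

lemma Tm_comp:
  assumes "module R X" "module R Y" "module R Z" "f \<in> mod_hom R X Y" "g \<in> mod_hom R Y Z"
    and "x \<in> carrier (T X)"
  shows "Tm Z g (Tm Y f x) = Tm Z (\<lambda>a. g (f a)) x"
  using tensor_map_comp[OF modA modA modA assms(1-3) mod_hom_id assms(4) mod_hom_id assms(5)] assms(6)
  by (simp add: Tm_def mem_T)

lemma Tm_cong:
  assumes "module R X" "module R Y" "f \<in> mod_hom R X Y" "g \<in> mod_hom R X Y"
    and "\<And>a. a \<in> carrier X \<Longrightarrow> f a = g a" "x \<in> carrier (T X)"
  shows "Tm Y f x = Tm Y g x"
  using tensor_map_cong[OF modA modA assms(1,2) mod_hom_id assms(3,4,5)] assms(6)
  by (simp add: Tm_def mem_T)

lemma Tm_sum: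
  assumes "module R X" "module R Y" "f \<in> mod_hom R X Y" "g \<in> mod_hom R X Y" "x \<in> carrier (T X)"
  shows "Tm Y (\<lambda>a. f a \<oplus>\<^bsub>Y\<^esub> g a) x = Tm Y f x \<oplus>\<^bsub>T Y\<^esub> Tm Y g x"
  using tensor_map_sum[OF modA modA assms(1,2) mod_hom_id assms(3,4)] assms(5)
  by (simp add: Tm_def mem_T)

lemma Tm_zero:
  assumes "module R X" "module R Y" "x \<in> carrier (T X)"
  shows "Tm Y (\<lambda>a. \<zero>\<^bsub>Y\<^esub>) x = \<zero>\<^bsub>T Y\<^esub>"
proof -
  interpret Y: module R Y by fact
  interpret TY: module R "T Y" using T_module[OF assms(2)] .
  note z = mod_hom_const_zero[OF assms(2), of X]
  have "Tm Y (\<lambda>a. \<zero>\<^bsub>Y\<^esub>) x \<in> carrier (T Y)"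
    using mod_hom_closed[OF Tm_hom[OF assms(1,2) z] assms(3)] .
  then show ?thesis
    using Tm_sum[OF assms(1,2) z z assms(3)] TY.add.r_cancel_one' by (simp del: T_simps)
qed

lemma Tm_comp_zero:
  assumes "module R X" "module R Y" "module R Z" "f \<in> mod_hom R X Y" "g \<in> mod_hom R Y Z"
    and "\<And>a. a \<in> carrier X \<Longrightarrow> g (f a) = \<zero>\<^bsub>Z\<^esub>" "x \<in> carrier (T X)"
  shows "Tm Z g (Tm Y f x) = \<zero>\<^bsub>T Z\<^esub>"
  using Tm_comp[OF assms(1-5,7)] Tm_zero[OF assms(1,3,7)]
    Tm_cong[OF assms(1,3) mod_hom_comp[OF assms(4,5)] mod_hom_const_zero[OF assms(3)] assms(6,7)]
  by (simp del: T_simps)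

lemma Tm_inj:
  assumes "module R K" "module R C" "eq_flat R D"
    and "j \<in> mod_hom R K C" "q \<in> mod_hom R C D" "inj_on j (carrier K)"
    and "j ` carrier K = mod_ker C D q" "q ` carrier C = carrier D"
  shows "inj_on (Tm C j) (carrier (T K))"
proof (rule inj_onI, rule ext)
  fix x y s assume "x \<in> carrier (T K)" "y \<in> carrier (T K)" "Tm C j x = Tm C j y"
  then show "x s = y s"
    using inj_onD[OF tensor_map_inj[OF modA assms], of s "x s" "y s"]
    by (simp add: mem_T Tm_def fun_eq_iff)
qed

lemma Tm_exact:
  assumes "module R K" "module R C" "eq_flat R D"
    and "j \<in> mod_hom R K C" "q \<in> mod_hom R C D" "inj_on j (carrier K)"
    and "j ` carrier K = mod_ker C D q" "q ` carrier C = carrier D"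
    and "x \<in> carrier (T C)" "Tm D q x = \<zero>\<^bsub>T D\<^esub>"
  shows "\<exists>k\<in>carrier (T K). Tm C j k = x"
proof -
  note modD = eq_flat_module[OF assms(3)]
  have "\<exists>k\<in>carrier (tensor R (A s) K). tensor_map R (A s) C (\<lambda>c. c) j k = x s" for s
    by (rule tensor_map_exact[OF modA assms(1,2) modD assms(4,5,7,8)])
      (use assms(9,10) in \<open>auto simp: mem_T Tm_def fun_eq_iff\<close>)
  then obtain k where k: "\<And>s. k s \<in> carrier (tensor R (A s) K)"
    "\<And>s. tensor_map R (A s) C (\<lambda>c. c) j (k s) = x s" by metis
  have "trans K s (k (Suc s)) = k s" for s
  proof (rule inj_onD[OF tensor_map_inj[OF modA assms(1-8)], of s])
    show "tensor_map R (A s) C (\<lambda>c. c) j (trans K s (k (Suc s))) = tensor_map R (A s) C (\<lambda>c. c) j (k s)"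
      using trans_level[OF assms(1,2,4) k(1), of s] k(2) assms(9) by (simp add: mem_T)
    show "trans K s (k (Suc s)) \<in> carrier (tensor R (A s) K)"
      by (rule mod_hom_closed[OF trans_hom[OF assms(1)] k(1)])
  qed (rule k(1))
  then show ?thesis
    using k by (intro bexI[of _ k]) (auto simp: mem_T Tm_def)
qed

text \<open>
  A compatible family is lifted one level at a time: any lift of the next entry is corrected by an
  element of the kernel, which exists because the transition map of the kernel is surjective.
\<close>

lemma Tm_surj:
  assumes "module R K" "module R C" "module R D"
    and "j \<in> mod_hom R K C" "q \<in> mod_hom R C D"
    and "j ` carrier K = mod_ker C D q" "q ` carrier C = carrier D"
  shows "Tm D q ` carrier (T C) = carrier (T D)"
proof
  show "Tm D q ` carrier (T C) \<subseteq> carrier (T D)"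
    using mod_hom_closed[OF Tm_hom[OF assms(2,3,5)]] by auto
  show "carrier (T D) \<subseteq> Tm D q ` carrier (T C)"
  proof
    fix y assume y: "y \<in> carrier (T D)"
    let ?q = "\<lambda>s. tensor_map R (A s) D (\<lambda>c. c) q" and ?j = "\<lambda>s. tensor_map R (A s) C (\<lambda>c. c) j"
    let ?good = "\<lambda>s c. c \<in> carrier (tensor R (A s) C) \<and> ?q s c = y s"
    have lift: "\<exists>c. ?good s c" for s
    proof -
      have "y s \<in> ?q s ` carrier (tensor R (A s) C)"
        using y tensor_map_surj[OF modA modA assms(2,3) mod_hom_id assms(5) _ assms(7), of s]
        by (simp add: mem_T)
      then show ?thesis by auto
    qed
    have "\<exists>c. \<forall>s. ?good s (c s) \<and> trans C s (c (Suc s)) = c s"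
    proof (rule dependent_nat_choice)
      show "\<exists>c. ?good 0 c" by (rule lift)
      fix c s assume c: "?good s c"
      obtain b where b: "?good (Suc s) b" using lift by auto
      interpret Cs: module R "tensor R (A s) C" by (rule module_tensor[OF modA assms(2)])
      interpret Ct: module R "tensor R (A (Suc s)) C" by (rule module_tensor[OF modA assms(2)])
      interpret Ds: module R "tensor R (A s) D" by (rule module_tensor[OF modA assms(3)])
      interpret Dt: module R "tensor R (A (Suc s)) D" by (rule module_tensor[OF modA assms(3)])
      note qh = level_hom[OF assms(2,3,5)] and jh = level_hom[OF assms(1,2,4)]
      note th = trans_hom[OF assms(2), of s]
      have tb: "trans C s b \<in> carrier (tensor R (A s) C)" using mod_hom_closed[OF th] b by simp
      have "?q s (trans C s b) = y s"
        using trans_level[OF assms(2,3,5), of b s] b y by (simp add: mem_T)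
      then have "?q s (trans C s b \<ominus>\<^bsub>tensor R (A s) C\<^esub> c) = \<zero>\<^bsub>tensor R (A s) D\<^esub>"
        using mod_hom_diff[OF Cs.module_axioms Ds.module_axioms qh tb] c y
        by (simp add: mem_T a_minus_def Ds.r_neg)
      then obtain k where k: "k \<in> carrier (tensor R (A s) K)"
        "?j s k = trans C s b \<ominus>\<^bsub>tensor R (A s) C\<^esub> c"
        using tensor_map_exact[OF modA assms(1-3,4,5,6,7)] tb c by (metis Cs.minus_closed)
      have "k \<in> trans K s ` carrier (tensor R (A (Suc s)) K)" using k(1) trans_surj[OF assms(1)] by simp
      then obtain k' where k': "k' \<in> carrier (tensor R (A (Suc s)) K)" "trans K s k' = k" by auto
      have jk': "?j (Suc s) k' \<in> carrier (tensor R (A (Suc s)) C)" using mod_hom_closed[OF jh k'(1)] .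
      let ?c = "b \<ominus>\<^bsub>tensor R (A (Suc s)) C\<^esub> ?j (Suc s) k'"
      have "trans C s (?j (Suc s) k') = trans C s b \<ominus>\<^bsub>tensor R (A s) C\<^esub> c"
        using trans_level[OF assms(1,2,4) k'(1)] k'(2) k(2) by simp
      then have "trans C s ?c = trans C s b \<ominus>\<^bsub>tensor R (A s) C\<^esub> (trans C s b \<ominus>\<^bsub>tensor R (A s) C\<^esub> c)"
        using mod_hom_diff[OF Ct.module_axioms Cs.module_axioms th _ jk'] b by simp
      also have "\<dots> = c"
        using tb c by (simp add: a_minus_def Cs.minus_add Cs.add.m_assoc[symmetric] Cs.r_neg)
      finally have "trans C s ?c = c" .
      moreover have "?q (Suc s) (?j (Suc s) k') = \<zero>\<^bsub>tensor R (A (Suc s)) D\<^esub>"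
      proof -
        have qj: "q (j a) = \<zero>\<^bsub>D\<^esub>" if "a \<in> carrier K" for a
          using assms(6) that by (auto simp: mod_ker_def)
        have "?q (Suc s) (?j (Suc s) k') = tensor_map R (A (Suc s)) D (\<lambda>c. c) (\<lambda>a. q (j a)) k'"
          by (rule tensor_map_comp[OF modA modA modA assms(1-3) mod_hom_id assms(4) mod_hom_id assms(5) k'(1)])
        also have "\<dots> = tensor_map R (A (Suc s)) D (\<lambda>c. c) (\<lambda>a. \<zero>\<^bsub>D\<^esub>) k'"
          by (rule tensor_map_cong[OF modA modA assms(1,3) mod_hom_id mod_hom_comp[OF assms(4,5)]
                mod_hom_const_zero[OF assms(3)] qj k'(1)])
        also have "\<dots> = \<zero>\<^bsub>tensor R (A (Suc s)) D\<^esub>"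
        proof (rule tensor_hom_eqI[OF modA assms(1) Dt.module_axioms _ mod_hom_const_zero[OF Dt.module_axioms] _ k'(1)])
          show "tensor_map R (A (Suc s)) D (\<lambda>c. c) (\<lambda>a. \<zero>\<^bsub>D\<^esub>) \<in>
              mod_hom R (tensor R (A (Suc s)) K) (tensor R (A (Suc s)) D)"
            by (rule level_hom[OF assms(1,3) mod_hom_const_zero[OF assms(3)]])
          fix a b assume ab: "a \<in> carrier (A (Suc s))" "b \<in> carrier K"
          show "tensor_map R (A (Suc s)) D (\<lambda>c. c) (\<lambda>a. \<zero>\<^bsub>D\<^esub>) (pure_tensor R (A (Suc s)) K a b) =
              \<zero>\<^bsub>tensor R (A (Suc s)) D\<^esub>"
            using tensor_map_pure[OF modA modA assms(1,3) mod_hom_id mod_hom_const_zero[OF assms(3)] ab]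
              mod_hom_zero[OF assms(3) Dt.module_axioms pure_tensor_homs(2)[OF modA assms(3) ab(1)]]
            by simp
        qed
        finally show ?thesis .
      qed
      then have "?good (Suc s) ?c"
        using mod_hom_diff[OF Ct.module_axioms Dt.module_axioms qh _ jk', of b] b jk' y
        by (simp add: mem_T a_minus_def)
      ultimately show "\<exists>c'. ?good (Suc s) c' \<and> trans C s c' = c" by auto
    qed
    then obtain c where c: "\<forall>s. ?good s (c s) \<and> trans C s (c (Suc s)) = c s" ..
    then have "c \<in> carrier (T C)" "Tm D q c = y" by (simp_all add: mem_T Tm_def)
    then show "y \<in> Tm D q ` carrier (T C)" by auto
  qed
qed

end

section \<open>Homology of complexes\<close>

definition is_complex :: "('r, 'z) ring_scheme \<Rightarrow> ('r, 'a) chain_complex \<Rightarrow> bool" where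
  "is_complex R C \<longleftrightarrow> (\<forall>n. module R (obj C n)) \<and>
     (\<forall>n. diff C n \<in> mod_hom R (obj C (Suc n)) (obj C n)) \<and>
     (\<forall>n. \<forall>x\<in>carrier (obj C (Suc (Suc n))). diff C n (diff C (Suc n) x) = \<zero>\<^bsub>obj C n\<^esub>)"

lemma is_complexD:
  assumes "is_complex R C"
  shows "module R (obj C n)" "diff C n \<in> mod_hom R (obj C (Suc n)) (obj C n)"
    "x \<in> carrier (obj C (Suc (Suc n))) \<Longrightarrow> diff C n (diff C (Suc n) x) = \<zero>\<^bsub>obj C n\<^esub>"
  using assms by (auto simp: is_complex_def)

lemma cycles_simps [simp]:
  "cycles C 0 = carrier (obj C 0)"
  "cycles C (Suc n) = mod_ker (obj C (Suc n)) (obj C n) (diff C n)"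
  by (simp_all add: cycles_def)

lemma cycles_closed: "x \<in> cycles C i \<Longrightarrow> x \<in> carrier (obj C i)"
  by (cases i) (auto simp: mod_ker_def)

lemma submodule_cycles: "is_complex R C \<Longrightarrow> submodule (cycles C i) R (obj C i)"
  by (cases i) (auto intro!: submodule_ker module.carrier_is_submodule simp: is_complexD)

lemma submodule_boundaries: "is_complex R C \<Longrightarrow> submodule (boundaries C i) R (obj C i)"
  unfolding boundaries_def by (auto intro!: submodule_image simp: is_complexD)

lemma boundaries_cycles:
  assumes "is_complex R C"
  shows "boundaries C i \<subseteq> cycles C i"
  using mod_hom_closed[OF is_complexD(2)[OF assms]] is_complexD(3)[OF assms]
  by (cases i) (auto simp: boundaries_def mod_ker_def)

abbreviation cycle_module :: "('r, 'a) chain_complex \<Rightarrow> nat \<Rightarrow> ('r, 'a) module" where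
  "cycle_module C i \<equiv> (obj C i)\<lparr>carrier := cycles C i\<rparr>"

lemma module_cycle_module: "is_complex R C \<Longrightarrow> module R (cycle_module C i)"
  by (rule submodule_module[OF is_complexD(1) submodule_cycles])

lemma submodule_boundaries_cycles:
  "is_complex R C \<Longrightarrow> submodule (boundaries C i) R (cycle_module C i)"
  by (rule submodule_of_submodule[OF is_complexD(1) submodule_cycles submodule_boundaries boundaries_cycles])

lemma module_homology: "is_complex R C \<Longrightarrow> module R (homology C i)"
  unfolding homology_def by (rule module_quot[OF module_cycle_module submodule_boundaries_cycles])

definition hclass :: "('r, 'a) chain_complex \<Rightarrow> nat \<Rightarrow> 'a \<Rightarrow> 'a set" where
  "hclass C i x = boundaries C i +>\<^bsub>cycle_module C i\<^esub> x"

lemma carrier_homology: "carrier (homology C i) = hclass C i ` cycles C i"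
  by (simp add: homology_def carrier_quot_module hclass_def)

lemma submodule_minus:
  fixes M :: "('r, 'a) module"
  assumes "module R M" "submodule H R M" "x \<in> H" "y \<in> H"
  shows "x \<ominus>\<^bsub>M\<lparr>carrier := H\<rparr>\<^esub> y = x \<ominus>\<^bsub>M\<^esub> y"
proof -
  have "(\<lambda>x. x) \<in> mod_hom R (M\<lparr>carrier := H\<rparr>) M"
    using submodule_in_carrier[OF assms(1,2)] by (auto simp: mod_hom_def)
  from mod_hom_diff[OF submodule_module[OF assms(1,2)] assms(1) this] assms(3,4) show ?thesis by simp
qed

lemma hclass_eq_iff:
  assumes "is_complex R C" "x \<in> cycles C i" "y \<in> cycles C i"
  shows "hclass C i x = hclass C i y \<longleftrightarrow> x \<ominus>\<^bsub>obj C i\<^esub> y \<in> boundaries C i"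
  using coset_eq_iff[OF module_cycle_module submodule_boundaries_cycles, OF assms(1,1), of x i y]
    submodule_minus[OF is_complexD(1) submodule_cycles, OF assms(1,1,2,3)] assms(2,3)
  by (simp add: hclass_def)

lemma hclass_zero_iff:
  assumes "is_complex R C" "x \<in> cycles C i"
  shows "hclass C i x = \<zero>\<^bsub>homology C i\<^esub> \<longleftrightarrow> x \<in> boundaries C i"
  using coset_eq_self_iff[OF module_cycle_module submodule_boundaries_cycles, OF assms(1,1), of x i]
    assms(2) by (simp add: hclass_def homology_def zero_quot_module)

text \<open>
  Maps of homology modules come from maps that respect cycles and boundaries. The degrees may
  differ, so that connecting maps are included.
\<close>

definition preserves ::
    "('r, 'z) ring_scheme \<Rightarrow> ('r, 'a) chain_complex \<Rightarrow> nat \<Rightarrow> ('r, 'b) chain_complex \<Rightarrow> nat \<Rightarrow>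
     ('a \<Rightarrow> 'b) \<Rightarrow> bool" where
  "preserves R C i D j f \<longleftrightarrow> f \<in> mod_hom R (obj C i) (obj D j) \<and>
     (\<forall>x\<in>cycles C i. f x \<in> cycles D j) \<and> (\<forall>x\<in>boundaries C i. f x \<in> boundaries D j)"

definition hmap :: "('r, 'b) chain_complex \<Rightarrow> nat \<Rightarrow> ('a \<Rightarrow> 'b) \<Rightarrow> 'a set \<Rightarrow> 'b set" where
  "hmap D j f = quot_map (cycle_module D j) (boundaries D j) f"

lemma preserves_cycle_hom:
  "preserves R C i D j f \<Longrightarrow> f \<in> mod_hom R (cycle_module C i) (cycle_module D j)"
  using cycles_closed[of _ C i] by (auto simp: preserves_def mod_hom_def)

lemma hmap_hclass:
  assumes "is_complex R C" "is_complex R D" "preserves R C i D j f" "x \<in> cycles C i"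
  shows "hmap D j f (hclass C i x) = hclass D j (f x)"
  unfolding hmap_def hclass_def
  by (rule quot_map_coset_hom[OF module_cycle_module[OF assms(1)] submodule_boundaries_cycles[OF assms(1)]
        module_cycle_module[OF assms(2)] submodule_boundaries_cycles[OF assms(2)] preserves_cycle_hom[OF assms(3)]])
    (use assms in \<open>auto simp: preserves_def\<close>)

lemma hmap_hom:
  assumes "is_complex R C" "is_complex R D" "preserves R C i D j f"
  shows "hmap D j f \<in> mod_hom R (homology C i) (homology D j)"
  unfolding hmap_def homology_def
  by (rule quot_map_hom[OF module_cycle_module[OF assms(1)] submodule_boundaries_cycles[OF assms(1)]
        module_cycle_module[OF assms(2)] submodule_boundaries_cycles[OF assms(2)] preserves_cycle_hom[OF assms(3)]])
    (use assms in \<open>auto simp: preserves_def\<close>)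

lemma hmap_exactI:
  assumes "is_complex R C" "is_complex R D" "is_complex R E"
    and "preserves R C i D j f" "preserves R D j E k g"
    and "\<And>x. x \<in> cycles C i \<Longrightarrow> g (f x) \<in> boundaries E k"
    and "\<And>y. y \<in> cycles D j \<Longrightarrow> g y \<in> boundaries E k \<Longrightarrow>
      \<exists>x\<in>cycles C i. f x \<ominus>\<^bsub>obj D j\<^esub> y \<in> boundaries D j"
  shows "hmap D j f ` carrier (homology C i) = mod_ker (homology D j) (homology E k) (hmap E k g)"
proof
  have cyc: "f x \<in> cycles D j" if "x \<in> cycles C i" for x using assms(4) that by (simp add: preserves_def)
  have cyc': "g y \<in> cycles E k" if "y \<in> cycles D j" for y using assms(5) that by (simp add: preserves_def)
  show "hmap D j f ` carrier (homology C i) \<subseteq> mod_ker (homology D j) (homology E k) (hmap E k g)"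
  proof
    fix z assume "z \<in> hmap D j f ` carrier (homology C i)"
    then obtain x where x: "x \<in> cycles C i" "z = hclass D j (f x)"
      by (auto simp: carrier_homology hmap_hclass[OF assms(1,2,4)])
    then have "hmap E k g z = \<zero>\<^bsub>homology E k\<^esub>"
      using hclass_zero_iff[OF assms(3) cyc'[OF cyc[OF x(1)]]] assms(6)[OF x(1)] cyc[OF x(1)]
      by (simp add: hmap_hclass[OF assms(2,3,5)])
    then show "z \<in> mod_ker (homology D j) (homology E k) (hmap E k g)"
      using x cyc by (simp add: mod_ker_def carrier_homology)
  qed
  show "mod_ker (homology D j) (homology E k) (hmap E k g) \<subseteq> hmap D j f ` carrier (homology C i)"
  proof
    fix z assume "z \<in> mod_ker (homology D j) (homology E k) (hmap E k g)"
    then obtain y where y: "y \<in> cycles D j" "z = hclass D j y" "g y \<in> boundaries E k"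
      using cyc' by (auto simp: carrier_homology mod_ker_def hmap_hclass[OF assms(2,3,5)]
          hclass_zero_iff[OF assms(3)])
    then obtain x where x: "x \<in> cycles C i" "f x \<ominus>\<^bsub>obj D j\<^esub> y \<in> boundaries D j"
      using assms(7) by auto
    then have "hmap D j f (hclass C i x) = z"
      using y cyc by (simp add: hmap_hclass[OF assms(1,2,4)] hclass_eq_iff[OF assms(2)])
    then show "z \<in> hmap D j f ` carrier (homology C i)" using x(1) by (auto simp: carrier_homology)
  qed
qed

definition chain_map ::
    "('r, 'z) ring_scheme \<Rightarrow> ('r, 'a) chain_complex \<Rightarrow> ('r, 'b) chain_complex \<Rightarrow>
     (nat \<Rightarrow> 'a \<Rightarrow> 'b) \<Rightarrow> bool" where
  "chain_map R C D \<phi> \<longleftrightarrow> (\<forall>n. \<phi> n \<in> mod_hom R (obj C n) (obj D n)) \<and>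
     (\<forall>n. \<forall>x\<in>carrier (obj C (Suc n)). \<phi> n (diff C n x) = diff D n (\<phi> (Suc n) x))"

lemma chain_mapD:
  assumes "chain_map R C D \<phi>"
  shows "\<phi> n \<in> mod_hom R (obj C n) (obj D n)"
    "x \<in> carrier (obj C (Suc n)) \<Longrightarrow> \<phi> n (diff C n x) = diff D n (\<phi> (Suc n) x)"
  using assms by (auto simp: chain_map_def)

lemma chain_map_comp:
  assumes "chain_map R C D \<phi>" "chain_map R D E \<psi>"
  shows "chain_map R C E (\<lambda>n x. \<psi> n (\<phi> n x))"
  unfolding chain_map_def
  using mod_hom_comp[OF chain_mapD(1)[OF assms(1)] chain_mapD(1)[OF assms(2)]]
    mod_hom_closed[OF chain_mapD(1)[OF assms(1)]] chain_mapD(2)[OF assms(1)] chain_mapD(2)[OF assms(2)]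
  by simp

lemma chain_map_preserves:
  assumes "is_complex R C" "is_complex R D" "chain_map R C D \<phi>"
  shows "preserves R C i D i (\<phi> i)"
proof -
  note hom = chain_mapD(1)[OF assms(3)] and com = chain_mapD(2)[OF assms(3)]
  have "\<phi> i x \<in> cycles D i" if "x \<in> cycles C i" for x
  proof (cases i)
    case 0
    then show ?thesis using that mod_hom_closed[OF hom] by simp
  next
    case (Suc n)
    then show ?thesis
      using that mod_hom_closed[OF hom] com[of x n, symmetric]
        mod_hom_zero[OF is_complexD(1)[OF assms(1)] is_complexD(1)[OF assms(2)] hom]
      by (simp add: mod_ker_def)
  qed
  moreover have "\<phi> i x \<in> boundaries D i" if "x \<in> boundaries C i" for x
    using that com mod_hom_closed[OF hom] by (auto simp: boundaries_def)
  ultimately show ?thesis using hom by (simp add: preserves_def)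
qed

lemma homology_map_hmap: "homology_map D \<phi> i = hmap D i (\<phi> i)"
  by (simp add: homology_map_def hmap_def)

lemma homology_map_hom:
  assumes "is_complex R C" "is_complex R D" "chain_map R C D \<phi>"
  shows "homology_map D \<phi> i \<in> mod_hom R (homology C i) (homology D i)"
  unfolding homology_map_hmap by (rule hmap_hom[OF assms(1,2) chain_map_preserves[OF assms]])

lemma homology_map_hclass:
  assumes "is_complex R C" "is_complex R D" "chain_map R C D \<phi>" "x \<in> cycles C i"
  shows "homology_map D \<phi> i (hclass C i x) = hclass D i (\<phi> i x)"
  unfolding homology_map_hmap by (rule hmap_hclass[OF assms(1,2) chain_map_preserves[OF assms(1-3)] assms(4)])

lemma homology_map_comp:
  assumes "is_complex R C" "is_complex R D" "is_complex R E" "chain_map R C D \<phi>" "chain_map R D E \<psi>"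
    and "z \<in> carrier (homology C i)"
  shows "homology_map E \<psi> i (homology_map D \<phi> i z) = homology_map E (\<lambda>n x. \<psi> n (\<phi> n x)) i z"
proof -
  obtain x where x: "x \<in> cycles C i" "z = hclass C i x" using assms(6) by (auto simp: carrier_homology)
  have "\<phi> i x \<in> cycles D i" using chain_map_preserves[OF assms(1,2,4), of i] x(1) by (simp add: preserves_def)
  then show ?thesis
    using x by (simp add: homology_map_hclass[OF assms(1,2,4)] homology_map_hclass[OF assms(2,3,5)]
      homology_map_hclass[OF assms(1,3) chain_map_comp[OF assms(4,5)]])
qed

definition homotopic ::
    "('r, 'z) ring_scheme \<Rightarrow> ('r, 'a) chain_complex \<Rightarrow> ('r, 'b) chain_complex \<Rightarrow>
     (nat \<Rightarrow> 'a \<Rightarrow> 'b) \<Rightarrow> (nat \<Rightarrow> 'a \<Rightarrow> 'b) \<Rightarrow> bool" where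
  "homotopic R C D \<phi> \<psi> \<longleftrightarrow> (\<exists>h. (\<forall>n. h n \<in> mod_hom R (obj C n) (obj D (Suc n))) \<and>
     (\<forall>x\<in>carrier (obj C 0). \<phi> 0 x = \<psi> 0 x \<oplus>\<^bsub>obj D 0\<^esub> diff D 0 (h 0 x)) \<and>
     (\<forall>n. \<forall>x\<in>carrier (obj C (Suc n)). \<phi> (Suc n) x = \<psi> (Suc n) x \<oplus>\<^bsub>obj D (Suc n)\<^esub>
        (diff D (Suc n) (h (Suc n) x) \<oplus>\<^bsub>obj D (Suc n)\<^esub> h n (diff C n x))))"

lemma homotopic_homology_map:
  assumes "is_complex R C" "is_complex R D" "chain_map R C D \<phi>" "chain_map R C D \<psi>"
    and "homotopic R C D \<phi> \<psi>" "z \<in> carrier (homology C i)"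
  shows "homology_map D \<phi> i z = homology_map D \<psi> i z"
proof -
  obtain h where h: "\<And>n. h n \<in> mod_hom R (obj C n) (obj D (Suc n))"
    and h0: "\<forall>x\<in>carrier (obj C 0). \<phi> 0 x = \<psi> 0 x \<oplus>\<^bsub>obj D 0\<^esub> diff D 0 (h 0 x)"
    and hS: "\<forall>n. \<forall>x\<in>carrier (obj C (Suc n)). \<phi> (Suc n) x = \<psi> (Suc n) x \<oplus>\<^bsub>obj D (Suc n)\<^esub>
        (diff D (Suc n) (h (Suc n) x) \<oplus>\<^bsub>obj D (Suc n)\<^esub> h n (diff C n x))"
    using assms(5) unfolding homotopic_def by auto
  interpret D: module R "obj D n" for n by (rule is_complexD(1)[OF assms(2)])
  obtain x where x: "x \<in> cycles C i" "z = hclass C i x" using assms(6) by (auto simp: carrier_homology)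
  note xC = cycles_closed[OF x(1)]
  have d: "diff D i (h i x) \<in> carrier (obj D i)"
    using mod_hom_closed[OF is_complexD(2)[OF assms(2)]] mod_hom_closed[OF h xC] by simp
  have \<psi>: "\<psi> i x \<in> carrier (obj D i)" using mod_hom_closed[OF chain_mapD(1)[OF assms(4)] xC] .
  have "\<phi> i x = \<psi> i x \<oplus>\<^bsub>obj D i\<^esub> diff D i (h i x)"
  proof (cases i)
    case 0
    then show ?thesis using h0 xC by simp
  next
    case (Suc n)
    then have "h n (diff C n x) = \<zero>\<^bsub>obj D (Suc n)\<^esub>"
      using x(1) mod_hom_zero[OF is_complexD(1)[OF assms(1)] is_complexD(1)[OF assms(2)] h]
      by (simp add: mod_ker_def)
    then show ?thesis using hS xC Suc d by simp
  qed
  then have "\<phi> i x \<ominus>\<^bsub>obj D i\<^esub> \<psi> i x = diff D i (h i x)"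
    using d \<psi> by (simp add: a_minus_def D.add.m_comm[of "\<psi> i x"] D.add.m_assoc D.r_neg)
  then have "\<phi> i x \<ominus>\<^bsub>obj D i\<^esub> \<psi> i x \<in> boundaries D i"
    using mod_hom_closed[OF h xC] by (auto simp: boundaries_def)
  moreover have "\<phi> i x \<in> cycles D i" "\<psi> i x \<in> cycles D i"
    using chain_map_preserves[OF assms(1,2,3), of i] chain_map_preserves[OF assms(1,2,4), of i] x(1)
    by (simp_all add: preserves_def)
  ultimately show ?thesis
    using x by (simp add: homology_map_hclass[OF assms(1-3)] homology_map_hclass[OF assms(1,2,4)]
      hclass_eq_iff[OF assms(2)])
qed


section \<open>Mapping cones\<close>

text \<open>
  \<open>C\<close> is the mapping cone of \<open>\<phi> : P \<rightarrow> Q\<close>, that is \<open>C\<^sub>n = P\<^sub>n\<^sub>-\<^sub>1 \<oplus> Q\<^sub>n\<close> with differential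
  \<open>(x, y) \<mapsto> (- d x, \<phi> x + d y)\<close>. The inclusions \<open>j\<close>, \<open>i\<close> and the projections \<open>p\<close>, \<open>q\<close> are
  described by equations between compositions and sums of linear maps, so the image of a cone under
  an additive functor is again a cone.
\<close>

locale cone =
  fixes R :: "('r, 'z) ring_scheme" and P :: "('r, 'p) chain_complex" and Q :: "('r, 'q) chain_complex"
    and C :: "('r, 'c) chain_complex" and \<phi> :: "nat \<Rightarrow> 'p \<Rightarrow> 'q"
    and i :: "nat \<Rightarrow> 'q \<Rightarrow> 'c" and j :: "nat \<Rightarrow> 'p \<Rightarrow> 'c"
    and p :: "nat \<Rightarrow> 'c \<Rightarrow> 'p" and q :: "nat \<Rightarrow> 'c \<Rightarrow> 'q"
  assumes cP: "is_complex R P" and cQ: "is_complex R Q" and cC: "is_complex R C"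
    and chain: "chain_map R P Q \<phi>"
    and ih: "i n \<in> mod_hom R (obj Q n) (obj C n)"
    and jh: "j n \<in> mod_hom R (obj P n) (obj C (Suc n))"
    and ph: "p n \<in> mod_hom R (obj C (Suc n)) (obj P n)"
    and qh: "q n \<in> mod_hom R (obj C n) (obj Q n)"
    and qi: "y \<in> carrier (obj Q n) \<Longrightarrow> q n (i n y) = y"
    and pj: "x \<in> carrier (obj P n) \<Longrightarrow> p n (j n x) = x"
    and p_i: "y \<in> carrier (obj Q (Suc n)) \<Longrightarrow> p n (i (Suc n) y) = \<zero>\<^bsub>obj P n\<^esub>"
    and qj: "x \<in> carrier (obj P n) \<Longrightarrow> q (Suc n) (j n x) = \<zero>\<^bsub>obj Q (Suc n)\<^esub>"
    and decomp: "c \<in> carrier (obj C (Suc n)) \<Longrightarrow>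
       j n (p n c) \<oplus>\<^bsub>obj C (Suc n)\<^esub> i (Suc n) (q (Suc n) c) = c"
    and decomp0: "c \<in> carrier (obj C 0) \<Longrightarrow> i 0 (q 0 c) = c"
    and di: "y \<in> carrier (obj Q (Suc n)) \<Longrightarrow> diff C n (i (Suc n) y) = i n (diff Q n y)"
    and dj0: "x \<in> carrier (obj P 0) \<Longrightarrow> diff C 0 (j 0 x) = i 0 (\<phi> 0 x)"
    and djS: "x \<in> carrier (obj P (Suc n)) \<Longrightarrow>
       diff C (Suc n) (j (Suc n) x) \<oplus>\<^bsub>obj C (Suc n)\<^esub> j n (diff P n x) = i (Suc n) (\<phi> (Suc n) x)"
begin

lemmas modP = is_complexD(1)[OF cP] and modQ = is_complexD(1)[OF cQ] and modC = is_complexD(1)[OF cC]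
lemmas dP = is_complexD(2)[OF cP] and dQ = is_complexD(2)[OF cQ] and dC = is_complexD(2)[OF cC]
lemmas \<phi>h = chain_mapD(1)[OF chain]
lemmas closed = mod_hom_closed[OF ih] mod_hom_closed[OF jh] mod_hom_closed[OF ph] mod_hom_closed[OF qh]
  mod_hom_closed[OF dP] mod_hom_closed[OF dQ] mod_hom_closed[OF dC] mod_hom_closed[OF \<phi>h]

sublocale P: module R "obj P n" for n by (rule modP)
sublocale Q: module R "obj Q n" for n by (rule modQ)
sublocale C: module R "obj C n" for n by (rule modC)

lemma eqI:
  assumes "c \<in> carrier (obj C (Suc n))" "c' \<in> carrier (obj C (Suc n))"
    and "p n c = p n c'" "q (Suc n) c = q (Suc n) c'"
  shows "c = c'"
  using decomp[OF assms(1), unfolded assms(3,4) decomp[OF assms(2)]] by (rule sym)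

lemma eqI0:
  assumes "c \<in> carrier (obj C 0)" "c' \<in> carrier (obj C 0)" "q 0 c = q 0 c'"
  shows "c = c'"
  using decomp0[OF assms(1), unfolded assms(3) decomp0[OF assms(2)]] by (rule sym)

lemma pair:
  assumes "x \<in> carrier (obj P n)" "y \<in> carrier (obj Q (Suc n))"
  shows "\<exists>c\<in>carrier (obj C (Suc n)). p n c = x \<and> q (Suc n) c = y"
  by (rule bexI[of _ "j n x \<oplus>\<^bsub>obj C (Suc n)\<^esub> i (Suc n) y"])
    (use assms in \<open>auto simp: closed mod_hom_add[OF ph] mod_hom_add[OF qh] pj p_i qj qi\<close>)

lemma p_diff_j:
  assumes "x \<in> carrier (obj P (Suc n))"
  shows "p n (diff C (Suc n) (j (Suc n) x)) = \<ominus>\<^bsub>obj P n\<^esub> diff P n x"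
proof -
  have "p n (diff C (Suc n) (j (Suc n) x)) \<oplus>\<^bsub>obj P n\<^esub> diff P n x = \<zero>\<^bsub>obj P n\<^esub>"
    using arg_cong[OF djS[OF assms], of "p n"] assms
    by (simp add: mod_hom_add[OF ph] closed pj p_i)
  then show ?thesis using assms by (intro P.minus_equality[symmetric]) (simp_all add: closed)
qed

lemma p_diff:
  assumes "c \<in> carrier (obj C (Suc (Suc n)))"
  shows "p n (diff C (Suc n) c) = \<ominus>\<^bsub>obj P n\<^esub> diff P n (p (Suc n) c)"
proof -
  have "p n (diff C (Suc n) c) =
      p n (diff C (Suc n) (j (Suc n) (p (Suc n) c) \<oplus>\<^bsub>obj C (Suc (Suc n))\<^esub> i (Suc (Suc n)) (q (Suc (Suc n)) c)))"
    using decomp[OF assms] by simp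
  also have "\<dots> = \<ominus>\<^bsub>obj P n\<^esub> diff P n (p (Suc n) c)"
    using assms by (simp add: mod_hom_add[OF dC] mod_hom_add[OF ph] closed p_diff_j di p_i)
  finally show ?thesis .
qed

lemma q_diff:
  assumes "c \<in> carrier (obj C (Suc n))"
  shows "q n (diff C n c) = \<phi> n (p n c) \<oplus>\<^bsub>obj Q n\<^esub> diff Q n (q (Suc n) c)"
proof -
  have j: "q n (diff C n (j n x)) = \<phi> n x" if "x \<in> carrier (obj P n)" for x
  proof (cases n)
    case 0
    then show ?thesis using that dj0[of x] by (simp add: qi closed)
  next
    case (Suc m)
    then show ?thesis using that arg_cong[OF djS[of x m], of "q (Suc m)"]
      by (simp add: mod_hom_add[OF qh] closed qi qj)
  qed
  have "q n (diff C n c) = q n (diff C n (j n (p n c) \<oplus>\<^bsub>obj C (Suc n)\<^esub> i (Suc n) (q (Suc n) c)))"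
    using decomp[OF assms] by simp
  also have "\<dots> = \<phi> n (p n c) \<oplus>\<^bsub>obj Q n\<^esub> diff Q n (q (Suc n) c)"
    using assms by (simp add: mod_hom_add[OF dC] mod_hom_add[OF qh] closed j di qi)
  finally show ?thesis .
qed

lemma i_chain: "chain_map R Q C i"
  by (simp add: chain_map_def ih di)

lemma p_preserves: "preserves R C (Suc n) P n (p n)"
proof -
  have "p n c \<in> cycles P n" if c: "c \<in> cycles C (Suc n)" for c
  proof (cases n)
    case 0
    then show ?thesis using c by (auto simp: mod_ker_def closed)
  next
    case (Suc m)
    have "c \<in> carrier (obj C (Suc (Suc m)))" "diff C (Suc m) c = \<zero>\<^bsub>obj C (Suc m)\<^esub>"
      using c Suc by (auto simp: mod_ker_def)
    then have "\<ominus>\<^bsub>obj P m\<^esub> diff P m (p (Suc m) c) = \<zero>\<^bsub>obj P m\<^esub>"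
      using p_diff[of c m] mod_hom_zero[OF modC modP ph, of m] by simp
    then show ?thesis using c Suc by (simp add: mod_ker_def closed)
  qed
  moreover have "p n c \<in> boundaries P n" if c: "c \<in> boundaries C (Suc n)" for c
  proof -
    obtain b where b: "b \<in> carrier (obj C (Suc (Suc n)))" "c = diff C (Suc n) b"
      using c by (auto simp: boundaries_def)
    then have "p n c = diff P n (\<ominus>\<^bsub>obj P (Suc n)\<^esub> p (Suc n) b)"
      by (simp add: p_diff closed mod_hom_neg[OF modP modP dP])
    then show ?thesis unfolding boundaries_def using b(1) closed by blast
  qed
  ultimately show ?thesis by (simp add: preserves_def ph)
qed

text \<open>Since the cone consists of pairs, the connecting map is simply the projection.\<close>

lemma long_exact:
  "long_exact R (homology P) (homology Q) (homology C) (homology_map Q \<phi>) (homology_map C i)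
     (\<lambda>n. hmap P n (p n))"
proof -
  note \<phi>r = chain_map_preserves[OF cP cQ chain] and ir = chain_map_preserves[OF cQ cC i_chain]
  have zero: "m \<ominus>\<^bsub>obj P n\<^esub> m = \<zero>\<^bsub>obj P n\<^esub>" if "m \<in> carrier (obj P n)" for m n
    using that by (simp add: a_minus_def P.r_neg)
  have exB: "homology_map Q \<phi> n ` carrier (homology P n) =
      mod_ker (homology Q n) (homology C n) (homology_map C i n)" for n
    unfolding homology_map_hmap
  proof (rule hmap_exactI[OF cP cQ cC \<phi>r ir])
    fix x assume x: "x \<in> cycles P n"
    note xP = cycles_closed[OF x]
    have "i n (\<phi> n x) = diff C n (j n x)"
    proof (cases n)
      case 0
      then show ?thesis using dj0 xP by simp
    next
      case (Suc m)
      then have "j m (diff P m x) = \<zero>\<^bsub>obj C (Suc m)\<^esub>"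
        using x mod_hom_zero[OF modP modC jh] by (simp add: mod_ker_def)
      then show ?thesis using djS[of x m] Suc xP by (simp add: closed)
    qed
    then show "i n (\<phi> n x) \<in> boundaries C n" using xP closed(2) by (auto simp: boundaries_def)
  next
    fix y assume y: "y \<in> cycles Q n" "i n y \<in> boundaries C n"
    then obtain c where c: "c \<in> carrier (obj C (Suc n))" "i n y = diff C n c"
      by (auto simp: boundaries_def)
    note yQ = cycles_closed[OF y(1)]
    have y_eq: "y = \<phi> n (p n c) \<oplus>\<^bsub>obj Q n\<^esub> diff Q n (q (Suc n) c)"
      using q_diff[OF c(1)] c(2) qi[OF yQ] by simp
    have "p n c \<in> cycles P n"
    proof (cases n)
      case 0
      then show ?thesis using c(1) closed(3)[of c n] by simp
    next
      case (Suc m)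
      then have "\<ominus>\<^bsub>obj P m\<^esub> diff P m (p (Suc m) c) = \<zero>\<^bsub>obj P m\<^esub>"
        using p_diff[of c m] c yQ p_i[of y m] by simp
      then show ?thesis using c Suc by (simp add: mod_ker_def closed)
    qed
    moreover have "\<phi> n (p n c) \<ominus>\<^bsub>obj Q n\<^esub> y = diff Q n (\<ominus>\<^bsub>obj Q (Suc n)\<^esub> q (Suc n) c)"
      unfolding y_eq using c(1)
      by (simp add: closed mod_hom_neg[OF modQ modQ dQ] a_minus_def Q.minus_add
          Q.add.m_assoc[symmetric] Q.r_neg)
    then have "\<phi> n (p n c) \<ominus>\<^bsub>obj Q n\<^esub> y \<in> boundaries Q n"
      unfolding boundaries_def using c(1) closed by (metis Q.a_inv_closed image_eqI)
    ultimately show "\<exists>x\<in>cycles P n. \<phi> n x \<ominus>\<^bsub>obj Q n\<^esub> y \<in> boundaries Q n" by auto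
  qed
  have exC: "homology_map C i (Suc n) ` carrier (homology Q (Suc n)) =
      mod_ker (homology C (Suc n)) (homology P n) (hmap P n (p n))" for n
    unfolding homology_map_hmap
  proof (rule hmap_exactI[OF cQ cC cP ir p_preserves])
    fix y assume "y \<in> cycles Q (Suc n)"
    then show "p n (i (Suc n) y) \<in> boundaries P n"
      using p_i[of y n] submodule_zero[OF modP submodule_boundaries[OF cP]]
      by (simp add: mod_ker_def)
  next
    fix c assume c: "c \<in> cycles C (Suc n)" "p n c \<in> boundaries P n"
    then obtain a where a: "a \<in> carrier (obj P (Suc n))" "p n c = diff P n a"
      by (auto simp: boundaries_def)
    have cc: "c \<in> carrier (obj C (Suc n))" "diff C n c = \<zero>\<^bsub>obj C n\<^esub>" using c(1) by (auto simp: mod_ker_def)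
    \<comment> \<open>Adding this boundary makes the first component zero, so the result comes from \<open>Q\<close>.\<close>
    let ?b = "diff C (Suc n) (j (Suc n) a)"
    let ?c = "c \<oplus>\<^bsub>obj C (Suc n)\<^esub> ?b"
    have b: "?b \<in> carrier (obj C (Suc n))" using a(1) by (simp add: closed)
    have "p n ?c = \<zero>\<^bsub>obj P n\<^esub>"
      using cc(1) b a by (simp add: mod_hom_add[OF ph] p_diff_j closed P.r_neg)
    then have ic: "i (Suc n) (q (Suc n) ?c) = ?c"
      using decomp[of ?c n] mod_hom_zero[OF modP modC jh] cc(1) b by (simp add: closed)
    have qc: "q (Suc n) ?c \<in> carrier (obj Q (Suc n))" using cc(1) b by (simp add: closed)
    have "i n (diff Q n (q (Suc n) ?c)) = diff C n ?c" using di[OF qc] ic by simp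
    also have "\<dots> = \<zero>\<^bsub>obj C n\<^esub>"
      using cc b a(1) is_complexD(3)[OF cC, of "j (Suc n) a"] by (simp add: mod_hom_add[OF dC] closed)
    finally have "q n (i n (diff Q n (q (Suc n) ?c))) = \<zero>\<^bsub>obj Q n\<^esub>"
      using mod_hom_zero[OF modC modQ qh] by simp
    then have "diff Q n (q (Suc n) ?c) = \<zero>\<^bsub>obj Q n\<^esub>" using qi[OF closed(6)[OF qc]] by simp
    then have "q (Suc n) ?c \<in> cycles Q (Suc n)" using qc by (simp add: mod_ker_def)
    moreover have "i (Suc n) (q (Suc n) ?c) \<ominus>\<^bsub>obj C (Suc n)\<^esub> c = ?b"
      unfolding ic using cc(1) b by (simp add: a_minus_def C.add.m_comm[of c] C.add.m_assoc C.r_neg)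
    then have "i (Suc n) (q (Suc n) ?c) \<ominus>\<^bsub>obj C (Suc n)\<^esub> c \<in> boundaries C (Suc n)"
      using a(1) closed(2) by (auto simp: boundaries_def)
    ultimately show "\<exists>y\<in>cycles Q (Suc n). i (Suc n) y \<ominus>\<^bsub>obj C (Suc n)\<^esub> c \<in> boundaries C (Suc n)" by auto
  qed
  have exA: "hmap P n (p n) ` carrier (homology C (Suc n)) =
      mod_ker (homology P n) (homology Q n) (homology_map Q \<phi> n)" for n
    unfolding homology_map_hmap
  proof (rule hmap_exactI[OF cC cP cQ p_preserves \<phi>r])
    fix c assume "c \<in> cycles C (Suc n)"
    then have c: "c \<in> carrier (obj C (Suc n))" "diff C n c = \<zero>\<^bsub>obj C n\<^esub>" by (auto simp: mod_ker_def)
    have "\<phi> n (p n c) \<oplus>\<^bsub>obj Q n\<^esub> diff Q n (q (Suc n) c) = \<zero>\<^bsub>obj Q n\<^esub>"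
      using q_diff[OF c(1)] c(2) mod_hom_zero[OF modC modQ qh] by simp
    then have "\<phi> n (p n c) = \<ominus>\<^bsub>obj Q n\<^esub> diff Q n (q (Suc n) c)"
      using c(1) by (intro Q.minus_equality[symmetric]) (simp_all add: closed)
    also have "\<dots> = diff Q n (\<ominus>\<^bsub>obj Q (Suc n)\<^esub> q (Suc n) c)"
      using c(1) by (simp add: closed mod_hom_neg[OF modQ modQ dQ])
    finally show "\<phi> n (p n c) \<in> boundaries Q n"
      unfolding boundaries_def using c(1) closed by (metis Q.a_inv_closed image_eqI)
  next
    fix a assume a: "a \<in> cycles P n" "\<phi> n a \<in> boundaries Q n"
    note aP = cycles_closed[OF a(1)]
    obtain b where b: "b \<in> carrier (obj Q (Suc n))" "\<phi> n a = diff Q n b"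
      using a(2) by (auto simp: boundaries_def)
    \<comment> \<open>The pair \<open>(a, -b)\<close> is a cycle, because \<open>\<phi> a - d b = 0\<close>.\<close>
    obtain c where c: "c \<in> carrier (obj C (Suc n))" "p n c = a" "q (Suc n) c = \<ominus>\<^bsub>obj Q (Suc n)\<^esub> b"
      using pair[OF aP, of "\<ominus>\<^bsub>obj Q (Suc n)\<^esub> b"] b(1) by auto
    have q0: "q n (diff C n c) = q n \<zero>\<^bsub>obj C n\<^esub>"
      using b c by (simp add: q_diff mod_hom_neg[OF modQ modQ dQ] closed Q.r_neg mod_hom_zero[OF modC modQ qh])
    have "diff C n c = \<zero>\<^bsub>obj C n\<^esub>"
    proof (cases n)
      case 0
      then show ?thesis using c(1) q0 by (intro eqI0) (simp_all add: closed)
    next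
      case (Suc m)
      have "p m (diff C (Suc m) c) = p m \<zero>\<^bsub>obj C (Suc m)\<^esub>"
        using p_diff[of c m] c Suc a(1) mod_hom_zero[OF modC modP ph] by (simp add: mod_ker_def)
      then show ?thesis using c(1) q0 Suc by (intro eqI[of _ m]) (simp_all add: closed)
    qed
    then have "c \<in> cycles C (Suc n)" using c(1) by (simp add: mod_ker_def)
    moreover have "p n c \<ominus>\<^bsub>obj P n\<^esub> a \<in> boundaries P n"
      using c(2) zero[OF aP] submodule_zero[OF modP submodule_boundaries[OF cP]] by simp
    ultimately show "\<exists>x\<in>cycles C (Suc n). p n x \<ominus>\<^bsub>obj P n\<^esub> a \<in> boundaries P n" by auto
  qed
  have "homology_map C i 0 ` carrier (homology Q 0) = carrier (homology C 0)"
  proof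
    show "homology_map C i 0 ` carrier (homology Q 0) \<subseteq> carrier (homology C 0)"
      using mod_hom_closed[OF homology_map_hom[OF cQ cC i_chain]] by auto
    show "carrier (homology C 0) \<subseteq> homology_map C i 0 ` carrier (homology Q 0)"
    proof
      fix z assume "z \<in> carrier (homology C 0)"
      then obtain c where c: "c \<in> carrier (obj C 0)" "z = hclass C 0 c" by (auto simp: carrier_homology)
      have "q 0 c \<in> cycles Q 0" using c(1) by (simp add: closed)
      then have "homology_map C i 0 (hclass Q 0 (q 0 c)) = z"
        using homology_map_hclass[OF cQ cC i_chain, of "q 0 c" 0] decomp0[OF c(1)] c(2) by simp
      then show "z \<in> homology_map C i 0 ` carrier (homology Q 0)"
        using \<open>q 0 c \<in> cycles Q 0\<close> by (auto simp: carrier_homology)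
    qed
  qed
  then show ?thesis
    unfolding long_exact_def
    using module_homology[OF cP] module_homology[OF cQ] module_homology[OF cC]
      homology_map_hom[OF cP cQ chain] homology_map_hom[OF cQ cC i_chain] hmap_hom[OF cC cP p_preserves]
      exA exB exC by simp
qed

text \<open>If the cone is exact, the outer terms of the long exact sequence vanish.\<close>

lemma exact_cone_bij:
  assumes "\<And>n. boundaries C n = cycles C n"
  shows "bij_betw (homology_map Q \<phi> n) (carrier (homology P n)) (carrier (homology Q n))"
proof -
  have triv: "carrier (homology C n) = {\<zero>\<^bsub>homology C n\<^esub>}" for n
  proof -
    have "\<zero>\<^bsub>obj C n\<^esub> \<in> cycles C n" by (rule submodule_zero[OF modC submodule_cycles[OF cC]])
    moreover have "hclass C n x = \<zero>\<^bsub>homology C n\<^esub>" if "x \<in> cycles C n" for x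
      using hclass_zero_iff[OF cC that] assms that by simp
    ultimately show ?thesis unfolding carrier_homology by blast
  qed
  note ex = long_exact[unfolded long_exact_def]
  note hQ = module_homology[OF cQ] and hP = module_homology[OF cP] and hC = module_homology[OF cC]
  have "homology_map Q \<phi> n ` carrier (homology P n) = carrier (homology Q n)"
  proof -
    have "homology_map Q \<phi> n ` carrier (homology P n) =
        mod_ker (homology Q n) (homology C n) (homology_map C i n)" using ex by simp
    also have "\<dots> = carrier (homology Q n)"
      using mod_hom_closed[OF homology_map_hom[OF cQ cC i_chain, of n]] triv[of n]
      by (auto simp: mod_ker_def)
    finally show ?thesis .
  qed
  moreover have "inj_on (homology_map Q \<phi> n) (carrier (homology P n))"
  proof (rule mod_hom_inj_onI[OF hP hQ homology_map_hom[OF cP cQ chain]])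
    fix z assume "z \<in> carrier (homology P n)" "homology_map Q \<phi> n z = \<zero>\<^bsub>homology Q n\<^esub>"
    then have "z \<in> mod_ker (homology P n) (homology Q n) (homology_map Q \<phi> n)" by (simp add: mod_ker_def)
    moreover have "hmap P n (p n) ` carrier (homology C (Suc n)) =
        mod_ker (homology P n) (homology Q n) (homology_map Q \<phi> n)" using ex by simp
    ultimately have "z \<in> hmap P n (p n) ` carrier (homology C (Suc n))" by simp
    then show "z = \<zero>\<^bsub>homology P n\<^esub>"
      using triv[of "Suc n"] mod_hom_zero[OF hC hP hmap_hom[OF cC cP p_preserves]] by auto
  qed
  ultimately show ?thesis by (simp add: bij_betw_def)
qed

end

lemma mod_hom_inv_into:
  assumes "module R M" "f \<in> mod_hom R M N" "bij_betw f (carrier M) (carrier N)"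
  shows "inv_into (carrier M) f \<in> mod_hom R N M"
proof -
  interpret M: module R M by fact
  let ?g = "inv_into (carrier M) f"
  have inj: "inj_on f (carrier M)" and im: "carrier N = f ` carrier M"
    using assms(3) by (auto simp: bij_betw_def)
  have gf: "?g (f x) = x" if "x \<in> carrier M" for x using inj that by (rule inv_into_f_f)
  show ?thesis
    by (rule mod_homI)
      (auto simp: im gf mod_hom_add[OF assms(2), symmetric] mod_hom_smult[OF assms(2), symmetric])
qed

lemma exact_transfer:
  assumes "module R A" "module R B" "module R C" "module R C'"
    and "\<alpha> \<in> mod_hom R A B" "\<beta> \<in> mod_hom R B C" "c \<in> mod_hom R C C'"
    and "\<alpha> ` carrier A = mod_ker B C \<beta>"
    and "bij_betw a (carrier A) (carrier A')" "bij_betw b (carrier B) (carrier B')" 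
      "bij_betw c (carrier C) (carrier C')"
  shows "(\<lambda>x. b (\<alpha> (inv_into (carrier A) a x))) ` carrier A' =
    mod_ker B' C' (\<lambda>x. c (\<beta> (inv_into (carrier B) b x)))"
proof -
  have A': "carrier A' = a ` carrier A" and B': "carrier B' = b ` carrier B"
    and inja: "inj_on a (carrier A)" and injb: "inj_on b (carrier B)" and injc: "inj_on c (carrier C)"
    using assms(9-11) by (auto simp: bij_betw_def)
  have ga: "inv_into (carrier A) a (a x) = x" if "x \<in> carrier A" for x using inja that by (rule inv_into_f_f)
  have gb: "inv_into (carrier B) b (b x) = x" if "x \<in> carrier B" for x using injb that by (rule inv_into_f_f)
  have c0: "c z = \<zero>\<^bsub>C'\<^esub> \<longleftrightarrow> z = \<zero>\<^bsub>C\<^esub>" if "z \<in> carrier C" for z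
    using mod_hom_zero[OF assms(3,4,7)] inj_onD[OF injc, of z "\<zero>\<^bsub>C\<^esub>"] that
      submodule_zero[OF assms(3) module.carrier_is_submodule[OF assms(3)]] by auto
  have "(\<lambda>x. b (\<alpha> (inv_into (carrier A) a x))) ` carrier A' = b ` \<alpha> ` carrier A"
    unfolding A' image_image by (rule image_cong) (auto simp: ga)
  also have "\<dots> = b ` mod_ker B C \<beta>" using assms(8) by simp
  also have "\<dots> = mod_ker B' C' (\<lambda>x. c (\<beta> (inv_into (carrier B) b x)))"
    unfolding mod_ker_def B'
    using c0 mod_hom_closed[OF assms(6)] mod_hom_zero[OF assms(3,4,7)] by (auto simp: gb)
  finally show ?thesis .
qed

lemma long_exact_transfer:
  assumes "long_exact R A B C \<alpha> \<beta> \<delta>"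
    and "\<And>n. module R (A' n)" "\<And>n. module R (B' n)" "\<And>n. module R (C' n)"
    and "\<And>n. a n \<in> mod_hom R (A n) (A' n)" "\<And>n. b n \<in> mod_hom R (B n) (B' n)"
      "\<And>n. c n \<in> mod_hom R (C n) (C' n)"
    and "\<And>n. bij_betw (a n) (carrier (A n)) (carrier (A' n))"
      "\<And>n. bij_betw (b n) (carrier (B n)) (carrier (B' n))"
      "\<And>n. bij_betw (c n) (carrier (C n)) (carrier (C' n))"
  shows "long_exact R A' B' C' (\<lambda>n x. b n (\<alpha> n (inv_into (carrier (A n)) (a n) x)))
    (\<lambda>n x. c n (\<beta> n (inv_into (carrier (B n)) (b n) x)))
    (\<lambda>n x. a n (\<delta> n (inv_into (carrier (C (Suc n))) (c (Suc n)) x)))"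
proof -
  have modA: "module R (A n)" and modB: "module R (B n)" and modC: "module R (C n)"
    and \<alpha>: "\<alpha> n \<in> mod_hom R (A n) (B n)" and \<beta>: "\<beta> n \<in> mod_hom R (B n) (C n)"
    and \<delta>: "\<delta> n \<in> mod_hom R (C (Suc n)) (A n)"
    and exB: "\<alpha> n ` carrier (A n) = mod_ker (B n) (C n) (\<beta> n)"
    and exC: "\<beta> (Suc n) ` carrier (B (Suc n)) = mod_ker (C (Suc n)) (A n) (\<delta> n)"
    and exA: "\<delta> n ` carrier (C (Suc n)) = mod_ker (A n) (B n) (\<alpha> n)"
    and surj: "\<beta> 0 ` carrier (B 0) = carrier (C 0)" for n
    using assms(1) by (auto simp: long_exact_def)
  note inv = mod_hom_inv_into[OF modA assms(5,8)] mod_hom_inv_into[OF modB assms(6,9)]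
    mod_hom_inv_into[OF modC assms(7,10)]
  have "(\<lambda>x. c 0 (\<beta> 0 (inv_into (carrier (B 0)) (b 0) x))) ` carrier (B' 0) =
      c 0 ` \<beta> 0 ` inv_into (carrier (B 0)) (b 0) ` carrier (B' 0)" by (simp add: image_image)
  also have "inv_into (carrier (B 0)) (b 0) ` carrier (B' 0) = carrier (B 0)"
    using bij_betw_inv_into[OF assms(9)] by (simp add: bij_betw_def)
  also have "c 0 ` \<beta> 0 ` carrier (B 0) = carrier (C' 0)"
    using surj assms(10)[of 0] by (simp add: bij_betw_def)
  finally show ?thesis
    unfolding long_exact_def
    by (intro conjI allI assms(2-4) mod_hom_comp[OF mod_hom_comp[OF inv(1) \<alpha>] assms(6)]
        mod_hom_comp[OF mod_hom_comp[OF inv(2) \<beta>] assms(7)]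
        mod_hom_comp[OF mod_hom_comp[OF inv(3) \<delta>] assms(5)]
        exact_transfer[OF modA modB modC assms(4) \<alpha> \<beta> assms(7) exB assms(8-10)]
        exact_transfer[OF modB modC modA assms(2) \<beta> \<delta> assms(5) exC assms(9,10,8)]
        exact_transfer[OF modC modA modB assms(3) \<delta> \<alpha> assms(6) exA assms(10,8,9)])
qed

section \<open>Resolutions\<close>

definition eq_flat_resolution ::
    "('r, 'z) ring_scheme \<Rightarrow> ('r, 'x) module \<Rightarrow> ('r, 'f) chain_complex \<Rightarrow> ('f \<Rightarrow> 'x) \<Rightarrow> bool" where
  "eq_flat_resolution R X F \<epsilon> \<longleftrightarrow>
     module R X \<and> is_complex R F \<and> (\<forall>n. eq_flat R (obj F n)) \<and>
     \<epsilon> \<in> mod_hom R (obj F 0) X \<and> \<epsilon> ` carrier (obj F 0) = carrier X \<and>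
     boundaries F 0 = mod_ker (obj F 0) X \<epsilon> \<and> (\<forall>n. boundaries F (Suc n) = cycles F (Suc n))"

lemma eq_flat_resolutionD:
  assumes "eq_flat_resolution R X F \<epsilon>"
  shows "module R X" "is_complex R F" "eq_flat R (obj F n)" "\<epsilon> \<in> mod_hom R (obj F 0) X"
    "\<epsilon> ` carrier (obj F 0) = carrier X" "boundaries F 0 = mod_ker (obj F 0) X \<epsilon>"
    "boundaries F (Suc n) = cycles F (Suc n)"
  using assms by (simp_all add: eq_flat_resolution_def)

lemma flat_resolution_eq_flat:
  assumes "flat_resolution R X F \<epsilon>"
  shows "eq_flat_resolution R X F \<epsilon>"
proof -
  have F: "flat_module R (obj F n)" "diff F n \<in> mod_hom R (obj F (Suc n)) (obj F n)"
    "boundaries F (Suc n) = cycles F (Suc n)" for n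
    using assms by (simp_all add: flat_resolution_def)
  have ef: "eq_flat R (obj F n)" for n by (rule flat_module_eq_flat[OF F(1)])
  have "diff F n (diff F (Suc n) x) = \<zero>\<^bsub>obj F n\<^esub>" if "x \<in> carrier (obj F (Suc (Suc n)))" for n x
  proof -
    have "diff F (Suc n) x \<in> boundaries F (Suc n)" using that by (simp add: boundaries_def)
    then show ?thesis unfolding F(3) by (simp add: mod_ker_def)
  qed
  then have "is_complex R F" using F(2) eq_flat_module[OF ef] by (simp add: is_complex_def)
  then show ?thesis using assms ef unfolding eq_flat_resolution_def flat_resolution_def by simp
qed

lemma lifts_to_chain_map: "lifts_to R F \<epsilon> G \<eta> f \<phi> \<Longrightarrow> chain_map R F G \<phi>"
  by (simp add: lifts_to_def chain_map_def)

lemma lifts_to_augmentation: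
  "lifts_to R F \<epsilon> G \<eta> f \<phi> \<Longrightarrow> x \<in> carrier (obj F 0) \<Longrightarrow> \<eta> (\<phi> 0 x) = f (\<epsilon> x)"
  by (simp add: lifts_to_def)

lemma lifts_toI:
  "chain_map R F G \<phi> \<Longrightarrow> (\<And>x. x \<in> carrier (obj F 0) \<Longrightarrow> \<eta> (\<phi> 0 x) = f (\<epsilon> x)) \<Longrightarrow>
    lifts_to R F \<epsilon> G \<eta> f \<phi>"
  by (simp add: lifts_to_def chain_map_def)

lemma lifts_to_comp:
  assumes "lifts_to R F \<epsilon> G \<eta> f \<phi>" "lifts_to R G \<eta> H \<theta> g \<psi>"
  shows "lifts_to R F \<epsilon> H \<theta> (\<lambda>x. g (f x)) (\<lambda>n x. \<psi> n (\<phi> n x))"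
  by (rule lifts_toI[OF chain_map_comp[OF lifts_to_chain_map[OF assms(1)] lifts_to_chain_map[OF assms(2)]]])
    (simp add: lifts_to_augmentation[OF assms(1)] lifts_to_augmentation[OF assms(2)]
      mod_hom_closed[OF chain_mapD(1)[OF lifts_to_chain_map[OF assms(1)]]])

subsection \<open>Free resolutions in a single type\<close>

text \<open>
  All modules of a complex live in one type, but the kernel of a map of free modules on \<open>S\<close>
  consists of functions on \<open>S\<close>, so it cannot be used directly as the basis of the next module. The
  following type contains codes for all finitely supported functions on itself.
\<close>

datatype ('x, 'r) res_index = Leaf 'x | Node "('r \<times> ('x, 'r) res_index) list"

text \<open>The value on nodes is arbitrary, since the first basis consists of leaves.\<close>

fun leaf_val :: "('x, 'r) res_index \<Rightarrow> 'x" where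
  "leaf_val (Leaf x) = x"
| "leaf_val (Node l) = undefined"

definition encode :: "('r, 'z) ring_scheme \<Rightarrow> (('x, 'r) res_index \<Rightarrow> 'r) \<Rightarrow> ('x, 'r) res_index" where
  "encode R w = Node (SOME l. set l = {(w u, u) | u. w u \<noteq> \<zero>\<^bsub>R\<^esub>})"

definition decode :: "('r, 'z) ring_scheme \<Rightarrow> ('x, 'r) res_index \<Rightarrow> ('x, 'r) res_index \<Rightarrow> 'r" where
  "decode R = inv_into (carrier (free_module R UNIV)) (encode R)"

lemma inj_encode:
  fixes R :: "('r, 'z) ring_scheme"
  shows "inj_on (encode R) (carrier (free_module R (UNIV :: ('x, 'r) res_index set)))"
proof (rule inj_onI)
  fix v w :: "('x, 'r) res_index \<Rightarrow> 'r"
  let ?G = "\<lambda>w. {(w u, u) | u. w u \<noteq> \<zero>\<^bsub>R\<^esub>}"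
  assume vw: "v \<in> carrier (free_module R UNIV)" "w \<in> carrier (free_module R UNIV)" "encode R v = encode R w"
  \<comment> \<open>The list of the pairs \<open>(w u, u)\<close> with \<open>w u \<noteq> 0\<close> determines \<open>w\<close>.\<close>
  have ex: "set (SOME l. set l = ?G w) = ?G w" if "w \<in> carrier (free_module R UNIV)"
    for w :: "('x, 'r) res_index \<Rightarrow> 'r"
  proof (rule someI_ex)
    have "?G w = (\<lambda>u. (w u, u)) ` {u. w u \<noteq> \<zero>\<^bsub>R\<^esub>}" by auto
    moreover have "finite {u. w u \<noteq> \<zero>\<^bsub>R\<^esub>}" using that by (simp add: mem_free_module)
    ultimately have "finite (?G w)" by simp
    then show "\<exists>l. set l = ?G w" by (rule finite_list)
  qed
  have "(SOME l. set l = ?G v) = (SOME l. set l = ?G w)"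
    using vw(3) by (simp only: encode_def res_index.inject)
  then have "set (SOME l. set l = ?G v) = set (SOME l. set l = ?G w)" by (rule arg_cong)
  then have "?G v = ?G w" unfolding ex[OF vw(1)] ex[OF vw(2)] .
  then have *: "(a, u) \<in> ?G v \<longleftrightarrow> (a, u) \<in> ?G w" for a u by (rule arg_cong)
  have "v u = w u" for u
  proof (cases "v u = \<zero>\<^bsub>R\<^esub>")
    case True
    then show ?thesis using *[of "w u" u] by auto
  next
    case False
    then show ?thesis using *[of "v u" u] by auto
  qed
  then show "v = w" by (rule ext)
qed

lemma decode_encode:
  assumes "w \<in> carrier (free_module R S)"
  shows "decode R (encode R w) = w"
  unfolding decode_def by (rule inv_into_f_f[OF inj_encode free_module_mono[OF assms]]) simp

text \<open>
  The map from the free module on the codes of elements of \<open>R\<^sup>S\<close> that sends each basis element to the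
  element that it encodes.
\<close>

definition cover_diff ::
    "('r, 'z) ring_scheme \<Rightarrow> ('x, 'r) res_index set \<Rightarrow>
     (('x, 'r) res_index \<Rightarrow> 'r) \<Rightarrow> ('x, 'r) res_index \<Rightarrow> 'r" where
  "cover_diff R S = lin_ext R (free_module R S) (decode R)"

lemma cover_diff:
  assumes "cring R" "submodule K R (free_module R S)"
  shows "cover_diff R S \<in> mod_hom R (free_module R (encode R ` K)) (free_module R S)"
    and "cover_diff R S ` carrier (free_module R (encode R ` K)) = K"
proof -
  note modS = module_free_module[OF assms(1), of S]
  note modK = module_free_module[OF assms(1), of "encode R ` K"]
  interpret F: module R "free_module R (encode R ` K)" by fact
  have KS: "w \<in> carrier (free_module R S)" if "w \<in> K" for w
    by (rule submodule_in_carrier[OF modS assms(2) that])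
  have dec: "decode R (encode R w) = w" if "w \<in> K" for w by (rule decode_encode[OF KS[OF that]])
  show hom: "cover_diff R S \<in> mod_hom R (free_module R (encode R ` K)) (free_module R S)"
    unfolding cover_diff_def by (rule lin_ext_hom[OF modS]) (auto simp: dec KS)
  have gen: "cover_diff R S (free_gen R (encode R w)) = w" if "w \<in> K" for w
    unfolding cover_diff_def
    by (subst lin_ext_gen[OF modS]) (simp_all add: dec[OF that] KS[OF that])
  show "cover_diff R S ` carrier (free_module R (encode R ` K)) = K"
  proof
    show "K \<subseteq> cover_diff R S ` carrier (free_module R (encode R ` K))"
    proof
      fix w assume "w \<in> K"
      then show "w \<in> cover_diff R S ` carrier (free_module R (encode R ` K))"
        using gen[of w] free_gen_closed[OF assms(1), of "encode R w" "encode R ` K"] by force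
    qed
    have "cover_diff R S v \<in> K" if "v \<in> carrier (free_module R (encode R ` K))" for v
      using assms(1) that
    proof (induction v rule: free_module_induct)
      case zero
      then show ?case
        using mod_hom_zero[OF modK modS hom] submodule_zero[OF modS assms(2)] by simp
    next
      case (add v r s)
      have e: "free_gen R s \<in> carrier (free_module R (encode R ` K))"
        using free_gen_closed[OF assms(1) add.hyps(3)] .
      have "cover_diff R S (free_gen R s) \<in> K" using add.hyps(3) gen by auto
      then show ?case
        using add.IH mod_hom_add[OF hom add.hyps(1) F.smult_closed[OF add.hyps(2) e]]
          mod_hom_smult[OF hom add.hyps(2) e] module.submoduleE(4,5)[OF modS assms(2)] add.hyps(2)
        by (simp del: free_module_simps)
    qed
    then show "cover_diff R S ` carrier (free_module R (encode R ` K)) \<subseteq> K" by auto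
  qed
qed

text \<open>The basis of the \<open>n\<close>-th module, and the kernel of the map leaving that module.\<close>

primrec res_step ::
    "('r, 'z) ring_scheme \<Rightarrow> ('r, 'x) module \<Rightarrow> nat \<Rightarrow>
     ('x, 'r) res_index set \<times> (('x, 'r) res_index \<Rightarrow> 'r) set" where
  "res_step R X 0 = (Leaf ` carrier X,
     mod_ker (free_module R (Leaf ` carrier X)) X (lin_ext R X leaf_val))"
| "res_step R X (Suc n) = (let S = fst (res_step R X n); S' = encode R ` snd (res_step R X n) in
     (S', mod_ker (free_module R S') (free_module R S) (cover_diff R S)))"

definition free_res ::
    "('r, 'z) ring_scheme \<Rightarrow> ('r, 'x) module \<Rightarrow> ('r, ('x, 'r) res_index \<Rightarrow> 'r) chain_complex" where
  "free_res R X = \<lparr>obj = (\<lambda>n. free_module R (fst (res_step R X n))),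
     diff = (\<lambda>n. cover_diff R (fst (res_step R X n)))\<rparr>"

definition free_aug :: "('r, 'z) ring_scheme \<Rightarrow> ('r, 'x) module \<Rightarrow> (('x, 'r) res_index \<Rightarrow> 'r) \<Rightarrow> 'x" where
  "free_aug R X = lin_ext R X leaf_val"

lemma free_res_obj: "obj (free_res R X) n = free_module R (fst (res_step R X n))"
  by (simp add: free_res_def)

lemma free_res_resolution:
  assumes "module R X"
  shows "eq_flat_resolution R X (free_res R X) (free_aug R X)"
proof -
  interpret X: module R X by fact
  note R = X.R.cring_axioms
  note modF = module_free_module[OF R]
  let ?S = "\<lambda>n. fst (res_step R X n)" and ?K = "\<lambda>n. snd (res_step R X n)"
  have aug: "free_aug R X \<in> mod_hom R (free_module R (?S 0)) X"
    unfolding free_aug_def by (rule lin_ext_hom[OF assms]) auto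
  have K: "submodule (?K n) R (free_module R (?S n))" for n
  proof (induction n)
    case 0
    show ?case using submodule_ker[OF modF assms aug] by (simp add: free_aug_def)
  next
    case (Suc n)
    show ?case using submodule_ker[OF modF modF cover_diff(1)[OF R Suc]] by (simp add: Let_def)
  qed
  have S: "?S (Suc n) = encode R ` ?K n" for n by (simp add: Let_def)
  note d = cover_diff(1)[OF R K, folded S] and im = cover_diff(2)[OF R K, folded S]
  have KS: "?K (Suc n) = mod_ker (free_module R (?S (Suc n))) (free_module R (?S n)) (cover_diff R (?S n))" for n
    by (simp add: Let_def)
  have dd: "cover_diff R (?S n) (cover_diff R (?S (Suc n)) x) = (\<lambda>_. \<zero>\<^bsub>R\<^esub>)"
    if "x \<in> carrier (free_module R (?S (Suc (Suc n))))" for n x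
  proof -
    have "cover_diff R (?S (Suc n)) x \<in> ?K (Suc n)" using im[of "Suc n"] that by blast
    then show ?thesis unfolding KS by (simp add: mod_ker_def)
  qed
  have cx: "is_complex R (free_res R X)"
    unfolding is_complex_def using d dd by (simp add: free_res_def modF del: res_step.simps)
  have "free_aug R X ` carrier (free_module R (?S 0)) = carrier X"
  proof
    show "free_aug R X ` carrier (free_module R (?S 0)) \<subseteq> carrier X" using mod_hom_closed[OF aug] by auto
    show "carrier X \<subseteq> free_aug R X ` carrier (free_module R (?S 0))"
    proof
      fix x assume x: "x \<in> carrier X"
      have "free_aug R X (free_gen R (Leaf x)) = x"
        unfolding free_aug_def by (subst lin_ext_gen[OF assms]) (simp_all add: x)
      moreover have "free_gen R (Leaf x) \<in> carrier (free_module R (?S 0))"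
        by (rule free_gen_closed[OF R]) (simp add: x)
      ultimately show "x \<in> free_aug R X ` carrier (free_module R (?S 0))" by force
    qed
  qed
  moreover have "boundaries (free_res R X) 0 = mod_ker (free_module R (?S 0)) X (free_aug R X)"
    using im[of 0] by (simp add: boundaries_def free_res_def free_aug_def Let_def)
  moreover have "boundaries (free_res R X) (Suc n) = cycles (free_res R X) (Suc n)" for n
    using im[of "Suc n"] KS[of n] by (simp add: boundaries_def free_res_def del: res_step.simps)
  ultimately show ?thesis
    unfolding eq_flat_resolution_def
    using assms cx aug by (simp add: free_res_obj eq_flat_free_module[OF R] del: res_step.simps)
qed

subsection \<open>Lifting and homotopy\<close>

text \<open>
  Free modules are projective: the images of the basis can be lifted one by one.
\<close>

lemma free_module_lift:
  assumes "module R M" "module R N" "g \<in> mod_hom R M N" "h \<in> mod_hom R (free_module R S) N"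
    and "\<And>s. s \<in> S \<Longrightarrow> h (free_gen R s) \<in> g ` carrier M"
  shows "\<exists>\<phi>\<in>mod_hom R (free_module R S) M. \<forall>w\<in>carrier (free_module R S). g (\<phi> w) = h w"
proof -
  have "\<exists>t. \<forall>s\<in>S. t s \<in> carrier M \<and> g (t s) = h (free_gen R s)"
    using assms(5) by (intro bchoice) (metis imageE)
  then obtain t where t: "\<And>s. s \<in> S \<Longrightarrow> t s \<in> carrier M" "\<And>s. s \<in> S \<Longrightarrow> g (t s) = h (free_gen R s)"
    by auto
  have hom: "lin_ext R M t \<in> mod_hom R (free_module R S) M" by (rule lin_ext_hom[OF assms(1) t(1)])
  have "g (lin_ext R M t w) = h w" if "w \<in> carrier (free_module R S)" for w
    by (rule free_module_hom_eqI[OF assms(2) mod_hom_comp[OF hom assms(3)] assms(4) _ that])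
      (simp add: lin_ext_gen[OF assms(1)] t)
  then show ?thesis using hom by auto
qed

text \<open>
  The lift is constructed degree by degree. That \<open>\<phi>\<^sub>n\<close> maps boundaries to boundaries is what allows to
  lift \<open>\<phi>\<^sub>n \<circ> d\<close> along the differential of \<open>G\<close>, and it holds again for the next map because the
  cycles of \<open>G\<close> are boundaries.
\<close>

lemma free_res_lift:
  assumes "module R X" "eq_flat_resolution R Y G \<eta>" "f \<in> mod_hom R X Y"
  shows "\<exists>\<phi>. lifts_to R (free_res R X) (free_aug R X) G \<eta> f \<phi>"
proof -
  let ?P = "free_res R X" and ?\<pi> = "free_aug R X"
  note P = eq_flat_resolutionD[OF free_res_resolution[OF assms(1)]]
  note G = eq_flat_resolutionD[OF assms(2)]
  note cP = is_complexD[OF P(2)] and cG = is_complexD[OF G(2)]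
  let ?good = "\<lambda>n \<phi>. \<phi> \<in> mod_hom R (obj ?P n) (obj G n) \<and> (\<forall>x\<in>boundaries ?P n. \<phi> x \<in> boundaries G n) \<and>
    (n = 0 \<longrightarrow> (\<forall>x\<in>carrier (obj ?P 0). \<eta> (\<phi> x) = f (?\<pi> x)))"
  let ?rel = "\<lambda>n \<phi> \<phi>'. \<forall>x\<in>carrier (obj ?P (Suc n)). \<phi> (diff ?P n x) = diff G n (\<phi>' x)"
  have "\<exists>\<phi>. \<forall>n. ?good n (\<phi> n) \<and> ?rel n (\<phi> n) (\<phi> (Suc n))"
  proof (rule dependent_nat_choice)
    have h: "(\<lambda>x. f (?\<pi> x)) \<in> mod_hom R (obj ?P 0) Y" by (rule mod_hom_comp[OF P(4) assms(3)])
    have "\<exists>\<phi>\<in>mod_hom R (obj ?P 0) (obj G 0). \<forall>w\<in>carrier (obj ?P 0). \<eta> (\<phi> w) = f (?\<pi> w)"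
      unfolding free_res_obj
    proof (rule free_module_lift[OF cG(1) G(1) G(4) h[unfolded free_res_obj]])
      fix s assume "s \<in> fst (res_step R X 0)"
      then have "free_gen R s \<in> carrier (obj ?P 0)"
        unfolding free_res_obj by (rule free_gen_closed[OF module_cring[OF assms(1)]])
      then show "f (?\<pi> (free_gen R s)) \<in> \<eta> ` carrier (obj G 0)"
        unfolding G(5) by (rule mod_hom_closed[OF h])
    qed
    then obtain \<phi> where \<phi>: "\<phi> \<in> mod_hom R (obj ?P 0) (obj G 0)"
      "\<forall>w\<in>carrier (obj ?P 0). \<eta> (\<phi> w) = f (?\<pi> w)" by auto
    have "\<phi> x \<in> boundaries G 0" if "x \<in> boundaries ?P 0" for x
      using that \<phi> mod_hom_closed[OF \<phi>(1)] mod_hom_zero[OF assms(1) G(1) assms(3)]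
      unfolding P(6) G(6) by (simp add: mod_ker_def)
    then show "\<exists>\<phi>. ?good 0 \<phi>" using \<phi> by auto
  next
    fix \<phi> n assume \<phi>: "?good n \<phi>"
    have h: "(\<lambda>x. \<phi> (diff ?P n x)) \<in> mod_hom R (obj ?P (Suc n)) (obj G n)"
      using mod_hom_comp[OF cP(2)] \<phi> by auto
    have "\<exists>\<psi>\<in>mod_hom R (obj ?P (Suc n)) (obj G (Suc n)).
        \<forall>w\<in>carrier (obj ?P (Suc n)). diff G n (\<psi> w) = \<phi> (diff ?P n w)"
      unfolding free_res_obj[of R X "Suc n"]
    proof (rule free_module_lift[OF cG(1) cG(1) cG(2) h[unfolded free_res_obj[of R X "Suc n"]]])
      fix s assume "s \<in> fst (res_step R X (Suc n))"
      then have "free_gen R s \<in> carrier (obj ?P (Suc n))"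
        unfolding free_res_obj by (rule free_gen_closed[OF module_cring[OF assms(1)]])
      then have "diff ?P n (free_gen R s) \<in> boundaries ?P n" by (simp add: boundaries_def)
      moreover have "\<forall>x\<in>boundaries ?P n. \<phi> x \<in> boundaries G n" using \<phi> by simp
      ultimately have "\<phi> (diff ?P n (free_gen R s)) \<in> boundaries G n" by simp
      then show "\<phi> (diff ?P n (free_gen R s)) \<in> diff G n ` carrier (obj G (Suc n))"
        by (simp only: boundaries_def)
    qed
    then obtain \<psi> where \<psi>: "\<psi> \<in> mod_hom R (obj ?P (Suc n)) (obj G (Suc n))"
      "\<forall>w\<in>carrier (obj ?P (Suc n)). diff G n (\<psi> w) = \<phi> (diff ?P n w)" by auto
    have "\<psi> x \<in> boundaries G (Suc n)" if x: "x \<in> boundaries ?P (Suc n)" for x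
    proof -
      have "x \<in> carrier (obj ?P (Suc n))" "diff ?P n x = \<zero>\<^bsub>obj ?P n\<^esub>"
        using x unfolding P(7) by (auto simp: mod_ker_def)
      then show ?thesis unfolding G(7)
        using \<psi> \<phi> mod_hom_closed[OF \<psi>(1)] mod_hom_zero[OF cP(1) cG(1), of \<phi> n n]
        by (simp add: mod_ker_def)
    qed
    then show "\<exists>\<psi>. ?good (Suc n) \<psi> \<and> ?rel n \<phi> \<psi>" using \<psi> by auto
  qed
  then obtain \<phi> where "\<forall>n. ?good n (\<phi> n) \<and> ?rel n (\<phi> n) (\<phi> (Suc n))" ..
  then show ?thesis unfolding lifts_to_def by (intro exI[of _ \<phi>]) simp
qed

text \<open>
  The invariant of the construction is that \<open>\<phi>\<^sub>n - \<psi>\<^sub>n - d h\<^sub>n\<close> vanishes on boundaries. Then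
  \<open>\<phi>\<^sub>n\<^sub>+\<^sub>1 - \<psi>\<^sub>n\<^sub>+\<^sub>1 - h\<^sub>n d\<close> takes values in the cycles of \<open>G\<close>, which are boundaries, and lifts to \<open>h\<^sub>n\<^sub>+\<^sub>1\<close>.
\<close>

lemma free_res_homotopic:
  assumes "module R X" "eq_flat_resolution R Y G \<eta>"
    and "lifts_to R (free_res R X) (free_aug R X) G \<eta> f \<phi>"
    and "lifts_to R (free_res R X) (free_aug R X) G \<eta> f \<psi>"
  shows "homotopic R (free_res R X) G \<phi> \<psi>"
proof -
  let ?P = "free_res R X" and ?\<pi> = "free_aug R X"
  note P = eq_flat_resolutionD[OF free_res_resolution[OF assms(1)]]
  note G = eq_flat_resolutionD[OF assms(2)]
  note cP = is_complexD[OF P(2)] and cG = is_complexD[OF G(2)]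
  note \<phi> = chain_mapD[OF lifts_to_chain_map[OF assms(3)]] and \<psi> = chain_mapD[OF lifts_to_chain_map[OF assms(4)]]
  interpret G: module R "obj G n" for n by (rule cG(1))
  have gen: "free_gen R s \<in> carrier (obj ?P n)" if "s \<in> fst (res_step R X n)" for s n
    unfolding free_res_obj by (rule free_gen_closed[OF module_cring[OF assms(1)] that])
  have move: "a = b \<oplus>\<^bsub>obj G n\<^esub> c" if "c = a \<ominus>\<^bsub>obj G n\<^esub> b" "a \<in> carrier (obj G n)" "b \<in> carrier (obj G n)"
    for a b c n
    using that by (simp add: a_minus_def G.add.m_comm[of b] G.add.m_assoc G.l_neg)
  let ?good = "\<lambda>n h. h \<in> mod_hom R (obj ?P n) (obj G (Suc n)) \<and>
    (\<forall>x\<in>boundaries ?P n. \<phi> n x = \<psi> n x \<oplus>\<^bsub>obj G n\<^esub> diff G n (h x)) \<and>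
    (n = 0 \<longrightarrow> (\<forall>x\<in>carrier (obj ?P 0). \<phi> 0 x = \<psi> 0 x \<oplus>\<^bsub>obj G 0\<^esub> diff G 0 (h x)))"
  let ?rel = "\<lambda>n h h'. \<forall>x\<in>carrier (obj ?P (Suc n)). \<phi> (Suc n) x = \<psi> (Suc n) x \<oplus>\<^bsub>obj G (Suc n)\<^esub>
        (diff G (Suc n) (h' x) \<oplus>\<^bsub>obj G (Suc n)\<^esub> h (diff ?P n x))"
  have "\<exists>h. \<forall>n. ?good n (h n) \<and> ?rel n (h n) (h (Suc n))"
  proof (rule dependent_nat_choice)
    have h: "(\<lambda>x. \<phi> 0 x \<ominus>\<^bsub>obj G 0\<^esub> \<psi> 0 x) \<in> mod_hom R (obj ?P 0) (obj G 0)"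
      by (rule mod_hom_minus[OF cG(1) \<phi>(1) \<psi>(1)])
    have "\<exists>h\<in>mod_hom R (obj ?P 0) (obj G (Suc 0)).
        \<forall>w\<in>carrier (obj ?P 0). diff G 0 (h w) = \<phi> 0 w \<ominus>\<^bsub>obj G 0\<^esub> \<psi> 0 w"
      unfolding free_res_obj
    proof (rule free_module_lift[OF cG(1) cG(1) cG(2) h[unfolded free_res_obj]])
      fix s assume "s \<in> fst (res_step R X 0)"
      note e = gen[OF this]
      have cl: "\<phi> 0 (free_gen R s) \<in> carrier (obj G 0)" "\<psi> 0 (free_gen R s) \<in> carrier (obj G 0)"
        using mod_hom_closed[OF \<phi>(1) e] mod_hom_closed[OF \<psi>(1) e] .
      interpret Y: module R Y by (rule G(1))
      have "\<eta> (\<phi> 0 (free_gen R s) \<ominus>\<^bsub>obj G 0\<^esub> \<psi> 0 (free_gen R s)) = \<zero>\<^bsub>Y\<^esub>"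
        using cl mod_hom_diff[OF cG(1) G(1) G(4) cl] mod_hom_closed[OF G(4)]
          lifts_to_augmentation[OF assms(3) e] lifts_to_augmentation[OF assms(4) e]
        by (metis Y.r_neg a_minus_def)
      then have "\<phi> 0 (free_gen R s) \<ominus>\<^bsub>obj G 0\<^esub> \<psi> 0 (free_gen R s) \<in> boundaries G 0"
        unfolding G(6) using cl by (simp add: mod_ker_def)
      then show "\<phi> 0 (free_gen R s) \<ominus>\<^bsub>obj G 0\<^esub> \<psi> 0 (free_gen R s) \<in> diff G 0 ` carrier (obj G (Suc 0))"
        by (simp add: boundaries_def)
    qed
    then obtain h where h: "h \<in> mod_hom R (obj ?P 0) (obj G (Suc 0))"
      "\<forall>w\<in>carrier (obj ?P 0). diff G 0 (h w) = \<phi> 0 w \<ominus>\<^bsub>obj G 0\<^esub> \<psi> 0 w" by auto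
    have "\<phi> 0 x = \<psi> 0 x \<oplus>\<^bsub>obj G 0\<^esub> diff G 0 (h x)" if "x \<in> carrier (obj ?P 0)" for x
      by (rule move) (use h that mod_hom_closed[OF \<phi>(1) that] mod_hom_closed[OF \<psi>(1) that] in auto)
    moreover have "boundaries ?P 0 \<subseteq> carrier (obj ?P 0)" unfolding P(6) by (auto simp: mod_ker_def)
    ultimately show "\<exists>h. ?good 0 h" using h(1) by (intro exI[of _ h]) auto
  next
    fix h n assume h: "?good n h"
    let ?\<chi> = "\<lambda>x. \<phi> (Suc n) x \<ominus>\<^bsub>obj G (Suc n)\<^esub> \<psi> (Suc n) x \<ominus>\<^bsub>obj G (Suc n)\<^esub> h (diff ?P n x)"
    have hd: "(\<lambda>x. h (diff ?P n x)) \<in> mod_hom R (obj ?P (Suc n)) (obj G (Suc n))"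
      using mod_hom_comp[OF cP(2)] h by auto
    have \<chi>: "?\<chi> \<in> mod_hom R (obj ?P (Suc n)) (obj G (Suc n))"
      by (rule mod_hom_minus[OF cG(1) mod_hom_minus[OF cG(1) \<phi>(1) \<psi>(1)] hd])
    have "\<exists>h'\<in>mod_hom R (obj ?P (Suc n)) (obj G (Suc (Suc n))).
        \<forall>w\<in>carrier (obj ?P (Suc n)). diff G (Suc n) (h' w) = ?\<chi> w"
      unfolding free_res_obj[of R X "Suc n"]
    proof (rule free_module_lift[OF cG(1) cG(1) cG(2) \<chi>[unfolded free_res_obj[of R X "Suc n"]]])
      fix s assume "s \<in> fst (res_step R X (Suc n))"
      note e = gen[OF this]
      let ?e = "free_gen R s"
      have cl: "\<phi> (Suc n) ?e \<in> carrier (obj G (Suc n))" "\<psi> (Suc n) ?e \<in> carrier (obj G (Suc n))"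
        "h (diff ?P n ?e) \<in> carrier (obj G (Suc n))"
        using mod_hom_closed[OF \<phi>(1) e] mod_hom_closed[OF \<psi>(1) e] mod_hom_closed[OF hd e] .
      have de: "diff ?P n ?e \<in> boundaries ?P n" using e by (simp add: boundaries_def)
      then have deP: "diff ?P n ?e \<in> carrier (obj ?P n)"
        using mod_hom_closed[OF cP(2) e] by simp
      have "diff G n (?\<chi> ?e) = \<phi> n (diff ?P n ?e) \<ominus>\<^bsub>obj G n\<^esub> \<psi> n (diff ?P n ?e)
          \<ominus>\<^bsub>obj G n\<^esub> diff G n (h (diff ?P n ?e))"
        using cl by (simp add: mod_hom_diff[OF cG(1,1,2)] \<phi>(2)[OF e] \<psi>(2)[OF e])
      also have "\<dots> = \<zero>\<^bsub>obj G n\<^esub>"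
      proof -
        have *: "\<phi> n (diff ?P n ?e) = \<psi> n (diff ?P n ?e) \<oplus>\<^bsub>obj G n\<^esub> diff G n (h (diff ?P n ?e))"
          using h de by auto
        have c: "\<psi> n (diff ?P n ?e) \<in> carrier (obj G n)" "diff G n (h (diff ?P n ?e)) \<in> carrier (obj G n)"
          using mod_hom_closed[OF \<psi>(1) deP] mod_hom_closed[OF cG(2) cl(3)] .
        show ?thesis unfolding * using c
          by (simp add: a_minus_def G.add.m_comm[of "\<psi> n (diff ?P n ?e)"] G.add.m_assoc G.r_neg)
      qed
      finally have "?\<chi> ?e \<in> boundaries G (Suc n)"
        unfolding G(7) using mod_hom_closed[OF \<chi> e] by (simp add: mod_ker_def)
      then show "?\<chi> ?e \<in> diff G (Suc n) ` carrier (obj G (Suc (Suc n)))" by (simp add: boundaries_def)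
    qed
    then obtain h' where h': "h' \<in> mod_hom R (obj ?P (Suc n)) (obj G (Suc (Suc n)))"
      "\<forall>w\<in>carrier (obj ?P (Suc n)). diff G (Suc n) (h' w) = ?\<chi> w" by auto
    have rel: "\<phi> (Suc n) x = \<psi> (Suc n) x \<oplus>\<^bsub>obj G (Suc n)\<^esub>
        (diff G (Suc n) (h' x) \<oplus>\<^bsub>obj G (Suc n)\<^esub> h (diff ?P n x))"
      if x: "x \<in> carrier (obj ?P (Suc n))" for x
    proof -
      have cl: "\<phi> (Suc n) x \<in> carrier (obj G (Suc n))" "\<psi> (Suc n) x \<in> carrier (obj G (Suc n))"
        "h (diff ?P n x) \<in> carrier (obj G (Suc n))"
        using mod_hom_closed[OF \<phi>(1) x] mod_hom_closed[OF \<psi>(1) x] mod_hom_closed[OF hd x] .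
      have "diff G (Suc n) (h' x) \<oplus>\<^bsub>obj G (Suc n)\<^esub> h (diff ?P n x) =
          \<phi> (Suc n) x \<ominus>\<^bsub>obj G (Suc n)\<^esub> \<psi> (Suc n) x"
        using h'(2) x cl by (simp add: a_minus_def G.add.m_assoc G.l_neg)
      then show ?thesis by (intro move cl)
    qed
    have "\<phi> (Suc n) x = \<psi> (Suc n) x \<oplus>\<^bsub>obj G (Suc n)\<^esub> diff G (Suc n) (h' x)"
      if "x \<in> boundaries ?P (Suc n)" for x
    proof -
      have x: "x \<in> carrier (obj ?P (Suc n))" "diff ?P n x = \<zero>\<^bsub>obj ?P n\<^esub>"
        using that unfolding P(7) by (auto simp: mod_ker_def)
      have "h (diff ?P n x) = \<zero>\<^bsub>obj G (Suc n)\<^esub>"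
        using x(2) h mod_hom_zero[OF cP(1) cG(1), of h n "Suc n"] by simp
      then show ?thesis
        using rel[OF x(1)] mod_hom_closed[OF cG(2) mod_hom_closed[OF h'(1) x(1)]] by simp
    qed
    then show "\<exists>h'. ?good (Suc n) h' \<and> ?rel n h h'" using h'(1) rel by (intro exI[of _ h']) auto
  qed
  then obtain h where "\<forall>n. ?good n (h n) \<and> ?rel n (h n) (h (Suc n))" ..
  then show ?thesis unfolding homotopic_def by (intro exI[of _ h]) simp
qed

subsection \<open>The cone of a map of resolutions\<close>

text \<open>
  The first summand in degree zero is the zero submodule of \<open>P\<^sub>0\<close>, so that all modules of the cone have
  the same type.
\<close>

definition cone_cx ::
    "('r, 'p) chain_complex \<Rightarrow> ('r, 'q) chain_complex \<Rightarrow> (nat \<Rightarrow> 'p \<Rightarrow> 'q) \<Rightarrow>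
     ('r, 'p \<times> 'q) chain_complex" where
  "cone_cx P Q \<phi> = \<lparr>obj = (\<lambda>n. case n of
       0 \<Rightarrow> dsum ((obj P 0)\<lparr>carrier := {\<zero>\<^bsub>obj P 0\<^esub>}\<rparr>) (obj Q 0)
     | Suc m \<Rightarrow> dsum (obj P m) (obj Q (Suc m))),
     diff = (\<lambda>n (x, y). (case n of 0 \<Rightarrow> \<zero>\<^bsub>obj P 0\<^esub> | Suc m \<Rightarrow> \<ominus>\<^bsub>obj P m\<^esub> diff P m x,
       \<phi> n x \<oplus>\<^bsub>obj Q n\<^esub> diff Q n y))\<rparr>"

definition cone_in :: "('r, 'p) chain_complex \<Rightarrow> nat \<Rightarrow> 'q \<Rightarrow> 'p \<times> 'q" where
  "cone_in P n y = (case n of 0 \<Rightarrow> \<zero>\<^bsub>obj P 0\<^esub> | Suc m \<Rightarrow> \<zero>\<^bsub>obj P m\<^esub>, y)"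

lemma cone_cx_simps [simp]:
  "obj (cone_cx P Q \<phi>) 0 = dsum ((obj P 0)\<lparr>carrier := {\<zero>\<^bsub>obj P 0\<^esub>}\<rparr>) (obj Q 0)"
  "obj (cone_cx P Q \<phi>) (Suc m) = dsum (obj P m) (obj Q (Suc m))"
  "diff (cone_cx P Q \<phi>) 0 = (\<lambda>(x, y). (\<zero>\<^bsub>obj P 0\<^esub>, \<phi> 0 x \<oplus>\<^bsub>obj Q 0\<^esub> diff Q 0 y))"
  "diff (cone_cx P Q \<phi>) (Suc m) =
     (\<lambda>(x, y). (\<ominus>\<^bsub>obj P m\<^esub> diff P m x, \<phi> (Suc m) x \<oplus>\<^bsub>obj Q (Suc m)\<^esub> diff Q (Suc m) y))"
  by (simp_all add: cone_cx_def)

lemma cone_in_simps [simp]: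
  "cone_in P 0 y = (\<zero>\<^bsub>obj P 0\<^esub>, y)" "cone_in P (Suc m) y = (\<zero>\<^bsub>obj P m\<^esub>, y)"
  by (simp_all add: cone_in_def)

lemma is_complex_cone_cx:
  assumes "is_complex R P" "is_complex R Q" "chain_map R P Q \<phi>"
  shows "is_complex R (cone_cx P Q \<phi>)"
proof -
  note P = is_complexD[OF assms(1)] and Q = is_complexD[OF assms(2)] and \<phi> = chain_mapD[OF assms(3)]
  interpret P: module R "obj P n" for n by (rule P(1))
  interpret Q: module R "obj Q n" for n by (rule Q(1))
  note closed = mod_hom_closed[OF P(2)] mod_hom_closed[OF Q(2)] mod_hom_closed[OF \<phi>(1)]
  note add = mod_hom_add[OF P(2)] mod_hom_add[OF Q(2)] mod_hom_add[OF \<phi>(1)]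
  note smult = mod_hom_smult[OF P(2)] mod_hom_smult[OF Q(2)] mod_hom_smult[OF \<phi>(1)]
  note neg = mod_hom_neg[OF P(1,1,2)] mod_hom_neg[OF P(1) Q(1) \<phi>(1)]
  have obj: "module R (obj (cone_cx P Q \<phi>) n)" for n
    by (cases n) (auto intro!: module_dsum P(1) Q(1)
        submodule_module[OF P(1) submodule_singleton_zero[OF P(1)]])
  have hom: "diff (cone_cx P Q \<phi>) n \<in> mod_hom R (obj (cone_cx P Q \<phi>) (Suc n)) (obj (cone_cx P Q \<phi>) n)" for n
    by (cases n) (auto intro!: mod_homI simp: closed add smult Q.smult_r_distr P.smult_r_minus P.minus_add
        Q.add.m_assoc Q.add.m_lcomm)
  have "diff (cone_cx P Q \<phi>) n (diff (cone_cx P Q \<phi>) (Suc n) c) = \<zero>\<^bsub>obj (cone_cx P Q \<phi>) n\<^esub>"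
    if c0: "c \<in> carrier (obj (cone_cx P Q \<phi>) (Suc (Suc n)))" for c n
  proof -
    obtain x y where c: "c = (x, y)" "x \<in> carrier (obj P (Suc n))" "y \<in> carrier (obj Q (Suc (Suc n)))"
      using c0 by (cases c) auto
    have "\<phi> n (\<ominus>\<^bsub>obj P n\<^esub> diff P n x) \<oplus>\<^bsub>obj Q n\<^esub>
        diff Q n (\<phi> (Suc n) x \<oplus>\<^bsub>obj Q (Suc n)\<^esub> diff Q (Suc n) y) = \<zero>\<^bsub>obj Q n\<^esub>"
      using c by (simp add: closed add neg \<phi>(2) Q(3) Q.l_neg)
    then show ?thesis using c P(3)[of x] by (cases n) (simp_all add: neg closed P(3))
  qed
  then show ?thesis using obj hom by (simp only: is_complex_def) blast
qed

lemma cone_cx_cone: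
  assumes "is_complex R P" "is_complex R Q" "chain_map R P Q \<phi>"
  shows "cone R P Q (cone_cx P Q \<phi>) \<phi> (cone_in P) (\<lambda>n x. (x, \<zero>\<^bsub>obj Q (Suc n)\<^esub>)) (\<lambda>_. fst) (\<lambda>_. snd)"
proof -
  note P = is_complexD[OF assms(1)] and Q = is_complexD[OF assms(2)] and \<phi> = chain_mapD[OF assms(3)]
  interpret P: module R "obj P n" for n by (rule P(1))
  interpret Q: module R "obj Q n" for n by (rule Q(1))
  note closed = mod_hom_closed[OF P(2)] mod_hom_closed[OF Q(2)] mod_hom_closed[OF \<phi>(1)]
  note zero = mod_hom_zero[OF P(1,1,2)] mod_hom_zero[OF Q(1,1,2)] mod_hom_zero[OF P(1) Q(1) \<phi>(1)]
  note Z = submodule_module[OF P(1) submodule_singleton_zero[OF P(1)]]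
  show ?thesis
  proof
    show "cone_in P n \<in> mod_hom R (obj Q n) (obj (cone_cx P Q \<phi>) n)" for n
      using dsum_homs(4)[OF Z Q(1)] dsum_homs(4)[OF P(1) Q(1)] by (cases n) (simp_all add: mod_hom_def Pi_iff)
    show "snd \<in> mod_hom R (obj (cone_cx P Q \<phi>) n) (obj Q n)" for n
      using dsum_homs(2)[OF Z Q(1)] dsum_homs(2)[OF P(1) Q(1)] by (cases n) simp_all
    show "(\<lambda>x. (x, \<zero>\<^bsub>obj Q (Suc n)\<^esub>)) \<in> mod_hom R (obj P n) (obj (cone_cx P Q \<phi>) (Suc n))" for n
      using dsum_homs(3)[OF P(1) Q(1)] by simp
    show "fst \<in> mod_hom R (obj (cone_cx P Q \<phi>) (Suc n)) (obj P n)" for n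
      using dsum_homs(1)[OF P(1) Q(1)] by simp
    show "diff (cone_cx P Q \<phi>) n (cone_in P (Suc n) y) = cone_in P n (diff Q n y)"
      if "y \<in> carrier (obj Q (Suc n))" for y n
      using that by (cases n) (simp_all add: zero closed)
    show "snd (cone_in P n y) = y" for y :: 'd and n by (cases n) simp_all
  qed (use assms is_complex_cone_cx[OF assms] in \<open>auto simp: zero closed P.l_neg\<close>)
qed

lemma eq_flat_cone_cx:
  assumes "\<And>n. eq_flat R (obj P n)" "\<And>n. eq_flat R (obj Q n)"
  shows "eq_flat R (obj (cone_cx P Q \<phi>) n)"
  by (cases n) (auto intro!: eq_flat_dsum assms eq_flat_zero eq_flat_module[OF assms(1)])

text \<open>
  The homology of the cone of a lift of \<open>f\<close> is the kernel of \<open>f\<close> in degree one, its cokernel in degree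
  zero, and zero elsewhere; here \<open>f\<close> is injective.
\<close>

lemma cone_cx_exact:
  assumes "eq_flat_resolution R X P \<pi>" "eq_flat_resolution R Y Q \<eta>"
    and "f \<in> mod_hom R X Y" "inj_on f (carrier X)" "lifts_to R P \<pi> Q \<eta> f \<phi>"
  shows "boundaries (cone_cx P Q \<phi>) (Suc n) = cycles (cone_cx P Q \<phi>) (Suc n)"
    and "boundaries (cone_cx P Q \<phi>) 0 =
      {c \<in> carrier (obj (cone_cx P Q \<phi>) 0). \<eta> (snd c) \<in> f ` carrier X}"
proof -
  note rP = eq_flat_resolutionD[OF assms(1)] and rQ = eq_flat_resolutionD[OF assms(2)]
  note P = is_complexD[OF rP(2)] and Q = is_complexD[OF rQ(2)]
  note chain = lifts_to_chain_map[OF assms(5)] and aug = lifts_to_augmentation[OF assms(5)]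
  note \<phi> = chain_mapD[OF chain]
  interpret P: module R "obj P n" for n by (rule P(1))
  interpret Q: module R "obj Q n" for n by (rule Q(1))
  interpret X: module R X by (rule rP(1))
  interpret Y: module R Y by (rule rQ(1))
  note closed = mod_hom_closed[OF P(2)] mod_hom_closed[OF Q(2)] mod_hom_closed[OF \<phi>(1)]
  note cx = is_complex_cone_cx[OF rP(2) rQ(2) chain]
  have lift: "\<exists>x'\<in>carrier (obj P (Suc n)). \<exists>y'\<in>carrier (obj Q (Suc (Suc n))).
      x = \<ominus>\<^bsub>obj P n\<^esub> diff P n x' \<and> y = \<phi> (Suc n) x' \<oplus>\<^bsub>obj Q (Suc n)\<^esub> diff Q (Suc n) y'"
    if x: "x \<in> boundaries P n" and y: "y \<in> carrier (obj Q (Suc n))"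
      and eq: "\<phi> n x \<oplus>\<^bsub>obj Q n\<^esub> diff Q n y = \<zero>\<^bsub>obj Q n\<^esub>" for x y n
  proof -
    obtain z where z: "z \<in> carrier (obj P (Suc n))" "x = diff P n z" using x by (auto simp: boundaries_def)
    have "diff Q n (\<phi> (Suc n) z \<oplus>\<^bsub>obj Q (Suc n)\<^esub> y) = \<zero>\<^bsub>obj Q n\<^esub>"
      using eq z y \<phi>(2)[OF z(1)] by (simp add: mod_hom_add[OF Q(2)] closed)
    then have "\<phi> (Suc n) z \<oplus>\<^bsub>obj Q (Suc n)\<^esub> y \<in> boundaries Q (Suc n)"
      unfolding rQ(7) using z y by (simp add: mod_ker_def closed)
    then obtain y' where y': "y' \<in> carrier (obj Q (Suc (Suc n)))"
      "\<phi> (Suc n) z \<oplus>\<^bsub>obj Q (Suc n)\<^esub> y = diff Q (Suc n) y'" by (auto simp: boundaries_def)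
    have "\<phi> (Suc n) (\<ominus>\<^bsub>obj P (Suc n)\<^esub> z) \<oplus>\<^bsub>obj Q (Suc n)\<^esub> diff Q (Suc n) y' = y"
      using z y by (simp add: y'(2)[symmetric] mod_hom_neg[OF P(1) Q(1) \<phi>(1)] closed
          Q.add.m_assoc[symmetric] Q.l_neg)
    moreover have "x = \<ominus>\<^bsub>obj P n\<^esub> diff P n (\<ominus>\<^bsub>obj P (Suc n)\<^esub> z)"
      using z by (simp add: mod_hom_neg[OF P(1,1,2)] closed)
    ultimately show ?thesis using z(1) y'(1) by (metis P.a_inv_closed)
  qed
  have "cycles (cone_cx P Q \<phi>) (Suc n) \<subseteq> boundaries (cone_cx P Q \<phi>) (Suc n)" for n
  proof
    fix c assume "c \<in> cycles (cone_cx P Q \<phi>) (Suc n)"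
    then obtain x y where c: "c = (x, y)" "x \<in> carrier (obj P n)" "y \<in> carrier (obj Q (Suc n))"
      "diff (cone_cx P Q \<phi>) n (x, y) = \<zero>\<^bsub>obj (cone_cx P Q \<phi>) n\<^esub>" by (auto simp: mod_ker_def)
    have eq: "\<phi> n x \<oplus>\<^bsub>obj Q n\<^esub> diff Q n y = \<zero>\<^bsub>obj Q n\<^esub>" using c(4) by (cases n) simp_all
    have "x \<in> boundaries P n"
    proof (cases n)
      case 0
      have "diff Q 0 y \<in> boundaries Q 0" using c(3) 0 by (auto simp: boundaries_def)
      then have y0: "\<eta> (diff Q 0 y) = \<zero>\<^bsub>Y\<^esub>" "diff Q 0 y \<in> carrier (obj Q 0)"
        unfolding rQ(6) by (auto simp: mod_ker_def)
      have xP: "x \<in> carrier (obj P 0)" using c(2) 0 by simp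
      note cl = mod_hom_closed[OF \<phi>(1) xP] mod_hom_closed[OF rP(4) xP]
      have "\<eta> (\<phi> 0 x \<oplus>\<^bsub>obj Q 0\<^esub> diff Q 0 y) = \<zero>\<^bsub>Y\<^esub>"
        using eq 0 mod_hom_zero[OF Q(1) rQ(1,4)] by simp
      then have "f (\<pi> x) = f \<zero>\<^bsub>X\<^esub>"
        using aug[OF xP] mod_hom_add[OF rQ(4) cl(1) y0(2)] y0(1) mod_hom_closed[OF rQ(4) cl(1)]
          mod_hom_zero[OF rP(1) rQ(1) assms(3)] by simp
      then have "\<pi> x = \<zero>\<^bsub>X\<^esub>" using inj_onD[OF assms(4)] cl(2) by blast
      then show ?thesis unfolding 0 rP(6) using xP by (simp add: mod_ker_def)
    next
      case (Suc m)
      then have "diff P m x = \<zero>\<^bsub>obj P m\<^esub>" using c(2,4) by (simp add: closed)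
      then show ?thesis unfolding Suc rP(7) using c(2) Suc by (simp add: mod_ker_def)
    qed
    from lift[OF this c(3) eq] obtain x' y' where
      xy: "x' \<in> carrier (obj P (Suc n))" "y' \<in> carrier (obj Q (Suc (Suc n)))"
      "x = \<ominus>\<^bsub>obj P n\<^esub> diff P n x'" "y = \<phi> (Suc n) x' \<oplus>\<^bsub>obj Q (Suc n)\<^esub> diff Q (Suc n) y'" by auto
    then have "c = diff (cone_cx P Q \<phi>) (Suc n) (x', y')" using c(1) by simp
    then show "c \<in> boundaries (cone_cx P Q \<phi>) (Suc n)"
      unfolding boundaries_def using xy(1,2) by (intro image_eqI[of _ _ "(x', y')"]) simp_all
  qed
  then show "boundaries (cone_cx P Q \<phi>) (Suc n) = cycles (cone_cx P Q \<phi>) (Suc n)"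
    using boundaries_cycles[OF cx, of "Suc n"] by (rule equalityI[rotated])
  show "boundaries (cone_cx P Q \<phi>) 0 = {c \<in> carrier (obj (cone_cx P Q \<phi>) 0). \<eta> (snd c) \<in> f ` carrier X}"
  proof
    show "boundaries (cone_cx P Q \<phi>) 0 \<subseteq>
        {c \<in> carrier (obj (cone_cx P Q \<phi>) 0). \<eta> (snd c) \<in> f ` carrier X}"
    proof
      fix c assume "c \<in> boundaries (cone_cx P Q \<phi>) 0"
      then obtain x y where xy: "x \<in> carrier (obj P 0)" "y \<in> carrier (obj Q (Suc 0))"
        "c = (\<zero>\<^bsub>obj P 0\<^esub>, \<phi> 0 x \<oplus>\<^bsub>obj Q 0\<^esub> diff Q 0 y)" by (auto simp: boundaries_def)
      have "diff Q 0 y \<in> boundaries Q 0" using xy(2) by (auto simp: boundaries_def)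
      then have y0: "\<eta> (diff Q 0 y) = \<zero>\<^bsub>Y\<^esub>" unfolding rQ(6) by (auto simp: mod_ker_def)
      have "\<eta> (snd c) = f (\<pi> x)"
        using xy y0 aug[OF xy(1)] mod_hom_closed[OF assms(3)] mod_hom_closed[OF rP(4) xy(1)]
        by (simp add: mod_hom_add[OF rQ(4)] closed)
      then show "c \<in> {c \<in> carrier (obj (cone_cx P Q \<phi>) 0). \<eta> (snd c) \<in> f ` carrier X}"
        using xy mod_hom_closed[OF rP(4) xy(1)] by (simp add: closed)
    qed
    show "{c \<in> carrier (obj (cone_cx P Q \<phi>) 0). \<eta> (snd c) \<in> f ` carrier X}
        \<subseteq> boundaries (cone_cx P Q \<phi>) 0"
    proof
      fix c assume "c \<in> {c \<in> carrier (obj (cone_cx P Q \<phi>) 0). \<eta> (snd c) \<in> f ` carrier X}"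
      then obtain y a where c: "c = (\<zero>\<^bsub>obj P 0\<^esub>, y)" "y \<in> carrier (obj Q 0)" "a \<in> carrier X" "\<eta> y = f a"
        by auto
      have "a \<in> \<pi> ` carrier (obj P 0)" using c(3) rP(5) by simp
      then obtain x where x: "x \<in> carrier (obj P 0)" "a = \<pi> x" by auto
      have "\<eta> (y \<ominus>\<^bsub>obj Q 0\<^esub> \<phi> 0 x) = \<zero>\<^bsub>Y\<^esub>"
        using c x aug[OF x(1)] mod_hom_closed[OF assms(3) c(3)]
          mod_hom_diff[OF Q(1) rQ(1,4) c(2) closed(3)[OF x(1)]]
        by (simp add: a_minus_def[of Y] Y.r_neg)
      then have "y \<ominus>\<^bsub>obj Q 0\<^esub> \<phi> 0 x \<in> boundaries Q 0"
        unfolding rQ(6) using c x by (simp add: mod_ker_def closed)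
      then obtain z where z: "z \<in> carrier (obj Q (Suc 0))" "y \<ominus>\<^bsub>obj Q 0\<^esub> \<phi> 0 x = diff Q 0 z"
        by (auto simp: boundaries_def)
      have "\<phi> 0 x \<oplus>\<^bsub>obj Q 0\<^esub> diff Q 0 z = y"
        unfolding z(2)[symmetric] using c x closed(3)[OF x(1)]
        by (simp add: a_minus_def Q.add.m_comm[of y] Q.add.m_assoc[symmetric] Q.r_neg)
      then have "c = diff (cone_cx P Q \<phi>) 0 (x, z)" using c(1) by simp
      then show "c \<in> boundaries (cone_cx P Q \<phi>) 0"
        unfolding boundaries_def using x z by (intro image_eqI[of _ _ "(x, z)"]) simp_all
    qed
  qed
qed

lemma cone_cx_acyclic:
  assumes "eq_flat_resolution R X P \<pi>" "eq_flat_resolution R X Q \<eta>" "lifts_to R P \<pi> Q \<eta> (\<lambda>x. x) \<phi>"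
  shows "boundaries (cone_cx P Q \<phi>) n = cycles (cone_cx P Q \<phi>) n"
proof (cases n)
  case 0
  have "\<eta> y \<in> carrier X" if "y \<in> carrier (obj Q 0)" for y
    using mod_hom_closed[OF eq_flat_resolutionD(4)[OF assms(2)] that] .
  then show ?thesis
    unfolding 0 cone_cx_exact(2)[OF assms(1,2) mod_hom_id inj_on_id2 assms(3)] by auto
next
  case (Suc m)
  then show ?thesis using cone_cx_exact(1)[OF assms(1,2) mod_hom_id inj_on_id2 assms(3)] by simp
qed

lemma cone_cx_resolution:
  assumes "short_exact R X Y Z f g" "eq_flat_resolution R X P \<pi>" "eq_flat_resolution R Y Q \<eta>"
    and "lifts_to R P \<pi> Q \<eta> f \<phi>"
  shows "eq_flat_resolution R Z (cone_cx P Q \<phi>) (\<lambda>c. g (\<eta> (snd c)))"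
proof -
  have ses: "module R Z" "f \<in> mod_hom R X Y" "g \<in> mod_hom R Y Z" "inj_on f (carrier X)"
    "f ` carrier X = mod_ker Y Z g" "g ` carrier Y = carrier Z"
    using assms(1) by (auto simp: short_exact_def)
  note rP = eq_flat_resolutionD[OF assms(2)] and rQ = eq_flat_resolutionD[OF assms(3)]
  note chain = lifts_to_chain_map[OF assms(4)]
  note ex = cone_cx_exact[OF assms(2,3) ses(2,4) assms(4)]
  interpret P0: module R "obj P 0" by (rule is_complexD(1)[OF rP(2)])
  have snd: "snd \<in> mod_hom R (obj (cone_cx P Q \<phi>) 0) (obj Q 0)"
    by (rule cone.qh[OF cone_cx_cone[OF rP(2) rQ(2) chain]])
  have eps: "(\<lambda>c. g (\<eta> (snd c))) \<in> mod_hom R (obj (cone_cx P Q \<phi>) 0) Z"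
    by (rule mod_hom_comp[OF mod_hom_comp[OF snd rQ(4)] ses(3)])
  have "(\<lambda>c. g (\<eta> (snd c))) ` carrier (obj (cone_cx P Q \<phi>) 0) = g ` \<eta> ` carrier (obj Q 0)"
    by (auto simp: image_iff)
  moreover have "boundaries (cone_cx P Q \<phi>) 0 = mod_ker (obj (cone_cx P Q \<phi>) 0) Z (\<lambda>c. g (\<eta> (snd c)))"
    unfolding ex(2) ses(5) using mod_hom_closed[OF rQ(4)] by (auto simp: mod_ker_def)
  ultimately show ?thesis
    unfolding eq_flat_resolution_def
    using ses(1,6) rQ(5) eps ex(1) is_complex_cone_cx[OF rP(2) rQ(2) chain]
      eq_flat_cone_cx[OF rP(3) rQ(3)] by simp
qed

section \<open>Derived functors of a completed tensor product\<close>

lemma homology_map_cong: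
  assumes "is_complex R C" "is_complex R D" "chain_map R C D \<phi>" "chain_map R C D \<psi>"
    and "\<And>x. x \<in> carrier (obj C i) \<Longrightarrow> \<phi> i x = \<psi> i x" "z \<in> carrier (homology C i)"
  shows "homology_map D \<phi> i z = homology_map D \<psi> i z"
proof -
  obtain x where "x \<in> cycles C i" "z = hclass C i x" using assms(6) by (auto simp: carrier_homology)
  then show ?thesis using assms(5)[OF cycles_closed]
    by (simp add: homology_map_hclass[OF assms(1-3)] homology_map_hclass[OF assms(1,2,4)])
qed

context surj_system
begin

definition TC :: "('r, 'f) chain_complex \<Rightarrow> ('r, nat \<Rightarrow> ('n \<times> 'f \<Rightarrow> 'r) set) chain_complex" where
  "TC F = \<lparr>obj = (\<lambda>i. T (obj F i)), diff = (\<lambda>i. Tm (obj F i) (diff F i))\<rparr>"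

abbreviation TCm :: "('r, 'g) chain_complex \<Rightarrow> (nat \<Rightarrow> 'f \<Rightarrow> 'g) \<Rightarrow> nat \<Rightarrow>
    (nat \<Rightarrow> ('n \<times> 'f \<Rightarrow> 'r) set) \<Rightarrow> nat \<Rightarrow> ('n \<times> 'g \<Rightarrow> 'r) set" where
  "TCm G \<phi> \<equiv> \<lambda>n. Tm (obj G n) (\<phi> n)"

lemma TC_simps [simp]: "obj (TC F) n = T (obj F n)" "diff (TC F) n = Tm (obj F n) (diff F n)"
  by (simp_all add: TC_def)

lemma is_complex_TC:
  assumes "is_complex R F"
  shows "is_complex R (TC F)"
proof -
  note F = is_complexD[OF assms]
  show ?thesis unfolding is_complex_def
    using T_module[OF F(1)] Tm_hom[OF F(1,1,2)] Tm_comp_zero[OF F(1,1,1,2,2,3)]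
    by (simp del: T_simps)
qed

lemma chain_map_TC:
  assumes "is_complex R F" "is_complex R G" "chain_map R F G \<phi>"
  shows "chain_map R (TC F) (TC G) (TCm G \<phi>)"
proof -
  note F = is_complexD[OF assms(1)] and G = is_complexD[OF assms(2)] and \<phi> = chain_mapD[OF assms(3)]
  have "Tm (obj G n) (\<phi> n) (Tm (obj F n) (diff F n) x) =
      Tm (obj G n) (diff G n) (Tm (obj G (Suc n)) (\<phi> (Suc n)) x)"
    if "x \<in> carrier (T (obj F (Suc n)))" for n x
    using Tm_comp[OF F(1,1) G(1) F(2) \<phi>(1) that] Tm_comp[OF F(1) G(1,1) \<phi>(1) G(2) that]
      Tm_cong[OF F(1) G(1) mod_hom_comp[OF F(2) \<phi>(1)] mod_hom_comp[OF \<phi>(1) G(2)] \<phi>(2) that]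
    by simp
  then show ?thesis using Tm_hom[OF F(1) G(1) \<phi>(1)] by (simp add: chain_map_def)
qed

lemma homotopic_TC:
  assumes "is_complex R F" "is_complex R G" "chain_map R F G \<phi>" "chain_map R F G \<psi>" "homotopic R F G \<phi> \<psi>"
  shows "homotopic R (TC F) (TC G) (TCm G \<phi>) (TCm G \<psi>)"
proof -
  note F = is_complexD[OF assms(1)] and G = is_complexD[OF assms(2)]
  note \<phi> = chain_mapD[OF assms(3)] and \<psi> = chain_mapD[OF assms(4)]
  obtain h where *: "\<forall>n. h n \<in> mod_hom R (obj F n) (obj G (Suc n))"
    "\<forall>x\<in>carrier (obj F 0). \<phi> 0 x = \<psi> 0 x \<oplus>\<^bsub>obj G 0\<^esub> diff G 0 (h 0 x)"
    "\<forall>n. \<forall>x\<in>carrier (obj F (Suc n)). \<phi> (Suc n) x = \<psi> (Suc n) x \<oplus>\<^bsub>obj G (Suc n)\<^esub>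
        (diff G (Suc n) (h (Suc n) x) \<oplus>\<^bsub>obj G (Suc n)\<^esub> h n (diff F n x))"
    using assms(5) unfolding homotopic_def by auto
  have h: "\<And>n. h n \<in> mod_hom R (obj F n) (obj G (Suc n))"
    and h0: "\<And>x. x \<in> carrier (obj F 0) \<Longrightarrow> \<phi> 0 x = \<psi> 0 x \<oplus>\<^bsub>obj G 0\<^esub> diff G 0 (h 0 x)"
    and hS: "\<And>n x. x \<in> carrier (obj F (Suc n)) \<Longrightarrow> \<phi> (Suc n) x = \<psi> (Suc n) x \<oplus>\<^bsub>obj G (Suc n)\<^esub>
        (diff G (Suc n) (h (Suc n) x) \<oplus>\<^bsub>obj G (Suc n)\<^esub> h n (diff F n x))"
    using * by simp_all
  note dh = mod_hom_comp[OF h G(2)] and hd = mod_hom_comp[OF F(2) h]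
  have "Tm (obj G 0) (\<phi> 0) x = Tm (obj G 0) (\<psi> 0) x \<oplus>\<^bsub>T (obj G 0)\<^esub>
      Tm (obj G 0) (diff G 0) (Tm (obj G (Suc 0)) (h 0) x)" if x: "x \<in> carrier (T (obj F 0))" for x
    using Tm_cong[OF F(1) G(1) \<phi>(1) mod_hom_sum[OF G(1) \<psi>(1) dh] h0 x]
      Tm_sum[OF F(1) G(1) \<psi>(1) dh x] Tm_comp[OF F(1) G(1,1) h G(2) x] by (simp del: T_simps)
  moreover have "Tm (obj G (Suc n)) (\<phi> (Suc n)) x = Tm (obj G (Suc n)) (\<psi> (Suc n)) x \<oplus>\<^bsub>T (obj G (Suc n))\<^esub>
      (Tm (obj G (Suc n)) (diff G (Suc n)) (Tm (obj G (Suc (Suc n))) (h (Suc n)) x) \<oplus>\<^bsub>T (obj G (Suc n))\<^esub>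
       Tm (obj G (Suc n)) (h n) (Tm (obj F n) (diff F n) x))" if x: "x \<in> carrier (T (obj F (Suc n)))" for n x
    using Tm_cong[OF F(1) G(1) \<phi>(1) mod_hom_sum[OF G(1) \<psi>(1) mod_hom_sum[OF G(1) dh hd]] hS x]
      Tm_sum[OF F(1) G(1) \<psi>(1) mod_hom_sum[OF G(1) dh hd] x] Tm_sum[OF F(1) G(1) dh hd x]
      Tm_comp[OF F(1) G(1,1) h G(2) x] Tm_comp[OF F(1,1) G(1) F(2) h x] by (simp del: T_simps)
  ultimately show ?thesis
    unfolding homotopic_def using Tm_hom[OF F(1) G(1) h]
    by (intro exI[of _ "\<lambda>n. Tm (obj G (Suc n)) (h n)"]) (simp del: T_simps)
qed

lemma cone_TC:
  assumes "cone R P Q C \<phi> i j pr qr"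
  shows "cone R (TC P) (TC Q) (TC C) (TCm Q \<phi>) (TCm C i) (\<lambda>n. Tm (obj C (Suc n)) (j n))
    (TCm P pr) (TCm Q qr)"
proof -
  interpret c: cone R P Q C \<phi> i j pr qr by fact
  have idP: "Tm (obj P n) h x = x"
    if "h \<in> mod_hom R (obj P n) (obj P n)" "\<And>a. a \<in> carrier (obj P n) \<Longrightarrow> h a = a" "x \<in> carrier (T (obj P n))"
    for h n x using Tm_cong[OF c.modP c.modP that(1) mod_hom_id that(2,3)] Tm_id[OF c.modP that(3)] by simp
  have idQ: "Tm (obj Q n) h x = x"
    if "h \<in> mod_hom R (obj Q n) (obj Q n)" "\<And>a. a \<in> carrier (obj Q n) \<Longrightarrow> h a = a" "x \<in> carrier (T (obj Q n))"
    for h n x using Tm_cong[OF c.modQ c.modQ that(1) mod_hom_id that(2,3)] Tm_id[OF c.modQ that(3)] by simp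
  have idC: "Tm (obj C n) h x = x"
    if "h \<in> mod_hom R (obj C n) (obj C n)" "\<And>a. a \<in> carrier (obj C n) \<Longrightarrow> h a = a" "x \<in> carrier (T (obj C n))"
    for h n x using Tm_cong[OF c.modC c.modC that(1) mod_hom_id that(2,3)] Tm_id[OF c.modC that(3)] by simp
  show ?thesis
  proof
    show "is_complex R (TC P)" "is_complex R (TC Q)" "is_complex R (TC C)"
      by (rule is_complex_TC, rule c.cP c.cQ c.cC)+
    show "chain_map R (TC P) (TC Q) (TCm Q \<phi>)" by (rule chain_map_TC[OF c.cP c.cQ c.chain])
    fix n
    show "TCm C i n \<in> mod_hom R (obj (TC Q) n) (obj (TC C) n)" using Tm_hom[OF c.modQ c.modC c.ih] by simp
    show "Tm (obj C (Suc n)) (j n) \<in> mod_hom R (obj (TC P) n) (obj (TC C) (Suc n))"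
      using Tm_hom[OF c.modP c.modC c.jh] by simp
    show "TCm P pr n \<in> mod_hom R (obj (TC C) (Suc n)) (obj (TC P) n)" using Tm_hom[OF c.modC c.modP c.ph] by simp
    show "TCm Q qr n \<in> mod_hom R (obj (TC C) n) (obj (TC Q) n)" using Tm_hom[OF c.modC c.modQ c.qh] by simp
    show "TCm Q qr n (TCm C i n y) = y" if "y \<in> carrier (obj (TC Q) n)" for y
      using that Tm_comp[OF c.modQ c.modC c.modQ c.ih c.qh] idQ[OF mod_hom_comp[OF c.ih c.qh] c.qi] by simp
    show "TCm P pr n (Tm (obj C (Suc n)) (j n) x) = x" if "x \<in> carrier (obj (TC P) n)" for x
      using that Tm_comp[OF c.modP c.modC c.modP c.jh c.ph] idP[OF mod_hom_comp[OF c.jh c.ph] c.pj] by simp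
    show "TCm P pr n (TCm C i (Suc n) y) = \<zero>\<^bsub>obj (TC P) n\<^esub>" if "y \<in> carrier (obj (TC Q) (Suc n))" for y
      using that Tm_comp_zero[OF c.modQ c.modC c.modP c.ih c.ph c.p_i] by (simp del: T_simps)
    show "TCm Q qr (Suc n) (Tm (obj C (Suc n)) (j n) x) = \<zero>\<^bsub>obj (TC Q) (Suc n)\<^esub>"
      if "x \<in> carrier (obj (TC P) n)" for x
      using that Tm_comp_zero[OF c.modP c.modC c.modQ c.jh c.qh c.qj] by (simp del: T_simps)
    note jp = mod_hom_comp[OF c.ph c.jh] and iq = mod_hom_comp[OF c.qh c.ih]
    show "Tm (obj C (Suc n)) (j n) (TCm P pr n x) \<oplus>\<^bsub>obj (TC C) (Suc n)\<^esub> TCm C i (Suc n) (TCm Q qr (Suc n) x) = x"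
      if "x \<in> carrier (obj (TC C) (Suc n))" for x
    proof -
      have x: "x \<in> carrier (T (obj C (Suc n)))" using that by simp
      show ?thesis
        using Tm_comp[OF c.modC c.modP c.modC c.ph c.jh x] Tm_comp[OF c.modC c.modQ c.modC c.qh c.ih x]
          Tm_sum[OF c.modC c.modC jp iq x] idC[OF mod_hom_sum[OF c.modC jp iq] c.decomp x]
        by (simp del: T_simps)
    qed
    show "TCm C i 0 (TCm Q qr 0 x) = x" if "x \<in> carrier (obj (TC C) 0)" for x
      using that Tm_comp[OF c.modC c.modQ c.modC c.qh c.ih] idC[OF mod_hom_comp[OF c.qh c.ih] c.decomp0] by simp
    show "diff (TC C) n (TCm C i (Suc n) y) = TCm C i n (diff (TC Q) n y)"
      if "y \<in> carrier (obj (TC Q) (Suc n))" for y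
    proof -
      have y: "y \<in> carrier (T (obj Q (Suc n)))" using that by simp
      show ?thesis
        using Tm_comp[OF c.modQ c.modC c.modC c.ih c.dC y] Tm_comp[OF c.modQ c.modQ c.modC c.dQ c.ih y]
          Tm_cong[OF c.modQ c.modC mod_hom_comp[OF c.ih c.dC] mod_hom_comp[OF c.dQ c.ih] c.di y] by simp
    qed
    show "diff (TC C) 0 (Tm (obj C (Suc 0)) (j 0) x) = TCm C i 0 (TCm Q \<phi> 0 x)"
      if "x \<in> carrier (obj (TC P) 0)" for x
    proof -
      have x: "x \<in> carrier (T (obj P 0))" using that by simp
      show ?thesis
        using Tm_comp[OF c.modP c.modC c.modC c.jh c.dC x] Tm_comp[OF c.modP c.modQ c.modC c.\<phi>h c.ih x]
          Tm_cong[OF c.modP c.modC mod_hom_comp[OF c.jh c.dC] mod_hom_comp[OF c.\<phi>h c.ih] c.dj0 x] by simp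
    qed
    show "diff (TC C) (Suc n) (Tm (obj C (Suc (Suc n))) (j (Suc n)) x) \<oplus>\<^bsub>obj (TC C) (Suc n)\<^esub>
        Tm (obj C (Suc n)) (j n) (diff (TC P) n x) = TCm C i (Suc n) (TCm Q \<phi> (Suc n) x)"
      if "x \<in> carrier (obj (TC P) (Suc n))" for x
    proof -
      have x: "x \<in> carrier (T (obj P (Suc n)))" using that by simp
      note dj = mod_hom_comp[OF c.jh c.dC] and jd = mod_hom_comp[OF c.dP c.jh]
      show ?thesis
        using Tm_comp[OF c.modP c.modC c.modC c.jh c.dC x] Tm_comp[OF c.modP c.modP c.modC c.dP c.jh x]
          Tm_comp[OF c.modP c.modQ c.modC c.\<phi>h c.ih x] Tm_sum[OF c.modP c.modC dj jd x]
          Tm_cong[OF c.modP c.modC mod_hom_sum[OF c.modC dj jd] mod_hom_comp[OF c.\<phi>h c.ih] c.djS x]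
        by (simp del: T_simps)
    qed
  qed
qed

text \<open>
  In an exact complex of flat modules that ends in degree zero, all modules of cycles are flat, by
  induction on the degree. So the complex splices short exact sequences of flat modules, on which
  the functor is exact.
\<close>

lemma TC_acyclic:
  assumes "is_complex R C" "\<And>n. eq_flat R (obj C n)" "\<And>n. boundaries C n = cycles C n"
  shows "boundaries (TC C) n = cycles (TC C) n"
proof -
  note C = is_complexD[OF assms(1)]
  let ?Z = "\<lambda>n. cycle_module C n"
  note modZ = module_cycle_module[OF assms(1)]
  have incl: "(\<lambda>x. x) \<in> mod_hom R (?Z n) (obj C n)" for n
    using cycles_closed[of _ C n] by (auto simp: mod_hom_def)
  have d: "diff C n \<in> mod_hom R (obj C (Suc n)) (?Z n)" for n
    using C(2)[of n] assms(3)[of n, symmetric] by (auto simp: mod_hom_def boundaries_def)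
  have dim: "diff C n ` carrier (obj C (Suc n)) = carrier (?Z n)" for n
    using assms(3)[of n] by (simp add: boundaries_def)
  have ker: "(\<lambda>x. x) ` carrier (?Z (Suc n)) = mod_ker (obj C (Suc n)) (?Z n) (diff C n)" for n
    by (simp add: mod_ker_def)
  have flatZ: "eq_flat R (?Z n)" for n
  proof (induction n)
    case 0
    then show ?case using assms(2)[of 0] by simp
  next
    case (Suc n)
    show ?case by (rule eq_flat_kernel[OF modZ assms(2) Suc incl d inj_on_id2 ker dim])
  qed
  \<comment> \<open>The cokernel of \<open>Z\<^sub>n\<^sub>+\<^sub>1 \<rightarrow> C\<^sub>n\<^sub>+\<^sub>1\<close> is the flat module \<open>Z\<^sub>n\<close>.\<close>
  have injZ: "inj_on (Tm (obj C n) (\<lambda>x. x)) (carrier (T (?Z n)))" for n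
  proof (cases n)
    case 0
    then show ?thesis using Tm_id[OF C(1)[of 0]] by (simp add: inj_on_def)
  next
    case (Suc m)
    show ?thesis unfolding Suc by (rule Tm_inj[OF modZ C(1) flatZ incl d inj_on_id2 ker dim])
  qed
  have surjZ: "Tm (?Z n) (diff C n) ` carrier (T (obj C (Suc n))) = carrier (T (?Z n))" for n
    by (rule Tm_surj[OF modZ C(1) modZ incl d ker dim])
  have fac: "Tm (obj C n) (\<lambda>x. x) (Tm (?Z n) (diff C n) x) = Tm (obj C n) (diff C n) x"
    if "x \<in> carrier (T (obj C (Suc n)))" for n x
    using Tm_comp[OF C(1) modZ C(1) d incl that] .
  have "cycles (TC C) n \<subseteq> boundaries (TC C) n"
  proof
    fix x assume x: "x \<in> cycles (TC C) n"
    have "\<exists>z\<in>carrier (T (?Z n)). Tm (obj C n) (\<lambda>x. x) z = x"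
    proof (cases n)
      case 0
      then show ?thesis using x Tm_id[OF C(1)[of 0]] by auto
    next
      case (Suc m)
      have xT: "x \<in> carrier (T (obj C (Suc m)))" and dx: "Tm (obj C m) (diff C m) x = \<zero>\<^bsub>T (obj C m)\<^esub>"
        using x Suc by (simp_all add: mod_ker_def del: T_simps)
      have TZ: "module R (T (?Z m))" by (rule T_module[OF modZ])
      have "Tm (?Z m) (diff C m) x = \<zero>\<^bsub>T (?Z m)\<^esub>"
      proof (rule inj_onD[OF injZ])
        show "Tm (obj C m) (\<lambda>x. x) (Tm (?Z m) (diff C m) x) = Tm (obj C m) (\<lambda>x. x) \<zero>\<^bsub>T (?Z m)\<^esub>"
          using fac[OF xT] dx mod_hom_zero[OF TZ T_module[OF C(1)] Tm_hom[OF modZ C(1) incl]]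
          by (simp del: T_simps)
        show "Tm (?Z m) (diff C m) x \<in> carrier (T (?Z m))"
          by (rule mod_hom_closed[OF Tm_hom[OF C(1) modZ d] xT])
        show "\<zero>\<^bsub>T (?Z m)\<^esub> \<in> carrier (T (?Z m))"
          by (rule submodule_zero[OF TZ module.carrier_is_submodule[OF TZ]])
      qed
      then show ?thesis
        unfolding Suc by (rule Tm_exact[OF modZ C(1) flatZ incl d inj_on_id2 ker dim xT])
    qed
    then obtain z where z: "z \<in> carrier (T (?Z n))" "Tm (obj C n) (\<lambda>x. x) z = x" by auto
    have "z \<in> Tm (?Z n) (diff C n) ` carrier (T (obj C (Suc n)))" using surjZ[of n] z(1) by simp
    then obtain y where y: "y \<in> carrier (T (obj C (Suc n)))" "z = Tm (?Z n) (diff C n) y" by auto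
    have eq: "x = diff (TC C) n y" using fac[OF y(1)] z(2) y(2) by simp
    show "x \<in> boundaries (TC C) n" unfolding boundaries_def eq by (rule imageI) (simp add: y(1))
  qed
  then show ?thesis using boundaries_cycles[OF is_complex_TC[OF assms(1)], of n] by (rule equalityI[rotated])
qed

subsection \<open>Independence of the resolution\<close>

abbreviation H :: "('r, 'f) chain_complex \<Rightarrow> nat \<Rightarrow> ('r, (nat \<Rightarrow> ('n \<times> 'f \<Rightarrow> 'r) set) set) module" where
  "H F i \<equiv> homology (TC F) i"

abbreviation Hm :: "('r, 'g) chain_complex \<Rightarrow> (nat \<Rightarrow> 'f \<Rightarrow> 'g) \<Rightarrow> nat \<Rightarrow>
    (nat \<Rightarrow> ('n \<times> 'f \<Rightarrow> 'r) set) set \<Rightarrow> (nat \<Rightarrow> ('n \<times> 'g \<Rightarrow> 'r) set) set" where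
  "Hm G \<phi> i \<equiv> homology_map (TC G) (TCm G \<phi>) i"

lemma Hm_hom:
  assumes "is_complex R F" "is_complex R G" "chain_map R F G \<phi>"
  shows "Hm G \<phi> i \<in> mod_hom R (H F i) (H G i)"
  by (rule homology_map_hom[OF is_complex_TC[OF assms(1)] is_complex_TC[OF assms(2)] chain_map_TC[OF assms]])

lemma Hm_comp:
  assumes "is_complex R F" "is_complex R G" "is_complex R K" "chain_map R F G \<phi>" "chain_map R G K \<psi>"
    and "z \<in> carrier (H F i)"
  shows "Hm K \<psi> i (Hm G \<phi> i z) = Hm K (\<lambda>n x. \<psi> n (\<phi> n x)) i z"
proof -
  note c = is_complex_TC[OF assms(1)] is_complex_TC[OF assms(2)] is_complex_TC[OF assms(3)]
  note f = chain_map_TC[OF assms(1,2,4)] and g = chain_map_TC[OF assms(2,3,5)]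
  note gf = chain_map_TC[OF assms(1,3) chain_map_comp[OF assms(4,5)]]
  have "Hm K \<psi> i (Hm G \<phi> i z) = homology_map (TC K) (\<lambda>n x. TCm K \<psi> n (TCm G \<phi> n x)) i z"
    by (rule homology_map_comp[OF c f g assms(6)])
  also have "\<dots> = Hm K (\<lambda>n x. \<psi> n (\<phi> n x)) i z"
    by (rule homology_map_cong[OF c(1,3) chain_map_comp[OF f g] gf _ assms(6)])
      (simp add: Tm_comp[OF is_complexD(1)[OF assms(1)] is_complexD(1)[OF assms(2)]
        is_complexD(1)[OF assms(3)] chain_mapD(1)[OF assms(4)] chain_mapD(1)[OF assms(5)]])
  finally show ?thesis .
qed

lemma Hm_homotopic:
  assumes "is_complex R F" "is_complex R G" "chain_map R F G \<phi>" "chain_map R F G \<psi>"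
    and "homotopic R F G \<phi> \<psi>" "z \<in> carrier (H F i)"
  shows "Hm G \<phi> i z = Hm G \<psi> i z"
  by (rule homotopic_homology_map[OF is_complex_TC[OF assms(1)] is_complex_TC[OF assms(2)]
        chain_map_TC[OF assms(1-3)] chain_map_TC[OF assms(1,2,4)] homotopic_TC[OF assms(1-5)] assms(6)])

lemma Hm_lifts_eq:
  assumes "module R X" "eq_flat_resolution R Y G \<eta>"
    and "lifts_to R (free_res R X) (free_aug R X) G \<eta> f \<phi>"
    and "lifts_to R (free_res R X) (free_aug R X) G \<eta> f \<psi>"
    and "z \<in> carrier (H (free_res R X) i)"
  shows "Hm G \<phi> i z = Hm G \<psi> i z"
  by (rule Hm_homotopic[OF eq_flat_resolutionD(2)[OF free_res_resolution[OF assms(1)]]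
        eq_flat_resolutionD(2)[OF assms(2)] lifts_to_chain_map[OF assms(3)] lifts_to_chain_map[OF assms(4)]
        free_res_homotopic[OF assms(1-4)] assms(5)])

lemma Hm_bij:
  assumes "eq_flat_resolution R X P \<pi>" "eq_flat_resolution R X Q \<eta>" "lifts_to R P \<pi> Q \<eta> (\<lambda>x. x) \<phi>"
  shows "bij_betw (Hm Q \<phi> i) (carrier (H P i)) (carrier (H Q i))"
proof -
  note P = eq_flat_resolutionD[OF assms(1)] and Q = eq_flat_resolutionD[OF assms(2)]
  note chain = lifts_to_chain_map[OF assms(3)]
  show ?thesis
    by (rule cone.exact_cone_bij[OF cone_TC[OF cone_cx_cone[OF P(2) Q(2) chain]]
          TC_acyclic[OF is_complex_cone_cx[OF P(2) Q(2) chain] eq_flat_cone_cx[OF P(3) Q(3)]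
            cone_cx_acyclic[OF assms]]])
qed

definition induced ::
    "('r, 'x) module \<Rightarrow> ('r, 'f) chain_complex \<Rightarrow> ('f \<Rightarrow> 'x) \<Rightarrow> ('r, 'f) chain_complex \<Rightarrow> ('f \<Rightarrow> 'y) \<Rightarrow>
     ('x \<Rightarrow> 'y) \<Rightarrow>
     (nat \<Rightarrow> (nat \<Rightarrow> ('n \<times> 'f \<Rightarrow> 'r) set) set \<Rightarrow> (nat \<Rightarrow> ('n \<times> 'f \<Rightarrow> 'r) set) set) \<Rightarrow> bool" where
  "induced X F \<epsilon> G \<eta> f \<alpha> \<longleftrightarrow>
     (\<forall>(P :: ('r, 'f) chain_complex) \<pi> \<phi> \<psi>.
        eq_flat_resolution R X P \<pi> \<and> lifts_to R P \<pi> F \<epsilon> (\<lambda>x. x) \<phi> \<and> lifts_to R P \<pi> G \<eta> f \<psi> \<longrightarrow>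
        (\<forall>i. \<forall>z\<in>carrier (H P i). \<alpha> i (Hm F \<phi> i z) = Hm G \<psi> i z))"

text \<open>
  The free resolution maps to every resolution, uniquely up to homotopy, and these maps induce
  isomorphisms; so it is enough to know an induced map on the free resolution.
\<close>

lemma inducedI:
  assumes "eq_flat_resolution R X F \<epsilon>" "eq_flat_resolution R Y G \<eta>"
    and "lifts_to R (free_res R X) (free_aug R X) F \<epsilon> (\<lambda>x. x) a"
    and "lifts_to R (free_res R X) (free_aug R X) G \<eta> f \<theta>"
    and "\<And>i w. w \<in> carrier (H (free_res R X) i) \<Longrightarrow> \<alpha> i (Hm F a i w) = Hm G \<theta> i w"
  shows "induced X F \<epsilon> G \<eta> f \<alpha>"
  unfolding induced_def
proof (intro allI impI ballI)
  fix P \<pi> \<phi> \<psi> i z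
  assume *: "eq_flat_resolution R X P \<pi> \<and> lifts_to R P \<pi> F \<epsilon> (\<lambda>x. x) \<phi> \<and> lifts_to R P \<pi> G \<eta> f \<psi>"
    and z: "z \<in> carrier (H P i)"
  then have P: "eq_flat_resolution R X P \<pi>" and \<phi>: "lifts_to R P \<pi> F \<epsilon> (\<lambda>x. x) \<phi>"
    and \<psi>: "lifts_to R P \<pi> G \<eta> f \<psi>" by auto
  note modX = eq_flat_resolutionD(1)[OF P]
  let ?L = "free_res R X"
  note L = free_res_resolution[OF modX]
  note cx = eq_flat_resolutionD(2)[OF L] eq_flat_resolutionD(2)[OF P]
    eq_flat_resolutionD(2)[OF assms(1)] eq_flat_resolutionD(2)[OF assms(2)]
  obtain \<chi> where \<chi>: "lifts_to R ?L (free_aug R X) P \<pi> (\<lambda>x. x) \<chi>"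
    using free_res_lift[OF modX P mod_hom_id] by auto
  have "z \<in> Hm P \<chi> i ` carrier (H ?L i)" using Hm_bij[OF L P \<chi>, of i] z by (simp add: bij_betw_def)
  then obtain w where w: "w \<in> carrier (H ?L i)" "z = Hm P \<chi> i w" by auto
  have "Hm F \<phi> i z = Hm F (\<lambda>n x. \<phi> n (\<chi> n x)) i w"
    unfolding w(2) by (rule Hm_comp[OF cx(1-3) lifts_to_chain_map[OF \<chi>] lifts_to_chain_map[OF \<phi>] w(1)])
  also have "\<dots> = Hm F a i w"
    by (rule Hm_lifts_eq[OF modX assms(1) lifts_to_comp[OF \<chi> \<phi>] assms(3) w(1)])
  finally have "\<alpha> i (Hm F \<phi> i z) = Hm G \<theta> i w" using assms(5)[OF w(1)] by simp
  also have "\<dots> = Hm G (\<lambda>n x. \<psi> n (\<chi> n x)) i w"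
    by (rule Hm_lifts_eq[OF modX assms(2,4) lifts_to_comp[OF \<chi> \<psi>] w(1)])
  also have "\<dots> = Hm G \<psi> i z"
    unfolding w(2)
    by (rule Hm_comp[OF cx(1,2,4) lifts_to_chain_map[OF \<chi>] lifts_to_chain_map[OF \<psi>] w(1), symmetric])
  finally show "\<alpha> i (Hm F \<phi> i z) = Hm G \<psi> i z" .
qed

subsection \<open>The long exact sequence\<close>

text \<open>
  The cone of a lift \<open>\<phi> : P \<rightarrow> Q\<close> of \<open>f\<close> to free resolutions is a resolution of \<open>Z\<close>. Its long exact
  sequence is carried over to the given resolutions by the isomorphisms between resolutions.
\<close>

theorem long_exact_derived:
  fixes F G K :: "('r, 'f) chain_complex"
    and X :: "('r, 'x) module" and Y :: "('r, 'y) module" and Z :: "('r, 'v) module"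
  assumes "short_exact R X Y Z f g"
    and "eq_flat_resolution R X F \<epsilon>" "eq_flat_resolution R Y G \<eta>" "eq_flat_resolution R Z K \<theta>"
  shows "\<exists>\<alpha> \<beta> \<delta>. induced X F \<epsilon> G \<eta> f \<alpha> \<and> induced Y G \<eta> K \<theta> g \<beta> \<and> long_exact R (H F) (H G) (H K) \<alpha> \<beta> \<delta>"
proof -
  have ses: "module R X" "module R Y" "module R Z" "f \<in> mod_hom R X Y" "g \<in> mod_hom R Y Z"
    "f ` carrier X = mod_ker Y Z g"
    using assms(1) by (auto simp: short_exact_def)
  let ?P = "free_res R X" and ?Q = "free_res R Y" and ?W = "free_res R Z"
  let ?\<pi> = "free_aug R X" and ?\<kappa> = "free_aug R Y" and ?\<omega> = "free_aug R Z"
  note rP = free_res_resolution[OF ses(1)] and rQ = free_res_resolution[OF ses(2)]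
    and rW = free_res_resolution[OF ses(3)]
  obtain a where a: "lifts_to R ?P ?\<pi> F \<epsilon> (\<lambda>x. x) a" using free_res_lift[OF ses(1) assms(2) mod_hom_id] by auto
  obtain b where b: "lifts_to R ?Q ?\<kappa> G \<eta> (\<lambda>x. x) b" using free_res_lift[OF ses(2) assms(3) mod_hom_id] by auto
  obtain c where c: "lifts_to R ?W ?\<omega> K \<theta> (\<lambda>x. x) c" using free_res_lift[OF ses(3) assms(4) mod_hom_id] by auto
  obtain \<phi> where \<phi>: "lifts_to R ?P ?\<pi> ?Q ?\<kappa> f \<phi>" using free_res_lift[OF ses(1) rQ ses(4)] by auto
  obtain \<psi> where \<psi>: "lifts_to R ?Q ?\<kappa> ?W ?\<omega> g \<psi>" using free_res_lift[OF ses(2) rW ses(5)] by auto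
  let ?C = "cone_cx ?P ?Q \<phi>" and ?\<gamma> = "\<lambda>c. g (?\<kappa> (snd c))"
  have rC: "eq_flat_resolution R Z ?C ?\<gamma>" by (rule cone_cx_resolution[OF assms(1) rP rQ \<phi>])
  obtain e where e: "lifts_to R ?W ?\<omega> ?C ?\<gamma> (\<lambda>x. x) e" using free_res_lift[OF ses(3) rC mod_hom_id] by auto
  note cP = eq_flat_resolutionD(2)[OF rP] and cQ = eq_flat_resolutionD(2)[OF rQ]
    and cW = eq_flat_resolutionD(2)[OF rW] and cC = eq_flat_resolutionD(2)[OF rC]
    and cF = eq_flat_resolutionD(2)[OF assms(2)] and cG = eq_flat_resolutionD(2)[OF assms(3)]
    and cK = eq_flat_resolutionD(2)[OF assms(4)]
  note cone = cone_cx_cone[OF cP cQ lifts_to_chain_map[OF \<phi>]]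
  have incl: "lifts_to R ?Q ?\<kappa> ?C ?\<gamma> g (cone_in ?P)"
    by (rule lifts_toI[OF cone.i_chain[OF cone]]) simp
  note ma = Hm_hom[OF cP cF lifts_to_chain_map[OF a]] and mb = Hm_hom[OF cQ cG lifts_to_chain_map[OF b]]
    and mc = Hm_hom[OF cW cK lifts_to_chain_map[OF c]] and me = Hm_hom[OF cW cC lifts_to_chain_map[OF e]]
  note ba = Hm_bij[OF rP assms(2) a] and bb = Hm_bij[OF rQ assms(3) b]
    and bc = Hm_bij[OF rW assms(4) c] and be = Hm_bij[OF rW rC e]
  have mH: "module R (H L n)" if "is_complex R L" for L :: "('r, 'l) chain_complex" and n
    by (rule module_homology[OF is_complex_TC[OF that]])
  \<comment> \<open>The cone and \<open>K\<close> both resolve \<open>Z\<close>; they are compared through the free resolution \<open>?W\<close>.\<close>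
  define t where "t = (\<lambda>n z. Hm K c n (inv_into (carrier (H ?W n)) (Hm ?C e n) z))"
  have mt: "t n \<in> mod_hom R (H ?C n) (H K n)" for n
    unfolding t_def by (rule mod_hom_comp[OF mod_hom_inv_into[OF mH[OF cW] me be] mc])
  have bt: "bij_betw (t n) (carrier (H ?C n)) (carrier (H K n))" for n
    using bij_betw_trans[OF bij_betw_inv_into[OF be] bc] unfolding t_def comp_def .
  define \<alpha> where "\<alpha> = (\<lambda>n x. Hm G b n (Hm ?Q \<phi> n (inv_into (carrier (H ?P n)) (Hm F a n) x)))"
  define \<beta> where "\<beta> = (\<lambda>n x. t n (Hm ?C (cone_in ?P) n (inv_into (carrier (H ?Q n)) (Hm G b n) x)))"
  obtain \<delta> where "long_exact R (H F) (H G) (H K) \<alpha> \<beta> \<delta>"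
    using long_exact_transfer[where a = "Hm F a" and b = "Hm G b" and c = t,
        OF cone.long_exact[OF cone_TC[OF cone]]
        mH[OF cF] mH[OF cG] mH[OF cK] ma mb mt ba bb bt] unfolding \<alpha>_def \<beta>_def by blast
  moreover have "induced X F \<epsilon> G \<eta> f \<alpha>"
  proof (rule inducedI[OF assms(2,3) a])
    show "lifts_to R ?P ?\<pi> G \<eta> f (\<lambda>n x. b n (\<phi> n x))" using lifts_to_comp[OF \<phi> b] .
    fix i w assume w: "w \<in> carrier (H ?P i)"
    have "inv_into (carrier (H ?P i)) (Hm F a i) (Hm F a i w) = w"
      using ba[of i] w by (intro inv_into_f_f) (auto simp: bij_betw_def)
    then show "\<alpha> i (Hm F a i w) = Hm G (\<lambda>n x. b n (\<phi> n x)) i w"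
      unfolding \<alpha>_def using Hm_comp[OF cP cQ cG lifts_to_chain_map[OF \<phi>] lifts_to_chain_map[OF b] w] by simp
  qed
  moreover have "induced Y G \<eta> K \<theta> g \<beta>"
  proof (rule inducedI[OF assms(3,4) b])
    show "lifts_to R ?Q ?\<kappa> K \<theta> g (\<lambda>n x. c n (\<psi> n x))" using lifts_to_comp[OF \<psi> c] .
    fix i w assume w: "w \<in> carrier (H ?Q i)"
    have w1: "inv_into (carrier (H ?Q i)) (Hm G b i) (Hm G b i w) = w"
      using bb[of i] w by (intro inv_into_f_f) (auto simp: bij_betw_def)
    have pw: "Hm ?W \<psi> i w \<in> carrier (H ?W i)"
      by (rule mod_hom_closed[OF Hm_hom[OF cQ cW lifts_to_chain_map[OF \<psi>]] w])
    \<comment> \<open>The inclusion into the cone and \<open>e \<circ> \<psi>\<close> both lift \<open>g\<close>, hence agree on homology.\<close>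
    have "Hm ?C (cone_in ?P) i w = Hm ?C (\<lambda>n x. e n (\<psi> n x)) i w"
      by (rule Hm_lifts_eq[OF ses(2) rC incl lifts_to_comp[OF \<psi> e] w])
    also have "\<dots> = Hm ?C e i (Hm ?W \<psi> i w)"
      by (rule Hm_comp[OF cQ cW cC lifts_to_chain_map[OF \<psi>] lifts_to_chain_map[OF e] w, symmetric])
    finally have "t i (Hm ?C (cone_in ?P) i w) = Hm K c i (Hm ?W \<psi> i w)"
      unfolding t_def using be[of i] pw by (simp add: bij_betw_def inv_into_f_f)
    also have "\<dots> = Hm K (\<lambda>n x. c n (\<psi> n x)) i w"
      by (rule Hm_comp[OF cQ cW cK lifts_to_chain_map[OF \<psi>] lifts_to_chain_map[OF c] w])
    finally show "\<beta> i (Hm G b i w) = Hm K (\<lambda>n x. c n (\<psi> n x)) i w" unfolding \<beta>_def w1 .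
  qed
  ultimately show ?thesis by blast
qed

end

section \<open>Adic quotients\<close>

lemma ideal_power:
  assumes "cring R" "ideal I R"
  shows "ideal (I [^]\<^bsub>ideals_set R\<^esub> (s :: nat)) R"
    and "I [^]\<^bsub>ideals_set R\<^esub> Suc s \<subseteq> I [^]\<^bsub>ideals_set R\<^esub> s"
proof -
  interpret R: cring R by fact
  interpret S: comm_monoid "ideals_set R" by (rule R.ideals_set_is_comm_monoid)
  have pow: "ideal (I [^]\<^bsub>ideals_set R\<^esub> (t :: nat)) R" for t
    using S.nat_pow_closed[of I t] assms(2) by (simp add: ideals_set_def)
  show "ideal (I [^]\<^bsub>ideals_set R\<^esub> s) R" by (rule pow)
  have "I [^]\<^bsub>ideals_set R\<^esub> Suc s = ideal_prod R (I [^]\<^bsub>ideals_set R\<^esub> s) I"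
    by (simp add: ideals_set_def)
  then show "I [^]\<^bsub>ideals_set R\<^esub> Suc s \<subseteq> I [^]\<^bsub>ideals_set R\<^esub> s"
    using R.ideal_prod_inter[OF pow assms(2)] by auto
qed

text \<open>
  The transition map \<open>N / I\<^sup>s\<^sup>+\<^sup>1 N \<rightarrow> N / I\<^sup>s N\<close> is induced by the identity of \<open>N\<close>, hence surjective.
\<close>

lemma adic_system:
  assumes "ideal I R" "module R N"
  shows "surj_system R (adic_quot R I N) (adic_proj R I N)"
proof -
  interpret N: module R N by fact
  note pow = ideal_power[OF N.R.cring_axioms assms(1)]
  let ?S = "\<lambda>s. {a \<odot>\<^bsub>N\<^esub> x | a x. a \<in> I [^]\<^bsub>ideals_set R\<^esub> s \<and> x \<in> carrier N}"
  let ?K = "ideal_power_mult R I N"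
  have gens: "?S s \<subseteq> carrier N" for s :: nat
    using additive_subgroup.a_subset[OF ideal.axioms(1)[OF pow(1)]] by auto
  have sub: "submodule (?K s) R N" for s
    unfolding ideal_power_mult_def by (rule submodule_span[OF assms(2) gens])
  have mono: "?K (Suc s) \<subseteq> ?K s" for s
    unfolding ideal_power_mult_def[of R I N "Suc s"]
  proof (rule span_least[OF sub])
    have "?S (Suc s) \<subseteq> ?S s" using pow(2)[of s] by blast
    then show "?S (Suc s) \<subseteq> ?K s"
      unfolding ideal_power_mult_def using span_superset[of "?S s" R N] by (rule subset_trans)
  qed
  have val: "adic_proj R I N s (?K (Suc s) +>\<^bsub>N\<^esub> x) = ?K s +>\<^bsub>N\<^esub> x" if "x \<in> carrier N" for s x
    unfolding adic_proj_def
    by (rule quot_map_coset_hom[OF assms(2) sub assms(2) sub mod_hom_id _ that]) (use mono in blast)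
  show ?thesis
  proof (rule surj_system.intro)
    fix s
    show "module R (adic_quot R I N s)" unfolding adic_quot_def by (rule module_quot[OF assms(2) sub])
    show "adic_proj R I N s \<in> mod_hom R (adic_quot R I N (Suc s)) (adic_quot R I N s)"
      unfolding adic_proj_def adic_quot_def
      by (rule quot_map_hom[OF assms(2) sub assms(2) sub mod_hom_id]) (use mono in blast)
    show "adic_proj R I N s ` carrier (adic_quot R I N (Suc s)) = carrier (adic_quot R I N s)"
      unfolding adic_quot_def carrier_quot_module image_image by (rule image_cong) (simp_all add: val)
  qed
qed

section \<open>Exactness of Matlis duality\<close>

text \<open>
  Baer's criterion: a maximal partial extension of \<open>h\<close>, given by its graph, is defined
  everywhere. Otherwise it could be extended to a further element \<open>m\<close> by extending the map
  \<open>r \<mapsto> h (r m)\<close> from the ideal of all \<open>r\<close> where it is defined to \<open>R\<close>.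
\<close>

theorem injective_module_extend:
  fixes R :: "('r, 'z) ring_scheme" and E :: "('r, 'e) module"
    and M1 :: "('r, 'a) module" and M2 :: "('r, 'b) module"
  assumes "injective_module R E" "module R M1" "module R M2" "f \<in> mod_hom R M1 M2"
    and "inj_on f (carrier M1)" "h \<in> mod_hom R M1 E"
  shows "\<exists>h'\<in>mod_hom R M2 E. \<forall>x\<in>carrier M1. h' (f x) = h x"
proof -
  have modE: "module R E" using assms(1) by (simp add: injective_module_def)
  have baer: "\<exists>h'\<in>mod_hom R B E. \<forall>x\<in>carrier A. h' (j x) = k x"
    if "module R A" "module R B" "j \<in> mod_hom R A B" "inj_on j (carrier A)" "k \<in> mod_hom R A E"
    for A B :: "('r, 'r) module" and j k
    using assms(1) that unfolding injective_module_def by blast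
  interpret M1: module R M1 by fact
  interpret M2: module R M2 by fact
  interpret E: module R E by (rule modE)
  let ?D = "dsum M2 E"
  note modD = module_dsum[OF assms(3) modE]
  interpret D: module R ?D by (rule modD)
  note modR = regular_module_module[OF M1.R.cring_axioms]
  let ?G0 = "(\<lambda>x. (f x, h x)) ` carrier M1"
  define \<Omega> where "\<Omega> = {G. submodule G R ?D \<and> (\<forall>e. (\<zero>\<^bsub>M2\<^esub>, e) \<in> G \<longrightarrow> e = \<zero>\<^bsub>E\<^esub>) \<and> ?G0 \<subseteq> G}"
  have fh: "(\<lambda>x. (f x, h x)) \<in> mod_hom R M1 ?D"
    using assms(4,6) by (auto simp: mod_hom_def)
  have G0: "?G0 \<in> \<Omega>"
  proof -
    have "e = \<zero>\<^bsub>E\<^esub>" if e: "(\<zero>\<^bsub>M2\<^esub>, e) \<in> ?G0" for e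
    proof -
      obtain x where x: "x \<in> carrier M1" "f x = \<zero>\<^bsub>M2\<^esub>" "e = h x" using e by auto
      then have "x = \<zero>\<^bsub>M1\<^esub>"
        using inj_onD[OF assms(5), of x "\<zero>\<^bsub>M1\<^esub>"] mod_hom_zero[OF assms(2,3,4)] by simp
      then show ?thesis using x(3) mod_hom_zero[OF assms(2) modE assms(6)] by simp
    qed
    then show ?thesis using submodule_image[OF assms(2) modD fh] by (simp add: \<Omega>_def)
  qed
  have "\<exists>G\<in>\<Omega>. \<forall>X\<in>\<Omega>. G \<subseteq> X \<longrightarrow> X = G"
  proof (rule subset_Zorn_nonempty)
    show "\<Omega> \<noteq> {}" using G0 by auto
    fix \<C> assume ne: "\<C> \<noteq> {}" and ch: "subset.chain \<Omega> \<C>"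
    have sub: "G \<in> \<Omega>" if "G \<in> \<C>" for G using ch that by (auto simp: subset.chain_def)
    then have subm: "submodule G R ?D" if "G \<in> \<C>" for G using that by (simp add: \<Omega>_def)
    have two: "\<exists>G\<in>\<C>. a \<in> G \<and> b \<in> G" if ab: "a \<in> \<Union>\<C>" "b \<in> \<Union>\<C>" for a b
    proof -
      obtain A B where AB: "A \<in> \<C>" "B \<in> \<C>" "a \<in> A" "b \<in> B" using ab by auto
      then have "A \<subseteq> B \<or> B \<subseteq> A" using ch by (auto simp: subset.chain_def)
      then show ?thesis using AB by auto
    qed
    have "submodule (\<Union>\<C>) R ?D"
    proof (rule D.submoduleI)
      show "\<Union>\<C> \<subseteq> carrier ?D" using subm D.submoduleE(1) by blast
      show "\<zero>\<^bsub>?D\<^esub> \<in> \<Union>\<C>" using ne subm submodule_zero[OF modD] by blast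
      show "\<ominus>\<^bsub>?D\<^esub> a \<in> \<Union>\<C>" if "a \<in> \<Union>\<C>" for a using that subm D.submoduleE(3) by blast
      show "a \<oplus>\<^bsub>?D\<^esub> b \<in> \<Union>\<C>" if "a \<in> \<Union>\<C>" "b \<in> \<Union>\<C>" for a b
        using two[OF that] subm D.submoduleE(5) by blast
      show "r \<odot>\<^bsub>?D\<^esub> a \<in> \<Union>\<C>" if "r \<in> carrier R" "a \<in> \<Union>\<C>" for r a
        using that subm D.submoduleE(4) by blast
    qed
    moreover have "e = \<zero>\<^bsub>E\<^esub>" if "(\<zero>\<^bsub>M2\<^esub>, e) \<in> \<Union>\<C>" for e using that sub by (auto simp: \<Omega>_def)
    moreover have "?G0 \<subseteq> \<Union>\<C>"
    proof -
      obtain G where "G \<in> \<C>" using ne by auto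
      then have "?G0 \<subseteq> G" using sub by (simp add: \<Omega>_def)
      then show ?thesis using \<open>G \<in> \<C>\<close> by blast
    qed
    ultimately show "\<Union>\<C> \<in> \<Omega>" by (simp add: \<Omega>_def)
  qed
  then obtain G where G: "G \<in> \<Omega>" and max: "\<And>X. X \<in> \<Omega> \<Longrightarrow> G \<subseteq> X \<Longrightarrow> X = G" by blast
  have subG: "submodule G R ?D" and G00: "?G0 \<subseteq> G" and
    zG: "\<And>e. (\<zero>\<^bsub>M2\<^esub>, e) \<in> G \<Longrightarrow> e = \<zero>\<^bsub>E\<^esub>" using G by (auto simp: \<Omega>_def)
  have inG: "x \<in> carrier M2" "e \<in> carrier E" if "(x, e) \<in> G" for x e
    using submodule_in_carrier[OF modD subG that] by auto
  have uniq: "e = e'" if "(x, e) \<in> G" "(x, e') \<in> G" for x e e'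
  proof -
    note c = inG[OF that(1)] inG[OF that(2)]
    have "(x, e) \<ominus>\<^bsub>?D\<^esub> (x, e') \<in> G" by (rule submodule_diff[OF modD subG that])
    then have "(\<zero>\<^bsub>M2\<^esub>, e \<oplus>\<^bsub>E\<^esub> \<ominus>\<^bsub>E\<^esub> e') \<in> G"
      using c by (simp add: a_minus_def dsum_uminus[OF assms(3) modE] M2.r_neg)
    then have "e \<ominus>\<^bsub>E\<^esub> e' = \<zero>\<^bsub>E\<^esub>" using zG by (simp add: a_minus_def)
    moreover have "(e \<ominus>\<^bsub>E\<^esub> e') \<oplus>\<^bsub>E\<^esub> e' = e" using c by (simp add: a_minus_def E.add.m_assoc E.l_neg)
    ultimately show ?thesis using c by simp
  qed
  have addG: "(x \<oplus>\<^bsub>M2\<^esub> y, d \<oplus>\<^bsub>E\<^esub> e) \<in> G" if "(x, d) \<in> G" "(y, e) \<in> G" for x y d e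
    using D.submoduleE(5)[OF subG that] by simp
  have smultG: "(r \<odot>\<^bsub>M2\<^esub> x, r \<odot>\<^bsub>E\<^esub> d) \<in> G" if "(x, d) \<in> G" "r \<in> carrier R" for x d r
    using D.submoduleE(4)[OF subG that(2,1)] by simp
  have total: "\<exists>e. (m, e) \<in> G" if m: "m \<in> carrier M2" for m
  proof -
    have rm: "(\<lambda>r. r \<odot>\<^bsub>M2\<^esub> m) \<in> mod_hom R (regular_module R) M2"
      by (rule mod_homI) (auto simp: m M2.smult_l_distr M2.smult_assoc1)
    have fstG: "fst \<in> mod_hom R (?D\<lparr>carrier := G\<rparr>) M2"
      using dsum_homs(1)[OF assms(3) modE] D.submoduleE(1)[OF subG] by (auto simp: mod_hom_def)
    have modG: "module R (?D\<lparr>carrier := G\<rparr>)" by (rule submodule_module[OF modD subG])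
    have dom: "submodule (fst ` G) R M2" using submodule_image[OF modG assms(3) fstG] by simp
    let ?J = "{r \<in> carrier (regular_module R). r \<odot>\<^bsub>M2\<^esub> m \<in> fst ` G}"
    have subJ: "submodule ?J R (regular_module R)" by (rule submodule_vimage[OF modR assms(3) rm dom])
    let ?A = "(regular_module R)\<lparr>carrier := ?J\<rparr>"
    have modA: "module R ?A" by (rule submodule_module[OF modR subJ])
    define k where "k = (\<lambda>r. THE e. (r \<odot>\<^bsub>M2\<^esub> m, e) \<in> G)"
    have k: "k r = e" if "(r \<odot>\<^bsub>M2\<^esub> m, e) \<in> G" for r e
      unfolding k_def using that uniq by (intro the_equality)
    have kG: "(r \<odot>\<^bsub>M2\<^esub> m, k r) \<in> G" if "r \<in> ?J" for r using that k by force
    have kh: "k \<in> mod_hom R ?A E"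
    proof (rule mod_homI)
      fix r assume r: "r \<in> carrier ?A"
      then show "k r \<in> carrier E" using inG(2)[OF kG] by simp
      fix s assume s: "s \<in> carrier R"
      show "k (s \<odot>\<^bsub>?A\<^esub> r) = s \<odot>\<^bsub>E\<^esub> k r"
        using smultG[OF kG s, of r] r s m by (intro k) (simp add: M2.smult_assoc1)
    next
      fix r s assume "r \<in> carrier ?A" "s \<in> carrier ?A"
      then show "k (r \<oplus>\<^bsub>?A\<^esub> s) = k r \<oplus>\<^bsub>E\<^esub> k s"
        using addG[OF kG kG, of r s] m by (intro k) (simp add: M2.smult_l_distr)
    qed
    have incl: "(\<lambda>r. r) \<in> mod_hom R ?A (regular_module R)" by (auto simp: mod_hom_def)
    obtain k' where k': "k' \<in> mod_hom R (regular_module R) E" "\<forall>r\<in>?J. k' r = k r"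
      using baer[OF modA modR incl inj_on_id2 kh] by auto
    define e0 where "e0 = k' \<one>\<^bsub>R\<^esub>"
    have e0: "e0 \<in> carrier E" unfolding e0_def by (rule mod_hom_closed[OF k'(1)]) simp
    have k'e0: "k' r = r \<odot>\<^bsub>E\<^esub> e0" if "r \<in> carrier R" for r
      unfolding e0_def using mod_hom_smult[OF k'(1) that, of "\<one>\<^bsub>R\<^esub>"] that by simp
    \<comment> \<open>The graph of the extension that takes the value \<open>e0\<close> at \<open>m\<close>.\<close>
    let ?\<tau> = "\<lambda>(g, r). g \<oplus>\<^bsub>?D\<^esub> r \<odot>\<^bsub>?D\<^esub> (m, e0)"
    let ?S = "dsum (?D\<lparr>carrier := G\<rparr>) (regular_module R)"
    have \<tau>: "?\<tau> \<in> mod_hom R ?S ?D"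
    proof -
      have "fst \<in> mod_hom R ?S ?D"
        using mod_hom_comp[OF dsum_homs(1)[OF modG modR], of "\<lambda>g. g" ?D] D.submoduleE(1)[OF subG]
        by (auto simp: mod_hom_def)
      moreover have "(\<lambda>r. r \<odot>\<^bsub>?D\<^esub> (m, e0)) \<in> mod_hom R (regular_module R) ?D"
        by (rule mod_homI) (auto simp: m e0 M2.smult_l_distr M2.smult_assoc1 E.smult_l_distr E.smult_assoc1)
      note mod_hom_comp[OF dsum_homs(2)[OF modG modR] this]
      ultimately have "(\<lambda>x. fst x \<oplus>\<^bsub>?D\<^esub> snd x \<odot>\<^bsub>?D\<^esub> (m, e0)) \<in> mod_hom R ?S ?D"
        by (rule mod_hom_sum[OF modD])
      then show ?thesis by (simp only: case_prod_unfold)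
    qed
    let ?G' = "?\<tau> ` carrier ?S"
    have in': "(x \<oplus>\<^bsub>M2\<^esub> r \<odot>\<^bsub>M2\<^esub> m, e \<oplus>\<^bsub>E\<^esub> r \<odot>\<^bsub>E\<^esub> e0) \<in> ?G'" if "(x, e) \<in> G" "r \<in> carrier R" for x e r
      by (rule image_eqI[of _ _ "((x, e), r)"]) (use that in auto)
    have GG': "G \<subseteq> ?G'"
    proof
      fix y assume "y \<in> G"
      then obtain x e where "y = (x, e)" "(x, e) \<in> G" by (cases y) auto
      then show "y \<in> ?G'" using in'[of x e "\<zero>\<^bsub>R\<^esub>"] inG[of x e] m e0 by simp
    qed
    have "?G' \<in> \<Omega>"
    proof -
      have "e' = \<zero>\<^bsub>E\<^esub>" if z: "(\<zero>\<^bsub>M2\<^esub>, e') \<in> ?G'" for e'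
      proof -
        obtain x e r where xe: "(x, e) \<in> G" "r \<in> carrier R" "\<zero>\<^bsub>M2\<^esub> = x \<oplus>\<^bsub>M2\<^esub> r \<odot>\<^bsub>M2\<^esub> m"
          "e' = e \<oplus>\<^bsub>E\<^esub> r \<odot>\<^bsub>E\<^esub> e0" using z by auto
        note c = inG[OF xe(1)]
        have "r \<odot>\<^bsub>M2\<^esub> m \<oplus>\<^bsub>M2\<^esub> x = \<zero>\<^bsub>M2\<^esub>" using xe(2,3) c m by (simp add: M2.add.m_comm)
        then have "\<ominus>\<^bsub>M2\<^esub> x = r \<odot>\<^bsub>M2\<^esub> m" using xe(2) c m by (intro M2.minus_equality) auto
        moreover have "\<ominus>\<^bsub>?D\<^esub> (x, e) \<in> G" using D.submoduleE(3)[OF subG xe(1)] .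
        ultimately have "(r \<odot>\<^bsub>M2\<^esub> m, \<ominus>\<^bsub>E\<^esub> e) \<in> G"
          using dsum_uminus[OF assms(3) modE c] by simp
        moreover from this have rJ: "r \<in> ?J" using xe(2) by force
        ultimately have "\<ominus>\<^bsub>E\<^esub> e = r \<odot>\<^bsub>E\<^esub> e0"
          using k k'(2) k'e0[OF xe(2)] by auto
        then show ?thesis unfolding xe(4) using c by (simp add: E.r_neg flip: \<open>\<ominus>\<^bsub>E\<^esub> e = r \<odot>\<^bsub>E\<^esub> e0\<close>)
      qed
      then show ?thesis
        using submodule_image[OF module_dsum[OF modG modR] modD \<tau>] G00 GG' by (auto simp: \<Omega>_def)
    qed
    then have "?G' = G" by (rule max[OF _ GG'])
    moreover have "(m, e0) \<in> ?G'"
      using in'[of "\<zero>\<^bsub>M2\<^esub>" "\<zero>\<^bsub>E\<^esub>" "\<one>\<^bsub>R\<^esub>"] submodule_zero[OF modD subG] m e0 by simp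
    ultimately show ?thesis by auto
  qed
  define h' where "h' = (\<lambda>m. THE e. (m, e) \<in> G)"
  have h': "h' m = e" if "(m, e) \<in> G" for m e
    unfolding h'_def using that uniq by (intro the_equality)
  have hG: "(m, h' m) \<in> G" if "m \<in> carrier M2" for m using total[OF that] h' by auto
  have "h' \<in> mod_hom R M2 E"
    by (rule mod_homI) (auto intro: inG(2)[OF hG] h' addG smultG hG)
  moreover have "h' (f x) = h x" if "x \<in> carrier M1" for x using G00 that by (intro h') auto
  ultimately show ?thesis by auto
qed

lemma Hom_module_simps [simp]:
  "carrier (Hom_module R M N) = mod_hom R M N \<inter> extensional (carrier M)"
  "zero (Hom_module R M N) = (\<lambda>x\<in>carrier M. \<zero>\<^bsub>N\<^esub>)"
  "add (Hom_module R M N) = (\<lambda>f g. \<lambda>x\<in>carrier M. f x \<oplus>\<^bsub>N\<^esub> g x)"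
  "smult (Hom_module R M N) = (\<lambda>r f. \<lambda>x\<in>carrier M. r \<odot>\<^bsub>N\<^esub> f x)"
  by (simp_all add: Hom_module_def)

lemma mod_hom_restrict:
  assumes "module R M" "f \<in> mod_hom R M N"
  shows "(\<lambda>x\<in>carrier M. f x) \<in> mod_hom R M N"
  by (rule mod_hom_cong[OF _ assms]) simp

lemma module_Hom_module:
  assumes "module R M" "module R N"
  shows "module R (Hom_module R M N)"
proof -
  interpret M: module R M by fact
  interpret N: module R N by fact
  note cl = mod_hom_closed
  note rI = mod_hom_restrict[OF assms(1)]
  show ?thesis
  proof (rule moduleI)
    show "cring R" by (rule M.R.cring_axioms)
    show "abelian_group (Hom_module R M N)"
    proof (rule abelian_groupI)
      fix f assume f: "f \<in> carrier (Hom_module R M N)"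
      show "\<exists>g\<in>carrier (Hom_module R M N). g \<oplus>\<^bsub>Hom_module R M N\<^esub> f = \<zero>\<^bsub>Hom_module R M N\<^esub>"
        by (rule bexI[of _ "\<lambda>x\<in>carrier M. \<ominus>\<^bsub>N\<^esub> f x"])
          (use f in \<open>auto simp: cl N.l_neg intro!: rI mod_hom_uminus[OF assms(2)]\<close>)
    qed (auto intro!: rI mod_hom_sum[OF assms(2)] mod_hom_const_zero[OF assms(2)]
        simp: extensional_def fun_eq_iff cl N.add.m_assoc N.add.m_comm N.add.m_lcomm)
  qed (auto intro!: rI mod_hom_smult_const[OF assms(2)]
      simp: extensional_def fun_eq_iff cl N.smult_l_distr N.smult_r_distr N.smult_assoc1)
qed

lemma matlis_dual_map_hom:
  fixes M :: "('r, 'a) module" and M' :: "('r, 'b) module"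
  assumes "module R M" "module R M'" "u \<in> mod_hom R M M'"
  shows "matlis_dual_map M u \<in> mod_hom R (matlis_dual R E M') (matlis_dual R E M)"
proof -
  interpret M': module R M' by fact
  show ?thesis
    by (rule mod_homI)
      (auto intro!: mod_hom_restrict[OF assms(1)] mod_hom_comp[OF assms(3)]
        simp: matlis_dual_def matlis_dual_map_def fun_eq_iff mod_hom_closed[OF assms(3)])
qed

text \<open>
  A map \<open>M2 \<rightarrow> E\<close> that vanishes on the image of \<open>f\<close> factors through \<open>g\<close>; that restriction along \<open>f\<close>
  is surjective is the injectivity of \<open>E\<close>.
\<close>

lemma matlis_dual_exact:
  fixes E :: "('r, 'e) module"
  assumes "short_exact R M1 M2 M3 f g" "injective_module R E"
  shows "short_exact R (matlis_dual R E M3) (matlis_dual R E M2) (matlis_dual R E M1)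
    (matlis_dual_map M2 g) (matlis_dual_map M1 f)"
proof -
  have ses: "module R M1" "module R M2" "module R M3" "f \<in> mod_hom R M1 M2" "g \<in> mod_hom R M2 M3"
    "inj_on f (carrier M1)" "f ` carrier M1 = mod_ker M2 M3 g" "g ` carrier M2 = carrier M3"
    using assms(1) by (auto simp: short_exact_def)
  have modE: "module R E" using assms(2) by (simp add: injective_module_def)
  interpret M2: module R M2 by (rule ses(2))
  interpret M3: module R M3 by (rule ses(3))
  interpret E: module R E by (rule modE)
  note dual = matlis_dual_map_hom[where E = E]
  have gf: "g (f x) = \<zero>\<^bsub>M3\<^esub>" if "x \<in> carrier M1" for x using ses(7) that by (auto simp: mod_ker_def)
  have inj: "inj_on (matlis_dual_map M2 g) (carrier (matlis_dual R E M3))"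
  proof (rule inj_onI)
    fix h k assume hk: "h \<in> carrier (matlis_dual R E M3)" "k \<in> carrier (matlis_dual R E M3)"
      "matlis_dual_map M2 g h = matlis_dual_map M2 g k"
    show "h = k"
    proof (rule extensionalityI)
      show "h \<in> extensional (carrier M3)" "k \<in> extensional (carrier M3)"
        using hk by (simp_all add: matlis_dual_def)
      fix z assume "z \<in> carrier M3"
      then have "z \<in> g ` carrier M2" using ses(8) by simp
      then obtain y where "y \<in> carrier M2" "z = g y" by auto
      then show "h z = k z" using fun_cong[OF hk(3), of y] by (simp add: matlis_dual_map_def)
    qed
  qed
  have "matlis_dual_map M2 g ` carrier (matlis_dual R E M3) =
      mod_ker (matlis_dual R E M2) (matlis_dual R E M1) (matlis_dual_map M1 f)"
  proof
    show "matlis_dual_map M2 g ` carrier (matlis_dual R E M3) \<subseteq>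
        mod_ker (matlis_dual R E M2) (matlis_dual R E M1) (matlis_dual_map M1 f)"
    proof
      fix k assume "k \<in> matlis_dual_map M2 g ` carrier (matlis_dual R E M3)"
      then obtain h where h: "h \<in> carrier (matlis_dual R E M3)" "k = matlis_dual_map M2 g h" by auto
      have hh: "h \<in> mod_hom R M3 E" using h(1) by (simp add: matlis_dual_def)
      have "matlis_dual_map M1 f k = \<zero>\<^bsub>matlis_dual R E M1\<^esub>"
        unfolding h(2) using gf mod_hom_zero[OF ses(3) modE hh] mod_hom_closed[OF ses(4)]
        by (auto simp: matlis_dual_def matlis_dual_map_def fun_eq_iff)
      then show "k \<in> mod_ker (matlis_dual R E M2) (matlis_dual R E M1) (matlis_dual_map M1 f)"
        using mod_hom_closed[OF dual[OF ses(2,3,5)] h(1)] h(2) by (simp add: mod_ker_def)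
    qed
    show "mod_ker (matlis_dual R E M2) (matlis_dual R E M1) (matlis_dual_map M1 f) \<subseteq>
        matlis_dual_map M2 g ` carrier (matlis_dual R E M3)"
    proof
      fix k assume "k \<in> mod_ker (matlis_dual R E M2) (matlis_dual R E M1) (matlis_dual_map M1 f)"
      then have k: "k \<in> mod_hom R M2 E" "k \<in> extensional (carrier M2)"
        and kf: "matlis_dual_map M1 f k = (\<lambda>x\<in>carrier M1. \<zero>\<^bsub>E\<^esub>)"
        by (simp_all add: mod_ker_def matlis_dual_def)
      have k0: "k y = \<zero>\<^bsub>E\<^esub>" if "y \<in> carrier M2" "g y = \<zero>\<^bsub>M3\<^esub>" for y
      proof -
        have "y \<in> f ` carrier M1" using that ses(7) by (simp add: mod_ker_def)
        then obtain x where "x \<in> carrier M1" "y = f x" by auto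
        then show ?thesis using fun_cong[OF kf, of x] by (simp add: matlis_dual_map_def)
      qed
      have keq: "k y = k y'" if y: "y \<in> carrier M2" "y' \<in> carrier M2" "g y = g y'" for y y'
      proof -
        have "k (y \<ominus>\<^bsub>M2\<^esub> y') = \<zero>\<^bsub>E\<^esub>"
          using y mod_hom_diff[OF ses(2,3,5)] mod_hom_closed[OF ses(5)]
          by (intro k0) (simp_all add: a_minus_def[of M3] M3.r_neg)
        then have "k y \<ominus>\<^bsub>E\<^esub> k y' = \<zero>\<^bsub>E\<^esub>" using mod_hom_diff[OF ses(2) modE k(1) y(1,2)] by simp
        moreover have "(k y \<ominus>\<^bsub>E\<^esub> k y') \<oplus>\<^bsub>E\<^esub> k y' = k y"
          using mod_hom_closed[OF k(1)] y by (simp add: a_minus_def E.add.m_assoc E.l_neg)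
        ultimately show ?thesis using mod_hom_closed[OF k(1) y(2)] by simp
      qed
      define h where "h = (\<lambda>z\<in>carrier M3. k (SOME y. y \<in> carrier M2 \<and> g y = z))"
      have hg: "h (g y) = k y" if y: "y \<in> carrier M2" for y
      proof -
        let ?y = "SOME y'. y' \<in> carrier M2 \<and> g y' = g y"
        have "?y \<in> carrier M2 \<and> g ?y = g y" by (rule someI[of _ y]) (simp add: y)
        then have "k ?y = k y" by (intro keq) (auto simp: y)
        then show ?thesis using mod_hom_closed[OF ses(5) y] by (simp only: h_def restrict_apply' if_True)
      qed
      have "h \<in> mod_hom R M3 E"
      proof (rule mod_homI)
        fix z assume "z \<in> carrier M3"
        then have "z \<in> g ` carrier M2" using ses(8) by simp
        then obtain y where y: "y \<in> carrier M2" "z = g y" by auto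
        then show "h z \<in> carrier E" using hg mod_hom_closed[OF k(1)] by simp
        show "h (r \<odot>\<^bsub>M3\<^esub> z) = r \<odot>\<^bsub>E\<^esub> h z" if "r \<in> carrier R" for r
          using y that hg[of y] hg[of "r \<odot>\<^bsub>M2\<^esub> y"] mod_hom_smult[OF ses(5)] mod_hom_smult[OF k(1)] by simp
        fix z' assume "z' \<in> carrier M3"
        then have "z' \<in> g ` carrier M2" using ses(8) by simp
        then obtain y' where y': "y' \<in> carrier M2" "z' = g y'" by auto
        show "h (z \<oplus>\<^bsub>M3\<^esub> z') = h z \<oplus>\<^bsub>E\<^esub> h z'"
          using y y' hg[of y] hg[of y'] hg[of "y \<oplus>\<^bsub>M2\<^esub> y'"] mod_hom_add[OF ses(5)] mod_hom_add[OF k(1)] by simp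
      qed
      then have hD: "h \<in> carrier (matlis_dual R E M3)" by (simp add: matlis_dual_def h_def)
      have "matlis_dual_map M2 g h = k"
      proof (rule extensionalityI[of _ "carrier M2"])
        show "matlis_dual_map M2 g h x = k x" if "x \<in> carrier M2" for x
          using that hg by (simp add: matlis_dual_map_def)
      qed (simp_all add: matlis_dual_map_def k(2))
      then show "k \<in> matlis_dual_map M2 g ` carrier (matlis_dual R E M3)" using hD by auto
    qed
  qed
  moreover have "matlis_dual_map M1 f ` carrier (matlis_dual R E M2) = carrier (matlis_dual R E M1)"
  proof
    show "matlis_dual_map M1 f ` carrier (matlis_dual R E M2) \<subseteq> carrier (matlis_dual R E M1)"
      using mod_hom_closed[OF dual[OF ses(1,2,4)]] by auto
    show "carrier (matlis_dual R E M1) \<subseteq> matlis_dual_map M1 f ` carrier (matlis_dual R E M2)"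
    proof
      fix h assume h: "h \<in> carrier (matlis_dual R E M1)"
      then have hh: "h \<in> mod_hom R M1 E" "h \<in> extensional (carrier M1)" by (simp_all add: matlis_dual_def)
      obtain k where k: "k \<in> mod_hom R M2 E" "\<forall>x\<in>carrier M1. k (f x) = h x"
        using injective_module_extend[OF assms(2) ses(1,2,4,6) hh(1)] by auto
      let ?k = "\<lambda>x\<in>carrier M2. k x"
      have "?k \<in> carrier (matlis_dual R E M2)"
        using mod_hom_restrict[OF ses(2) k(1)] by (simp add: matlis_dual_def)
      moreover have "matlis_dual_map M1 f ?k = h"
      proof (rule extensionalityI[of _ "carrier M1"])
        show "matlis_dual_map M1 f ?k x = h x" if "x \<in> carrier M1" for x
          using that k(2) mod_hom_closed[OF ses(4) that] by (simp add: matlis_dual_map_def)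
      qed (simp_all add: matlis_dual_map_def hh(2))
      ultimately show "h \<in> matlis_dual_map M1 f ` carrier (matlis_dual R E M2)" by auto
    qed
  qed
  ultimately show ?thesis
    unfolding short_exact_def
    using inj dual[OF ses(2,3,5)] dual[OF ses(1,2,4)] module_Hom_module[OF ses(1) modE]
      module_Hom_module[OF ses(2) modE] module_Hom_module[OF ses(3) modE]
    by (simp add: matlis_dual_def)
qed

section \<open>Long exact sequences of local homology\<close>

lemma local_homology_long_exact:
  fixes F G K :: "('r, 'f) chain_complex"
  assumes "ideal I R" "module R N" "short_exact R X Y Z f g"
    and "flat_resolution R X F \<epsilon>" "flat_resolution R Y G \<eta>" "flat_resolution R Z K \<theta>"
  shows "\<exists>\<alpha> \<beta> \<delta>. induced_local_homology_map R I N X F \<epsilon> G \<eta> f \<alpha> \<and>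
    induced_local_homology_map R I N Y G \<eta> K \<theta> g \<beta> \<and>
    long_exact R (local_homology R I N F) (local_homology R I N G) (local_homology R I N K) \<alpha> \<beta> \<delta>"
proof -
  interpret S: surj_system R "adic_quot R I N" "adic_proj R I N" by (rule adic_system[OF assms(1,2)])
  have Tm: "adic_tensor_map R I N U u = S.Tm U u" for U :: "('r, 'f) module" and u :: "'f \<Rightarrow> 'f"
    by (simp add: adic_tensor_map_def S.Tm_def fun_eq_iff)
  have TC: "adic_tensor_complex R I N L = S.TC L" for L :: "('r, 'f) chain_complex"
    by (simp add: adic_tensor_complex_def S.TC_def S.T_def Tm)
  have H: "local_homology R I N L = S.H L" for L :: "('r, 'f) chain_complex"
    by (simp add: local_homology_def TC fun_eq_iff)
  have Hm: "local_homology_map R I N L \<phi> = S.Hm L \<phi>"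
    for L :: "('r, 'f) chain_complex" and \<phi> :: "nat \<Rightarrow> 'f \<Rightarrow> 'f"
    by (simp add: local_homology_map_def TC Tm fun_eq_iff)
  have ind: "induced_local_homology_map R I N U L \<nu> L' \<mu> u \<alpha>" if "S.induced U L \<nu> L' \<mu> u \<alpha>"
    for U :: "('r, 'u) module" and L L' :: "('r, 'f) chain_complex" and \<nu> and \<mu> :: "'f \<Rightarrow> 'w" and u \<alpha>
    unfolding induced_local_homology_map_def H Hm
  proof (intro allI impI)
    fix P :: "('r, 'f) chain_complex" and \<pi> \<phi> \<psi> i
    assume *: "flat_resolution R U P \<pi> \<and> lifts_to R P \<pi> L \<nu> (\<lambda>x. x) \<phi> \<and> lifts_to R P \<pi> L' \<mu> u \<psi>"
    then have "eq_flat_resolution R U P \<pi>" by (intro flat_resolution_eq_flat) simp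
    with * show "\<forall>z\<in>carrier (S.H P i). \<alpha> i (S.Hm L \<phi> i z) = S.Hm L' \<psi> i z"
      using that[unfolded S.induced_def, rule_format, of P \<pi> \<phi> \<psi>] by simp
  qed
  obtain \<alpha> \<beta> \<delta> where *: "S.induced X F \<epsilon> G \<eta> f \<alpha>" "S.induced Y G \<eta> K \<theta> g \<beta>"
    "long_exact R (S.H F) (S.H G) (S.H K) \<alpha> \<beta> \<delta>"
    using S.long_exact_derived[OF assms(3) flat_resolution_eq_flat[OF assms(4)]
        flat_resolution_eq_flat[OF assms(5)] flat_resolution_eq_flat[OF assms(6)]] by auto
  show ?thesis unfolding H
    by (intro exI[of _ \<alpha>] exI[of _ \<beta>] exI[of _ \<delta>] conjI ind * )
qed

theorem corollary2p7:
  fixes R :: "'r ring" and I :: "'r set"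
    and M1 :: "('r, 'm1) module" and M2 :: "('r, 'm2) module" and M3 :: "('r, 'm3) module"
    and f :: "'m1 \<Rightarrow> 'm2" and g :: "'m2 \<Rightarrow> 'm3"
    and N :: "('r, 'n) module"
    and E :: "('r, 'e) module" and \<iota> :: "'r set \<Rightarrow> 'e"
  assumes "cring R" and "noetherian_ring R" and "local_ring R"
    and "ideal I R"
    and "short_exact R M1 M2 M3 f g"
    and "fin_gen_module R N"
    and "injective_hull R (residue_field_module R) E \<iota>"
  shows
    "(\<forall>(F1 :: ('r, 'f) chain_complex) \<epsilon>1 (F2 :: ('r, 'f) chain_complex) \<epsilon>2
        (F3 :: ('r, 'f) chain_complex) \<epsilon>3.
        flat_resolution R (matlis_dual R E M1) F1 \<epsilon>1 \<and>
        flat_resolution R (matlis_dual R E M2) F2 \<epsilon>2 \<and>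
        flat_resolution R (matlis_dual R E M3) F3 \<epsilon>3 \<longrightarrow>
        (\<exists>\<alpha> \<beta> \<delta>.
           induced_local_homology_map R I N (matlis_dual R E M3) F3 \<epsilon>3 F2 \<epsilon>2
             (matlis_dual_map M2 g) \<alpha> \<and>
           induced_local_homology_map R I N (matlis_dual R E M2) F2 \<epsilon>2 F1 \<epsilon>1
             (matlis_dual_map M1 f) \<beta> \<and>
           long_exact R (local_homology R I N F3) (local_homology R I N F2)
             (local_homology R I N F1) \<alpha> \<beta> \<delta>)) \<and>
     (artinian_module R M1 \<and> artinian_module R M2 \<and> artinian_module R M3 \<longrightarrow>
       (\<forall>(G1 :: ('r, 'g) chain_complex) \<eta>1 (G2 :: ('r, 'g) chain_complex) \<eta>2
          (G3 :: ('r, 'g) chain_complex) \<eta>3.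
          flat_resolution R M1 G1 \<eta>1 \<and> flat_resolution R M2 G2 \<eta>2 \<and> flat_resolution R M3 G3 \<eta>3 \<longrightarrow>
          (\<exists>\<alpha> \<beta> \<delta>.
             induced_local_homology_map R I N M1 G1 \<eta>1 G2 \<eta>2 f \<alpha> \<and>
             induced_local_homology_map R I N M2 G2 \<eta>2 G3 \<eta>3 g \<beta> \<and>
             long_exact R (local_homology R I N G1) (local_homology R I N G2)
               (local_homology R I N G3) \<alpha> \<beta> \<delta>)))"
proof (intro conjI impI allI)
  have N: "module R N" using assms(6) by (simp add: fin_gen_module_def)
  have E: "injective_module R E" using assms(7) by (simp add: injective_hull_def)
  fix F1 F2 F3 :: "('r, 'f) chain_complex" and \<epsilon>1 \<epsilon>2 \<epsilon>3
  assume "flat_resolution R (matlis_dual R E M1) F1 \<epsilon>1 \<and>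
    flat_resolution R (matlis_dual R E M2) F2 \<epsilon>2 \<and> flat_resolution R (matlis_dual R E M3) F3 \<epsilon>3"
  then show "\<exists>\<alpha> \<beta> \<delta>.
      induced_local_homology_map R I N (matlis_dual R E M3) F3 \<epsilon>3 F2 \<epsilon>2 (matlis_dual_map M2 g) \<alpha> \<and>
      induced_local_homology_map R I N (matlis_dual R E M2) F2 \<epsilon>2 F1 \<epsilon>1 (matlis_dual_map M1 f) \<beta> \<and>
      long_exact R (local_homology R I N F3) (local_homology R I N F2) (local_homology R I N F1) \<alpha> \<beta> \<delta>"
    by (intro local_homology_long_exact[OF assms(4) N matlis_dual_exact[OF assms(5) E]]) auto
next
  have N: "module R N" using assms(6) by (simp add: fin_gen_module_def)
  fix G1 G2 G3 :: "('r, 'g) chain_complex" and \<eta>1 \<eta>2 \<eta>3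
  assume "flat_resolution R M1 G1 \<eta>1 \<and> flat_resolution R M2 G2 \<eta>2 \<and> flat_resolution R M3 G3 \<eta>3"
  then show "\<exists>\<alpha> \<beta> \<delta>. induced_local_homology_map R I N M1 G1 \<eta>1 G2 \<eta>2 f \<alpha> \<and>
      induced_local_homology_map R I N M2 G2 \<eta>2 G3 \<eta>3 g \<beta> \<and>
      long_exact R (local_homology R I N G1) (local_homology R I N G2) (local_homology R I N G3) \<alpha> \<beta> \<delta>"
    by (intro local_homology_long_exact[OF assms(4) N assms(5)]) auto
qed

end
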